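(* Assume $0<k_+<k_-$. Let $y$ be an arbitrary fixed point in $\mathbb R^2_+\cup\mathbb R^2_-$ and, for $x=|x|\hat x=|x|(\cos\theta_{\hat x},\sin\theta_{\hat x})\in\mathbb R^2_-$ with $\theta_{\hat x}\in(\pi,2\pi)$, let $$G_{Res}(x,y):=G(x,y)-\frac{e^{ik_-|x|}}{\sqrt{|x|}}G^\infty(\hat x,y).$$ Then $G_{Res}(x,y)=O(|x|^{-3/2})$ as $|x|\to+\infty$ for all $\theta_{\hat x}\in(\pi,2\pi)\setminus\{\pi+\theta_c,2\pi-\theta_c\}$, and $$\lim_{|x|\to+\infty}|G_{Res}(x,y)|\,|x|^{3/4}\ne0\qquad\text{for }\theta_{\hat x}\in\{\pi+\theta_c,2\pi-\theta_c\}.$$ In particular, $G_{Res}(x,y)=O(|x|^{-3/2})$ as $|x|\to+\infty$ does not hold for $\theta_{\hat x}\in\{\pi+\theta_c,2\pi-\theta_c\}$.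
   Context: Notation. $\mathbb R^2_\pm=\{(x_1,x_2)\in\mathbb R^2: x_2\gtrless 0\}$, $\Gamma_0=\{(x_1,0):x_1\in\mathbb R\}$, $\mathbb S^1_\pm=\{x\in\mathbb R^2_\pm:|x|=1\}$, $\hat x=x/|x|$, $y'=(y_1,-y_2)$ for $y=(y_1,y_2)$, $n:=k_-/k_+>1$, $\theta_c:=\arccos(1/n)\in(0,\pi/2)$. Function $\mathcal S$. For $z=|z|e^{i\theta_1}\ne0$ with $\theta_1\in(-\frac{3\pi}2,\frac\pi2)$ let $\mathcal S_1(z)=\sqrt{|z|}e^{i\theta_1/2}$; for $z=|z|e^{i\theta_2}\neq 0$ with $\theta_2\in(-\frac\pi2,\frac{3\pi}2)$ let $\mathcal S_2(z)=\sqrt{|z|}e^{i\theta_2/2}$; $\mathcal S_1(0)=\mathcal S_2(0)=0$. For $a>0$ let $\mathcal S(z,a)=\mathcal S_1(z-a)\mathcal S_2(z+a)$. (For real $z$: $\mathcal S(z,a)=\sqrt{z^2-a^2}$ if $|z|\ge a$ and $\mathcal S(z,a)=-i\sqrt{a^2-z^2}$ if $|z|<a$.) For $\theta\in\mathbb R$, $$\widetilde{\mathcal R}(\theta)=\frac{i\sin\theta-\mathcal S(\cos\theta,1/n)}{i\sin\theta+\mathcal S(\cos\theta,1/n)},\qquad \widetilde{\mathcal T}(\theta)=\widetilde{\mathcal R}(\theta)+1.$$ For $\hat x\in\mathbb S^1_-$, $$G^\infty(\hat x,y):=\frac{e^{i\pi/4}}{\sqrt{8\pi k_-}}\begin{cases}\widetilde{\mathcal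 T}(\theta_{\hat x})e^{-ik_-(y_1\cos\theta_{\hat x}-iy_2\mathcal S(\cos\theta_{\hat x},1/n))}, & y\in\mathbb R^2_+,\\ e^{-ik_-\hat x\cdot y}+\widetilde{\mathcal R}(\theta_{\hat x})e^{-ik_-\hat x\cdot y'}, & y\in\mathbb R^2_-.\end{cases}$$ Two-layered Green function. For $y\in\mathbb R^2_+\cup\mathbb R^2_-$, $G(\cdot,y)$ is the solution of $\Delta_xG(x,y)+k_\pm^2G(x,y)=-\delta(x,y)$ in $\mathbb R^2_\pm$, $[G(x,y)]=0$ and $[\partial G(x,y)/\partial\nu(x)]=0$ on $\Gamma_0$ (jumps across $\Gamma_0$, $\nu$ the unit normal pointing into $\mathbb R^2_+$), and $\lim_{|x|\to\infty}\sqrt{|x|}(\partial G(x,y)/\partial|x|-ik_\pm G(x,y))=0$ uniformly for all $\hat x\in\mathbb S^1_\pm$. Explicitly, for $x\in\mathbb R^2_-$, $$G(x,y)=\frac1{2\pi}\int_{-\infty}^{\infty}\frac{e^{-\mathcal S(\xi,k_+)y_2+\mathcal S(\xi,k_-)x_2}}{\mathcal S(\xi,k_+)+\mathcal S(\xi,k_-)}e^{i\xi(x_1-y_1)}d\xi\quad(y\in\mathbb R^2_+),$$ $$G(x,y)=\frac i4H^{(1)}_0(k_-|x-y|)+\frac1{4\pi}\int_{-\infty}^{\infty}\frac{\mathcal S(\xi,k_-)-\mathcal S(\xi,k_+)}{\mathcal S(\xi,k_+)+\mathcal S(\xi,k_-)}\frac{e^{-\mathcal S(\xi,k_-)|x_2+y_2|}}{\mathcal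 S(\xi,k_-)}e^{i\xi(x_1-y_1)}d\xi\quad(y\in\mathbb R^2_-),$$ with $H_0^{(1)}$ the Hankel function of the first kind of order $0$. The limits are taken along the ray of fixed direction $\hat x$. *)

theory Defs
  imports "HOL-Analysis.Analysis" "HOL-Library.Landau_Symbols"
begin

definition upper_half_plane :: "(real \<times> real) set" where
  "upper_half_plane = {x. snd x > 0}"

definition lower_half_plane :: "(real \<times> real) set" where
  "lower_half_plane = {x. snd x < 0}"

text \<open>The branches \<open>S1\<close> and \<open>S2\<close> of the square root are cut along the positive and the negative
  imaginary axis, respectively. On the cut itself their values are unspecified.\<close>

definition S1 :: "complex \<Rightarrow> complex" where
  "S1 z = (if z = 0 then 0 else
     rcis (sqrt (cmod z))
       ((THE \<theta>. \<theta> \<in> {- (3 * pi / 2) <..< pi / 2} \<and> z = rcis (cmod z) \<theta>) / 2))"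

definition S2 :: "complex \<Rightarrow> complex" where
  "S2 z = (if z = 0 then 0 else
     rcis (sqrt (cmod z))
       ((THE \<theta>. \<theta> \<in> {- (pi / 2) <..< 3 * pi / 2} \<and> z = rcis (cmod z) \<theta>) / 2))"

definition SS :: "complex \<Rightarrow> real \<Rightarrow> complex" where
  "SS z a = S1 (z - complex_of_real a) * S2 (z + complex_of_real a)"

lemma the_polar_angle:
  assumes "r > 0" "\<theta> \<in> {a <..< a + 2 * pi}"
  shows "(THE \<phi>. \<phi> \<in> {a <..< a + 2 * pi} \<and> rcis r \<theta> = rcis r \<phi>) = \<theta>"
proof (rule the_equality)
  fix \<phi> assume *: "\<phi> \<in> {a <..< a + 2 * pi} \<and> rcis r \<theta> = rcis r \<phi>"
  then have "cis \<theta> = cis \<phi>" using assms by (simp add: rcis_def)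
  then have "sin \<phi> = sin \<theta> \<and> cos \<phi> = cos \<theta>" by (auto simp: complex_eq_iff)
  then obtain n :: int where n: "\<phi> = \<theta> + 2 * pi * n" using sin_cos_eq_iff by blast
  have "\<bar>\<phi> - \<theta>\<bar> < 2 * pi" using * assms by (auto simp: abs_less_iff)
  then have "2 * pi * \<bar>real_of_int n\<bar> < 2 * pi * 1" using n by (simp add: abs_mult)
  then have "\<bar>real_of_int n\<bar> < 1" by simp
  then have "n = 0" by linarith
  then show "\<phi> = \<theta>" using n by simp
qed (use assms in auto)

lemma S1_rcis:
  assumes "r > 0" "\<theta> \<in> {- (3 * pi / 2) <..< pi / 2}"
  shows "S1 (rcis r \<theta>) = rcis (sqrt r) (\<theta> / 2)"
proof -
  have "- (3 * pi / 2) + 2 * pi = pi / 2" by (simp add: field_simps)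
  then show ?thesis
    using the_polar_angle[of r \<theta> "- (3 * pi / 2)"] assms by (simp add: S1_def)
qed

lemma S2_rcis:
  assumes "r > 0" "\<theta> \<in> {- (pi / 2) <..< 3 * pi / 2}"
  shows "S2 (rcis r \<theta>) = rcis (sqrt r) (\<theta> / 2)"
proof -
  have "- (pi / 2) + 2 * pi = 3 * pi / 2" by (simp add: field_simps)
  then show ?thesis
    using the_polar_angle[of r \<theta> "- (pi / 2)"] assms by (simp add: S2_def)
qed

lemma S1_of_real:
  "S1 (complex_of_real t) = (if t \<ge> 0 then complex_of_real (sqrt t)
     else - \<i> * complex_of_real (sqrt (- t)))"
proof -
  consider "t = 0" | "t > 0" | "t < 0" by linarith
  then show ?thesis
  proof cases
    case 3
    have "complex_of_real t = rcis (- t) (- pi)" by (simp add: complex_eq_iff)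
    moreover have "- pi \<in> {- (3 * pi / 2) <..< pi / 2}"
      using pi_gt_zero by (simp only: greaterThanLessThan_iff) linarith
    ultimately have "S1 (complex_of_real t) = rcis (sqrt (- t)) (- pi / 2)"
      using S1_rcis[of "- t" "- pi"] 3 by simp
    also have "\<dots> = - \<i> * complex_of_real (sqrt (- t))" by (simp add: complex_eq_iff)
    finally show ?thesis using 3 by simp
  qed (use S1_rcis[of t 0] in \<open>auto simp: S1_def rcis_def\<close>)
qed

lemma S2_of_real:
  "S2 (complex_of_real t) = (if t \<ge> 0 then complex_of_real (sqrt t)
     else \<i> * complex_of_real (sqrt (- t)))"
proof -
  consider "t = 0" | "t > 0" | "t < 0" by linarith
  then show ?thesis
  proof cases
    case 3
    have "complex_of_real t = rcis (- t) pi" by (simp add: complex_eq_iff)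
    moreover have "pi \<in> {- (pi / 2) <..< 3 * pi / 2}"
      using pi_gt_zero by (simp only: greaterThanLessThan_iff) linarith
    ultimately have "S2 (complex_of_real t) = rcis (sqrt (- t)) (pi / 2)"
      using S2_rcis[of "- t" pi] 3 by simp
    also have "\<dots> = \<i> * complex_of_real (sqrt (- t))" by (simp add: complex_eq_iff)
    finally show ?thesis using 3 by simp
  qed (use S2_rcis[of t 0] in \<open>auto simp: S2_def rcis_def\<close>)
qed

lemma SS_of_real:
  assumes "a > 0"
  shows "SS (complex_of_real t) a =
    (if \<bar>t\<bar> \<ge> a then complex_of_real (sqrt (t\<^sup>2 - a\<^sup>2))
     else - \<i> * complex_of_real (sqrt (a\<^sup>2 - t\<^sup>2)))"
proof -
  have eq: "SS (complex_of_real t) a =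
      S1 (complex_of_real (t - a)) * S2 (complex_of_real (t + a))"
    by (simp add: SS_def)
  have d: "t\<^sup>2 - a\<^sup>2 = (t - a) * (t + a)" "t\<^sup>2 - a\<^sup>2 = (a - t) * (- a - t)"
    "a\<^sup>2 - t\<^sup>2 = (a - t) * (a + t)"
    by (simp_all add: algebra_simps power2_eq_square)
  consider "t \<ge> a" | "\<bar>t\<bar> < a" | "t = - a" | "t < - a" using assms by linarith
  then show ?thesis
  proof cases
    case 1
    then show ?thesis unfolding eq S1_of_real S2_of_real d(1)
      using assms by (simp add: real_sqrt_mult)
  next
    case 2
    then have "\<not> t - a \<ge> 0" "t + a \<ge> 0" "\<not> \<bar>t\<bar> \<ge> a" by linarith+
    then show ?thesis unfolding eq S1_of_real S2_of_real d(3)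
      by (simp add: real_sqrt_mult add.commute)
  next
    case 3
    then show ?thesis unfolding eq S1_of_real S2_of_real using assms by simp
  next
    case 4
    have neg: "- (t + a) = - a - t" "- (t - a) = a - t" by simp_all
    show ?thesis unfolding eq S1_of_real S2_of_real d(2) neg
      using 4 assms by (simp add: real_sqrt_mult complex_eq_iff)
  qed
qed

definition R_tilde :: "real \<Rightarrow> real \<Rightarrow> complex" where
  "R_tilde n \<theta> =
     (\<i> * complex_of_real (sin \<theta>) - SS (complex_of_real (cos \<theta>)) (1 / n)) /
     (\<i> * complex_of_real (sin \<theta>) + SS (complex_of_real (cos \<theta>)) (1 / n))"

definition T_tilde :: "real \<Rightarrow> real \<Rightarrow> complex" where
  "T_tilde n \<theta> = R_tilde n \<theta> + 1"

definition refl_index :: "real \<Rightarrow> real \<Rightarrow> real" where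
  "refl_index kp km = km / kp"

definition critical_angle :: "real \<Rightarrow> real \<Rightarrow> real" where
  "critical_angle kp km = arccos (1 / refl_index kp km)"

definition direction :: "real \<Rightarrow> real \<times> real" where
  "direction \<theta> = (cos \<theta>, sin \<theta>)"

definition reflect :: "real \<times> real \<Rightarrow> real \<times> real" where
  "reflect y = (fst y, - snd y)"

text \<open>The far-field pattern, with the observation direction given by its angle \<open>\<theta>\<close> in
  \<open>(pi, 2 * pi)\<close>. The source point \<open>y\<close> is off the interface \<open>snd y = 0\<close>; the value there
  carries no meaning. The same applies to \<open>green\<close> below.\<close>

definition G_infty :: "real \<Rightarrow> real \<Rightarrow> real \<Rightarrow> real \<times> real \<Rightarrow> complex" where
  "G_infty kp km \<theta> y =
     (let n = refl_index kp km; y1 = complex_of_real (fst y); y2 = complex_of_real (snd y);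
          k = complex_of_real km in
      exp (\<i> * complex_of_real pi / 4) / complex_of_real (sqrt (8 * pi * km)) *
      (if y \<in> upper_half_plane then
         T_tilde n \<theta> *
         exp (- \<i> * k * (y1 * complex_of_real (cos \<theta>)
                           - \<i> * y2 * SS (complex_of_real (cos \<theta>)) (1 / n)))
       else
         exp (- \<i> * k * complex_of_real (direction \<theta> \<bullet> y)) +
         R_tilde n \<theta> * exp (- \<i> * k * complex_of_real (direction \<theta> \<bullet> reflect y))))"

text \<open>Bessel and Neumann functions of order 0 for positive real argument, by their ascending
  series.\<close>

definition bessel_J0 :: "real \<Rightarrow> real" where
  "bessel_J0 t = (\<Sum>m. (- 1) ^ m / (fact m)\<^sup>2 * (t / 2) ^ (2 * m))"

definition bessel_Y0 :: "real \<Rightarrow> real" where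
  "bessel_Y0 t = 2 / pi * (ln (t / 2) + euler_mascheroni) * bessel_J0 t
     - 2 / pi * (\<Sum>m. (- 1) ^ m * harm m / (fact m)\<^sup>2 * (t / 2) ^ (2 * m))"

definition hankel1_0 :: "real \<Rightarrow> complex" where
  "hankel1_0 t = Complex (bessel_J0 t) (bessel_Y0 t)"

text \<open>The two-layered Green function for an observation point \<open>x\<close> in the lower half-plane, i.e. the
  radiating solution of the transmission problem with wave number \<open>kp\<close> above and \<open>km\<close> below the
  interface, in its explicit Fourier (Sommerfeld) integral representation. The integrands are
  absolutely integrable over the line for \<open>snd x < 0\<close> and \<open>snd y \<noteq> 0\<close>.\<close>

definition green :: "real \<Rightarrow> real \<Rightarrow> real \<times> real \<Rightarrow> real \<times> real \<Rightarrow> complex" where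
  "green kp km x y =
     (let Sp = (\<lambda>\<xi>::real. SS (complex_of_real \<xi>) kp);
          Sm = (\<lambda>\<xi>::real. SS (complex_of_real \<xi>) km);
          x1 = fst x; x2 = snd x; y1 = fst y; y2 = snd y in
      if y \<in> upper_half_plane then
        1 / (2 * complex_of_real pi) *
        (LINT \<xi>|lborel.
           exp (- Sp \<xi> * complex_of_real y2 + Sm \<xi> * complex_of_real x2) / (Sp \<xi> + Sm \<xi>) *
           exp (\<i> * complex_of_real (\<xi> * (x1 - y1))))
      else
        \<i> / 4 * hankel1_0 (km * norm (x - y)) +
        1 / (4 * complex_of_real pi) *
        (LINT \<xi>|lborel.
           (Sm \<xi> - Sp \<xi>) / (Sp \<xi> + Sm \<xi>) *
           (exp (- Sm \<xi> * complex_of_real \<bar>x2 + y2\<bar>) / Sm \<xi>) *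
           exp (\<i> * complex_of_real (\<xi> * (x1 - y1)))))"

text \<open>The remainder at the point \<open>x = r *\<^sub>R direction \<theta>\<close>, so that \<open>|x| = r\<close>.\<close>

definition G_Res :: "real \<Rightarrow> real \<Rightarrow> real \<Rightarrow> real \<Rightarrow> real \<times> real \<Rightarrow> complex" where
  "G_Res kp km r \<theta> y =
     green kp km (r *\<^sub>R direction \<theta>) y -
     exp (\<i> * complex_of_real (km * r)) / complex_of_real (sqrt r) * G_infty kp km \<theta> y"

end

theory Submission
  imports Defs "HOL-Complex_Analysis.Complex_Analysis" "HOL-Probability.Distributions"
    "HOL-Real_Asymp.Real_Asymp"
begin

text \<open>
  Write \<open>\<theta> = 2 * pi - \<phi>\<close> with \<open>0 < \<phi> < pi\<close>, \<open>k = km\<close> and \<open>\<nu> = kp / km\<close>. Apart from the incident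
  Hankel function, the Green function is a spectral integral of
  \<open>h \<xi> / SS \<xi> k * exp (r * (- SS \<xi> k * sin \<phi> + \<i> * \<xi> * cos \<phi>))\<close>, where the amplitude \<open>h\<close> contains the
  Fresnel coefficient and the position of the source. Substituting \<open>\<xi> = k * cos t\<close> turns the two
  square roots into \<open>SS \<xi> k = - \<i> * k * sin t\<close> and \<open>SS \<xi> kp = k * s\<close> with
  \<open>s\<^sup>2 = (cos t)\<^sup>2 - \<nu>\<^sup>2\<close>, and the exponential into \<open>exp (\<i> * k * r * cos (t - \<phi>))\<close>, which has one
  saddle, at \<open>t = \<phi>\<close>. The amplitude is then \<open>A t + s * B t s\<close> with \<open>A\<close> entire and \<open>B\<close> continuous: its
  only singularities are square-root branch points where \<open>(cos t)\<^sup>2 = \<nu>\<^sup>2\<close>, that is at the critical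
  angle \<open>crit = arccos \<nu>\<close> and at \<open>pi - crit\<close>.

  On the real segment \<open>s\<close> is real for \<open>\<bar>cos t\<bar> > \<nu>\<close> and \<open>- \<i>\<close> times a positive number for \<open>\<bar>cos t\<bar> < \<nu>\<close>,
  so the amplitude continues holomorphically into three vertical strips separated by
  \<open>Re t = crit\<close> and \<open>Re t = pi - crit\<close>. In each strip the path is moved by Cauchy's theorem to the
  straight line of slope \<open>- 1\<close> through the saddle. What remains are the integrals of the jump of the
  amplitude over the two separating vertical segments; the jump is \<open>O(sqrt \<bar>Im t\<bar>)\<close> and the exponential
  decays there, hence they are \<open>O(r powr (- 3 / 2))\<close> (\<open>spectral_integral_diag\<close>).

  On the diagonal \<open>t = \<phi> + (1 - \<i>) * s\<close> the exponential is nearly \<open>exp (\<i> * k * r) * exp (- k * r * s\<^sup>2)\<close>.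
  If \<open>\<phi>\<close> is not critical the amplitude is differentiable at the saddle; the linear term integrates
  to something exponentially small, and the error beyond the leading Gaussian is
  \<open>O(r powr (- 3 / 2))\<close> (\<open>branched_regular\<close>). If \<open>\<phi>\<close> is critical the branch point sits on the saddle and
  the amplitude differs from its value there by \<open>\<beta> * sqrt \<bar>s\<bar>\<close> on one side and \<open>\<beta>' * sqrt \<bar>s\<bar>\<close> on the
  other. Rescaling \<open>s = u / sqrt r\<close> gives a correction of exact order \<open>r powr (- 3 / 4)\<close> with
  coefficient proportional to \<open>\<beta> + \<beta>'\<close>. The two one-sided roots differ by the factor \<open>- \<i>\<close>, so that
  \<open>\<beta> + \<beta>'\<close> is \<open>1 - \<i>\<close> times a nonzero number times \<open>B \<phi> 0\<close> (\<open>branched_critical\<close>), and \<open>B \<phi> 0\<close> does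
  not vanish in either half-plane.

  For a source below the interface the incident term requires the large-argument behaviour of
  \<open>hankel1_0\<close>, which is given by its ascending series. The same machinery supplies it: with
  amplitude \<open>1\<close> the spectral integral solves Bessel's equation, and its behaviour at \<open>0\<close> identifies
  it with \<open>\<i> * pi * hankel1_0\<close> (\<open>hankel_moment_eq_hankel1_0\<close>, \<open>hankel_asymptotics\<close>).
\<close>

section \<open>Primitives on strips and the angular substitution\<close>

definition strip :: "real \<Rightarrow> real \<Rightarrow> complex set" where
  "strip a b = {t. a \<le> Re t \<and> Re t \<le> b}"

lemma convex_strip: "convex (strip a b)"
proof -
  have "strip a b = {t. Re t \<ge> a} \<inter> {t. Re t \<le> b}" by (auto simp: strip_def)
  then show ?thesis by (simp add: convex_Int convex_halfspace_Re_ge convex_halfspace_Re_le)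
qed

lemma interior_strip: "interior (strip a b) \<subseteq> {t. a < Re t \<and> Re t < b}"
proof
  fix z assume "z \<in> interior (strip a b)"
  then obtain e where e: "e > 0" "cball z e \<subseteq> strip a b"
    by (meson mem_interior_cball)
  have "z - of_real e \<in> cball z e" "z + of_real e \<in> cball z e"
    using e(1) by (auto simp: dist_norm)
  then have "z - of_real e \<in> strip a b" "z + of_real e \<in> strip a b" using e(2) by blast+
  then show "z \<in> {t. a < Re t \<and> Re t < b}" using e(1) by (simp add: strip_def)
qed

text \<open>
  The amplitudes below are not holomorphic, and in general not even differentiable, on the boundary
  lines of their strips, where the branch points lie. Continuity there is enough for a primitive on
  the closed strip, because Cauchy's theorem for triangles needs holomorphy only in the interior.
\<close>

lemma strip_primitive:
  assumes "continuous_on (strip a b) f" "f holomorphic_on {t. a < Re t \<and> Re t < b}"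
  obtains P where "\<And>z. z \<in> strip a b \<Longrightarrow> (P has_field_derivative f z) (at z within strip a b)"
proof -
  have op: "open {t. a < Re t \<and> Re t < b}"
    by (intro open_Collect_conj open_Collect_less continuous_intros)
  have "f field_differentiable at x" if "x \<in> interior (strip a b) - {}" for x
    using that assms(2) op interior_strip holomorphic_on_imp_differentiable_at by blast
  then have "\<exists>P. \<forall>x\<in>strip a b. (P has_field_derivative f x) (at x within strip a b)"
    using holomorphic_convex_primitive[OF convex_strip finite.emptyI assms(1)] by metis
  then obtain P where "\<forall>x\<in>strip a b. (P has_field_derivative f x) (at x within strip a b)" ..
  then show ?thesis using that[of P] by simp
qed

lemma primitive_along_line:
  fixes z0 d :: complex
  assumes P: "\<And>z. z \<in> S \<Longrightarrow> (P has_field_derivative f z) (at z within S)"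
    and "a \<le> b" and S: "\<And>x. x \<in> {a..b} \<Longrightarrow> z0 + of_real x * d \<in> S"
  shows "((\<lambda>x. d * f (z0 + of_real x * d)) has_integral
           (P (z0 + of_real b * d) - P (z0 + of_real a * d))) {a..b}"
proof (rule fundamental_theorem_of_calculus[OF assms(2)])
  fix x assume x: "x \<in> {a..b}"
  have "((\<lambda>x. z0 + of_real x * d) has_vector_derivative d) (at x within {a..b})"
    by (auto intro!: derivative_eq_intros simp: has_vector_derivative_def scaleR_conv_of_real)
  moreover have "(P has_field_derivative f (z0 + of_real x * d))
      (at (z0 + of_real x * d) within (\<lambda>x. z0 + of_real x * d) ` {a..b})"
    by (rule DERIV_subset[OF P[OF S[OF x]]]) (use S in blast)
  ultimately show "((\<lambda>x. P (z0 + of_real x * d)) has_vector_derivative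
      d * f (z0 + of_real x * d)) (at x within {a..b})"
    using field_vector_diff_chain_within[of "\<lambda>x. z0 + of_real x * d" d x "{a..b}" P] by (simp add: o_def)
qed

text \<open>
  The finite set \<open>K\<close> takes up the end points of the angular substitution: the spectral integrand has the
  factor \<open>1 / SS \<xi> k\<close>, singular at \<open>\<xi> = \<plusminus>k\<close>, which the vanishing derivative of \<open>\<gamma>\<close> compensates.
\<close>

lemma absolutely_integrable_substitution:
  fixes f F :: "real \<Rightarrow> complex"
  assumes der: "\<And>x. x \<in> {u..v} \<Longrightarrow> (\<gamma> has_field_derivative \<gamma>' x) (at x within {u..v})"
    and inj: "inj_on \<gamma> {u..v}" and "finite K"
    and eq: "\<And>x. x \<in> {u..v} - K \<Longrightarrow> \<bar>\<gamma>' x\<bar> *\<^sub>R f (\<gamma> x) = F x"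
    and F: "continuous_on {u..v} F"
  shows "f absolutely_integrable_on (\<gamma> ` {u..v})"
    "(f has_integral (integral {u..v} F)) (\<gamma> ` {u..v})"
proof -
  have K: "negligible K" using assms(3) by (rule negligible_finite)
  have "F absolutely_integrable_on {u..v}"
    by (rule absolutely_integrable_continuous_real[OF F])
  then have 1: "(\<lambda>x. \<bar>\<gamma>' x\<bar> *\<^sub>R f (\<gamma> x)) absolutely_integrable_on {u..v}"
    by (rule absolutely_integrable_spike[OF _ K]) (use eq in auto)
  have 2: "integral {u..v} F = integral {u..v} (\<lambda>x. \<bar>\<gamma>' x\<bar> *\<^sub>R f (\<gamma> x))"
    by (rule integral_spike[OF K]) (use eq in auto)
  have "{u..v} \<in> sets lebesgue" by simp
  note cov = has_absolute_integral_change_of_variables_real[OF this der inj, of f "integral {u..v} F"]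
  have 4: "f absolutely_integrable_on (\<gamma> ` {u..v}) \<and> integral (\<gamma> ` {u..v}) f = integral {u..v} F"
    using cov 1 2 by metis
  then show 3: "f absolutely_integrable_on (\<gamma> ` {u..v})" by blast
  have "integral (\<gamma> ` {u..v}) f = integral {u..v} F"
    using 4 by blast
  moreover have "f integrable_on (\<gamma> ` {u..v})" using 3 by (rule set_lebesgue_integral_eq_integral(1))
  ultimately show "(f has_integral (integral {u..v} F)) (\<gamma> ` {u..v})"
    using integrable_integral by metis
qed

text \<open>
  The exponential factor of a plane wave of complex direction angle \<open>t\<close>, observed at distance \<open>r\<close> in
  direction \<open>\<phi>\<close>.
\<close>

definition wave :: "real \<Rightarrow> real \<Rightarrow> real \<Rightarrow> complex \<Rightarrow> complex" where
  "wave k \<phi> r t = exp (\<i> * of_real (k * r) * cos (t - of_real \<phi>))"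

lemma wave_holomorphic [holomorphic_intros]:
  "f holomorphic_on S \<Longrightarrow> (\<lambda>t. wave k \<phi> r (f t)) holomorphic_on S"
  unfolding wave_def by (intro holomorphic_intros)

lemma wave_continuous [continuous_intros]:
  "continuous_on S f \<Longrightarrow> continuous_on S (\<lambda>t. wave k \<phi> r (f t))"
proof -
  assume f: "continuous_on S f"
  have "continuous_on UNIV (wave k \<phi> r)"
    unfolding wave_def by (intro holomorphic_on_imp_continuous_on holomorphic_intros)
  from continuous_on_compose2[OF this f] show ?thesis by simp
qed

lemma norm_wave: "cmod (wave k \<phi> r t) = exp (k * r * sin (Re t - \<phi>) * sinh (Im t))"
  by (simp add: wave_def Im_cos sinh_field_def field_simps)

lemma SS_cos:
  assumes "k > 0" "a \<in> {0..pi}"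
  shows "SS (of_real (k * cos a)) k = - \<i> * of_real (k * sin a)"
proof -
  have s: "sin a \<ge> 0" using assms by (simp add: sin_ge_zero)
  have e: "k\<^sup>2 - (k * cos a)\<^sup>2 = (k * sin a)\<^sup>2"
    by (simp add: sin_squared_eq power_mult_distrib right_diff_distrib)
  show ?thesis
  proof (cases "\<bar>k * cos a\<bar> \<ge> k")
    case True
    then have "\<bar>cos a\<bar> \<ge> 1" using assms by (simp add: abs_mult)
    then have "\<bar>cos a\<bar> = 1" using abs_cos_le_one[of a] by linarith
    then have "(cos a)\<^sup>2 = 1" by (metis power2_abs one_power2)
    then have "sin a = 0" using sin_squared_eq[of a] by simp
    then show ?thesis using True e SS_of_real[OF assms(1), of "k * cos a"] by simp
  next
    case False
    then show ?thesis using SS_of_real[OF assms(1), of "k * cos a"] s e assms(1) by (simp add: real_sqrt_mult)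
  qed
qed

lemma SS_power2: "a > 0 \<Longrightarrow> (SS (complex_of_real \<xi>) a)\<^sup>2 = of_real (\<xi>\<^sup>2 - a\<^sup>2)"
proof -
  assume a: "a > 0"
  have "a\<^sup>2 \<le> \<xi>\<^sup>2 \<longleftrightarrow> a \<le> \<bar>\<xi>\<bar>" using abs_le_square_iff[of a \<xi>] a by simp
  then show ?thesis using a unfolding SS_of_real[OF a]
    by (auto simp: power_mult_distrib simp flip: of_real_power)
qed

lemma SS_scale:
  assumes "k > 0" "a > 0"
  shows "SS (complex_of_real (k * x)) (k * a) = of_real k * SS (of_real x) a"
proof -
  have "\<bar>k * x\<bar> \<ge> k * a \<longleftrightarrow> \<bar>x\<bar> \<ge> a" using assms by (simp add: abs_mult)
  moreover have "sqrt ((k * x)\<^sup>2 - (k * a)\<^sup>2) = k * sqrt (x\<^sup>2 - a\<^sup>2)" "sqrt ((k * a)\<^sup>2 - (k * x)\<^sup>2) = k * sqrt (a\<^sup>2 - x\<^sup>2)"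
    using assms by (simp_all add: power_mult_distrib real_sqrt_mult flip: right_diff_distrib)
  moreover have "k * a > 0" using assms by simp
  ultimately show ?thesis unfolding SS_of_real[OF assms(2)] using SS_of_real[of "k * a" "k * x"] by simp
qed

lemma SS_cosh:
  assumes "k > 0" "b \<ge> 0" "\<xi> = k * cosh b \<or> \<xi> = - (k * cosh b)"
  shows "SS (of_real \<xi>) k = of_real (k * sinh b)"
proof -
  have "\<bar>\<xi>\<bar> = k * cosh b" using assms by (auto simp: abs_mult)
  then have "\<bar>\<xi>\<bar> \<ge> k" "\<xi>\<^sup>2 = (k * cosh b)\<^sup>2" using assms cosh_real_ge_1[of b]
    by (auto simp: power2_eq_square mult_le_cancel_left1)
  moreover have "(k * cosh b)\<^sup>2 - k\<^sup>2 = (k * sinh b)\<^sup>2"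
    by (simp add: cosh_square_eq power_mult_distrib algebra_simps)
  ultimately show ?thesis using assms by (simp add: SS_of_real)
qed

text \<open>
  The purpose of the substitution \<open>\<xi> = k * cos t\<close>: the sign of the root is the one for which the phase
  combines to \<open>cos (t - \<phi>)\<close>.
\<close>

lemma phase_eq_wave:
  assumes "complex_of_real \<xi> = of_real k * cos t" "SS (of_real \<xi>) k = - \<i> * of_real k * sin t"
  shows "exp (of_real r * (- SS (of_real \<xi>) k * of_real (sin \<phi>) + \<i> * of_real (\<xi> * cos \<phi>)))
       = wave k \<phi> r t"
proof -
  have "of_real r * (- (- \<i> * of_real k * sin t) * of_real (sin \<phi>)
      + \<i> * (of_real k * cos t * of_real (cos \<phi>)))
     = \<i> * of_real (k * r) * cos (t - of_real \<phi>)"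
    by (simp add: cos_diff cos_of_real sin_of_real algebra_simps)
  then show ?thesis
    unfolding wave_def of_real_mult[of \<xi>] assms(2)[symmetric] assms(1)[symmetric] by (rule arg_cong)
qed

section \<open>Deforming the spectral path to the steepest-descent diagonal\<close>

lemma sinh_ge_self:
  fixes x :: real assumes "x \<ge> 0" shows "x \<le> sinh x"
proof -
  have "sinh 0 - 0 \<le> sinh x - x"
    using assms cosh_real_ge_1
    by (intro DERIV_nonneg_imp_nondecreasing[of 0 x "\<lambda>x. sinh x - x"])
       (auto intro!: exI derivative_eq_intros)
  then show ?thesis by simp
qed

text \<open>
  Half of the exponential absorbs \<open>sqrt (c * u)\<close>; integrating the other half gives the remaining power
  of \<open>c\<close>.
\<close>

lemma sqrt_exp_integral_bound:
  fixes f :: "real \<Rightarrow> complex"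
  assumes f: "(f has_integral D) {0..1}" and c: "c > 0" and "A \<ge> 0"
    and le: "\<And>u. u \<in> {0..1} \<Longrightarrow> cmod (f u) \<le> A * (sqrt u * exp (- (c * u)))"
  shows "cmod D \<le> 2 * A * c powr (- 3 / 2)"
proof -
  have int: "((\<lambda>u. exp (- (c / 2 * u))) has_integral
      (- exp (- (c / 2 * 1)) / (c / 2) - - exp (- (c / 2 * 0)) / (c / 2))) {0..1}"
    by (rule fundamental_theorem_of_calculus)
       (use c in \<open>auto intro!: derivative_eq_intros simp flip: has_real_derivative_iff_has_vector_derivative\<close>)
  have pt: "cmod (f u) \<le> A * c powr (- 1 / 2) * exp (- (c / 2 * u))" if "u \<in> {0..1}" for u
  proof -
    have "c * u \<le> exp (c * u)" using exp_ge_add_one_self[of "c * u"] by linarith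
    then have "sqrt (c * u) \<le> sqrt (exp (c * u))" by (rule real_sqrt_le_mono)
    also have "\<dots> = exp (c * u / 2)"
      by (rule real_sqrt_unique) (auto simp: power2_eq_square simp flip: exp_add)
    finally have "sqrt u * sqrt c * exp (- (c * u)) \<le> exp (c * u / 2) * exp (- (c * u))"
      by (intro mult_right_mono) (auto simp: real_sqrt_mult mult.commute)
    also have "\<dots> = exp (- (c / 2 * u))" by (simp flip: exp_add)
    finally have "sqrt u * exp (- (c * u)) \<le> c powr (- 1 / 2) * exp (- (c / 2 * u))"
      using c by (simp add: powr_minus powr_half_sqrt field_simps)
    with le[OF that] \<open>A \<ge> 0\<close> show ?thesis
      by (smt (verit, best) mult.assoc mult_left_mono)
  qed
  have "cmod (integral {0..1} f) \<le> integral {0..1} (\<lambda>u. A * c powr (- 1 / 2) * exp (- (c / 2 * u)))"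
    by (rule integral_norm_bound_integral)
       (use f int pt in \<open>auto simp: has_integral_iff intro!: integrable_on_mult_right\<close>)
  also have "\<dots> = A * c powr (- 1 / 2) * ((1 - exp (- (c / 2))) / (c / 2))"
    using int c by (simp add: has_integral_iff diff_divide_distrib)
  also have "\<dots> \<le> A * c powr (- 1 / 2) * (1 / (c / 2))"
    using c \<open>A \<ge> 0\<close> by (intro mult_left_mono divide_right_mono) auto
  also have "\<dots> = 2 * A * (c powr (- 1 / 2) * c powr (-1))"
    using c by (simp add: powr_minus field_simps)
  also have "\<dots> = 2 * A * c powr (- 1 / 2 + - 1)" by (simp only: powr_add)
  also have "\<dots> = 2 * A * c powr (- 3 / 2)" by simp
  finally show ?thesis using f by (simp add: has_integral_iff)
qed

text \<open>
  The discrepancy between two strips is the integral of the jump of the amplitude over the vertical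
  segment from \<open>p\<close> to \<open>T\<close>, the point of the steepest-descent diagonal above or below \<open>p\<close>. The segment lies in
  the valley of the saddle, where the wave decays like \<open>exp (- k * r * sin \<bar>p - \<phi>\<bar> * \<bar>Im t\<bar>)\<close>, and the
  square-root bound on the jump produces the exponent \<open>- 3 / 2\<close>. If \<open>p = \<phi>\<close> the segment is a point.
\<close>

lemma branch_mismatch_bound:
  fixes f g :: "complex \<Rightarrow> complex"
  assumes P: "\<And>z. z \<in> S \<Longrightarrow> (P has_field_derivative f z * wave k \<phi> r z) (at z within S)"
    and Q: "\<And>z. z \<in> S' \<Longrightarrow> (Q has_field_derivative g z * wave k \<phi> r z) (at z within S')"
    and S: "\<And>b. Complex p b \<in> S" "\<And>b. Complex p b \<in> S'"
    and k: "k > 0" "r > 0" "M \<ge> 0" and \<delta>: "\<bar>p - \<phi>\<bar> < pi"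
    and jump: "\<And>b. \<bar>b\<bar> \<le> pi \<Longrightarrow> cmod (f (Complex p b) - g (Complex p b)) \<le> M * sqrt \<bar>b\<bar>"
  defines "T \<equiv> Complex p (\<phi> - p)"
  shows "cmod ((P T - P p) - (Q T - Q p)) \<le>
     2 * M * pi\<^sup>2 * (k * \<bar>p - \<phi>\<bar> * sin \<bar>p - \<phi>\<bar>) powr (- 3 / 2) * r powr (- 3 / 2)"
proof (cases "p = \<phi>")
  case True
  then have "T = of_real p" by (simp add: T_def complex_eq_iff)
  then show ?thesis using True by simp
next
  case False
  define \<delta> where "\<delta> = \<bar>p - \<phi>\<bar>"
  have d: "0 < \<delta>" "\<delta> < pi" using False \<delta> by (auto simp: \<delta>_def)
  then have sd: "sin \<delta> > 0" by (rule sin_gt_zero)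
  define d where "d = \<i> * of_real (\<phi> - p)"
  have pd: "of_real p + of_real u * d = Complex p (u * (\<phi> - p))" for u
    by (simp add: d_def complex_eq_iff)
  have ends: "of_real p + of_real 1 * d = T" "of_real p + of_real 0 * d = of_real p"
    by (simp_all add: T_def d_def complex_eq_iff)
  have "((\<lambda>u. d * (f (of_real p + of_real u * d) * wave k \<phi> r (of_real p + of_real u * d))) has_integral
      (P T - P p)) {0..1}"
    using primitive_along_line[OF P, of 0 1 "of_real p" d] unfolding ends by (simp add: pd S)
  moreover have "((\<lambda>u. d * (g (of_real p + of_real u * d) * wave k \<phi> r (of_real p + of_real u * d))) has_integral
      (Q T - Q p)) {0..1}"
    using primitive_along_line[OF Q, of 0 1 "of_real p" d] unfolding ends by (simp add: pd S)
  ultimately have "((\<lambda>u. d * ((f (of_real p + of_real u * d) - g (of_real p + of_real u * d)) *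
       wave k \<phi> r (of_real p + of_real u * d))) has_integral ((P T - P p) - (Q T - Q p))) {0..1}"
    unfolding left_diff_distrib right_diff_distrib by (rule has_integral_diff)
  then have "cmod ((P T - P p) - (Q T - Q p)) \<le> 2 * (M * pi\<^sup>2) * (k * \<delta> * sin \<delta> * r) powr (- 3 / 2)"
  proof (rule sqrt_exp_integral_bound)
    show "k * \<delta> * sin \<delta> * r > 0" "M * pi\<^sup>2 \<ge> 0" using k d sd by auto
    fix u :: real assume u: "u \<in> {0..1}"
    let ?z = "of_real p + of_real u * d"
    have ub: "\<bar>u * (\<phi> - p)\<bar> = u * \<delta>" using u by (simp add: \<delta>_def abs_mult abs_minus_commute)
    have "u * \<delta> \<le> 1 * \<delta>" using u d by (intro mult_right_mono) auto
    then have "u * \<delta> \<le> pi" using d by linarith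
    then have "cmod (f ?z - g ?z) \<le> M * sqrt (u * \<delta>)"
      using jump[of "u * (\<phi> - p)"] by (simp only: pd ub)
    also have "\<dots> = M * sqrt \<delta> * sqrt u" by (simp add: real_sqrt_mult)
    also have "\<dots> \<le> M * pi * sqrt u"
    proof (intro mult_right_mono mult_left_mono k)
      have "sqrt \<delta> \<le> sqrt (pi\<^sup>2)" using d pi_gt3 by (intro real_sqrt_le_mono) (simp add: power2_eq_square, smt (verit) mult_le_cancel_left1)
      then show "sqrt \<delta> \<le> pi" by simp
    qed (use u in auto)
    finally have 1: "cmod (f ?z - g ?z) \<le> M * pi * sqrt u" .
    have "sin (p - \<phi>) * sinh (u * (\<phi> - p)) = - (sin \<delta> * sinh (u * \<delta>))"
    proof (cases "p \<ge> \<phi>")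
      case True
      then have "\<delta> = p - \<phi>" by (simp add: \<delta>_def)
      moreover have "u * (\<phi> - p) = - (u * (p - \<phi>))" by algebra
      ultimately show ?thesis by (simp only: sinh_minus)
    next
      case False
      then have "\<delta> = \<phi> - p" by (simp add: \<delta>_def)
      moreover have "sin (p - \<phi>) = - sin (\<phi> - p)" by (metis minus_diff_eq sin_minus)
      ultimately show ?thesis by simp
    qed
    also have "\<dots> \<le> - (sin \<delta> * (u * \<delta>))"
      using sd d u sinh_ge_self[of "u * \<delta>"] by simp
    finally have "k * r * (sin (p - \<phi>) * sinh (u * (\<phi> - p))) \<le> k * r * - (sin \<delta> * (u * \<delta>))"
      using k by (intro mult_left_mono) auto
    then have 2: "cmod (wave k \<phi> r ?z) \<le> exp (- (k * \<delta> * sin \<delta> * r * u))"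
      unfolding pd norm_wave by (simp add: mult_ac)
    have 3: "cmod d \<le> pi" using d by (simp add: d_def norm_mult \<delta>_def abs_minus_commute del: of_real_diff)
    have "cmod d * (cmod (f ?z - g ?z) * cmod (wave k \<phi> r ?z)) \<le>
       pi * ((M * pi * sqrt u) * exp (- (k * \<delta> * sin \<delta> * r * u)))"
      by (intro mult_mono 1 2 3 mult_nonneg_nonneg) (use k u in auto)
    then show "cmod (d * ((f ?z - g ?z) * wave k \<phi> r ?z)) \<le>
       M * pi\<^sup>2 * (sqrt u * exp (- (k * \<delta> * sin \<delta> * r * u)))"
      by (simp add: norm_mult power2_eq_square mult_ac)
  qed
  also have "(k * \<delta> * sin \<delta> * r) powr (- 3 / 2) = (k * \<delta> * sin \<delta>) powr (- 3 / 2) * r powr (- 3 / 2)"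
    by (rule powr_mult)
  finally show ?thesis by (simp add: \<delta>_def mult.assoc)
qed

definition spectral_integrand :: "real \<Rightarrow> real \<Rightarrow> (real \<Rightarrow> complex) \<Rightarrow> real \<Rightarrow> real \<Rightarrow> complex" where
  "spectral_integrand k \<phi> h r \<xi> = h \<xi> / SS (of_real \<xi>) k *
     exp (of_real r * (- SS (of_real \<xi>) k * of_real (sin \<phi>) + \<i> * of_real (\<xi> * cos \<phi>)))"

text \<open>
  The amplitude \<open>h\<close> of a spectral integral together with its continuations \<open>g1\<close>, \<open>g2\<close>, \<open>g3\<close> into
  three adjacent vertical strips of the \<open>t\<close>-plane. Under \<open>\<xi> = k * cos t\<close> the real \<open>\<xi>\<close>-axis corresponds to
  the path that descends along \<open>Re t = 0\<close>, follows the real segment from \<open>0\<close> to \<open>pi\<close> and descends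
  along \<open>Re t = pi\<close>. The assumptions \<open>propagating\<close> and \<open>evanescent\<close> say that the continuations
  reproduce \<open>h\<close> on the horizontal and vertical parts of it.
\<close>

locale layered_amplitude =
  fixes k \<phi> p1 p2 M :: real and h :: "real \<Rightarrow> complex" and g1 g2 g3 :: "complex \<Rightarrow> complex"
  assumes k: "k > 0" and \<phi>: "0 < \<phi>" "\<phi> < pi" and p: "0 < p1" "p1 < p2" "p2 < pi"
    and M: "M \<ge> 0"
    and cont: "continuous_on (strip 0 p1) g1" "continuous_on (strip p1 p2) g2"
      "continuous_on (strip p2 pi) g3"
    and hol: "g1 holomorphic_on {t. 0 < Re t \<and> Re t < p1}"
      "g2 holomorphic_on {t. p1 < Re t \<and> Re t < p2}" "g3 holomorphic_on {t. p2 < Re t \<and> Re t < pi}"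
    and jump: "\<And>b. \<bar>b\<bar> \<le> pi \<Longrightarrow> cmod (g1 (Complex p1 b) - g2 (Complex p1 b)) \<le> M * sqrt \<bar>b\<bar>"
      "\<And>b. \<bar>b\<bar> \<le> pi \<Longrightarrow> cmod (g2 (Complex p2 b) - g3 (Complex p2 b)) \<le> M * sqrt \<bar>b\<bar>"
    and propagating: "\<And>a. a \<in> {0..p1} \<Longrightarrow> h (k * cos a) = g1 (of_real a)"
      "\<And>a. a \<in> {p1..p2} \<Longrightarrow> h (k * cos a) = g2 (of_real a)"
      "\<And>a. a \<in> {p2..pi} \<Longrightarrow> h (k * cos a) = g3 (of_real a)"
    and evanescent: "\<And>b. b \<ge> 0 \<Longrightarrow> h (k * cosh b) = g1 (Complex 0 b)"
      "\<And>b. b \<ge> 0 \<Longrightarrow> h (- (k * cosh b)) = g3 (Complex pi (- b))"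
    and bounded: "\<And>\<xi>. \<bar>\<xi>\<bar> \<ge> k \<Longrightarrow> cmod (h \<xi>) \<le> M"
    and measurable [measurable]: "h \<in> borel_measurable borel"
begin

text \<open>
  The line of steepest descent through the saddle \<open>\<phi>\<close>, straightened. It meets \<open>Re t = 0\<close> and
  \<open>Re t = pi\<close> in \<open>\<i> * \<phi>\<close> and \<open>pi - \<i> * (pi - \<phi>)\<close>, which correspond to \<open>\<xi> = k * cosh \<phi>\<close> and
  \<open>\<xi> = - k * cosh (pi - \<phi>)\<close>.
\<close>

definition diag :: "real \<Rightarrow> complex" where
  "diag a = Complex a (\<phi> - a)"

abbreviation "integrand \<equiv> spectral_integrand k \<phi> h"

definition profile :: "real \<Rightarrow> complex" where
  "profile a = (if a < p1 then g1 (diag a) else if a < p2 then g2 (diag a) else g3 (diag a))"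

lemma propagating_piece:
  assumes P: "\<And>z. z \<in> strip a b \<Longrightarrow> (P has_field_derivative g z * wave k \<phi> r z) (at z within strip a b)"
    and "0 \<le> a" "a \<le> b" "b \<le> pi" and g: "continuous_on (strip a b) g"
    and h: "\<And>x. x \<in> {a..b} \<Longrightarrow> h (k * cos x) = g (of_real x)"
  shows "integrand r absolutely_integrable_on {k * cos b..k * cos a}"
    "(integrand r has_integral (\<i> * (P b - P a))) {k * cos b..k * cos a}"
proof -
  let ?F = "\<lambda>x::real. \<i> * (g (of_real x) * wave k \<phi> r (of_real x))"
  have img: "(\<lambda>x. k * cos x) ` {a..b} = {k * cos b..k * cos a}"
  proof (intro equalityI subsetI)
    fix y assume "y \<in> (\<lambda>x. k * cos x) ` {a..b}"
    then show "y \<in> {k * cos b..k * cos a}"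
      using assms(2-4) k by (auto intro!: cos_monotone_0_pi_le)
  next
    fix y assume y: "y \<in> {k * cos b..k * cos a}"
    have "\<exists>x\<ge>a. x \<le> b \<and> k * cos x = y"
      by (rule IVT2') (use y \<open>a \<le> b\<close> in \<open>auto intro!: continuous_intros\<close>)
    then show "y \<in> (\<lambda>x. k * cos x) ` {a..b}" by auto
  qed
  have line: "((\<lambda>x. 1 * (g (0 + of_real x * 1) * wave k \<phi> r (0 + of_real x * 1))) has_integral
       (P (0 + of_real b * 1) - P (0 + of_real a * 1))) {a..b}"
    by (rule primitive_along_line[OF P]) (use \<open>a \<le> b\<close> in \<open>auto simp: strip_def\<close>)
  have int: "(?F has_integral \<i> * (P b - P a)) {a..b}"
    using has_integral_mult_right[OF line, of \<i>] by simp
  have "continuous_on {a..b} ?F"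
    by (intro continuous_intros continuous_on_compose2[OF g]) (auto simp: strip_def)
  note sub = absolutely_integrable_substitution[OF _ _ _ _ this, of "\<lambda>x. k * cos x" "\<lambda>x. - (k * sin x)" "{0, pi}" "integrand r"]
  have eq: "\<bar>- (k * sin x)\<bar> *\<^sub>R integrand r (k * cos x) = ?F x" if "x \<in> {a..b} - {0, pi}" for x
  proof -
    have x: "0 < x" "x < pi" "x \<in> {a..b}" using that assms(2-4) by auto
    then have s: "sin x > 0" by (auto intro: sin_gt_zero)
    have SS: "SS (of_real (k * cos x)) k = - \<i> * of_real (k * sin x)"
      using SS_cos[OF k, of x] x by simp
    have "exp (of_real r * (- SS (of_real (k * cos x)) k * of_real (sin \<phi>) + \<i> * of_real (k * cos x * cos \<phi>))) = wave k \<phi> r x"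
      by (rule phase_eq_wave) (use SS in \<open>auto simp: cos_of_real sin_of_real\<close>)
    then show ?thesis
      unfolding spectral_integrand_def SS h[OF x(3)] using k s
      by (simp add: scaleR_conv_of_real field_simps abs_mult)
  qed
  have inj: "inj_on (\<lambda>x. k * cos x) {a..b}"
    using k assms(2-4) by (auto intro!: inj_onI dest!: cos_inj_pi[rotated -1])
  have der: "((\<lambda>x. k * cos x) has_real_derivative - (k * sin x)) (at x within {a..b})" for x
    by (auto intro!: derivative_eq_intros)
  from sub[OF der inj _ eq] show "integrand r absolutely_integrable_on {k * cos b..k * cos a}"
    by (simp add: img)
  from sub(2)[OF der inj _ eq] show "(integrand r has_integral (\<i> * (P b - P a))) {k * cos b..k * cos a}"
    using int by (simp add: img has_integral_iff)
qed

text \<open>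
  The cases \<open>e = 1\<close>, \<open>c = 0\<close> and \<open>e = - 1\<close>, \<open>c = pi\<close> are the two vertical parts of the path, which carry the
  frequencies \<open>\<xi> \<ge> k\<close> and \<open>\<xi> \<le> - k\<close>.
\<close>

lemma evanescent_piece:
  fixes c :: real and e :: real
  assumes P: "\<And>z. z \<in> S \<Longrightarrow> (P has_field_derivative g z * wave k \<phi> r z) (at z within S)"
    and "B \<ge> 0" and S: "\<And>b. Complex c b \<in> S"
    and g: "continuous_on S g" and e: "e = 1 \<and> c = 0 \<or> e = - 1 \<and> c = pi"
    and h: "\<And>b. b \<ge> 0 \<Longrightarrow> h (e * (k * cosh b)) = g (Complex c (e * b))"
  shows "integrand r absolutely_integrable_on (\<lambda>b. e * (k * cosh b)) ` {0..B}"
    "(integrand r has_integral (- (e * \<i>) * (P (Complex c (e * B)) - P c))) ((\<lambda>b. e * (k * cosh b)) ` {0..B})"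
proof -
  let ?F = "\<lambda>b::real. g (Complex c (e * b)) * wave k \<phi> r (Complex c (e * b))"
  have z: "of_real c + of_real x * (of_real e * \<i>) = Complex c (e * x)" for x
    by (simp add: complex_eq_iff)
  have "((\<lambda>x. (of_real e * \<i>) * (g (of_real c + of_real x * (of_real e * \<i>)) * wave k \<phi> r (of_real c + of_real x * (of_real e * \<i>)))) has_integral
       (P (of_real c + of_real B * (of_real e * \<i>)) - P (of_real c + of_real 0 * (of_real e * \<i>)))) {0..B}"
    by (rule primitive_along_line[OF P \<open>B \<ge> 0\<close>]) (use S in \<open>auto simp: z\<close>)
  from has_integral_mult_right[OF this[unfolded z], of "- (of_real e * \<i>)"]
  have *: "((\<lambda>x. - (of_real e * \<i>) * (of_real e * \<i> * ?F x)) has_integral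
      - (e * \<i>) * (P (Complex c (e * B)) - P c)) {0..B}"
    by (simp only: mult_zero_right complex_of_real_def)
  have "- (of_real e * \<i>) * (of_real e * \<i> * w) = w" for w
    using e by auto
  then have int: "(?F has_integral - (e * \<i>) * (P (Complex c (e * B)) - P c)) {0..B}"
    using * by simp
  have "continuous_on {0..B} ?F"
    unfolding z[symmetric] by (intro continuous_intros continuous_on_compose2[OF g]) (auto simp: z S)
  note sub = absolutely_integrable_substitution[OF _ _ _ _ this, of "\<lambda>x. e * (k * cosh x)" "\<lambda>x. e * (k * sinh x)" "{0}" "integrand r"]
  have eq: "\<bar>e * (k * sinh x)\<bar> *\<^sub>R integrand r (e * (k * cosh x)) = ?F x" if "x \<in> {0..B} - {0}" for x
  proof -
    have x: "0 < x" using that by auto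
    have SS: "SS (of_real (e * (k * cosh x))) k = of_real (k * sinh x)"
      by (rule SS_cosh) (use e k x in auto)
    have c: "cos (Complex c (e * x)) = of_real (e * cosh x)" "sin (Complex c (e * x)) = \<i> * of_real (sinh x)"
      using e by (auto simp: complex_eq_iff Re_cos Im_cos Re_sin Im_sin cosh_field_def sinh_field_def field_simps)
    have "exp (of_real r * (- SS (of_real (e * (k * cosh x))) k * of_real (sin \<phi>) + \<i> * of_real (e * (k * cosh x) * cos \<phi>))) = wave k \<phi> r (Complex c (e * x))"
      by (rule phase_eq_wave) (use SS in \<open>auto simp: c algebra_simps\<close>)
    then show ?thesis
      unfolding spectral_integrand_def SS h[OF less_imp_le[OF x]] using k x e
      by (auto simp: scaleR_conv_of_real field_simps abs_mult)
  qed
  have inj: "inj_on (\<lambda>x. e * (k * cosh x)) {0..B}"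
    using k e by (auto intro!: inj_onI)
  have der: "((\<lambda>x. e * (k * cosh x)) has_real_derivative e * (k * sinh x)) (at x within {0..B})" for x
    by (auto intro!: derivative_eq_intros)
  from sub[OF der inj _ eq] show "integrand r absolutely_integrable_on (\<lambda>b. e * (k * cosh b)) ` {0..B}"
    by simp
  from sub(2)[OF der inj _ eq] show "(integrand r has_integral (- (e * \<i>) * (P (Complex c (e * B)) - P c))) ((\<lambda>b. e * (k * cosh b)) ` {0..B})"
    using int by (simp add: has_integral_iff)
qed

lemma cosh_image:
  assumes "B \<ge> 0"
  shows "(\<lambda>b. 1 * (k * cosh b)) ` {0..B} = {k..k * cosh B}"
    "(\<lambda>b. - 1 * (k * cosh b)) ` {0..B} = {- (k * cosh B)..- k}"
proof -
  show 1: "(\<lambda>b. 1 * (k * cosh b)) ` {0..B} = {k..k * cosh B}"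
  proof (intro equalityI subsetI)
    fix y assume y: "y \<in> {k..k * cosh B}"
    have "\<exists>x\<ge>0. x \<le> B \<and> 1 * (k * cosh x) = y"
      by (rule IVT') (use y assms in \<open>auto intro!: continuous_intros\<close>)
    then show "y \<in> (\<lambda>b. 1 * (k * cosh b)) ` {0..B}" by auto
  qed (use k in \<open>auto simp: cosh_real_nonneg_le_iff mult_le_cancel_left1 cosh_real_ge_1\<close>)
  have "(\<lambda>b. - 1 * (k * cosh b)) ` {0..B} = uminus ` ((\<lambda>b. 1 * (k * cosh b)) ` {0..B})"
    by (simp add: image_image)
  then show "(\<lambda>b. - 1 * (k * cosh b)) ` {0..B} = {- (k * cosh B)..- k}"
    unfolding 1 by simp
qed

end

lemma SS_measurable [measurable]:
  assumes "a > 0" shows "(\<lambda>\<xi>::real. SS (of_real \<xi>) a) \<in> borel_measurable borel"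
  unfolding SS_of_real[OF assms] by measurable

lemma bigo_from_powr_exp_bound:
  fixes X :: "real \<Rightarrow> complex"
  assumes "c > 0" and bound: "\<And>r. r \<ge> 1 \<Longrightarrow> cmod (X r) \<le> A * r powr (- 3 / 2) + B * exp (- (c * r))"
  shows "X \<in> O[at_top](\<lambda>r. of_real (r powr (- 3 / 2)))"
proof -
  have e: "(\<lambda>r::real. exp (- (c * r))) \<in> O[at_top](\<lambda>r. r powr (- 3 / 2))"
    using \<open>c > 0\<close> by real_asymp
  have const: "(\<lambda>r. K * f r) \<in> O[at_top](g)" if "f \<in> O[at_top](g)" for K :: real and f g :: "real \<Rightarrow> real"
    using landau_o.big_mult[of "\<lambda>_. K" at_top "\<lambda>_. 1" f g] that by simp
  have "X \<in> O[at_top](\<lambda>r. of_real (A * r powr (- 3 / 2) + B * exp (- (c * r))))"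
  proof (rule landau_o.big_mono, rule eventually_mono[OF eventually_ge_at_top[of 1]])
    fix r :: real assume "1 \<le> r"
    from bound[OF this] show "cmod (X r) \<le> cmod (of_real (A * r powr (- 3 / 2) + B * exp (- (c * r))))"
      unfolding norm_of_real by linarith
  qed
  also have "(\<lambda>r. complex_of_real (A * r powr (- 3 / 2) + B * exp (- (c * r)))) \<in> O[at_top](\<lambda>r. of_real (r powr (- 3 / 2)))"
    by (rule landau_o.big.of_real_iff[THEN iffD2],
        rule sum_in_bigo(1)[OF const[OF landau_o.big_refl] const[OF e]])
  finally show ?thesis .
qed

lemma exp_abs_integrable:
  assumes "c > 0" shows "integrable lborel (\<lambda>x::real. exp (- (c * \<bar>x\<bar>)))"
proof -
  have "(\<lambda>x. exp (- (c * \<bar>x\<bar>))) absolutely_integrable_on {0..}"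
    using has_integral_eq[OF _ has_integral_exp_minus_to_infinity[OF assms, of 0], of "\<lambda>x. exp (- (c * \<bar>x\<bar>))"]
    by (intro nonnegative_absolutely_integrable_1) (auto simp: has_integral_iff)
  then have "integrable lborel (\<lambda>x. indicator {0..} x *\<^sub>R exp (- (c * \<bar>x\<bar>)))"
    unfolding set_integrable_def by (subst (asm) integrable_completion) auto
  then show ?thesis
    using has_bochner_integral_even_function[of "\<lambda>x. exp (- (c * \<bar>x\<bar>))"]
    by (auto simp: has_bochner_integral_iff)
qed

context layered_amplitude
begin

lemma integrand_measurable [measurable]: "integrand r \<in> borel_measurable borel"
  unfolding spectral_integrand_def using k by measurable

text \<open>
  Cauchy's theorem strip by strip, expressed through the primitives of the strips. The part of the path
  between the end points of the diagonal and the diagonal itself have the same end points, so the two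
  integrals differ only by the mismatches of the primitives along \<open>Re t = p1\<close> and \<open>Re t = p2\<close>.
\<close>

lemma compact_part:
  assumes r: "r > 0"
  obtains J S where "integrand r absolutely_integrable_on {- (k * cosh (pi - \<phi>))..k * cosh \<phi>}"
    "(integrand r has_integral J) {- (k * cosh (pi - \<phi>))..k * cosh \<phi>}"
    "((\<lambda>a. (1 - \<i>) * (profile a * wave k \<phi> r (diag a))) has_integral S) {0..pi}"
    "cmod (J - \<i> * S) \<le> (2 * M * pi\<^sup>2 * (k * \<bar>p1 - \<phi>\<bar> * sin \<bar>p1 - \<phi>\<bar>) powr (- 3 / 2) +
       2 * M * pi\<^sup>2 * (k * \<bar>p2 - \<phi>\<bar> * sin \<bar>p2 - \<phi>\<bar>) powr (- 3 / 2)) * r powr (- 3 / 2)"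
proof -
  have wc: "continuous_on X (\<lambda>z. g z * wave k \<phi> r z)" if "continuous_on X g" for X g
    using that by (intro continuous_intros)
  have wh: "(\<lambda>z. g z * wave k \<phi> r z) holomorphic_on X" if "g holomorphic_on X" for X g
    using that by (intro holomorphic_intros)
  obtain P1 where P1: "\<And>z. z \<in> strip 0 p1 \<Longrightarrow> (P1 has_field_derivative g1 z * wave k \<phi> r z) (at z within strip 0 p1)"
    using strip_primitive[OF wc[OF cont(1)] wh[OF hol(1)]] by blast
  obtain P2 where P2: "\<And>z. z \<in> strip p1 p2 \<Longrightarrow> (P2 has_field_derivative g2 z * wave k \<phi> r z) (at z within strip p1 p2)"
    using strip_primitive[OF wc[OF cont(2)] wh[OF hol(2)]] by blast
  obtain P3 where P3: "\<And>z. z \<in> strip p2 pi \<Longrightarrow> (P3 has_field_derivative g3 z * wave k \<phi> r z) (at z within strip p2 pi)"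
    using strip_primitive[OF wc[OF cont(3)] wh[OF hol(3)]] by blast
  let ?A1 = "k * cosh \<phi>" and ?A2 = "k * cosh (pi - \<phi>)"
  let ?D1 = "(P1 (diag p1) - P1 p1) - (P2 (diag p1) - P2 p1)"
  let ?D2 = "(P2 (diag p2) - P2 p2) - (P3 (diag p2) - P3 p2)"
  let ?S = "(P1 (diag p1) - P1 (diag 0)) + (P2 (diag p2) - P2 (diag p1)) + (P3 (diag pi) - P3 (diag p2))"
  note pp = propagating_piece[OF P1 order.refl _ _ cont(1) propagating(1)]
    propagating_piece[OF P2 _ _ _ cont(2) propagating(2)]
    propagating_piece[OF P3 _ _ order.refl cont(3) propagating(3)]
  have B: "0 \<le> \<phi>" "0 \<le> pi - \<phi>" using \<phi> by auto
  have ev: "\<And>b. b \<ge> 0 \<Longrightarrow> h (1 * (k * cosh b)) = g1 (Complex 0 (1 * b))"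
    "\<And>b. b \<ge> 0 \<Longrightarrow> h (- 1 * (k * cosh b)) = g3 (Complex pi (- 1 * b))"
    using evanescent by auto
  have "Complex 0 b \<in> strip 0 p1" "Complex pi b \<in> strip p2 pi" for b using p by (auto simp: strip_def)
  note e1 = evanescent_piece[OF P1 B(1) this(1) cont(1) _ ev(1), unfolded cosh_image[OF B(1)], simplified]
   and e3 = evanescent_piece[OF P3 B(2) this(2) cont(3) _ ev(2), unfolded cosh_image[OF B(2)], simplified]
  let ?J = "(((\<i> * (P3 (diag pi) - P3 pi) + \<i> * (P3 pi - P3 p2)) + \<i> * (P2 p2 - P2 p1)) + \<i> * (P1 p1 - P1 0)) + - (\<i> * (P1 (diag 0) - P1 0))"
  have c: "cos p2 \<le> cos p1" "-1 \<le> cos p2" "cos p1 \<le> 1" using p by (auto intro: cos_monotone_0_pi_le)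
  have d0: "diag 0 = Complex 0 \<phi>" "diag pi = Complex pi (\<phi> - pi)" by (simp_all add: diag_def)
  have ord: "- ?A2 \<le> - k" "- k \<le> k * cos p2" "k * cos p2 \<le> k * cos p1" "k * cos p1 \<le> k" "k \<le> ?A1"
    using k c cosh_real_ge_1[of "pi - \<phi>"] cosh_real_ge_1[of "\<phi>"] mult_left_mono[OF c(2), of k] by auto
  have i1: "(integrand r has_integral (\<i> * (P1 p1 - P1 0))) {k * cos p1..k}"
    "integrand r absolutely_integrable_on {k * cos p1..k}"
    using pp(1,2) p by auto
  have i2: "(integrand r has_integral (\<i> * (P2 p2 - P2 p1))) {k * cos p2..k * cos p1}"
    "integrand r absolutely_integrable_on {k * cos p2..k * cos p1}"
    using pp(3,4) p by auto
  have i3: "(integrand r has_integral (\<i> * (P3 pi - P3 p2))) {- k..k * cos p2}"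
    "integrand r absolutely_integrable_on {- k..k * cos p2}"
    using pp(5,6) p by auto
  have J: "(integrand r has_integral ?J) {- ?A2..?A1}"
    unfolding d0
    by (intro has_integral_combine[of "- ?A2" k] has_integral_combine[of "- ?A2" "k * cos p1"]
          has_integral_combine[of "- ?A2" "k * cos p2"] has_integral_combine[of "- ?A2" "- k"]
          e1(2) e3(2) i1(1) i2(1) i3(1)) (use ord in linarith)+
  have un: "{- ?A2..?A1} = {- ?A2..- k} \<union> {- k..k * cos p2} \<union> {k * cos p2..k * cos p1} \<union> {k * cos p1..k} \<union> {k..?A1}"
    using ord by auto
  have abs: "integrand r absolutely_integrable_on {- ?A2..?A1}"
    unfolding un by (intro absolutely_integrable_Un e1(1) e3(1) i1(2) i2(2) i3(2))
  have line: "of_real a * (1 - \<i>) + \<i> * of_real \<phi> = diag a" for a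
    by (simp add: diag_def complex_eq_iff)
  have slant: "((\<lambda>x. (1 - \<i>) * (g (diag x) * wave k \<phi> r (diag x))) has_integral (P (diag b) - P (diag a))) {a..b}"
    if "\<And>z. z \<in> strip a b \<Longrightarrow> (P has_field_derivative g z * wave k \<phi> r z) (at z within strip a b)" "a \<le> b" for a b g P
  proof -
    have "\<i> * of_real \<phi> + of_real x * (1 - \<i>) \<in> strip a b" if "x \<in> {a..b}" for x
      using that by (simp add: strip_def)
    from primitive_along_line[OF that(1) that(2) this] show ?thesis
      by (simp only: add.commute[of "\<i> * of_real \<phi>"] line)
  qed
  have "((\<lambda>x. (1 - \<i>) * (profile x * wave k \<phi> r (diag x))) has_integral (P1 (diag p1) - P1 (diag 0))) {0..p1}"
    by (rule has_integral_spike_finite[OF _ _ slant[OF P1], of "{p1}"]) (use p in \<open>auto simp: profile_def\<close>)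
  moreover have "((\<lambda>x. (1 - \<i>) * (profile x * wave k \<phi> r (diag x))) has_integral (P2 (diag p2) - P2 (diag p1))) {p1..p2}"
    by (rule has_integral_spike_finite[OF _ _ slant[OF P2], of "{p2}"]) (use p in \<open>auto simp: profile_def\<close>)
  moreover have "((\<lambda>x. (1 - \<i>) * (profile x * wave k \<phi> r (diag x))) has_integral (P3 (diag pi) - P3 (diag p2))) {p2..pi}"
    by (rule has_integral_spike_finite[OF _ _ slant[OF P3], of "{}"]) (use p in \<open>auto simp: profile_def\<close>)
  ultimately have S: "((\<lambda>x. (1 - \<i>) * (profile x * wave k \<phi> r (diag x))) has_integral ?S) {0..pi}"
    using p by (intro has_integral_combine[of 0 p2 pi] has_integral_combine[of 0 p1 p2]) auto
  \<comment> \<open>the primitives cancel at the end points of the diagonal; the differences at the two interfaces remain\<close>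
  have "cmod (?J - \<i> * ?S) = cmod (- \<i> * (?D1 + ?D2))"
    by (rule arg_cong[where f = cmod]) (simp add: algebra_simps)
  also have "\<dots> \<le> cmod ?D1 + cmod ?D2"
    unfolding norm_mult by (simp add: norm_triangle_ineq)
  also have "\<dots> \<le> 2 * M * pi\<^sup>2 * (k * \<bar>p1 - \<phi>\<bar> * sin \<bar>p1 - \<phi>\<bar>) powr (- 3 / 2) * r powr (- 3 / 2) +
       2 * M * pi\<^sup>2 * (k * \<bar>p2 - \<phi>\<bar> * sin \<bar>p2 - \<phi>\<bar>) powr (- 3 / 2) * r powr (- 3 / 2)"
    unfolding diag_def using \<phi> p k r M jump
    by (intro add_mono branch_mismatch_bound[OF P1 P2] branch_mismatch_bound[OF P2 P3]) (auto simp: strip_def)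
  finally show ?thesis
    using J abs S by (intro that) (auto simp: algebra_simps)
qed

end

context layered_amplitude
begin

text \<open>
  Outside the compact part \<open>SS \<xi> k\<close> is real, bounded away from \<open>0\<close> and at least \<open>\<bar>\<xi>\<bar> - k\<close>. One unit of
  \<open>r\<close> secures integrability in \<open>\<xi>\<close>, the rest exponential smallness in \<open>r\<close>.
\<close>

lemma tail_bound:
  obtains c F where "c > 0" "integrable lborel F"
    "\<And>r \<xi>. r \<ge> 1 \<Longrightarrow> \<xi> \<notin> {- (k * cosh (pi - \<phi>))..k * cosh \<phi>} \<Longrightarrow> cmod (integrand r \<xi>) \<le> exp (- c * (r - 1)) * F \<xi>"
proof -
  define A where "A = k * cosh (min \<phi> (pi - \<phi>))"
  define s where "s = sqrt (A\<^sup>2 - k\<^sup>2)"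
  have m: "0 < min \<phi> (pi - \<phi>)" using \<phi> by auto
  then have "1 < cosh (min \<phi> (pi - \<phi>))" using cosh_real_nonneg_less_iff[of 0 "min \<phi> (pi - \<phi>)"] by simp
  then have A: "A > k" unfolding A_def using k by simp
  then have s: "s > 0" unfolding s_def using k by (simp add: power_strict_mono)
  have sn: "sin \<phi> > 0" using \<phi> by (rule sin_gt_zero)
  let ?F = "\<lambda>\<xi>. M / s * exp (sin \<phi> * k) * exp (- (sin \<phi> * \<bar>\<xi>\<bar>))"
  show ?thesis
  proof (rule that[of "sin \<phi> * s" ?F])
    show "integrable lborel ?F" by (intro integrable_mult_right exp_abs_integrable sn)
    show "sin \<phi> * s > 0" using sn s by simp
    fix r \<xi> :: real assume r: "r \<ge> 1" and x: "\<xi> \<notin> {- (k * cosh (pi - \<phi>))..k * cosh \<phi>}"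
    have "A \<le> k * cosh \<phi>" "A \<le> k * cosh (pi - \<phi>)"
      unfolding A_def using \<phi> k by (auto simp: cosh_real_nonneg_le_iff)
    then have x: "\<bar>\<xi>\<bar> \<ge> A" using x by auto
    let ?R = "sqrt (\<xi>\<^sup>2 - k\<^sup>2)"
    have "A\<^sup>2 \<le> \<bar>\<xi>\<bar>\<^sup>2" using x A k by (intro power_mono) auto
    then have R1: "?R \<ge> s" unfolding s_def by simp
    have R2: "?R \<ge> \<bar>\<xi>\<bar> - k"
    proof (rule real_le_rsqrt)
      have "0 \<le> 2 * k * (\<bar>\<xi>\<bar> - k)" using x A k by simp
      then show "(\<bar>\<xi>\<bar> - k)\<^sup>2 \<le> \<xi>\<^sup>2 - k\<^sup>2" by (simp add: power2_eq_square algebra_simps flip: abs_mult)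
    qed
    have SS: "SS (of_real \<xi>) k = of_real ?R" using SS_of_real[OF k, of \<xi>] x A by simp
    have "cmod (integrand r \<xi>) = cmod (h \<xi>) / ?R * exp (- (r * (?R * sin \<phi>)))"
    proof -
      have "0 < ?R" using R1 s by linarith
      then show ?thesis unfolding spectral_integrand_def SS by (simp add: norm_mult norm_divide)
    qed
    also have "\<dots> \<le> M / s * exp (- (r * (?R * sin \<phi>)))"
      using bounded[of \<xi>] x A R1 s M by (intro mult_right_mono frac_le) auto
    also have "\<dots> \<le> M / s * (exp (- (sin \<phi> * s) * (r - 1)) * exp (sin \<phi> * k) * exp (- (sin \<phi> * \<bar>\<xi>\<bar>)))"
    proof -
      have "(r - 1) * (sin \<phi> * s) \<le> (r - 1) * (sin \<phi> * ?R)" "sin \<phi> * (\<bar>\<xi>\<bar> - k) \<le> sin \<phi> * ?R"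
        using r R1 R2 sn by (auto intro!: mult_left_mono)
      then have "exp (- (r * (?R * sin \<phi>))) \<le> exp (- (sin \<phi> * s) * (r - 1)) * exp (sin \<phi> * k) * exp (- (sin \<phi> * \<bar>\<xi>\<bar>))"
        unfolding exp_add[symmetric] by (simp add: algebra_simps)
      then show ?thesis using M s by (intro mult_left_mono) auto
    qed
    finally show "cmod (integrand r \<xi>) \<le> exp (- (sin \<phi> * s) * (r - 1)) * ?F \<xi>"
      by (simp add: mult_ac)
  qed
qed

text \<open>
  Up to the admissible error the spectral integral equals an integral over a finite segment of the
  diagonal. The factor \<open>\<i>\<close> comes from \<open>d\<xi> / SS \<xi> k = - \<i> * dt\<close> with reversed orientation and \<open>1 - \<i>\<close> is the
  derivative of \<open>diag\<close>.
\<close>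

lemma spectral_integral_diag:
  shows "r \<ge> 1 \<Longrightarrow> integrable lborel (integrand r)"
    and "(\<lambda>r. integral\<^sup>L lborel (integrand r) -
           \<i> * (1 - \<i>) * integral {0..pi} (\<lambda>a. profile a * wave k \<phi> r (diag a)))
         \<in> O[at_top](\<lambda>r. of_real (r powr (- 3 / 2)))"
proof -
  obtain c F where c: "c > 0" and F: "integrable lborel F" and tail:
    "\<And>r \<xi>. r \<ge> 1 \<Longrightarrow> \<xi> \<notin> {- (k * cosh (pi - \<phi>))..k * cosh \<phi>} \<Longrightarrow> cmod (integrand r \<xi>) \<le> exp (- c * (r - 1)) * F \<xi>"
    using tail_bound by metis
  let ?I = "{- (k * cosh (pi - \<phi>))..k * cosh \<phi>}"
  let ?K = "2 * M * pi\<^sup>2 * (k * \<bar>p1 - \<phi>\<bar> * sin \<bar>p1 - \<phi>\<bar>) powr (- 3 / 2) +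
       2 * M * pi\<^sup>2 * (k * \<bar>p2 - \<phi>\<bar> * sin \<bar>p2 - \<phi>\<bar>) powr (- 3 / 2)"
  let ?X = "\<lambda>r. integral\<^sup>L lborel (integrand r) -
           \<i> * (1 - \<i>) * integral {0..pi} (\<lambda>a. profile a * wave k \<phi> r (diag a))"
  have main: "integrable lborel (integrand r) \<and>
    cmod (?X r) \<le> ?K * r powr (- 3 / 2) + (\<integral>\<xi>. \<bar>F \<xi>\<bar> \<partial>lborel) * exp (- c * (r - 1))" if r: "r \<ge> 1" for r
  proof -
    have "r > 0" using r by simp
    then obtain J S where
      a: "integrand r absolutely_integrable_on ?I" and J: "(integrand r has_integral J) ?I"
     and S: "((\<lambda>a. (1 - \<i>) * (profile a * wave k \<phi> r (diag a))) has_integral S) {0..pi}"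
     and JS: "cmod (J - \<i> * S) \<le> ?K * r powr (- 3 / 2)" by (rule compact_part)
    have in1: "set_integrable lborel ?I (integrand r)"
      using a unfolding set_integrable_def by (subst (asm) integrable_completion) auto
    have J': "(LINT \<xi>:?I|lborel. integrand r \<xi>) = J"
      using set_borel_integral_eq_integral(2)[OF in1] J by (simp add: has_integral_iff)
    have F': "integrable lborel (\<lambda>\<xi>. exp (- c * (r - 1)) * \<bar>F \<xi>\<bar>)" using F by auto
    have le: "norm (indicator (- ?I) \<xi> *\<^sub>R integrand r \<xi>) \<le> exp (- c * (r - 1)) * \<bar>F \<xi>\<bar>" for \<xi>
    proof (cases "\<xi> \<in> ?I")
      case False
      have "exp (- c * (r - 1)) * F \<xi> \<le> exp (- c * (r - 1)) * \<bar>F \<xi>\<bar>" by (simp add: mult_left_mono)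
      from order.trans[OF tail[OF r False] this] show ?thesis using False by (simp add: indicator_def)
    qed simp
    have in2: "set_integrable lborel (- ?I) (integrand r)"
      unfolding set_integrable_def
    proof (rule Bochner_Integration.integrable_bound[OF F'])
      show "AE \<xi> in lborel. norm (indicator (- ?I) \<xi> *\<^sub>R integrand r \<xi>) \<le> norm (exp (- c * (r - 1)) * \<bar>F \<xi>\<bar>)"
        by (rule AE_I2, rule order.trans[OF le]) simp
    qed measurable
    have "set_integrable lborel (?I \<union> - ?I) (integrand r)"
      by (rule set_integrable_Un[OF in1 in2]) auto
    then have int: "integrable lborel (integrand r)" by (simp add: set_integrable_def)
    have "integral\<^sup>L lborel (integrand r) = (LINT \<xi>:?I \<union> - ?I|lborel. integrand r \<xi>)"
      by (simp add: set_lebesgue_integral_def)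
    also have "\<dots> = J + (LINT \<xi>:- ?I|lborel. integrand r \<xi>)"
      unfolding J'[symmetric] by (rule set_integral_Un[OF _ in1 in2]) auto
    finally have split: "integral\<^sup>L lborel (integrand r) = J + (LINT \<xi>:- ?I|lborel. integrand r \<xi>)" .
    have t: "cmod (LINT \<xi>:- ?I|lborel. integrand r \<xi>) \<le> (\<integral>\<xi>. exp (- c * (r - 1)) * \<bar>F \<xi>\<bar> \<partial>lborel)"
      unfolding set_lebesgue_integral_def
      by (rule order.trans[OF integral_norm_bound
            integral_mono[OF integrable_norm[OF in2[unfolded set_integrable_def]] F' le]])
    have S': "S = (1 - \<i>) * integral {0..pi} (\<lambda>a. profile a * wave k \<phi> r (diag a))"
      using S by (simp add: has_integral_iff)
    have "cmod (J - \<i> * S + (LINT \<xi>:- ?I|lborel. integrand r \<xi>)) \<le> ?K * r powr (- 3 / 2) + (\<integral>\<xi>. \<bar>F \<xi>\<bar> \<partial>lborel) * exp (- c * (r - 1))"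
      by (rule order.trans[OF norm_triangle_ineq], rule add_mono[OF JS]) (use t in \<open>simp add: mult.commute\<close>)
    moreover have "?X r = J - \<i> * S + (LINT \<xi>:- ?I|lborel. integrand r \<xi>)"
      unfolding split S' by (simp add: mult.assoc)
    ultimately show ?thesis using int by simp
  qed
  then show "integrable lborel (integrand r)" if "r \<ge> 1" using that by blast
  have "cmod (?X r) \<le> ?K * r powr (- 3 / 2) + (\<integral>\<xi>. \<bar>F \<xi>\<bar> \<partial>lborel) * exp c * exp (- (c * r))" if "r \<ge> 1" for r
  proof -
    have "exp (- c * (r - 1)) = exp c * exp (- (c * r))" by (simp add: algebra_simps flip: exp_add)
    with main[OF that] show ?thesis by (simp only: mult.assoc)
  qed
  from bigo_from_powr_exp_bound[OF c this] show "?X \<in> O[at_top](\<lambda>r. of_real (r powr (- 3 / 2)))" .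
qed

end

section \<open>Saddle-point asymptotics along the diagonal\<close>

lemma gaussian_integral:
  assumes "c > (0::real)"
  shows "has_bochner_integral lborel (\<lambda>s. exp (- (c * s\<^sup>2))) (sqrt (pi / c))"
proof -
  have "has_bochner_integral lborel (\<lambda>x::real. exp (- x\<^sup>2)) (sqrt pi)"
    using has_bochner_integral_even_function[OF gaussian_moment_0] by simp
  then have "has_bochner_integral lborel (\<lambda>x::real. exp (- (0 + sqrt c * x)\<^sup>2)) (sqrt pi /\<^sub>R \<bar>sqrt c\<bar>)"
    using assms by (subst (asm) lborel_has_bochner_integral_real_affine_iff[of "sqrt c" _ _ 0]) auto
  then show ?thesis
    using assms by (simp add: power_mult_distrib real_sqrt_divide field_simps)
qed

lemma exp_diff_bound:
  fixes a b :: complex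
  assumes "Re a \<le> B" "Re b \<le> B"
  shows "cmod (exp a - exp b) \<le> exp B * cmod (a - b)"
  by (rule field_differentiable_bound[of "{z. Re z \<le> B}" exp exp])
     (use assms in \<open>auto intro!: convex_halfspace_Re_le derivative_eq_intros\<close>)

text \<open>
  The weights \<open>s\<^sup>2\<close> and \<open>r * s ^ 4\<close> are the second-order error of the amplitude and the quartic error of
  the phase; both have size \<open>1 / r\<close> on the Gaussian scale \<open>s \<approx> 1 / sqrt r\<close>, which itself contributes
  \<open>1 / sqrt r\<close>.
\<close>

lemma gaussian_dominated:
  fixes f :: "real \<Rightarrow> complex"
  assumes f: "f \<in> borel_measurable borel" and c: "c > 0" and r: "r > 0" and K: "K1 \<ge> 0" "K2 \<ge> 0"
    and le: "\<And>s. cmod (f s) \<le> (K1 * s\<^sup>2 + K2 * r * s ^ 4) * exp (- (c * r * s\<^sup>2))"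
  shows "integrable lborel f" "cmod (integral\<^sup>L lborel f) \<le> (2 * K1 / c + 16 * K2 / c\<^sup>2) * sqrt (2 * pi / c) * r powr (- 3 / 2)"
proof -
  let ?A = "(2 * K1 / c + 16 * K2 / c\<^sup>2) / r"
  let ?G = "\<lambda>s. exp (- (c * r / 2 * s\<^sup>2))"
  have G: "has_bochner_integral lborel ?G (sqrt (pi / (c * r / 2)))"
    using c r by (intro gaussian_integral) auto
  have le2: "cmod (f s) \<le> ?A * ?G s" for s
  proof -
    let ?x = "c * r * s\<^sup>2 / 4"
    have x: "?x \<ge> 0" using c r by simp
    have e: "exp (- (c * r * s\<^sup>2)) = ?G s * exp (- (2 * ?x))" by (simp flip: exp_add)
    have "?x \<le> exp ?x" using exp_ge_add_one_self[of ?x] by linarith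
    then have "?x\<^sup>2 \<le> (exp ?x)\<^sup>2" using x by (intro power_mono)
    then have x2: "?x\<^sup>2 * exp (- (2 * ?x)) \<le> 1" by (simp add: exp_minus power2_eq_square field_simps flip: exp_add)
    have "2 * ?x \<le> exp (2 * ?x)" using exp_ge_add_one_self[of "2 * ?x"] by linarith
    then have x1: "2 * ?x * exp (- (2 * ?x)) \<le> 1" by (simp add: exp_minus field_simps)
    have "K1 * s\<^sup>2 + K2 * r * s ^ 4 = 2 * K1 / (c * r) * (2 * ?x) + 16 * K2 / (c\<^sup>2 * r) * ?x\<^sup>2"
      using c r by (simp add: field_simps power2_eq_square power4_eq_xxxx)
    then have "(K1 * s\<^sup>2 + K2 * r * s ^ 4) * exp (- (c * r * s\<^sup>2))
       = (2 * K1 / (c * r) * (2 * ?x * exp (- (2 * ?x))) + 16 * K2 / (c\<^sup>2 * r) * (?x\<^sup>2 * exp (- (2 * ?x)))) * ?G s"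
      unfolding e by (simp only: algebra_simps)
    also have "\<dots> \<le> (2 * K1 / (c * r) * 1 + 16 * K2 / (c\<^sup>2 * r) * 1) * ?G s"
      using c r K x1 x2 by (intro mult_right_mono add_mono mult_left_mono) auto
    also have "\<dots> = ?A * ?G s" using c r by (simp add: field_simps)
    finally show ?thesis using le[of s] by linarith
  qed
  have AG: "integrable lborel (\<lambda>s. ?A * ?G s)" using G by (intro integrable_mult_right) (auto simp: has_bochner_integral_iff)
  show int: "integrable lborel f"
  proof (rule Bochner_Integration.integrable_bound[OF AG])
    show "AE s in lborel. norm (f s) \<le> norm (?A * ?G s)"
      by (rule AE_I2, rule order.trans[OF le2]) (simp only: real_norm_def abs_ge_self)
  qed (use f in simp)
  have "cmod (integral\<^sup>L lborel f) \<le> (\<integral>s. cmod (f s) \<partial>lborel)" by (rule integral_norm_bound)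
  also have "\<dots> \<le> (\<integral>s. ?A * ?G s \<partial>lborel)" using int AG le2 by (intro integral_mono) auto
  also have "\<dots> = ?A * sqrt (pi / (c * r / 2))" using G by (simp add: has_bochner_integral_iff)
  also have "\<dots> = (2 * K1 / c + 16 * K2 / c\<^sup>2) * sqrt (2 * pi / c) * (1 / (r * sqrt r))"
    by (simp add: real_sqrt_divide real_sqrt_mult mult_ac)
  also have "1 / (r * sqrt r) = r powr (- 3 / 2)"
  proof -
    have "r powr (3 / 2) = r powr (1 + 1 / 2)" by simp
    also have "\<dots> = r * sqrt r" unfolding powr_add using r by (simp add: powr_half_sqrt)
    finally show ?thesis by (simp add: powr_minus_divide)
  qed
  finally show "cmod (integral\<^sup>L lborel f) \<le> (2 * K1 / c + 16 * K2 / c\<^sup>2) * sqrt (2 * pi / c) * r powr (- 3 / 2)" .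
qed

text \<open>
  The wave on the diagonal in the coordinate centred at the saddle, where \<open>t - \<phi> = (1 - \<i>) * s\<close> and
  \<open>\<kappa> = k * r\<close>.
\<close>

definition diag_wave :: "real \<Rightarrow> real \<Rightarrow> complex" where
  "diag_wave \<kappa> s = exp (\<i> * of_real \<kappa> * cos ((1 - \<i>) * of_real s))"

lemma sin_ge_chord:
  assumes "0 \<le> s" "s \<le> m" "0 < m" "m < pi"
  shows "sin m / m * s \<le> sin s"
proof -
  have "convex_on {0..pi} (\<lambda>x. - sin x)"
    by (rule convex_on_realI[where f' = "\<lambda>x. - cos x"]) (auto intro!: derivative_eq_intros cos_monotone_0_pi_le)
  from convex_onD[OF this, of "s / m" 0 m] show ?thesis
    using assms by (simp add: field_simps)
qed

text \<open>
  The modulus is \<open>exp (- \<kappa> * sin \<bar>s\<bar> * sinh \<bar>s\<bar>)\<close>; concavity of \<open>sin\<close> gives Gaussian decay over the whole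
  segment and not only near the saddle.
\<close>

lemma norm_diag_wave:
  assumes "\<bar>s\<bar> \<le> m" "0 < m" "m < pi" "\<kappa> \<ge> 0"
  shows "cmod (diag_wave \<kappa> s) \<le> exp (- (sin m / m * \<kappa> * s\<^sup>2))"
proof -
  have "cmod (diag_wave \<kappa> s) = exp (- (\<kappa> * (sin \<bar>s\<bar> * sinh \<bar>s\<bar>)))"
    by (cases "s \<ge> 0") (simp_all add: diag_wave_def Im_cos sinh_field_def field_simps)
  moreover have "sin m / m * \<bar>s\<bar> * \<bar>s\<bar> \<le> sin \<bar>s\<bar> * sinh \<bar>s\<bar>"
    using assms sin_gt_zero[of m] by (intro mult_mono sin_ge_chord sinh_ge_self) (auto intro: sin_ge_zero)
  then have "\<kappa> * (sin m / m * \<bar>s\<bar> * \<bar>s\<bar>) \<le> \<kappa> * (sin \<bar>s\<bar> * sinh \<bar>s\<bar>)"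
    using assms by (intro mult_left_mono)
  ultimately show ?thesis by (simp add: power2_eq_square mult_ac)
qed

text \<open>
  Since \<open>((1 - \<i>) * s)\<^sup>2 = - 2 * \<i> * s\<^sup>2\<close>, the quadratic Taylor term of the cosine becomes the real decay
  \<open>- s\<^sup>2\<close>, and there is no cubic term.
\<close>

lemma diag_phase_quartic:
  assumes "\<bar>s\<bar> \<le> pi"
  shows "cmod (\<i> * cos ((1 - \<i>) * of_real s) - (\<i> - of_real (s\<^sup>2))) \<le> exp pi * s ^ 4"
proof -
  let ?z = "(1 - \<i>) * complex_of_real s"
  have odd3: "\<not> Suc (Suc 0) dvd Suc (Suc (Suc 0))" by presburger
  have "cmod (cos ?z - (\<Sum>k\<le>3. of_real (cos_coeff k) * ?z ^ k)) \<le> exp \<bar>Im ?z\<bar> * cmod ?z ^ Suc 3 / fact 3"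
    by (rule Taylor_cos)
  also have "(\<Sum>k\<le>3. of_real (cos_coeff k) * ?z ^ k) = 1 + \<i> * of_real (s\<^sup>2)"
    by (simp add: cos_coeff_def numeral_eq_Suc complex_eq_iff odd3)
  finally have 1: "cmod (cos ?z - (1 + \<i> * of_real (s\<^sup>2))) \<le> exp \<bar>s\<bar> * cmod ?z ^ 4 / 6"
    by (simp add: fact_numeral)
  have "cmod ?z ^ 4 = 4 * s ^ 4"
    by (simp add: norm_mult cmod_def power_mult_distrib flip: power_abs) (simp add: power4_eq_xxxx)
  then have "exp \<bar>s\<bar> * cmod ?z ^ 4 / 6 = (exp \<bar>s\<bar> * s ^ 4) * (2 / 3)" by simp
  also have "\<dots> \<le> (exp \<bar>s\<bar> * s ^ 4) * 1" by (rule mult_left_mono) auto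
  also have "\<dots> \<le> exp pi * s ^ 4" using assms by (simp add: mult_right_mono)
  finally have "exp \<bar>s\<bar> * cmod ?z ^ 4 / 6 \<le> exp pi * s ^ 4" .
  moreover have "\<i> * cos ?z - (\<i> - of_real (s\<^sup>2)) = \<i> * (cos ?z - (1 + \<i> * of_real (s\<^sup>2)))"
    by (simp add: algebra_simps)
  ultimately show ?thesis using 1 by (simp only: norm_mult norm_ii)
qed

lemma diag_wave_gaussian:
  assumes s: "\<bar>s\<bar> \<le> m" "0 < m" "m < pi" "\<kappa> \<ge> 0"
  shows "cmod (diag_wave \<kappa> s - exp (\<i> * of_real \<kappa>) * of_real (exp (- (\<kappa> * s\<^sup>2))))
    \<le> \<kappa> * exp pi * s ^ 4 * exp (- (min 1 (sin m / m) * \<kappa> * s\<^sup>2))"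
proof -
  let ?a = "\<i> * of_real \<kappa> * cos ((1 - \<i>) * of_real s)" and ?b = "\<i> * of_real \<kappa> + of_real (- (\<kappa> * s\<^sup>2))"
  let ?B = "- (min 1 (sin m / m) * \<kappa> * s\<^sup>2)"
  have "cmod (exp ?a) \<le> exp (- (sin m / m * \<kappa> * s\<^sup>2))" using norm_diag_wave[OF s] by (simp add: diag_wave_def)
  then have "Re ?a \<le> - (sin m / m * \<kappa> * s\<^sup>2)" by simp
  also have "\<dots> \<le> ?B"
    using mult_right_mono[of "min 1 (sin m / m)" "sin m / m" "\<kappa> * s\<^sup>2"] s(4) by (simp add: mult.assoc)
  finally have 1: "Re ?a \<le> ?B" .
  have 2: "Re ?b \<le> ?B" using mult_right_mono[of "min 1 (sin m / m)" 1 "\<kappa> * s\<^sup>2"] s(4) by (simp add: mult.assoc)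
  have "cmod (?a - ?b) = cmod (of_real \<kappa> * (\<i> * cos ((1 - \<i>) * of_real s) - (\<i> - of_real (s\<^sup>2))))"
    by (rule arg_cong[where f = cmod]) (simp add: algebra_simps)
  also have "\<dots> \<le> \<kappa> * (exp pi * s ^ 4)"
    unfolding norm_mult using s diag_phase_quartic[of s] by (simp add: mult_left_mono)
  finally have "exp ?B * cmod (?a - ?b) \<le> exp ?B * (\<kappa> * (exp pi * s ^ 4))" by (intro mult_left_mono) auto
  with exp_diff_bound[OF 1 2] have "cmod (exp ?a - exp ?b) \<le> exp ?B * (\<kappa> * (exp pi * s ^ 4))" by linarith
  moreover have "exp ?b = exp (\<i> * of_real \<kappa>) * of_real (exp (- (\<kappa> * s\<^sup>2)))"
    by (simp only: exp_add exp_of_real)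
  ultimately show ?thesis by (simp add: diag_wave_def mult_ac)
qed

lemma diag_wave_continuous [continuous_intros]:
  "continuous_on S f \<Longrightarrow> continuous_on S (\<lambda>x. diag_wave \<kappa> (f x))"
proof -
  assume f: "continuous_on S f"
  have "continuous_on UNIV (\<lambda>z. exp (\<i> * of_real \<kappa> * cos ((1 - \<i>) * z)))"
    by (intro holomorphic_on_imp_continuous_on holomorphic_intros)
  from continuous_on_compose2[OF this continuous_on_of_real[OF f]] show ?thesis
    by (simp add: diag_wave_def)
qed

lemma diag_wave_measurable [measurable]: "diag_wave \<kappa> \<in> borel_measurable borel"
  by (intro borel_measurable_continuous_onI continuous_intros)

lemma sin_diag_continuous: "continuous_on S (\<lambda>s::real. sin ((1 - \<i>) * of_real s))"
proof -
  have "continuous_on UNIV (\<lambda>z. sin ((1 - \<i>) * z))"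
    by (intro holomorphic_on_imp_continuous_on holomorphic_intros)
  from continuous_on_compose2[OF this continuous_on_of_real[OF continuous_on_id]] show ?thesis by simp
qed

lemma sin_diag_measurable [measurable]: "(\<lambda>s::real. sin ((1 - \<i>) * of_real s)) \<in> borel_measurable borel"
  by (intro borel_measurable_continuous_onI sin_diag_continuous)

text \<open>
  The factor \<open>sin ((1 - \<i>) * s)\<close> is the derivative of the phase up to a constant, so this integral is a
  boundary term.
\<close>

lemma sin_diag_wave_integral:
  assumes "\<kappa> > 0" "a \<le> b"
  shows "((\<lambda>s. sin ((1 - \<i>) * of_real s) * diag_wave \<kappa> s) has_integral
     ((diag_wave \<kappa> b - diag_wave \<kappa> a) / (- (\<i> * of_real \<kappa> * (1 - \<i>))))) {a..b}"
proof -
  let ?c = "- (\<i> * of_real \<kappa> * (1 - \<i>))"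
  have c: "?c \<noteq> 0" using assms by (simp add: complex_eq_iff)
  have D: "((\<lambda>z. exp (\<i> * of_real \<kappa> * cos ((1 - \<i>) * z))) has_field_derivative
      ?c * (sin ((1 - \<i>) * z) * exp (\<i> * of_real \<kappa> * cos ((1 - \<i>) * z)))) (at z within S)" for z S
    by (auto intro!: derivative_eq_intros)
  have "((\<lambda>s. ?c * (sin ((1 - \<i>) * of_real s) * diag_wave \<kappa> s)) has_integral
      (diag_wave \<kappa> b - diag_wave \<kappa> a)) {a..b}"
  proof (rule fundamental_theorem_of_calculus[OF assms(2)])
    fix s assume "s \<in> {a..b}"
    show "(diag_wave \<kappa> has_vector_derivative ?c * (sin ((1 - \<i>) * of_real s) * diag_wave \<kappa> s)) (at s within {a..b})"
    proof -
      have "(of_real has_vector_derivative (1::complex)) (at s within {a..b})"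
        by (auto intro!: derivative_eq_intros simp: has_vector_derivative_def of_real_def)
      from field_vector_diff_chain_within[OF this D] show ?thesis
        by (simp add: diag_wave_def[abs_def] o_def)
    qed
  qed
  from has_integral_mult_right[OF this, of "inverse ?c"] show ?thesis
    using c unfolding mult.assoc[symmetric] left_inverse[OF c] by (simp add: divide_inverse mult.commute)
qed

text \<open>
  The linear part of \<open>f\<close> is measured by \<open>sin ((1 - \<i>) * s)\<close> instead of \<open>s\<close>. Then its integral against
  the wave is exact and exponentially small even though the segment is not symmetric about the
  saddle, and a bound of order \<open>s\<^sup>2\<close> on the rest suffices for the error \<open>r powr (- 3 / 2)\<close>.
\<close>

lemma saddle_regular:
  fixes f :: "real \<Rightarrow> complex"
  assumes f [measurable]: "f \<in> borel_measurable borel" and k: "k > 0"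
    and \<phi>: "0 < \<phi>" "\<phi> < pi" and C: "C \<ge> 0"
    and supp: "\<And>s. s \<notin> {- \<phi>..pi - \<phi>} \<Longrightarrow> f s = 0"
    and le: "\<And>s. s \<in> {- \<phi>..pi - \<phi>} \<Longrightarrow> cmod (f s - h0 - h1 * sin ((1 - \<i>) * of_real s)) \<le> C * s\<^sup>2"
  shows "(\<lambda>r. (\<integral>s. f s * diag_wave (k * r) s \<partial>lborel) - h0 * exp (\<i> * of_real (k * r)) * of_real (sqrt (pi / (k * r))))
    \<in> O[at_top](\<lambda>r. of_real (r powr (- 3 / 2)))"
proof -
  define m where "m = max \<phi> (pi - \<phi>)"
  define \<delta> where "\<delta> = min \<phi> (pi - \<phi>)"
  have m: "0 < m" "m < pi" and \<delta>: "\<delta> > 0" using \<phi> by (auto simp: m_def \<delta>_def)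
  define c where "c = k * min 1 (sin m / m)"
  have c: "c > 0" using k m sin_gt_zero[of m] by (simp add: c_def)
  define I where "I = {- \<phi>..pi - \<phi>}"
  have I: "\<bar>s\<bar> \<le> m" if "s \<in> I" for s using that by (auto simp: I_def m_def)
  have Imeas [measurable]: "I \<in> sets borel" by (simp add: I_def)
  let ?K1 = "C + cmod h0 / \<delta>\<^sup>2" and ?K2 = "cmod h0 * k * exp pi"
  have bound: "cmod ((\<integral>s. f s * diag_wave (k * r) s \<partial>lborel) - h0 * exp (\<i> * of_real (k * r)) * of_real (sqrt (pi / (k * r))))
     \<le> ((2 * ?K1 / c + 16 * ?K2 / c\<^sup>2) * sqrt (2 * pi / c)) * r powr (- 3 / 2) + cmod h1 * 2 / k * exp (- (c * \<delta>\<^sup>2 * r))" if r: "r \<ge> 1" for r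
  proof -
    let ?w = "diag_wave (k * r)"
    let ?g = "\<lambda>s. exp (\<i> * of_real (k * r)) * of_real (exp (- (k * r * s\<^sup>2))) :: complex"
    let ?sw = "\<lambda>s. indicator I s *\<^sub>R (sin ((1 - \<i>) * of_real s) * ?w s)"
    let ?d = "\<lambda>s. f s * ?w s - h0 * ?g s - h1 * ?sw s"
    have r0: "r > 0" and kr: "k * r > 0" using r k by auto
    have w: "cmod (?w s) \<le> exp (- (c * r * s\<^sup>2))" if "\<bar>s\<bar> \<le> m" for s
    proof -
      have "cmod (?w s) \<le> exp (- (sin m / m * (k * r) * s\<^sup>2))"
        by (rule norm_diag_wave) (use that m kr in auto)
      also have "\<dots> \<le> exp (- (c * r * s\<^sup>2))"
        using mult_right_mono[of "min 1 (sin m / m)" "sin m / m" "k * r * s\<^sup>2"] k r0 by (simp add: c_def mult_ac)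
      finally show ?thesis .
    qed
    have dm [measurable]: "?d \<in> borel_measurable borel" by measurable
    have dle: "cmod (?d s) \<le> (?K1 * s\<^sup>2 + ?K2 * r * s ^ 4) * exp (- (c * r * s\<^sup>2))" for s
    proof (cases "s \<in> I")
      case True
      then have s: "\<bar>s\<bar> \<le> m" "s \<in> {- \<phi>..pi - \<phi>}" using I by (auto simp: I_def)
      have "?d s = (f s - h0 - h1 * sin ((1 - \<i>) * of_real s)) * ?w s + h0 * (?w s - ?g s)"
        using True by (simp add: algebra_simps)
      also have "cmod \<dots> \<le> C * s\<^sup>2 * exp (- (c * r * s\<^sup>2)) + cmod h0 * (k * r * exp pi * s ^ 4 * exp (- (c * r * s\<^sup>2)))"
      proof (rule order.trans[OF norm_triangle_ineq], unfold norm_mult, intro add_mono mult_mono mult_left_mono)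
        show "cmod (?w s - ?g s) \<le> k * r * exp pi * s ^ 4 * exp (- (c * r * s\<^sup>2))"
          using diag_wave_gaussian[of s m "k * r"] s m kr by (simp add: c_def mult_ac)
      qed (auto intro!: le[OF s(2)] w[OF s(1)] C mult_nonneg_nonneg less_imp_le[OF k] less_imp_le[OF r0])
      also have "\<dots> = (C * s\<^sup>2 + ?K2 * r * s ^ 4) * exp (- (c * r * s\<^sup>2))" by (simp add: algebra_simps)
      also have "\<dots> \<le> (?K1 * s\<^sup>2 + ?K2 * r * s ^ 4) * exp (- (c * r * s\<^sup>2))"
        by (intro mult_right_mono add_right_mono) auto
      finally show ?thesis .
    next
      case False
      then have "\<bar>s\<bar> \<ge> \<delta>" by (auto simp: I_def \<delta>_def)
      then have "\<bar>s\<bar>\<^sup>2 \<ge> \<delta>\<^sup>2" using \<delta> by (intro power_mono) auto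
      then have s: "1 \<le> s\<^sup>2 / \<delta>\<^sup>2" using \<delta> by simp
      have "?d s = - (h0 * ?g s)" using False supp by (auto simp: I_def)
      then have "cmod (?d s) = cmod h0 * 1 * exp (- (k * r * s\<^sup>2))" by (simp add: norm_mult)
      also have "\<dots> \<le> cmod h0 * (s\<^sup>2 / \<delta>\<^sup>2) * exp (- (c * r * s\<^sup>2))"
      proof (intro mult_mono mult_left_mono s)
        have "min 1 (sin m / m) * (k * r * s\<^sup>2) \<le> 1 * (k * r * s\<^sup>2)" using kr by (intro mult_right_mono) auto
        then show "exp (- (k * r * s\<^sup>2)) \<le> exp (- (c * r * s\<^sup>2))" by (simp add: c_def mult_ac)
      qed auto
      also have "\<dots> = cmod h0 / \<delta>\<^sup>2 * s\<^sup>2 * exp (- (c * r * s\<^sup>2))" by simp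
      also have "\<dots> \<le> (?K1 * s\<^sup>2 + ?K2 * r * s ^ 4) * exp (- (c * r * s\<^sup>2))"
      proof (intro mult_right_mono)
        have "0 \<le> C * s\<^sup>2 + ?K2 * r * s ^ 4" using C k r0 by simp
        then show "cmod h0 / \<delta>\<^sup>2 * s\<^sup>2 \<le> ?K1 * s\<^sup>2 + ?K2 * r * s ^ 4" unfolding distrib_right by linarith
      qed simp
      finally show ?thesis .
    qed
    have K: "?K1 \<ge> 0" "?K2 \<ge> 0" using C k by auto
    note gd = gaussian_dominated[OF dm c r0 K dle]
    have g: "has_bochner_integral lborel ?g (exp (\<i> * of_real (k * r)) * of_real (sqrt (pi / (k * r))))"
      by (intro has_bochner_integral_mult_right has_bochner_integral_of_real gaussian_integral kr)
    let ?v = "(?w (pi - \<phi>) - ?w (- \<phi>)) / (- (\<i> * of_real (k * r) * (1 - \<i>)))"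
    have sw: "set_integrable lborel I (\<lambda>s. sin ((1 - \<i>) * of_real s) * ?w s)"
      unfolding I_def by (intro borel_integrable_atLeastAtMost' continuous_intros sin_diag_continuous)
    have swi: "has_bochner_integral lborel ?sw ?v"
      using sw set_borel_integral_eq_integral(2)[OF sw] sin_diag_wave_integral[OF kr, of "- \<phi>" "pi - \<phi>"]
      by (simp add: I_def set_integrable_def set_lebesgue_integral_def has_integral_iff has_bochner_integral_iff)
    have "has_bochner_integral lborel (\<lambda>s. ?d s + h1 * ?sw s + h0 * ?g s)
       ((\<integral>s. ?d s \<partial>lborel) + h1 * ?v + h0 * (exp (\<i> * of_real (k * r)) * of_real (sqrt (pi / (k * r)))))"
      by (intro has_bochner_integral_add has_bochner_integral_mult_right has_bochner_integral_integrable gd(1) swi g)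
    moreover have "(\<lambda>s. ?d s + h1 * ?sw s + h0 * ?g s) = (\<lambda>s. f s * ?w s)" by auto
    ultimately have "(\<integral>s. f s * ?w s \<partial>lborel) =
       (\<integral>s. ?d s \<partial>lborel) + h1 * ?v + h0 * (exp (\<i> * of_real (k * r)) * of_real (sqrt (pi / (k * r))))"
      by (simp only: has_bochner_integral_integral_eq)
    then have eq: "(\<integral>s. f s * ?w s \<partial>lborel) - h0 * exp (\<i> * of_real (k * r)) * of_real (sqrt (pi / (k * r)))
       = (\<integral>s. ?d s \<partial>lborel) + h1 * ?v"
      by (simp only: mult.assoc) simp
    have "cmod (?w (pi - \<phi>) - ?w (- \<phi>)) \<le> exp (- (c * r * \<delta>\<^sup>2)) + exp (- (c * r * \<delta>\<^sup>2))"
    proof (rule order.trans[OF norm_triangle_ineq4], rule add_mono)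
      have "\<delta>\<^sup>2 \<le> (pi - \<phi>)\<^sup>2" "\<delta>\<^sup>2 \<le> (- \<phi>)\<^sup>2" using \<delta> \<phi> by (auto simp: \<delta>_def intro!: power_mono)
      then have "exp (- (c * r * (pi - \<phi>)\<^sup>2)) \<le> exp (- (c * r * \<delta>\<^sup>2))" "exp (- (c * r * (- \<phi>)\<^sup>2)) \<le> exp (- (c * r * \<delta>\<^sup>2))"
        using c r0 by auto
      moreover have "\<bar>pi - \<phi>\<bar> \<le> m" "\<bar>- \<phi>\<bar> \<le> m" using \<phi> by (auto simp: m_def)
      ultimately show "cmod (?w (pi - \<phi>)) \<le> exp (- (c * r * \<delta>\<^sup>2))" "cmod (?w (- \<phi>)) \<le> exp (- (c * r * \<delta>\<^sup>2))"
        using order.trans[OF w[of "pi - \<phi>"]] order.trans[OF w[of "- \<phi>"]] by simp_all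
    qed
    then have "cmod ?v \<le> 2 * exp (- (c * r * \<delta>\<^sup>2)) / k"
    proof -
      have "cmod (- (\<i> * of_real (k * r) * (1 - \<i>))) = k * r * sqrt 2" using k r0 by (simp add: norm_mult cmod_def[of "1 - \<i>"])
      moreover have "k * 1 \<le> k * (r * sqrt 2)" using k r mult_mono[of 1 r 1 "sqrt 2"] by (intro mult_left_mono) auto
      ultimately show ?thesis
        unfolding norm_divide using k \<open>cmod (?w (pi - \<phi>) - ?w (- \<phi>)) \<le> _\<close> by (intro frac_le) (auto simp: mult.assoc)
    qed
    then have "cmod h1 * cmod ?v \<le> cmod h1 * (2 * exp (- (c * r * \<delta>\<^sup>2)) / k)"
      by (intro mult_left_mono) auto
    also have "cmod h1 * (2 * exp (- (c * r * \<delta>\<^sup>2)) / k) = cmod h1 * 2 / k * exp (- (c * \<delta>\<^sup>2 * r))"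
      by (simp add: mult_ac)
    finally have "cmod (h1 * ?v) \<le> cmod h1 * 2 / k * exp (- (c * \<delta>\<^sup>2 * r))"
      by (simp only: norm_mult)
    from order.trans[OF norm_triangle_ineq add_mono[OF gd(2) this]] show ?thesis unfolding eq .
  qed
  have "c * \<delta>\<^sup>2 > 0" using c \<delta> by simp
  from bigo_from_powr_exp_bound[OF this bound] show ?thesis .
qed

text \<open>
  The limit of the rescaled integral of \<open>sqrt s\<close> over one half of the diagonal.
\<close>

definition half_moment :: "real \<Rightarrow> real" where
  "half_moment k = (\<integral>u. indicator {0..} u * (sqrt u * exp (- (k * u\<^sup>2))) \<partial>lborel)"

lemma sqrt_gaussian_bound:
  fixes c u :: real
  assumes "c > 0"
  shows "sqrt \<bar>u\<bar> * exp (- (c * u\<^sup>2)) \<le> (1 + 2 / c) * exp (- (c / 2 * u\<^sup>2))"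
proof -
  have "sqrt \<bar>u\<bar> \<le> 1 + u\<^sup>2"
  proof (rule real_le_lsqrt)
    have "0 \<le> (\<bar>u\<bar> - 1)\<^sup>2" by simp
    then have "2 * \<bar>u\<bar> \<le> 1 + u\<^sup>2" by (simp add: power2_diff)
    then have "\<bar>u\<bar> \<le> (1 + u\<^sup>2) * 1" by simp
    also have "\<dots> \<le> (1 + u\<^sup>2) * (1 + u\<^sup>2)" by (rule mult_left_mono) auto
    finally show "\<bar>u\<bar> \<le> (1 + u\<^sup>2)\<^sup>2" by (simp only: power2_eq_square)
  qed auto
  also have "\<dots> \<le> (1 + 2 / c) * exp (c / 2 * u\<^sup>2)"
  proof -
    have "0 \<le> c / 2 * u\<^sup>2" using assms by simp
    then have "1 \<le> exp (c / 2 * u\<^sup>2)" "c / 2 * u\<^sup>2 \<le> exp (c / 2 * u\<^sup>2)"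
      using exp_ge_add_one_self[of "c / 2 * u\<^sup>2"] by linarith+
    then have "1 + 2 / c * (c / 2 * u\<^sup>2) \<le> exp (c / 2 * u\<^sup>2) + 2 / c * exp (c / 2 * u\<^sup>2)"
      using assms by (intro add_mono mult_left_mono) auto
    then show ?thesis using assms by (simp add: distrib_right)
  qed
  finally have "sqrt \<bar>u\<bar> * exp (- (c * u\<^sup>2)) \<le> (1 + 2 / c) * exp (c / 2 * u\<^sup>2) * exp (- (c * u\<^sup>2))"
    by (intro mult_right_mono) auto
  also have "\<dots> = (1 + 2 / c) * exp (- (c / 2 * u\<^sup>2))" by (simp add: mult.assoc flip: exp_add)
  finally show ?thesis .
qed

lemma half_moment_integrable:
  assumes "k > 0" shows "integrable lborel (\<lambda>u::real. indicator {0..} u * (sqrt u * exp (- (k * u\<^sup>2))))"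
proof (rule Bochner_Integration.integrable_bound)
  show "integrable lborel (\<lambda>u. (1 + 2 / k) * exp (- (k / 2 * u\<^sup>2)))"
    using gaussian_integral[of "k / 2"] assms by (auto simp: has_bochner_integral_iff)
  show "AE u in lborel. norm (indicator {0..} u * (sqrt u * exp (- (k * u\<^sup>2)))) \<le> norm ((1 + 2 / k) * exp (- (k / 2 * u\<^sup>2)))"
  proof (rule AE_I2)
    fix u :: real
    have "norm (indicator {0..} u * (sqrt u * exp (- (k * u\<^sup>2)))) \<le> sqrt \<bar>u\<bar> * exp (- (k * u\<^sup>2))"
      by (simp add: indicator_def abs_mult)
    also have "\<dots> \<le> (1 + 2 / k) * exp (- (k / 2 * u\<^sup>2))" by (rule sqrt_gaussian_bound[OF assms])
    also have "\<dots> \<le> norm ((1 + 2 / k) * exp (- (k / 2 * u\<^sup>2)))" by simp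
    finally show "norm (indicator {0..} u * (sqrt u * exp (- (k * u\<^sup>2)))) \<le> norm ((1 + 2 / k) * exp (- (k / 2 * u\<^sup>2)))" .
  qed
qed measurable

lemma half_moment_pos:
  assumes "k > 0" shows "half_moment k > 0"
proof -
  have "(\<integral>u. indicator {1..2} u * exp (- (4 * k)) \<partial>(lborel :: real measure)) \<le> half_moment k"
    unfolding half_moment_def
  proof (intro Bochner_Integration.integral_mono half_moment_integrable assms)
    fix u :: real
    show "indicator {1..2} u * exp (- (4 * k)) \<le> indicator {0..} u * (sqrt u * exp (- (k * u\<^sup>2)))"
    proof (cases "u \<in> {1..2}")
      case True
      then have "u\<^sup>2 \<le> 2\<^sup>2" by (intro power_mono) auto
      then have "1 * exp (- (4 * k)) \<le> sqrt u * exp (- (k * u\<^sup>2))"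
        using True assms by (intro mult_mono) auto
      then show ?thesis using True by simp
    qed (auto simp: indicator_def)
  qed auto
  then show ?thesis by (simp add: less_le_trans[OF exp_gt_zero])
qed

lemma bigo_powr_tendsto_zero:
  fixes X :: "real \<Rightarrow> complex"
  assumes "X \<in> O[at_top](\<lambda>r. of_real (r powr (- 3 / 2)))"
  shows "((\<lambda>r. of_real (r powr (3 / 4)) * X r) \<longlongrightarrow> 0) at_top"
proof -
  from assms obtain K where K: "\<forall>\<^sub>F r in at_top. cmod (X r) \<le> K * cmod (of_real (r powr (- 3 / 2)))"
    by (elim landau_o.bigE)
  show ?thesis
  proof (rule Lim_null_comparison)
    show "\<forall>\<^sub>F r in at_top. cmod (of_real (r powr (3 / 4)) * X r) \<le> K * r powr (- 3 / 4)"
      using K eventually_gt_at_top[of 0]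
    proof eventually_elim
      case (elim r)
      have "cmod (of_real (r powr (3 / 4)) * X r) = r powr (3 / 4) * cmod (X r)"
        by (simp add: norm_mult)
      also have "\<dots> \<le> r powr (3 / 4) * (K * r powr (- 3 / 2))"
        using elim(1) by (intro mult_left_mono) auto
      also have "\<dots> = K * (r powr (3 / 4) * r powr (- 3 / 2))" by simp
      also have "\<dots> = K * r powr (- 3 / 4)" by (simp flip: powr_add)
      finally show ?case .
    qed
    show "((\<lambda>r. K * r powr (- 3 / 4)) \<longlongrightarrow> 0) at_top" by real_asymp
  qed
qed

text \<open>
  After the substitution \<open>s = u / sqrt r\<close> the integrand of \<open>f - h0\<close> gains \<open>r powr (- 1 / 4)\<close> from the square
  root and \<open>r powr (- 1 / 2)\<close> from the measure; dominated convergence with a Gaussian bound gives the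
  limit. The constant part \<open>h0\<close> is covered by \<open>saddle_regular\<close>.
\<close>

lemma saddle_branch:
  fixes f :: "real \<Rightarrow> complex"
  assumes f [measurable]: "f \<in> borel_measurable borel" and k: "k > 0"
    and \<phi>: "0 < \<phi>" "\<phi> < pi" and C: "C \<ge> 0"
    and supp: "\<And>s. s \<notin> {- \<phi>..pi - \<phi>} \<Longrightarrow> f s = 0"
    and le: "\<And>s. s \<in> {- \<phi>..pi - \<phi>} \<Longrightarrow> cmod (f s - h0) \<le> C * sqrt \<bar>s\<bar>"
    and right: "((\<lambda>s. (f s - h0) / of_real (sqrt \<bar>s\<bar>)) \<longlongrightarrow> \<beta>) (at_right 0)"
    and left: "((\<lambda>s. (f s - h0) / of_real (sqrt \<bar>s\<bar>)) \<longlongrightarrow> \<beta>') (at_left 0)"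
  shows "((\<lambda>r. exp (- \<i> * of_real (k * r)) * of_real (r powr (3 / 4)) *
       ((\<integral>s. f s * diag_wave (k * r) s \<partial>lborel) - h0 * exp (\<i> * of_real (k * r)) * of_real (sqrt (pi / (k * r)))))
    \<longlongrightarrow> (\<beta> + \<beta>') * of_real (half_moment k)) at_top"
proof -
  define m where "m = max \<phi> (pi - \<phi>)"
  have m: "0 < m" "m < pi" using \<phi> by (auto simp: m_def)
  define c where "c = k * (sin m / m)"
  have c: "c > 0" using k m sin_gt_zero[of m] by (simp add: c_def)
  define I where "I = {- \<phi>..pi - \<phi>}"
  have I: "\<bar>s\<bar> \<le> m" if "s \<in> I" for s using that by (auto simp: I_def m_def)
  have Imeas [measurable]: "I \<in> sets borel" by (simp add: I_def)
  define F where "F s = (if s \<in> I then f s - h0 else 0)" for s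
  have Fm [measurable]: "F \<in> borel_measurable borel" unfolding F_def by measurable
  have F_le: "cmod (F s) \<le> C * sqrt \<bar>s\<bar>" for s using le[of s] C by (auto simp: F_def I_def)
  define e where "e r = exp (- \<i> * of_real (k * r))" for r
  have e_norm: "cmod (e r) = 1" for r by (simp add: e_def)
  define G where "G r u = e r * of_real (r powr (1 / 4)) * (F (u / sqrt r) * diag_wave (k * r) (u / sqrt r))" for r u
  have Gm [measurable]: "G r \<in> borel_measurable borel" for r unfolding G_def by measurable
  define L where "L u = (if u > 0 then \<beta> else if u < 0 then \<beta>' else 0) * of_real (sqrt \<bar>u\<bar> * exp (- (k * u\<^sup>2)))" for u :: real
  have Lm [measurable]: "L \<in> borel_measurable borel" unfolding L_def by measurable
  have powr: "r powr (1 / 4) * sqrt \<bar>u / sqrt r\<bar> = sqrt \<bar>u\<bar>" if "r > 0" for r u :: real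
  proof -
    have "sqrt (sqrt r) = r powr (1 / 4)"
      using that by (simp add: powr_half_sqrt[symmetric] powr_powr)
    then show ?thesis using that by (simp add: real_sqrt_divide abs_divide)
  qed
  have wave_lim: "((\<lambda>r. e r * diag_wave (k * r) (u / sqrt r)) \<longlongrightarrow> of_real (exp (- (k * u\<^sup>2)))) at_top" for u
  proof (rule LIM_zero_cancel, rule Lim_null_comparison)
    show "\<forall>\<^sub>F r in at_top. cmod (e r * diag_wave (k * r) (u / sqrt r) - of_real (exp (- (k * u\<^sup>2)))) \<le> k * exp pi * u ^ 4 * inverse r"
      using eventually_gt_at_top[of "(u / m)\<^sup>2"] eventually_gt_at_top[of 0]
    proof eventually_elim
      case (elim r)
      have "\<bar>u / m\<bar> \<le> sqrt r" using elim by (intro real_le_rsqrt) (simp add: power2_eq_square flip: abs_mult)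
      then have s: "\<bar>u / sqrt r\<bar> \<le> m" using elim m by (simp add: abs_divide field_simps)
      have kr: "0 \<le> k * r" using k elim by simp
      have s2: "r * (u / sqrt r)\<^sup>2 = u\<^sup>2" "r * (u / sqrt r) ^ 4 = u ^ 4 * inverse r"
        using elim by (simp_all add: power_divide power4_eq_xxxx power2_eq_square field_simps)
      have s3: "k * r * (u / sqrt r)\<^sup>2 = k * u\<^sup>2" using s2(1) by (simp only: mult.assoc)
      have ee: "e r * exp (\<i> * of_real (k * r)) = 1" by (simp add: e_def exp_minus)
      have "cmod (e r * diag_wave (k * r) (u / sqrt r) - of_real (exp (- (k * u\<^sup>2))))
        = cmod (e r * (diag_wave (k * r) (u / sqrt r) - exp (\<i> * of_real (k * r)) * of_real (exp (- (k * r * (u / sqrt r)\<^sup>2)))))"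
        unfolding s3 using ee by (simp add: right_diff_distrib mult.assoc[symmetric])
      also have "\<dots> = cmod (diag_wave (k * r) (u / sqrt r) - exp (\<i> * of_real (k * r)) * of_real (exp (- (k * r * (u / sqrt r)\<^sup>2))))"
        by (simp only: norm_mult e_norm mult_1)
      also have "\<dots> \<le> k * r * exp pi * (u / sqrt r) ^ 4 * exp (- (min 1 (sin m / m) * (k * r) * (u / sqrt r)\<^sup>2))"
        by (rule diag_wave_gaussian[OF s m kr])
      also have "\<dots> \<le> k * r * exp pi * (u / sqrt r) ^ 4 * 1"
        using kr sin_gt_zero[OF m] m by (intro mult_left_mono) auto
      also have "\<dots> = k * exp pi * u ^ 4 * inverse r" using s2(2) by (simp add: mult_ac)
      finally show ?case .
    qed
    show "((\<lambda>r. k * exp pi * u ^ 4 * inverse r) \<longlongrightarrow> 0) at_top"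
      by (rule tendsto_mult_right_zero[OF tendsto_inverse_0_at_top[OF filterlim_ident]])
  qed
  have s0: "((\<lambda>r. u / sqrt r) \<longlongrightarrow> 0) at_top" for u :: real by real_asymp
  have FI: "\<forall>\<^sub>F s in at 0. F s = f s - h0"
  proof -
    have "\<forall>\<^sub>F s in nhds 0. s \<in> {- \<phi><..<pi - \<phi>}"
      by (rule eventually_nhds_in_open) (use \<phi> in auto)
    then show ?thesis unfolding eventually_at_filter by eventually_elim (auto simp: F_def I_def)
  qed
  have G_lim: "((\<lambda>r. G r u) \<longlongrightarrow> L u) at_top" for u
  proof (cases "u = 0")
    case True
    then show ?thesis using F_le[of 0] by (simp add: G_def L_def)
  next
    case False
    have amp: "((\<lambda>r. of_real (r powr (1 / 4)) * F (u / sqrt r)) \<longlongrightarrow> (if u > 0 then \<beta> else \<beta>') * of_real (sqrt \<bar>u\<bar>)) at_top"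
    proof -
      have q: "((\<lambda>r. F (u / sqrt r) / of_real (sqrt \<bar>u / sqrt r\<bar>)) \<longlongrightarrow> (if u > 0 then \<beta> else \<beta>')) at_top"
      proof (cases "u > 0")
        case True
        have 1: "((\<lambda>s. F s / of_real (sqrt \<bar>s\<bar>)) \<longlongrightarrow> \<beta>) (at_right 0)"
          by (rule Lim_transform_eventually[OF right])
             (use FI in \<open>auto simp: eventually_at_split elim: eventually_mono\<close>)
        have 2: "filterlim (\<lambda>r. u / sqrt r) (at_right 0) at_top"
          unfolding filterlim_at by (intro conjI s0 eventually_mono[OF eventually_gt_at_top[of 0]]) (use True in auto)
        from filterlim_compose[OF 1 2] show ?thesis using True by simp
      next
        case F: False
        have 1: "((\<lambda>s. F s / of_real (sqrt \<bar>s\<bar>)) \<longlongrightarrow> \<beta>') (at_left 0)"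
          by (rule Lim_transform_eventually[OF left])
             (use FI in \<open>auto simp: eventually_at_split elim: eventually_mono\<close>)
        have 2: "filterlim (\<lambda>r. u / sqrt r) (at_left 0) at_top"
          unfolding filterlim_at using F False
          by (intro conjI s0 eventually_mono[OF eventually_gt_at_top[of 0]]) (auto simp: divide_less_0_iff)
        from filterlim_compose[OF 1 2] show ?thesis using F by simp
      qed
      have "((\<lambda>r. F (u / sqrt r) / of_real (sqrt \<bar>u / sqrt r\<bar>) * of_real (sqrt \<bar>u\<bar>)) \<longlongrightarrow> (if u > 0 then \<beta> else \<beta>') * of_real (sqrt \<bar>u\<bar>)) at_top"
        by (intro tendsto_mult_right q)
      then show ?thesis
      proof (rule Lim_transform_eventually)
        show "\<forall>\<^sub>F r in at_top. F (u / sqrt r) / of_real (sqrt \<bar>u / sqrt r\<bar>) * of_real (sqrt \<bar>u\<bar>) = of_real (r powr (1 / 4)) * F (u / sqrt r)"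
          using eventually_gt_at_top[of 0]
        proof eventually_elim
          case (elim r)
          then have nz: "sqrt \<bar>u / sqrt r\<bar> \<noteq> 0" using False by simp
          show ?case unfolding powr[OF elim, of u, symmetric] of_real_mult using nz
            by (simp del: abs_divide real_sqrt_abs)
        qed
      qed
    qed
    from tendsto_mult[OF wave_lim[of u] amp] show ?thesis
      using False by (cases "u > 0") (simp_all add: G_def L_def mult_ac)
  qed
  have G_le: "cmod (G r u) \<le> C * ((1 + 2 / c) * exp (- (c / 2 * u\<^sup>2)))" if r: "r > 0" for r u
  proof (cases "u / sqrt r \<in> I")
    case True
    have kr: "0 \<le> k * r" using k r by simp
    have s2: "r * (u / sqrt r)\<^sup>2 = u\<^sup>2" using r by (simp add: power_divide)
    have "cmod (diag_wave (k * r) (u / sqrt r)) \<le> exp (- (sin m / m * (k * r) * (u / sqrt r)\<^sup>2))"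
      by (rule norm_diag_wave[OF I[OF True] m kr])
    also have "\<dots> = exp (- (c * u\<^sup>2))" by (simp add: c_def mult_ac flip: s2)
    finally have w: "cmod (diag_wave (k * r) (u / sqrt r)) \<le> exp (- (c * u\<^sup>2))" .
    have "cmod (G r u) = r powr (1 / 4) * (cmod (F (u / sqrt r)) * cmod (diag_wave (k * r) (u / sqrt r)))"
      by (simp add: G_def norm_mult e_norm)
    also have "\<dots> \<le> r powr (1 / 4) * ((C * sqrt \<bar>u / sqrt r\<bar>) * exp (- (c * u\<^sup>2)))"
      using C by (intro mult_left_mono mult_mono F_le w) auto
    also have "\<dots> = C * (r powr (1 / 4) * sqrt \<bar>u / sqrt r\<bar>) * exp (- (c * u\<^sup>2))"
      by (simp only: mult_ac)
    also have "\<dots> = C * (sqrt \<bar>u\<bar> * exp (- (c * u\<^sup>2)))"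
      by (simp only: powr[OF r] mult.assoc)
    also have "\<dots> \<le> C * ((1 + 2 / c) * exp (- (c / 2 * u\<^sup>2)))"
      by (intro mult_left_mono sqrt_gaussian_bound c C)
    finally show ?thesis .
  qed (use C c in \<open>simp add: G_def F_def\<close>)
  have dom: "integrable lborel (\<lambda>u. C * ((1 + 2 / c) * exp (- (c / 2 * u\<^sup>2))))"
    using gaussian_integral[of "c / 2"] c by (auto simp: has_bochner_integral_iff)
  have main: "((\<lambda>r. \<integral>u. G r u \<partial>lborel) \<longlongrightarrow> (\<integral>u. L u \<partial>lborel)) at_top"
    by (rule integral_dominated_convergence_at_top[OF _ _ dom])
       (use G_lim G_le in \<open>auto intro: eventually_mono[OF eventually_gt_at_top[of 0]]\<close>)
  let ?g = "\<lambda>u. indicator {0..} u * (sqrt u * exp (- (k * u\<^sup>2))) :: real"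
  have g1: "has_bochner_integral lborel ?g (half_moment k)"
    using half_moment_integrable[OF k] by (simp add: has_bochner_integral_iff half_moment_def)
  then have "has_bochner_integral lborel (\<lambda>u. ?g (0 + (- 1) * u)) (half_moment k /\<^sub>R \<bar>- 1\<bar>)"
    by (subst (asm) lborel_has_bochner_integral_real_affine_iff[of "- 1" _ _ 0]) auto
  then have g2: "has_bochner_integral lborel (\<lambda>u. ?g (- u)) (half_moment k)" by simp
  have "has_bochner_integral lborel (\<lambda>u. \<beta> * of_real (?g u) + \<beta>' * of_real (?g (- u)))
      (\<beta> * of_real (half_moment k) + \<beta>' * of_real (half_moment k))"
    by (intro has_bochner_integral_add has_bochner_integral_mult_right has_bochner_integral_of_real g1 g2)
  moreover have "(\<lambda>u. \<beta> * of_real (?g u) + \<beta>' * of_real (?g (- u))) = L"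
    by (auto simp: L_def indicator_def fun_eq_iff)
  ultimately have L: "(\<integral>u. L u \<partial>lborel) = (\<beta> + \<beta>') * of_real (half_moment k)"
    by (simp add: has_bochner_integral_iff distrib_right)
  \<comment> \<open>the error of the constant amplitude 1, to which \<open>saddle_regular\<close> applies\<close>
  define Z where "Z r = (\<integral>s. indicator I s * diag_wave (k * r) s \<partial>lborel) - 1 * exp (\<i> * of_real (k * r)) * of_real (sqrt (pi / (k * r)))" for r
  have "Z \<in> O[at_top](\<lambda>r. of_real (r powr (- 3 / 2)))"
    unfolding Z_def
    by (rule saddle_regular[where ?h1.0 = 0 and C = 0, OF _ k \<phi>]) (auto simp: I_def)
  from bigo_powr_tendsto_zero[OF this] have "((\<lambda>r. cmod (of_real (r powr (3 / 4)) * Z r)) \<longlongrightarrow> 0) at_top"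
    by (rule tendsto_norm_zero)
  then have Z: "((\<lambda>r. e r * (of_real (r powr (3 / 4)) * Z r)) \<longlongrightarrow> 0) at_top"
    by (intro tendsto_norm_zero_cancel[of "\<lambda>r. e r * (of_real (r powr (3 / 4)) * Z r)"]) (simp add: norm_mult e_norm)
  have "((\<lambda>r. (\<integral>u. G r u \<partial>lborel) + h0 * (e r * (of_real (r powr (3 / 4)) * Z r)))
      \<longlongrightarrow> (\<beta> + \<beta>') * of_real (half_moment k) + h0 * 0) at_top"
    unfolding L[symmetric] by (intro tendsto_add main tendsto_mult_left Z)
  then have "((\<lambda>r. (\<integral>u. G r u \<partial>lborel) + h0 * (e r * (of_real (r powr (3 / 4)) * Z r)))
      \<longlongrightarrow> (\<beta> + \<beta>') * of_real (half_moment k)) at_top" by simp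
  then show ?thesis
  proof (rule Lim_transform_eventually)
    show "\<forall>\<^sub>F r in at_top. (\<integral>u. G r u \<partial>lborel) + h0 * (e r * (of_real (r powr (3 / 4)) * Z r)) =
      exp (- \<i> * of_real (k * r)) * of_real (r powr (3 / 4)) *
       ((\<integral>s. f s * diag_wave (k * r) s \<partial>lborel) - h0 * exp (\<i> * of_real (k * r)) * of_real (sqrt (pi / (k * r))))"
      using eventually_gt_at_top[of 0]
    proof eventually_elim
      case (elim r)
      let ?w = "diag_wave (k * r)"
      have kr: "0 \<le> k * r" "c * r > 0" using k elim c by auto
      have Fw: "integrable lborel (\<lambda>s. F s * ?w s)"
      proof (rule Bochner_Integration.integrable_bound)
        show "integrable lborel (\<lambda>s. C * ((1 + 2 / (c * r)) * exp (- (c * r / 2 * s\<^sup>2))))"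
          using gaussian_integral[of "c * r / 2"] kr(2) by (auto simp: has_bochner_integral_iff)
        show "AE s in lborel. norm (F s * ?w s) \<le> norm (C * ((1 + 2 / (c * r)) * exp (- (c * r / 2 * s\<^sup>2))))"
        proof (rule AE_I2)
          fix s
          show "norm (F s * ?w s) \<le> norm (C * ((1 + 2 / (c * r)) * exp (- (c * r / 2 * s\<^sup>2))))"
          proof (cases "s \<in> I")
            case True
            have "cmod (F s) * cmod (?w s) \<le> (C * sqrt \<bar>s\<bar>) * exp (- (sin m / m * (k * r) * s\<^sup>2))"
              using C by (intro mult_mono F_le norm_diag_wave[OF I[OF True] m kr(1)]) auto
            also have "\<dots> = C * (sqrt \<bar>s\<bar> * exp (- (c * r * s\<^sup>2)))" by (simp add: c_def mult_ac)
            also have "\<dots> \<le> C * ((1 + 2 / (c * r)) * exp (- (c * r / 2 * s\<^sup>2)))"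
              by (intro mult_left_mono sqrt_gaussian_bound kr C)
            also have "\<dots> \<le> norm (C * ((1 + 2 / (c * r)) * exp (- (c * r / 2 * s\<^sup>2))))"
              by (simp only: real_norm_def abs_ge_self)
            finally show ?thesis by (simp only: norm_mult)
          qed (simp add: F_def)
        qed
      qed measurable
      have Iw: "integrable lborel (\<lambda>s. indicator I s * ?w s)"
      proof -
        have "set_integrable lborel I ?w"
          unfolding I_def by (intro borel_integrable_atLeastAtMost' continuous_intros)
        then show ?thesis
          unfolding set_integrable_def by (rule back_subst[of "integrable lborel"]) (auto simp: indicator_def)
      qed
      have "(\<integral>s. f s * ?w s \<partial>lborel) = (\<integral>s. F s * ?w s + h0 * (indicator I s * ?w s) \<partial>lborel)"
        by (rule Bochner_Integration.integral_cong)
           (use supp in \<open>auto simp: F_def I_def indicator_def algebra_simps\<close>)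
      also have "\<dots> = (\<integral>s. F s * ?w s \<partial>lborel) + h0 * (\<integral>s. indicator I s * ?w s \<partial>lborel)"
        using Fw Iw by simp
      also have "(\<integral>s. F s * ?w s \<partial>lborel) = \<bar>1 / sqrt r\<bar> *\<^sub>R (\<integral>u. F (0 + 1 / sqrt r * u) * ?w (0 + 1 / sqrt r * u) \<partial>lborel)"
        by (rule lborel_integral_real_affine) (use elim in auto)
      finally have eq: "(\<integral>s. f s * ?w s \<partial>lborel) = of_real (1 / sqrt r) * (\<integral>u. F (u / sqrt r) * ?w (u / sqrt r) \<partial>lborel)
          + h0 * (\<integral>s. indicator I s * ?w s \<partial>lborel)"
        using elim by (simp add: scaleR_conv_of_real)
      have "r powr (3 / 4) = r powr (1 / 4 + 1 / 2)" by simp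
      also have "\<dots> = r powr (1 / 4) * sqrt r" unfolding powr_add using elim by (simp add: powr_half_sqrt)
      finally have "r powr (3 / 4) * (1 / sqrt r) = r powr (1 / 4)" using elim by simp
      then have p: "of_real (r powr (3 / 4)) * (of_real (1 / sqrt r) * x) = of_real (r powr (1 / 4)) * x" for x :: complex
        by (metis mult.assoc of_real_mult)
      have Gint: "(\<integral>u. G r u \<partial>lborel) = e r * (of_real (r powr (3 / 4)) * (of_real (1 / sqrt r) * (\<integral>u. F (u / sqrt r) * ?w (u / sqrt r) \<partial>lborel)))"
        unfolding p G_def by (simp add: mult.assoc)
      show ?case unfolding eq Gint Z_def e_def[symmetric] by (simp add: algebra_simps)
    qed
  qed
qed

section \<open>Asymptotics of spectral integrals with piecewise holomorphic amplitude\<close>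

lemma quadratic_remainder:
  fixes g :: "complex \<Rightarrow> complex"
  assumes "g holomorphic_on S" "open S" "z0 \<in> S"
  obtains C \<delta> where "\<delta> > 0" "C \<ge> 0" "\<And>z. cmod (z - z0) \<le> \<delta> \<Longrightarrow> cmod (g z - g z0 - deriv g z0 * (z - z0)) \<le> C * cmod (z - z0) ^ 2"
proof -
  obtain \<delta> where \<delta>: "\<delta> > 0" "cball z0 \<delta> \<subseteq> S" using assms(2,3) open_contains_cball by blast
  have d2: "deriv (deriv g) holomorphic_on S" using assms by (intro holomorphic_deriv)
  have "continuous_on (cball z0 \<delta>) (deriv (deriv g))"
    using d2 \<delta>(2) holomorphic_on_imp_continuous_on holomorphic_on_subset by blast
  then have "bounded (deriv (deriv g) ` cball z0 \<delta>)"
    by (intro compact_imp_bounded compact_continuous_image) auto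
  then obtain C where C: "C > 0" "\<And>z. z \<in> cball z0 \<delta> \<Longrightarrow> cmod (deriv (deriv g) z) \<le> C"
    unfolding bounded_pos by auto
  show ?thesis
  proof (rule that[OF \<delta>(1) less_imp_le[OF C(1)]])
    fix z assume "cmod (z - z0) \<le> \<delta>"
    then have z: "z \<in> cball z0 \<delta>" by (simp add: dist_norm norm_minus_commute)
    have D: "((deriv ^^ i) g has_field_derivative (deriv ^^ Suc i) g x) (at x within cball z0 \<delta>)"
      if "x \<in> cball z0 \<delta>" "i \<le> 1" for i x
    proof -
      have "(deriv ^^ i) g holomorphic_on S" using assms by (intro holomorphic_higher_deriv)
      then have "((deriv ^^ i) g has_field_derivative deriv ((deriv ^^ i) g) x) (at x)"
        using that \<delta> assms(2) by (intro holomorphic_derivI) auto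
      then show ?thesis by (auto intro: has_field_derivative_at_within)
    qed
    have "cmod ((deriv ^^ 0) g z - (\<Sum>i\<le>1. (deriv ^^ i) g z0 * (z - z0) ^ i / fact i)) \<le> C * cmod (z - z0) ^ Suc 1 / fact 1"
      by (rule complex_Taylor[OF convex_cball, where f = "\<lambda>i. (deriv ^^ i) g"])
         (use D C z \<delta>(1) in \<open>auto simp: numeral_2_eq_2\<close>)
    then show "cmod (g z - g z0 - deriv g z0 * (z - z0)) \<le> C * cmod (z - z0) ^ 2"
      by (simp add: numeral_2_eq_2 diff_diff_eq)
  qed
qed

context layered_amplitude
begin

lemma diag_continuous [continuous_intros]: "continuous_on S diag"
proof -
  have "diag = (\<lambda>a. of_real a + \<i> * of_real (\<phi> - a))" by (simp add: diag_def complex_eq_iff fun_eq_iff)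
  then show ?thesis by (auto intro!: continuous_intros)
qed

lemma wave_diag: "wave k \<phi> r (diag (\<phi> + s)) = diag_wave (k * r) s"
proof -
  have "diag (\<phi> + s) - of_real \<phi> = (1 - \<i>) * of_real s" by (simp add: diag_def complex_eq_iff)
  then show ?thesis by (simp add: wave_def diag_wave_def)
qed

text \<open>
  Extension by zero turns the integral over the segment into one over the line, which is the form
  required by the Gaussian estimates.
\<close>

definition centred_profile :: "real \<Rightarrow> complex" where
  "centred_profile s = (if s \<in> {- \<phi>..pi - \<phi>} then profile (\<phi> + s) else 0)"

lemma profile_pieces_continuous:
  "continuous_on {0..p1} (\<lambda>a. g1 (diag a))" "continuous_on {p1..p2} (\<lambda>a. g2 (diag a))"
  "continuous_on {p2..pi} (\<lambda>a. g3 (diag a))"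
  by (auto intro!: continuous_on_compose2[OF cont(1)] continuous_on_compose2[OF cont(2)]
       continuous_on_compose2[OF cont(3)] continuous_intros simp: strip_def diag_def)

lemma profile_bounded: obtains B where "B > 0" "\<And>a. a \<in> {0..pi} \<Longrightarrow> cmod (profile a) \<le> B"
proof -
  have "bounded ((\<lambda>a. g1 (diag a)) ` {0..p1} \<union> (\<lambda>a. g2 (diag a)) ` {p1..p2} \<union> (\<lambda>a. g3 (diag a)) ` {p2..pi})"
    by (intro bounded_Un[THEN iffD2] conjI compact_imp_bounded compact_continuous_image profile_pieces_continuous) auto
  then obtain B where B: "B > 0" "\<And>z. z \<in> (\<lambda>a. g1 (diag a)) ` {0..p1} \<union> (\<lambda>a. g2 (diag a)) ` {p1..p2} \<union> (\<lambda>a. g3 (diag a)) ` {p2..pi} \<Longrightarrow> cmod z \<le> B"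
    unfolding bounded_pos by blast
  show ?thesis
  proof (rule that[OF B(1)])
    fix a assume "a \<in> {0..pi}"
    then show "cmod (profile a) \<le> B" unfolding profile_def using p by (auto intro!: B(2))
  qed
qed

lemma centred_profile_measurable [measurable]: "centred_profile \<in> borel_measurable borel"
proof -
  have m: "(\<lambda>a. indicator {0..p1} a *\<^sub>R g1 (diag a)) \<in> borel_measurable borel"
    "(\<lambda>a. indicator {p1..p2} a *\<^sub>R g2 (diag a)) \<in> borel_measurable borel"
    "(\<lambda>a. indicator {p2..pi} a *\<^sub>R g3 (diag a)) \<in> borel_measurable borel"
    by (intro borel_measurable_continuous_on_indicator profile_pieces_continuous; simp)+
  have "centred_profile = (\<lambda>s. if \<phi> + s \<in> {0..pi} then
      (if \<phi> + s < p1 then indicator {0..p1} (\<phi> + s) *\<^sub>R g1 (diag (\<phi> + s)) else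
       if \<phi> + s < p2 then indicator {p1..p2} (\<phi> + s) *\<^sub>R g2 (diag (\<phi> + s)) else
       indicator {p2..pi} (\<phi> + s) *\<^sub>R g3 (diag (\<phi> + s))) else 0)"
    by (auto simp: centred_profile_def profile_def fun_eq_iff)
  also have "\<dots> \<in> borel_measurable borel"
    using measurable_compose[OF _ m(1), of "\<lambda>s. \<phi> + s"] measurable_compose[OF _ m(2), of "\<lambda>s. \<phi> + s"]
      measurable_compose[OF _ m(3), of "\<lambda>s. \<phi> + s"] by measurable
  finally show ?thesis .
qed

lemma profile_integral:
  "integral {0..pi} (\<lambda>a. profile a * wave k \<phi> r (diag a)) = (\<integral>s. centred_profile s * diag_wave (k * r) s \<partial>lborel)"
proof -
  obtain B where B: "B > 0" "\<And>a. a \<in> {0..pi} \<Longrightarrow> cmod (profile a) \<le> B" using profile_bounded by blast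
  let ?f = "\<lambda>s. centred_profile s * diag_wave (k * r) s"
  have b: "bounded (diag_wave (k * r) ` {- \<phi>..pi - \<phi>})"
    by (intro compact_imp_bounded compact_continuous_image continuous_intros) auto
  then obtain D where "\<forall>z\<in>diag_wave (k * r) ` {- \<phi>..pi - \<phi>}. cmod z \<le> D"
    unfolding bounded_iff by blast
  then have D: "cmod (diag_wave (k * r) s) \<le> D" if "s \<in> {- \<phi>..pi - \<phi>}" for s using that by blast
  have int: "set_integrable lborel {- \<phi>..pi - \<phi>} ?f"
  proof -
    have "set_integrable lborel {- \<phi>..pi - \<phi>} (\<lambda>_. B * D)"
      by (intro borel_integrable_atLeastAtMost' continuous_intros)
    then show ?thesis unfolding set_integrable_def
    proof (rule Bochner_Integration.integrable_bound)
      show "AE s in lborel. norm (indicator {- \<phi>..pi - \<phi>} s *\<^sub>R ?f s) \<le> norm (indicator {- \<phi>..pi - \<phi>} s *\<^sub>R (B * D))"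
      proof (rule AE_I2)
        fix s
        show "norm (indicator {- \<phi>..pi - \<phi>} s *\<^sub>R ?f s) \<le> norm (indicator {- \<phi>..pi - \<phi>} s *\<^sub>R (B * D))"
        proof (cases "s \<in> {- \<phi>..pi - \<phi>}")
          case True
          have "cmod (centred_profile s) * cmod (diag_wave (k * r) s) \<le> B * D"
            using True B D[OF True] by (intro mult_mono) (auto simp: centred_profile_def)
          then show ?thesis using True by (simp add: norm_mult)
        qed simp
      qed
    qed measurable
  qed
  let ?F = "\<lambda>a. indicator {0..pi} a *\<^sub>R (profile a * wave k \<phi> r (diag a))"
  have shift: "?F (\<phi> + 1 * s) = ?f s" "indicator {- \<phi>..pi - \<phi>} s *\<^sub>R ?f s = ?f s" for s
    by (auto simp: centred_profile_def indicator_def wave_diag)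
  have "integrable lborel (\<lambda>s. ?F (\<phi> + 1 * s))"
    using int unfolding set_integrable_def shift .
  then have "integrable lborel ?F"
    by (subst (asm) lborel_integrable_real_affine_iff) auto
  then have "integral {0..pi} (\<lambda>a. profile a * wave k \<phi> r (diag a)) = (\<integral>a. ?F a \<partial>lborel)"
    using set_borel_integral_eq_integral(2)[of "{0..pi}" "\<lambda>a. profile a * wave k \<phi> r (diag a)"]
    by (simp add: set_integrable_def set_lebesgue_integral_def)
  also have "\<dots> = \<bar>1\<bar> *\<^sub>R (\<integral>s. ?F (\<phi> + 1 * s) \<partial>lborel)"
    by (rule lborel_integral_real_affine) auto
  finally show ?thesis by (simp only: shift abs_one scaleR_one)
qed

lemma profile_at_phi: "profile \<phi> = h (k * cos \<phi>)"
proof -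
  have "diag \<phi> = of_real \<phi>" by (simp add: diag_def complex_eq_iff)
  then show ?thesis using propagating[of \<phi>] \<phi> by (auto simp: profile_def)
qed

text \<open>
  If the saddle is not on an interface, one holomorphic continuation describes the profile near it,
  and Taylor expansion verifies the hypothesis of \<open>saddle_regular\<close>. Away from the saddle that
  hypothesis costs only a larger constant, since \<open>s\<^sup>2\<close> is bounded below there.
\<close>

lemma spectral_asymptotics_regular:
  assumes "\<phi> \<noteq> p1" "\<phi> \<noteq> p2"
  shows "(\<lambda>r. integral\<^sup>L lborel (integrand r) -
           \<i> * (1 - \<i>) * (h (k * cos \<phi>) * exp (\<i> * of_real (k * r)) * of_real (sqrt (pi / (k * r)))))
         \<in> O[at_top](\<lambda>r. of_real (r powr (- 3 / 2)))"
proof -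
  obtain B where B: "B > 0" "\<And>a. a \<in> {0..pi} \<Longrightarrow> cmod (profile a) \<le> B" using profile_bounded by blast
  have "\<exists>g u v. g holomorphic_on {t. u < Re t \<and> Re t < v} \<and> u < \<phi> \<and> \<phi> < v \<and> (\<forall>a. u < a \<and> a < v \<longrightarrow> profile a = g (diag a))"
  proof -
    consider "\<phi> < p1" | "p1 < \<phi>" "\<phi> < p2" | "p2 < \<phi>" using assms by linarith
    then show ?thesis
    proof cases
      case 1
      then show ?thesis using hol(1) \<phi> by (intro exI[of _ g1] exI[of _ 0] exI[of _ p1]) (auto simp: profile_def)
    next
      case 2
      then show ?thesis using hol(2) \<phi> by (intro exI[of _ g2] exI[of _ p1] exI[of _ p2]) (auto simp: profile_def)
    next
      case 3
      then show ?thesis using hol(3) \<phi> p by (intro exI[of _ g3] exI[of _ p2] exI[of _ pi]) (auto simp: profile_def)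
    qed
  qed
  then obtain g u v where g: "g holomorphic_on {t. u < Re t \<and> Re t < v}" and uv: "u < \<phi>" "\<phi> < v"
    and pg: "\<And>a. u < a \<Longrightarrow> a < v \<Longrightarrow> profile a = g (diag a)" by blast
  have op: "open {t. u < Re t \<and> Re t < v}"
    by (intro open_Collect_conj open_Collect_less continuous_intros)
  have "of_real \<phi> \<in> {t. u < Re t \<and> Re t < v}" using uv by simp
  from quadratic_remainder[OF g op this] obtain C \<delta> where \<delta>: "\<delta> > 0" "C \<ge> 0"
    "\<And>z. cmod (z - of_real \<phi>) \<le> \<delta> \<Longrightarrow> cmod (g z - g (of_real \<phi>) - deriv g (of_real \<phi>) * (z - of_real \<phi>)) \<le> C * cmod (z - of_real \<phi>) ^ 2" by blast
  have "sin holomorphic_on (UNIV :: complex set)" by (intro holomorphic_on_sin)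
  moreover have "deriv sin (0 :: complex) = 1" using DERIV_imp_deriv[OF DERIV_sin[of "0::complex"]] by simp
  ultimately obtain C' \<delta>' where "\<delta>' > 0" "C' \<ge> 0"
    and sin_raw: "\<And>z::complex. cmod (z - 0) \<le> \<delta>' \<Longrightarrow> cmod (sin z - sin 0 - deriv sin 0 * (z - 0)) \<le> C' * cmod (z - 0) ^ 2"
    and d0: "deriv sin (0 :: complex) = 1"
    using quadratic_remainder[OF _ open_UNIV UNIV_I, of sin 0] by metis
  note \<delta>' = this(1,2)
  have sin_q: "cmod (sin z - z) \<le> C' * cmod z ^ 2" if "cmod z \<le> \<delta>'" for z :: complex
    using sin_raw[of z] that d0 by simp
  let ?h1 = "deriv g \<phi>"
  define \<epsilon> where "\<epsilon> = min (min (\<delta> / 2) (\<delta>' / 2)) (min (\<phi> - u) (v - \<phi>) / 2)"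
  have \<epsilon>: "\<epsilon> > 0" using \<delta>(1) \<delta>'(1) uv by (simp add: \<epsilon>_def)
  have gphi: "g \<phi> = h (k * cos \<phi>)" using pg[OF uv] profile_at_phi by (simp add: diag_def complex_of_real_def)
  have "bounded ((\<lambda>s::real. sin ((1 - \<i>) * of_real s)) ` {- \<phi>..pi - \<phi>})"
    by (intro compact_imp_bounded compact_continuous_image sin_diag_continuous) auto
  then obtain D where "\<forall>z\<in>(\<lambda>s::real. sin ((1 - \<i>) * of_real s)) ` {- \<phi>..pi - \<phi>}. cmod z \<le> D"
    unfolding bounded_iff by blast
  then have D: "cmod (sin ((1 - \<i>) * of_real s)) \<le> D" if "s \<in> {- \<phi>..pi - \<phi>}" for s using that by blast
  let ?C1 = "2 * C + cmod ?h1 * (2 * C')" and ?C2 = "(B + cmod (h (k * cos \<phi>)) + cmod ?h1 * D) / \<epsilon>\<^sup>2"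
  have D0: "D \<ge> 0" using D[of 0] \<phi> by (auto intro: order.trans[OF norm_ge_zero])
  have "(\<lambda>r. (\<integral>s. centred_profile s * diag_wave (k * r) s \<partial>lborel) - h (k * cos \<phi>) * exp (\<i> * of_real (k * r)) * of_real (sqrt (pi / (k * r))))
    \<in> O[at_top](\<lambda>r. of_real (r powr (- 3 / 2)))"
  proof (rule saddle_regular[OF centred_profile_measurable k \<phi>, where ?h1.0 = ?h1 and C = "?C1 + ?C2"])
    show "0 \<le> ?C1 + ?C2" using \<delta> \<delta>' B D0 by (auto intro!: add_nonneg_nonneg divide_nonneg_nonneg mult_nonneg_nonneg)
    fix s assume s: "s \<in> {- \<phi>..pi - \<phi>}"
    let ?z = "(1 - \<i>) * complex_of_real s"
    have nz: "cmod ?z = sqrt 2 * \<bar>s\<bar>" "cmod ?z ^ 2 = 2 * s\<^sup>2"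
      by (simp_all add: norm_mult cmod_def[of "1 - \<i>"] power_mult_distrib)
    show "cmod (centred_profile s - h (k * cos \<phi>) - ?h1 * sin ?z) \<le> (?C1 + ?C2) * s\<^sup>2"
    proof (cases "\<bar>s\<bar> < \<epsilon>")
      case True
      then have "u < \<phi> + s" "\<phi> + s < v" by (auto simp: \<epsilon>_def min_def split: if_splits)
      then have "centred_profile s = g (diag (\<phi> + s))" using s pg by (simp add: centred_profile_def)
      also have "diag (\<phi> + s) = of_real \<phi> + ?z" by (simp add: diag_def complex_eq_iff)
      finally have c: "centred_profile s = g (of_real \<phi> + ?z)" .
      have "cmod ?z \<le> 2 * \<bar>s\<bar>" unfolding nz by (intro mult_right_mono) (auto simp: real_le_lsqrt)
      then have z: "cmod ?z \<le> \<delta>" "cmod ?z \<le> \<delta>'" using True by (auto simp: \<epsilon>_def)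
      have "centred_profile s - h (k * cos \<phi>) - ?h1 * sin ?z = (g (of_real \<phi> + ?z) - g \<phi> - ?h1 * ?z) - ?h1 * (sin ?z - ?z)"
        unfolding c gphi by (simp add: algebra_simps)
      also have "cmod \<dots> \<le> C * cmod ?z ^ 2 + cmod ?h1 * (C' * cmod ?z ^ 2)"
      proof (rule order.trans[OF norm_triangle_ineq4], rule add_mono)
        show "cmod (g (of_real \<phi> + ?z) - g \<phi> - ?h1 * ?z) \<le> C * cmod ?z ^ 2"
          using \<delta>(3)[of "of_real \<phi> + ?z"] z by (simp only: add_diff_cancel_left')
        show "cmod (?h1 * (sin ?z - ?z)) \<le> cmod ?h1 * (C' * cmod ?z ^ 2)"
          unfolding norm_mult[of ?h1] by (intro mult_left_mono sin_q z) auto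
      qed
      also have "\<dots> = ?C1 * s\<^sup>2" unfolding nz by (simp add: algebra_simps)
      also have "\<dots> \<le> (?C1 + ?C2) * s\<^sup>2" using B D0 by (intro mult_right_mono) auto
      finally show ?thesis .
    next
      case False
      then have "\<epsilon>\<^sup>2 \<le> \<bar>s\<bar>\<^sup>2" using \<epsilon> by (intro power_mono) auto
      then have s1: "1 \<le> s\<^sup>2 / \<epsilon>\<^sup>2" using \<epsilon> by simp
      have "cmod (centred_profile s) \<le> B" using s B by (simp add: centred_profile_def)
      then have "cmod (centred_profile s - h (k * cos \<phi>) - ?h1 * sin ?z) \<le> B + cmod (h (k * cos \<phi>)) + cmod ?h1 * D"
        using D[OF s] by (intro order.trans[OF norm_triangle_ineq4] add_mono) (auto simp: norm_mult intro!: mult_left_mono)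
      also have "\<dots> \<le> (B + cmod (h (k * cos \<phi>)) + cmod ?h1 * D) * (s\<^sup>2 / \<epsilon>\<^sup>2)"
        using mult_left_mono[OF s1, of "B + cmod (h (k * cos \<phi>)) + cmod ?h1 * D"] B D0 by simp
      also have "\<dots> = ?C2 * s\<^sup>2" by simp
      also have "\<dots> \<le> (?C1 + ?C2) * s\<^sup>2" using \<delta> \<delta>' by (intro mult_right_mono) auto
      finally show ?thesis .
    qed
  qed (auto simp: centred_profile_def)
  from landau_o.big.cmult_in_iff[THEN iffD2, OF _ this, of "\<i> * (1 - \<i>)"]
  have "(\<lambda>r. \<i> * (1 - \<i>) * ((\<integral>s. centred_profile s * diag_wave (k * r) s \<partial>lborel) - h (k * cos \<phi>) * exp (\<i> * of_real (k * r)) * of_real (sqrt (pi / (k * r)))))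
    \<in> O[at_top](\<lambda>r. of_real (r powr (- 3 / 2)))" by (simp add: complex_eq_iff)
  from sum_in_bigo(1)[OF spectral_integral_diag(2) this] show ?thesis
    by (simp only: profile_integral right_diff_distrib add_diff_eq diff_add_cancel)
qed

text \<open>
  The one-sided limits bound the quotient near the saddle, boundedness of the profile does the rest;
  this is the hypothesis of \<open>saddle_branch\<close>.
\<close>

lemma spectral_asymptotics_branch:
  assumes right: "((\<lambda>s. (profile (\<phi> + s) - h (k * cos \<phi>)) / of_real (sqrt \<bar>s\<bar>)) \<longlongrightarrow> \<beta>) (at_right 0)"
    and left: "((\<lambda>s. (profile (\<phi> + s) - h (k * cos \<phi>)) / of_real (sqrt \<bar>s\<bar>)) \<longlongrightarrow> \<beta>') (at_left 0)"
  shows "((\<lambda>r. exp (- \<i> * of_real (k * r)) * (of_real (r powr (3 / 4)) * (integral\<^sup>L lborel (integrand r) -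
           \<i> * (1 - \<i>) * (h (k * cos \<phi>) * exp (\<i> * of_real (k * r)) * of_real (sqrt (pi / (k * r)))))))
         \<longlongrightarrow> \<i> * (1 - \<i>) * ((\<beta> + \<beta>') * of_real (half_moment k))) at_top"
proof -
  let ?h0 = "h (k * cos \<phi>)"
  let ?q = "\<lambda>s. (centred_profile s - ?h0) / of_real (sqrt \<bar>s\<bar>)"
  obtain B where B: "B > 0" "\<And>a. a \<in> {0..pi} \<Longrightarrow> cmod (profile a) \<le> B" using profile_bounded by blast
  have I: "\<forall>\<^sub>F s in at 0. centred_profile s = profile (\<phi> + s)"
  proof -
    have "\<forall>\<^sub>F s in nhds 0. s \<in> {- \<phi><..<pi - \<phi>}"
      by (rule eventually_nhds_in_open) (use \<phi> in auto)
    then show ?thesis unfolding eventually_at_filter by eventually_elim (auto simp: centred_profile_def)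
  qed
  have r: "(?q \<longlongrightarrow> \<beta>) (at_right 0)"
    by (rule Lim_transform_eventually[OF right])
       (use I in \<open>auto simp: eventually_at_split elim: eventually_mono\<close>)
  have l: "(?q \<longlongrightarrow> \<beta>') (at_left 0)"
    by (rule Lim_transform_eventually[OF left])
       (use I in \<open>auto simp: eventually_at_split elim: eventually_mono\<close>)
  define K where "K = cmod \<beta> + cmod \<beta>' + 1"
  have "\<forall>\<^sub>F s in at_right 0. cmod (?q s) < K" "\<forall>\<^sub>F s in at_left 0. cmod (?q s) < K"
    using order_tendstoD(2)[OF tendsto_norm[OF r], of K] order_tendstoD(2)[OF tendsto_norm[OF l], of K]
    by (auto simp: K_def add_pos_nonneg add_nonneg_pos)
  then have "\<forall>\<^sub>F s in at 0. cmod (?q s) < K" by (simp add: eventually_at_split)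
  then obtain d where d: "d > 0" "\<And>s. s \<noteq> 0 \<Longrightarrow> \<bar>s\<bar> < d \<Longrightarrow> cmod (?q s) < K"
    unfolding eventually_at by (auto simp: dist_real_def)
  have c0: "centred_profile 0 = ?h0" using \<phi> profile_at_phi by (simp add: centred_profile_def)
  let ?C = "K + (B + cmod ?h0) / sqrt d"
  have le: "cmod (centred_profile s - ?h0) \<le> ?C * sqrt \<bar>s\<bar>" if s: "s \<in> {- \<phi>..pi - \<phi>}" for s
  proof (cases "s = 0 \<or> \<bar>s\<bar> < d")
    case True
    have "cmod (centred_profile s - ?h0) \<le> K * sqrt \<bar>s\<bar>"
    proof (cases "s = 0")
      case False
      then have "cmod (centred_profile s - ?h0) / sqrt \<bar>s\<bar> < K"
        using d(2)[of s] True by (simp add: norm_divide)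
      then show ?thesis using False by (simp add: divide_less_eq)
    qed (simp add: c0)
    also have "\<dots> \<le> ?C * sqrt \<bar>s\<bar>" using B d(1) by (intro mult_right_mono) auto
    finally show ?thesis .
  next
    case False
    then have "sqrt d \<le> sqrt \<bar>s\<bar>" by auto
    then have s1: "1 \<le> sqrt \<bar>s\<bar> / sqrt d" using d(1) by simp
    have "cmod (centred_profile s - ?h0) \<le> B + cmod ?h0"
      using s B by (intro order.trans[OF norm_triangle_ineq4] add_mono) (auto simp: centred_profile_def)
    also have "\<dots> \<le> (B + cmod ?h0) * (sqrt \<bar>s\<bar> / sqrt d)"
      using mult_left_mono[OF s1, of "B + cmod ?h0"] B by simp
    also have "\<dots> = (B + cmod ?h0) / sqrt d * sqrt \<bar>s\<bar>" by simp
    also have "\<dots> \<le> ?C * sqrt \<bar>s\<bar>" by (intro mult_right_mono) (auto simp: K_def)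
    finally show ?thesis .
  qed
  have C: "?C \<ge> 0" using B d(1) by (auto simp: K_def intro!: add_nonneg_nonneg)
  have "((\<lambda>r. exp (- \<i> * of_real (k * r)) * of_real (r powr (3 / 4)) *
       ((\<integral>s. centred_profile s * diag_wave (k * r) s \<partial>lborel) - ?h0 * exp (\<i> * of_real (k * r)) * of_real (sqrt (pi / (k * r)))))
    \<longlongrightarrow> (\<beta> + \<beta>') * of_real (half_moment k)) at_top"
    by (rule saddle_branch[OF centred_profile_measurable k \<phi> C _ le r l]) (auto simp: centred_profile_def)
  from tendsto_mult_left[OF this, of "\<i> * (1 - \<i>)"]
  have main: "((\<lambda>r. \<i> * (1 - \<i>) * (exp (- \<i> * of_real (k * r)) * of_real (r powr (3 / 4)) *
       ((\<integral>s. centred_profile s * diag_wave (k * r) s \<partial>lborel) - ?h0 * exp (\<i> * of_real (k * r)) * of_real (sqrt (pi / (k * r))))))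
    \<longlongrightarrow> \<i> * (1 - \<i>) * ((\<beta> + \<beta>') * of_real (half_moment k))) at_top" .
  let ?Y = "\<lambda>r. integral\<^sup>L lborel (integrand r) - \<i> * (1 - \<i>) * (\<integral>s. centred_profile s * diag_wave (k * r) s \<partial>lborel)"
  have "((\<lambda>r. of_real (r powr (3 / 4)) * ?Y r) \<longlongrightarrow> 0) at_top"
    using bigo_powr_tendsto_zero[OF spectral_integral_diag(2)] by (simp only: profile_integral)
  then have "((\<lambda>r. cmod (of_real (r powr (3 / 4)) * ?Y r)) \<longlongrightarrow> 0) at_top"
    by (rule tendsto_norm_zero)
  then have "((\<lambda>r. cmod (exp (- \<i> * of_real (k * r)) * (of_real (r powr (3 / 4)) * ?Y r))) \<longlongrightarrow> 0) at_top"
    by (simp add: norm_mult)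
  then have "((\<lambda>r. exp (- \<i> * of_real (k * r)) * (of_real (r powr (3 / 4)) * ?Y r)) \<longlongrightarrow> 0) at_top"
    by (rule tendsto_norm_zero_cancel)
  from tendsto_add[OF main this] show ?thesis
    by (rule back_subst[of "\<lambda>X. X"]) (simp add: algebra_simps)
qed

end

section \<open>Branches of the vertical wavenumber\<close>

lemma complex_cos_continuous: "continuous_on S f \<Longrightarrow> continuous_on S (\<lambda>x. cos (f x :: complex))"
  and complex_sin_continuous: "continuous_on S f \<Longrightarrow> continuous_on S (\<lambda>x. sin (f x :: complex))"
proof -
  have "continuous_on UNIV (cos :: complex \<Rightarrow> complex)" "continuous_on UNIV (sin :: complex \<Rightarrow> complex)"
    by (intro holomorphic_on_imp_continuous_on holomorphic_intros)+
  then show "continuous_on S f \<Longrightarrow> continuous_on S (\<lambda>x. cos (f x))" "continuous_on S f \<Longrightarrow> continuous_on S (\<lambda>x. sin (f x))"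
    by (auto intro: continuous_on_compose2)
qed

text \<open>
  The roots below are needed up to and including the branch point, so the origin has to be added to
  the slit plane.
\<close>

lemma continuous_on_csqrt_slit: "continuous_on (insert 0 (- \<real>\<^sub>\<le>\<^sub>0)) csqrt"
  unfolding continuous_on_eq_continuous_within
proof
  fix z :: complex assume z: "z \<in> insert 0 (- \<real>\<^sub>\<le>\<^sub>0)"
  show "continuous (at z within insert 0 (- \<real>\<^sub>\<le>\<^sub>0)) csqrt"
  proof (cases "z = 0")
    case True
    have "((\<lambda>w. sqrt (cmod w)) \<longlongrightarrow> sqrt (cmod 0)) (at 0 within insert 0 (- \<real>\<^sub>\<le>\<^sub>0))"
      by (intro tendsto_intros)
    then have "((\<lambda>w. cmod (csqrt w)) \<longlongrightarrow> 0) (at 0 within insert 0 (- \<real>\<^sub>\<le>\<^sub>0))"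
      by simp
    from tendsto_norm_zero_cancel[OF this] show ?thesis unfolding True continuous_within csqrt_0 .
  qed (use z continuous_within_csqrt in auto)
qed

lemma csqrt_real_scale:
  assumes "r \<ge> 0" shows "csqrt (of_real r * z) = of_real (sqrt r) * csqrt z"
proof -
  have 1: "(cmod (of_real r * z) + Re (of_real r * z)) / 2 = r * ((cmod z + Re z) / 2)"
    "(cmod (of_real r * z) - Re (of_real r * z)) / 2 = r * ((cmod z - Re z) / 2)"
    using assms by (simp_all add: norm_mult algebra_simps)
  show ?thesis
  proof (cases "r = 0")
    case False
    then have "(Im (of_real r * z) = 0) = (Im z = 0)" "sgn (Im (of_real r * z)) = sgn (Im z)"
      using assms by (auto simp: sgn_mult)
    then show ?thesis unfolding complex_eq_iff csqrt.sel 1 real_sqrt_mult by simp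
  qed simp
qed

text \<open>
  \<open>outer_root\<close> and \<open>inner_root\<close> continue the root with square \<open>(cos t)\<^sup>2 - \<nu>\<^sup>2\<close> from the parts of
  the real segment on which \<open>\<bar>cos t\<bar> \<ge> \<nu>\<close> and \<open>\<bar>cos t\<bar> \<le> \<nu>\<close>, with the sign prescribed by \<open>SS\<close>. In the
  corresponding vertical strips the argument of \<open>csqrt\<close> avoids the cut except at the branch points.
\<close>

definition outer_root :: "real \<Rightarrow> complex \<Rightarrow> complex" where
  "outer_root \<nu> t = csqrt ((cos t)\<^sup>2 - of_real (\<nu>\<^sup>2))"

definition inner_root :: "real \<Rightarrow> complex \<Rightarrow> complex" where
  "inner_root \<nu> t = - \<i> * csqrt (of_real (\<nu>\<^sup>2) - (cos t)\<^sup>2)"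

lemma root_squares:
  "(outer_root \<nu> t)\<^sup>2 = (cos t)\<^sup>2 - of_real (\<nu>\<^sup>2)" "(inner_root \<nu> t)\<^sup>2 = (cos t)\<^sup>2 - of_real (\<nu>\<^sup>2)"
  by (simp_all add: outer_root_def inner_root_def power_mult_distrib)

lemma norm_roots:
  "cmod (outer_root \<nu> t) = sqrt (cmod ((cos t)\<^sup>2 - of_real (\<nu>\<^sup>2)))"
  "cmod (inner_root \<nu> t) = sqrt (cmod ((cos t)\<^sup>2 - of_real (\<nu>\<^sup>2)))"
  by (simp_all add: outer_root_def inner_root_def norm_mult norm_minus_commute)

lemma Re_Im_cos_squared:
  "Re ((cos t)\<^sup>2) = (cos (Re t))\<^sup>2 * (cosh (Im t))\<^sup>2 - (sin (Re t))\<^sup>2 * (sinh (Im t))\<^sup>2"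
  "Im ((cos t)\<^sup>2) = - (2 * (cos (Re t) * sin (Re t)) * (cosh (Im t) * sinh (Im t)))"
proof -
  have "Re (cos t) = cos (Re t) * cosh (Im t)" "Im (cos t) = - (sin (Re t) * sinh (Im t))"
    by (simp_all add: Re_cos Im_cos cosh_field_def sinh_field_def field_simps)
  then show "Re ((cos t)\<^sup>2) = (cos (Re t))\<^sup>2 * (cosh (Im t))\<^sup>2 - (sin (Re t))\<^sup>2 * (sinh (Im t))\<^sup>2"
    "Im ((cos t)\<^sup>2) = - (2 * (cos (Re t) * sin (Re t)) * (cosh (Im t) * sinh (Im t)))"
    by (simp_all add: power2_eq_square)
qed

text \<open>
  The imaginary part of \<open>(cos t)\<^sup>2\<close> vanishes only on the lines \<open>Im t = 0\<close> and \<open>sin (Re t) = 0\<close>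
  within this region; there \<open>(cos t)\<^sup>2 \<ge> (cos (Re t))\<^sup>2\<close>.
\<close>

lemma outer_avoids_cut:
  assumes "0 < \<nu>" "\<nu> \<le> \<bar>cos (Re t)\<bar>" "(cos t)\<^sup>2 - of_real (\<nu>\<^sup>2) \<in> \<real>\<^sub>\<le>\<^sub>0"
  shows "(cos t)\<^sup>2 = of_real (\<nu>\<^sup>2)" "\<bar>cos (Re t)\<bar> = \<nu>"
proof -
  from assms(3) have im: "Im ((cos t)\<^sup>2) = 0" and re: "Re ((cos t)\<^sup>2) \<le> \<nu>\<^sup>2"
    by (auto simp: complex_nonpos_Reals_iff)
  have c: "\<nu>\<^sup>2 \<le> (cos (Re t))\<^sup>2" using assms(1,2) by (metis abs_le_square_iff abs_of_pos)
  have nz: "cos (Re t) \<noteq> 0" using assms by auto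
  have ch: "1 \<le> (cosh (Im t))\<^sup>2" using cosh_real_ge_1[of "Im t"] by (simp add: one_le_power)
  have le: "(cos (Re t))\<^sup>2 \<le> Re ((cos t)\<^sup>2)" "sin (Re t) = 0 \<or> Im t = 0"
  proof -
    show s: "sin (Re t) = 0 \<or> Im t = 0" using im nz by (auto simp: Re_Im_cos_squared)
    have "(cos (Re t))\<^sup>2 * 1 \<le> (cos (Re t))\<^sup>2 * (cosh (Im t))\<^sup>2" using ch by (intro mult_left_mono) auto
    with s show "(cos (Re t))\<^sup>2 \<le> Re ((cos t)\<^sup>2)" by (auto simp: Re_Im_cos_squared)
  qed
  have eq: "(cos (Re t))\<^sup>2 = \<nu>\<^sup>2" "Re ((cos t)\<^sup>2) = \<nu>\<^sup>2" using le re c by linarith+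
  then show "\<bar>cos (Re t)\<bar> = \<nu>" using assms(1) by (metis abs_of_pos power2_eq_iff abs_minus_cancel)
  show "(cos t)\<^sup>2 = of_real (\<nu>\<^sup>2)" using eq(2) im by (simp add: complex_eq_iff)
qed

text \<open>
  Here \<open>(cos t)\<^sup>2\<close> is real only for \<open>Im t = 0\<close> or \<open>cos (Re t) = 0\<close>, and in the second case it is not
  positive.
\<close>

lemma inner_avoids_cut:
  assumes "0 < \<nu>" "\<nu> < 1" "\<bar>cos (Re t)\<bar> \<le> \<nu>" "of_real (\<nu>\<^sup>2) - (cos t)\<^sup>2 \<in> \<real>\<^sub>\<le>\<^sub>0"
  shows "(cos t)\<^sup>2 = of_real (\<nu>\<^sup>2)" "\<bar>cos (Re t)\<bar> = \<nu>"
proof -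
  from assms(4) have im: "Im ((cos t)\<^sup>2) = 0" and re: "\<nu>\<^sup>2 \<le> Re ((cos t)\<^sup>2)"
    by (auto simp: complex_nonpos_Reals_iff)
  have c: "(cos (Re t))\<^sup>2 \<le> \<nu>\<^sup>2" using assms(1,3) by (metis abs_le_square_iff abs_of_pos)
  have "\<nu>\<^sup>2 < 1" using assms(1,2) by (simp add: power_less_one_iff)
  then have "(sin (Re t))\<^sup>2 > 0" using c unfolding sin_squared_eq by linarith
  then have nz: "sin (Re t) \<noteq> 0" by auto
  have s: "cos (Re t) = 0 \<or> Im t = 0" using im nz by (auto simp: Re_Im_cos_squared)
  have "cos (Re t) \<noteq> 0"
  proof
    assume "cos (Re t) = 0"
    then have "Re ((cos t)\<^sup>2) \<le> 0" by (simp add: Re_Im_cos_squared)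
    moreover have "\<nu>\<^sup>2 > 0" using assms(1) by simp
    ultimately show False using re by linarith
  qed
  with s have "Im t = 0" by blast
  then have "Re ((cos t)\<^sup>2) = (cos (Re t))\<^sup>2" by (simp add: Re_Im_cos_squared)
  then have eq: "(cos (Re t))\<^sup>2 = \<nu>\<^sup>2" "Re ((cos t)\<^sup>2) = \<nu>\<^sup>2" using re c by linarith+
  then show "\<bar>cos (Re t)\<bar> = \<nu>" using assms(1) by (metis abs_of_pos power2_eq_iff abs_minus_cancel)
  show "(cos t)\<^sup>2 = of_real (\<nu>\<^sup>2)" using eq(2) im by (simp add: complex_eq_iff)
qed

lemma outer_root_continuous:
  assumes "0 < \<nu>" "\<And>t. t \<in> S \<Longrightarrow> \<nu> \<le> \<bar>cos (Re t)\<bar>"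
  shows "continuous_on S (outer_root \<nu>)"
  unfolding outer_root_def
  by (rule continuous_on_compose2[OF continuous_on_csqrt_slit])
     (use outer_avoids_cut[OF assms(1)] assms(2) in \<open>auto intro!: continuous_intros complex_cos_continuous\<close>)

lemma inner_root_continuous:
  assumes "0 < \<nu>" "\<nu> < 1" "\<And>t. t \<in> S \<Longrightarrow> \<bar>cos (Re t)\<bar> \<le> \<nu>"
  shows "continuous_on S (inner_root \<nu>)"
  unfolding inner_root_def
  by (intro continuous_intros, rule continuous_on_compose2[OF continuous_on_csqrt_slit])
     (use inner_avoids_cut(1)[OF assms(1,2)] assms(3) in \<open>force intro!: continuous_intros complex_cos_continuous\<close>)+

lemma outer_root_holomorphic:
  assumes "0 < \<nu>" "\<And>t. t \<in> S \<Longrightarrow> \<nu> < \<bar>cos (Re t)\<bar>"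
  shows "outer_root \<nu> holomorphic_on S"
  unfolding outer_root_def
proof (intro holomorphic_intros)
  fix t assume t: "t \<in> S"
  from outer_avoids_cut(2)[OF assms(1) less_imp_le[OF assms(2)[OF t]]] assms(2)[OF t]
  show "(cos t)\<^sup>2 - of_real (\<nu>\<^sup>2) \<notin> \<real>\<^sub>\<le>\<^sub>0" by auto
qed

lemma inner_root_holomorphic:
  assumes "0 < \<nu>" "\<nu> < 1" "\<And>t. t \<in> S \<Longrightarrow> \<bar>cos (Re t)\<bar> < \<nu>"
  shows "inner_root \<nu> holomorphic_on S"
  unfolding inner_root_def
proof (intro holomorphic_intros)
  fix t assume t: "t \<in> S"
  from inner_avoids_cut(2)[OF assms(1,2) less_imp_le[OF assms(3)[OF t]]] assms(3)[OF t]
  show "of_real (\<nu>\<^sup>2) - (cos t)\<^sup>2 \<notin> \<real>\<^sub>\<le>\<^sub>0" by auto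
qed

lemma SS_eq_root:
  assumes "0 < k" "0 < \<nu>" "complex_of_real \<xi> = of_real k * cos t"
  shows "\<nu> \<le> \<bar>\<xi> / k\<bar> \<Longrightarrow> SS (of_real \<xi>) (\<nu> * k) = of_real k * outer_root \<nu> t"
    and "\<bar>\<xi> / k\<bar> \<le> \<nu> \<Longrightarrow> SS (of_real \<xi>) (\<nu> * k) = of_real k * inner_root \<nu> t"
proof -
  have c: "cos t = of_real (\<xi> / k)" using assms by simp
  have vk: "0 < \<nu> * k" using assms by simp
  have e: "\<xi>\<^sup>2 - (\<nu> * k)\<^sup>2 = k\<^sup>2 * ((\<xi> / k)\<^sup>2 - \<nu>\<^sup>2)" "(\<nu> * k)\<^sup>2 - \<xi>\<^sup>2 = k\<^sup>2 * (\<nu>\<^sup>2 - (\<xi> / k)\<^sup>2)"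
    using assms by (simp_all add: field_simps power2_eq_square)
  have o: "outer_root \<nu> t = csqrt (of_real ((\<xi> / k)\<^sup>2 - \<nu>\<^sup>2))" "inner_root \<nu> t = - \<i> * csqrt (of_real (\<nu>\<^sup>2 - (\<xi> / k)\<^sup>2))"
    unfolding outer_root_def inner_root_def c by simp_all
  show "SS (of_real \<xi>) (\<nu> * k) = of_real k * outer_root \<nu> t" if "\<nu> \<le> \<bar>\<xi> / k\<bar>"
  proof -
    have "\<nu>\<^sup>2 \<le> (\<xi> / k)\<^sup>2" using that assms(2) by (metis abs_le_square_iff abs_of_pos)
    then have "csqrt (of_real ((\<xi> / k)\<^sup>2 - \<nu>\<^sup>2)) = of_real (sqrt ((\<xi> / k)\<^sup>2 - \<nu>\<^sup>2))"
      by (intro csqrt_of_real) simp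
    moreover have "\<nu> * k \<le> \<bar>\<xi>\<bar>" using that assms(1) by (simp add: field_simps abs_divide)
    ultimately show ?thesis unfolding o SS_of_real[OF vk] e using assms(1) by (simp add: real_sqrt_mult)
  qed
  show "SS (of_real \<xi>) (\<nu> * k) = of_real k * inner_root \<nu> t" if "\<bar>\<xi> / k\<bar> \<le> \<nu>"
  proof -
    have s: "(\<xi> / k)\<^sup>2 \<le> \<nu>\<^sup>2" using that assms(2) by (metis abs_le_square_iff abs_of_pos)
    then have q: "csqrt (of_real (\<nu>\<^sup>2 - (\<xi> / k)\<^sup>2)) = of_real (sqrt (\<nu>\<^sup>2 - (\<xi> / k)\<^sup>2))"
      by (intro csqrt_of_real) simp
    have le: "\<bar>\<xi>\<bar> \<le> \<nu> * k" using that assms(1) by (simp add: field_simps abs_divide)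
    show ?thesis
    proof (cases "\<nu> * k \<le> \<bar>\<xi>\<bar>")
      case True
      then have "\<bar>\<xi>\<bar> = \<nu> * k" using le by linarith
      then have "\<bar>\<xi> / k\<bar> = \<nu>" using assms(1) by (simp add: abs_divide)
      then have "(\<xi> / k)\<^sup>2 = \<nu>\<^sup>2" by (metis power2_abs)
      then show ?thesis unfolding o SS_of_real[OF vk] e by simp
    next
      case False
      then show ?thesis unfolding o SS_of_real[OF vk] e q using assms(1) by (simp add: real_sqrt_mult)
    qed
  qed
qed

lemma cos_squared_diff:
  "(cos x)\<^sup>2 - (cos y)\<^sup>2 = - (sin (x + y) * sin (x - y))" for x y :: complex
  unfolding sin_add sin_diff using sin_cos_squared_add[of x] sin_cos_squared_add[of y] by algebra

text \<open>
  The radicand \<open>(cos t)\<^sup>2 - (cos p)\<^sup>2\<close> is Lipschitz and zero at the branch point, so both roots are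
  of order \<open>sqrt \<bar>b\<bar>\<close> on the separating line. This is the source of the square-root bound on the jumps.
\<close>

lemma norm_root_near_branch:
  assumes "(cos p)\<^sup>2 = \<nu>\<^sup>2" "\<bar>b\<bar> \<le> pi"
  shows "sqrt (cmod ((cos (Complex p b))\<^sup>2 - of_real (\<nu>\<^sup>2))) \<le> cosh pi * sqrt \<bar>b\<bar>"
proof -
  have v: "of_real (\<nu>\<^sup>2) = (cos (of_real p :: complex))\<^sup>2" by (simp add: assms(1)[symmetric] cos_of_real)
  have z: "Complex p b - of_real p = \<i> * of_real b" "Complex p b + of_real p = Complex (2 * p) b"
    by (simp_all add: complex_eq_iff)
  have eq: "cmod ((cos (Complex p b))\<^sup>2 - of_real (\<nu>\<^sup>2)) = cmod (sin (Complex (2 * p) b)) * cmod (sin (\<i> * of_real b))"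
    unfolding v cos_squared_diff z by (simp add: norm_mult)
  have ch: "cosh b \<le> cosh pi" using assms(2) cosh_real_nonneg_le_iff[of "\<bar>b\<bar>" pi] by simp
  have "cmod (sin (Complex (2 * p) b)) \<le> cosh b"
  proof (rule power2_le_imp_le)
    have "Re (sin (Complex (2 * p) b)) = sin (2 * p) * cosh b" "Im (sin (Complex (2 * p) b)) = cos (2 * p) * sinh b"
      by (simp_all add: Re_sin Im_sin cosh_field_def sinh_field_def)
    then have "(cmod (sin (Complex (2 * p) b)))\<^sup>2 = (sin (2 * p))\<^sup>2 * (cosh b)\<^sup>2 + (cos (2 * p))\<^sup>2 * (sinh b)\<^sup>2"
      by (simp add: cmod_power2 power_mult_distrib)
    also have "\<dots> = (cosh b)\<^sup>2 - (cos (2 * p))\<^sup>2"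
      unfolding sin_squared_eq sinh_square_eq by (simp add: algebra_simps)
    finally show "(cmod (sin (Complex (2 * p) b)))\<^sup>2 \<le> (cosh b)\<^sup>2" by simp
  qed simp
  then have 1: "cmod (sin (Complex (2 * p) b)) \<le> cosh pi" using ch by linarith
  have sh: "sinh x \<le> x * cosh x" if "x \<ge> 0" for x :: real
  proof -
    have "0 * cosh 0 - sinh 0 \<le> x * cosh x - sinh x"
      using that by (intro DERIV_nonneg_imp_nondecreasing[of 0 x "\<lambda>x. x * cosh x - sinh x"])
        (auto intro!: exI derivative_eq_intros)
    then show ?thesis by simp
  qed
  have "cmod (sin (\<i> * of_real b)) = sinh \<bar>b\<bar>"
  proof -
    have "sin (\<i> * of_real b) = \<i> * of_real (sinh b)"
      by (simp add: complex_eq_iff Re_sin Im_sin sinh_field_def)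
    then show ?thesis by (simp add: norm_mult)
  qed
  also have "\<dots> \<le> \<bar>b\<bar> * cosh \<bar>b\<bar>" by (rule sh) simp
  also have "\<dots> \<le> \<bar>b\<bar> * cosh pi" using ch by (intro mult_left_mono) auto
  finally have 2: "cmod (sin (\<i> * of_real b)) \<le> \<bar>b\<bar> * cosh pi" .
  have "cmod ((cos (Complex p b))\<^sup>2 - of_real (\<nu>\<^sup>2)) \<le> cosh pi * (\<bar>b\<bar> * cosh pi)"
    unfolding eq by (intro mult_mono 1 2) auto
  then have "sqrt (cmod ((cos (Complex p b))\<^sup>2 - of_real (\<nu>\<^sup>2))) \<le> sqrt ((cosh pi)\<^sup>2 * \<bar>b\<bar>)"
    by (intro real_sqrt_le_mono) (simp add: power2_eq_square mult_ac)
  also have "\<dots> = cosh pi * sqrt \<bar>b\<bar>" by (simp add: real_sqrt_mult)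
  finally show ?thesis .
qed

section \<open>Amplitudes with square-root branch points\<close>

text \<open>
  \<open>H t s\<close> is the amplitude as a function of the angle and of the second root \<open>s\<close>. Splitting off \<open>A\<close>, the
  amplitude at \<open>s = 0\<close>, isolates the branching: inserting either root into \<open>H\<close> produces the strip
  continuations, and \<open>B \<phi> 0\<close> is the coefficient of the square-root singularity at a critical \<open>\<phi>\<close>.
\<close>

locale branched_amplitude =
  fixes k \<phi> \<nu> M :: real and h :: "real \<Rightarrow> complex" and H B :: "complex \<Rightarrow> complex \<Rightarrow> complex"
    and A :: "complex \<Rightarrow> complex"
  assumes k: "k > 0" and \<phi>: "0 < \<phi>" "\<phi> < pi" and \<nu>: "0 < \<nu>" "\<nu> < 1" and M: "M \<ge> 0"
    and H_split: "\<And>t s. H t s = A t + s * B t s"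
    and A: "A holomorphic_on UNIV"
    and B: "continuous_on UNIV (\<lambda>x. B (fst x) (snd x))"
    and H_holomorphic: "\<And>\<sigma> S. \<sigma> holomorphic_on S \<Longrightarrow> (\<lambda>t. H t (\<sigma> t)) holomorphic_on S"
    and h: "\<And>\<xi> t s. complex_of_real \<xi> = of_real k * cos t \<Longrightarrow> SS (of_real \<xi>) k = - \<i> * of_real k * sin t \<Longrightarrow>
        SS (of_real \<xi>) (\<nu> * k) = of_real k * s \<Longrightarrow> h \<xi> = H t s"
    and bounded: "\<And>\<xi>. \<bar>\<xi>\<bar> \<ge> k \<Longrightarrow> cmod (h \<xi>) \<le> M"
    and measurable: "h \<in> borel_measurable borel"
begin

definition crit :: real where "crit = arccos \<nu>"

lemma crit: "0 < crit" "crit < pi / 2" "cos crit = \<nu>" "cos (pi - crit) = - \<nu>"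
proof -
  show "cos crit = \<nu>" unfolding crit_def using \<nu> by (intro cos_arccos) auto
  then show "cos (pi - crit) = - \<nu>" by simp
  show "0 < crit" unfolding crit_def using arccos_less_arccos[of \<nu> 1] \<nu> by simp
  show "crit < pi / 2" unfolding crit_def using arccos_less_arccos[of 0 \<nu>] \<nu> by simp
qed

lemma B_continuous: "continuous_on S f \<Longrightarrow> continuous_on S g \<Longrightarrow> continuous_on S (\<lambda>x. B (f x) (g x))"
  using continuous_on_compose2[OF B continuous_on_Pair, of S f g] by simp

lemma H_continuous: "continuous_on S \<sigma> \<Longrightarrow> continuous_on S (\<lambda>t. H t (\<sigma> t))"
  unfolding H_split
  by (intro continuous_intros B_continuous holomorphic_on_imp_continuous_on[OF holomorphic_on_subset[OF A]]) auto

lemma outer_strips: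
  "t \<in> strip 0 crit \<Longrightarrow> \<nu> \<le> \<bar>cos (Re t)\<bar>" "t \<in> strip (pi - crit) pi \<Longrightarrow> \<nu> \<le> \<bar>cos (Re t)\<bar>"
  "0 < Re t \<Longrightarrow> Re t < crit \<Longrightarrow> \<nu> < \<bar>cos (Re t)\<bar>" "pi - crit < Re t \<Longrightarrow> Re t < pi \<Longrightarrow> \<nu> < \<bar>cos (Re t)\<bar>"
proof -
  show "\<nu> \<le> \<bar>cos (Re t)\<bar>" if "t \<in> strip 0 crit"
    using that cos_monotone_0_pi_le[of "Re t" crit] crit by (auto simp: strip_def)
  show "\<nu> \<le> \<bar>cos (Re t)\<bar>" if "t \<in> strip (pi - crit) pi"
    using that cos_monotone_0_pi_le[of "pi - crit" "Re t"] crit by (auto simp: strip_def)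
  show "\<nu> < \<bar>cos (Re t)\<bar>" if "0 < Re t" "Re t < crit"
    using that cos_monotone_0_pi[of "Re t" crit] crit by auto
  show "\<nu> < \<bar>cos (Re t)\<bar>" if "pi - crit < Re t" "Re t < pi"
    using that cos_monotone_0_pi[of "pi - crit" "Re t"] crit by auto
qed

lemma inner_strip:
  "t \<in> strip crit (pi - crit) \<Longrightarrow> \<bar>cos (Re t)\<bar> \<le> \<nu>"
  "crit < Re t \<Longrightarrow> Re t < pi - crit \<Longrightarrow> \<bar>cos (Re t)\<bar> < \<nu>"
proof -
  show "\<bar>cos (Re t)\<bar> \<le> \<nu>" if "t \<in> strip crit (pi - crit)"
    using that cos_monotone_0_pi_le[of crit "Re t"] cos_monotone_0_pi_le[of "Re t" "pi - crit"] crit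
    by (auto simp: strip_def)
  show "\<bar>cos (Re t)\<bar> < \<nu>" if "crit < Re t" "Re t < pi - crit"
    using that cos_monotone_0_pi[of crit "Re t"] cos_monotone_0_pi[of "Re t" "pi - crit"] crit by auto
qed

abbreviation "outer_amp \<equiv> \<lambda>t. H t (outer_root \<nu> t)"
abbreviation "inner_amp \<equiv> \<lambda>t. H t (inner_root \<nu> t)"

lemma branch_mismatch:
  assumes "(cos p)\<^sup>2 = \<nu>\<^sup>2"
  obtains K where "K \<ge> 0" "\<And>b. \<bar>b\<bar> \<le> pi \<Longrightarrow> cmod (outer_amp (Complex p b) - inner_amp (Complex p b)) \<le> K * sqrt \<bar>b\<bar>"
proof -
  have line: "continuous_on S (Complex p)" for S
    by (rule continuous_on_Complex) (auto intro: continuous_intros)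
  let ?R = "cosh pi * sqrt pi"
  let ?X = "Complex p ` {- pi..pi} \<times> cball (0::complex) ?R"
  have "compact ?X"
    by (intro compact_Times compact_continuous_image line) auto
  then have "bounded ((\<lambda>x. B (fst x) (snd x)) ` ?X)"
    by (intro compact_imp_bounded compact_continuous_image continuous_on_subset[OF B]) auto
  then obtain D where D: "D > 0" "\<forall>z\<in>(\<lambda>x. B (fst x) (snd x)) ` ?X. cmod z \<le> D"
    unfolding bounded_pos by blast
  show ?thesis
  proof (rule that[of "2 * (cosh pi * D)"])
    show "0 \<le> 2 * (cosh pi * D)" using D by simp
    fix b :: real assume b: "\<bar>b\<bar> \<le> pi"
    let ?t = "Complex p b"
    have s: "cmod (outer_root \<nu> ?t) \<le> cosh pi * sqrt \<bar>b\<bar>" "cmod (inner_root \<nu> ?t) \<le> cosh pi * sqrt \<bar>b\<bar>"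
      using norm_root_near_branch[OF assms b] by (simp_all add: norm_roots)
    have "cosh pi * sqrt \<bar>b\<bar> \<le> ?R" using b by (intro mult_left_mono) auto
    then have "cmod (outer_root \<nu> ?t) \<le> ?R" "cmod (inner_root \<nu> ?t) \<le> ?R" using s by linarith+
    moreover have "?t \<in> Complex p ` {- pi..pi}" using b by (intro imageI) auto
    ultimately have "(?t, outer_root \<nu> ?t) \<in> ?X" "(?t, inner_root \<nu> ?t) \<in> ?X" by simp_all
    from D(2)[rule_format, OF imageI, OF this(1)] D(2)[rule_format, OF imageI, OF this(2)]
    have d: "cmod (B ?t (outer_root \<nu> ?t)) \<le> D" "cmod (B ?t (inner_root \<nu> ?t)) \<le> D" by simp_all
    have "cmod (outer_amp ?t - inner_amp ?t) = cmod (outer_root \<nu> ?t * B ?t (outer_root \<nu> ?t) - inner_root \<nu> ?t * B ?t (inner_root \<nu> ?t))"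
      by (simp add: H_split)
    also have "\<dots> \<le> cosh pi * sqrt \<bar>b\<bar> * D + cosh pi * sqrt \<bar>b\<bar> * D"
      by (rule order.trans[OF norm_triangle_ineq4], unfold norm_mult, intro add_mono mult_mono s d) auto
    also have "\<dots> = 2 * (cosh pi * D) * sqrt \<bar>b\<bar>" by simp
    finally show "cmod (outer_amp ?t - inner_amp ?t) \<le> 2 * (cosh pi * D) * sqrt \<bar>b\<bar>" .
  qed
qed

lemma layered_amplitude_exists: "\<exists>K. layered_amplitude k \<phi> crit (pi - crit) K h outer_amp inner_amp outer_amp"
proof -
  have sq: "(cos crit)\<^sup>2 = \<nu>\<^sup>2" "(cos (pi - crit))\<^sup>2 = \<nu>\<^sup>2" unfolding crit by simp_all
  obtain K1 where K1: "K1 \<ge> 0" "\<And>b. \<bar>b\<bar> \<le> pi \<Longrightarrow> cmod (outer_amp (Complex crit b) - inner_amp (Complex crit b)) \<le> K1 * sqrt \<bar>b\<bar>"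
    using branch_mismatch[OF sq(1)] by blast
  obtain K2 where K2: "K2 \<ge> 0" "\<And>b. \<bar>b\<bar> \<le> pi \<Longrightarrow> cmod (outer_amp (Complex (pi - crit) b) - inner_amp (Complex (pi - crit) b)) \<le> K2 * sqrt \<bar>b\<bar>"
    using branch_mismatch[OF sq(2)] by blast
  have h_outer: "h (k * cos a) = outer_amp (of_real a)" if "a \<in> {0..pi}" "\<nu> \<le> \<bar>cos a\<bar>" for a
    by (rule h) (use that k \<nu> SS_cos[OF k, of a] SS_eq_root(1)[of k \<nu> "k * cos a" "of_real a"] in \<open>auto simp: cos_of_real sin_of_real\<close>)
  have h_inner: "h (k * cos a) = inner_amp (of_real a)" if "a \<in> {0..pi}" "\<bar>cos a\<bar> \<le> \<nu>" for a
    by (rule h) (use that k \<nu> SS_cos[OF k, of a] SS_eq_root(2)[of k \<nu> "k * cos a" "of_real a"] in \<open>auto simp: cos_of_real sin_of_real\<close>)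
  have trig: "cos (Complex 0 b) = of_real (cosh b)" "sin (Complex 0 b) = \<i> * of_real (sinh b)"
    "cos (Complex pi (- b)) = - of_real (cosh b)" "sin (Complex pi (- b)) = \<i> * of_real (sinh b)" for b
    by (auto simp: complex_eq_iff Re_cos Im_cos Re_sin Im_sin cosh_field_def sinh_field_def field_simps)
  have ii: "- (\<i> * of_real k * (\<i> * z)) = of_real k * z" for z by (simp add: complex_eq_iff)
  have big: "\<nu> \<le> \<bar>k * cosh b / k\<bar>" "\<nu> \<le> \<bar>- (k * cosh b) / k\<bar>" for b
    using k \<nu> cosh_real_ge_1[of b] by auto
  have ev1: "h (k * cosh b) = outer_amp (Complex 0 b)" if "b \<ge> 0" for b
    by (rule h) (use that k \<nu> SS_cosh[OF k, of b "k * cosh b"] SS_eq_root(1)[of k \<nu> "k * cosh b" "Complex 0 b"] big in \<open>auto simp: trig ii\<close>)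
  have ev2: "h (- (k * cosh b)) = outer_amp (Complex pi (- b))" if "b \<ge> 0" for b
    by (rule h) (use that k \<nu> SS_cosh[OF k, of b "- (k * cosh b)"] SS_eq_root(1)[of k \<nu> "- (k * cosh b)" "Complex pi (- b)"] big in \<open>auto simp: trig ii\<close>)
  have "layered_amplitude k \<phi> crit (pi - crit) (M + K1 + K2) h outer_amp inner_amp outer_amp"
  proof
    show "0 < k" "0 < \<phi>" "\<phi> < pi" "0 < crit" "crit < pi - crit" "pi - crit < pi" "0 \<le> M + K1 + K2"
      using k \<phi> crit M K1 K2 by auto
    show "continuous_on (strip 0 crit) outer_amp" "continuous_on (strip (pi - crit) pi) outer_amp"
      by (intro H_continuous outer_root_continuous \<nu> outer_strips; assumption)+
    show "continuous_on (strip crit (pi - crit)) inner_amp"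
      by (intro H_continuous inner_root_continuous \<nu> inner_strip; assumption)
    show "outer_amp holomorphic_on {t. 0 < Re t \<and> Re t < crit}" "outer_amp holomorphic_on {t. pi - crit < Re t \<and> Re t < pi}"
      by (intro H_holomorphic outer_root_holomorphic \<nu>; auto intro: outer_strips)+
    show "inner_amp holomorphic_on {t. crit < Re t \<and> Re t < pi - crit}"
      by (intro H_holomorphic inner_root_holomorphic \<nu>; auto intro: inner_strip)
    show "cmod (outer_amp (Complex crit b) - inner_amp (Complex crit b)) \<le> (M + K1 + K2) * sqrt \<bar>b\<bar>" if "\<bar>b\<bar> \<le> pi" for b
      by (rule order.trans[OF K1(2)[OF that]], rule mult_right_mono) (use M K2 in auto)
    show "cmod (inner_amp (Complex (pi - crit) b) - outer_amp (Complex (pi - crit) b)) \<le> (M + K1 + K2) * sqrt \<bar>b\<bar>" if "\<bar>b\<bar> \<le> pi" for b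
      by (subst norm_minus_commute, rule order.trans[OF K2(2)[OF that]], rule mult_right_mono) (use M K1 in auto)
    show "h (k * cos a) = outer_amp (of_real a)" if "a \<in> {0..crit}" for a
      by (rule h_outer) (use that crit outer_strips(1)[of "of_real a"] in \<open>auto simp: strip_def\<close>)
    show "h (k * cos a) = inner_amp (of_real a)" if "a \<in> {crit..pi - crit}" for a
      by (rule h_inner) (use that crit inner_strip(1)[of "of_real a"] in \<open>auto simp: strip_def\<close>)
    show "h (k * cos a) = outer_amp (of_real a)" if "a \<in> {pi - crit..pi}" for a
      by (rule h_outer) (use that crit outer_strips(2)[of "of_real a"] in \<open>auto simp: strip_def\<close>)
    show "h (k * cosh b) = outer_amp (Complex 0 b)" "h (- (k * cosh b)) = outer_amp (Complex pi (- b))" if "b \<ge> 0" for b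
      using ev1 ev2 that by auto
    show "cmod (h \<xi>) \<le> M + K1 + K2" if "k \<le> \<bar>\<xi>\<bar>" for \<xi>
      using bounded[OF that] K1 K2 by auto
    show "h \<in> borel_measurable borel" by (rule measurable)
  qed
  then show ?thesis ..
qed

lemma branched_integrable: "r \<ge> 1 \<Longrightarrow> integrable lborel (spectral_integrand k \<phi> h r)"
  using layered_amplitude_exists layered_amplitude.spectral_integral_diag(1) by blast

theorem branched_regular:
  assumes "\<phi> \<noteq> crit" "\<phi> \<noteq> pi - crit"
  shows "(\<lambda>r. integral\<^sup>L lborel (spectral_integrand k \<phi> h r) -
           \<i> * (1 - \<i>) * (h (k * cos \<phi>) * exp (\<i> * of_real (k * r)) * of_real (sqrt (pi / (k * r)))))
         \<in> O[at_top](\<lambda>r. of_real (r powr (- 3 / 2)))"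
proof -
  obtain K where "layered_amplitude k \<phi> crit (pi - crit) K h outer_amp inner_amp outer_amp" using layered_amplitude_exists ..
  from layered_amplitude.spectral_asymptotics_regular[OF this assms] show ?thesis .
qed

end

text \<open>
  The argument of the root vanishes to first order; positive real factors can be pulled out of the
  principal root, which leaves the root of the slope.
\<close>

lemma csqrt_ratio_limit:
  fixes W :: "real \<Rightarrow> complex"
  assumes W: "((\<lambda>s. W s / of_real \<bar>s\<bar>) \<longlongrightarrow> c) F" and c: "c \<notin> \<real>\<^sub>\<le>\<^sub>0" and "\<forall>\<^sub>F s in F. s \<noteq> 0"
  shows "((\<lambda>s. csqrt (W s) / of_real (sqrt \<bar>s\<bar>)) \<longlongrightarrow> csqrt c) F"
proof -
  have "((\<lambda>s. csqrt (W s / of_real \<bar>s\<bar>)) \<longlongrightarrow> csqrt c) F"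
    by (rule isCont_tendsto_compose[OF continuous_at_csqrt[OF c] W])
  then show ?thesis
  proof (rule Lim_transform_eventually)
    show "\<forall>\<^sub>F s in F. csqrt (W s / of_real \<bar>s\<bar>) = csqrt (W s) / of_real (sqrt \<bar>s\<bar>)"
      using assms(3)
    proof eventually_elim
      case (elim s)
      have "csqrt (W s) = csqrt (of_real \<bar>s\<bar> * (W s / of_real \<bar>s\<bar>))" using elim by simp
      also have "\<dots> = of_real (sqrt \<bar>s\<bar>) * csqrt (W s / of_real \<bar>s\<bar>)" by (rule csqrt_real_scale) simp
      finally show ?case using elim by simp
    qed
  qed
qed

lemma cos_squared_slope:
  fixes p :: real
  defines "t \<equiv> \<lambda>s. of_real p + (1 - \<i>) * complex_of_real s"
  shows "((\<lambda>s. ((cos (t s))\<^sup>2 - (cos (of_real p))\<^sup>2) / of_real s) \<longlongrightarrow> - (of_real (sin (2 * p)) * (1 - \<i>))) (at 0)"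
proof -
  let ?f = "\<lambda>z. (cos (of_real p + (1 - \<i>) * z))\<^sup>2 :: complex"
  have "(?f has_field_derivative - (of_real (sin (2 * p)) * (1 - \<i>))) (at 0)"
    unfolding sin_double by (auto intro!: derivative_eq_intros simp: cos_of_real sin_of_real)
  then have "((\<lambda>z. (?f z - ?f 0) / z) \<longlongrightarrow> - (of_real (sin (2 * p)) * (1 - \<i>))) (at 0)"
    by (simp add: DERIV_def)
  moreover have "filterlim complex_of_real (at 0) (at 0)"
    by (auto simp: filterlim_at eventually_at_filter intro!: tendsto_eq_intros)
  ultimately have "((\<lambda>s. (?f (of_real s) - ?f 0) / of_real s) \<longlongrightarrow> - (of_real (sin (2 * p)) * (1 - \<i>))) (at 0)"
    by (rule filterlim_compose)
  then show ?thesis by (simp add: t_def)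
qed

context branched_amplitude
begin

text \<open>
  The diagonal through the saddle, parametrised from the saddle.
\<close>

definition ray :: "real \<Rightarrow> complex" where "ray s = of_real \<phi> + (1 - \<i>) * of_real s"

definition branch_constant :: complex where
  "branch_constant = csqrt (of_real \<bar>sin (2 * \<phi>)\<bar> * (1 - \<i>))"

text \<open>
  The entire part \<open>A\<close> is differentiable and drops out after division by \<open>sqrt \<bar>s\<bar>\<close>.
\<close>

lemma amplitude_slope:
  assumes \<sigma>: "((\<lambda>s. \<sigma> s / of_real (sqrt \<bar>s\<bar>)) \<longlongrightarrow> b) F" and F: "F \<le> at 0"
  shows "((\<lambda>s. (H (ray s) (\<sigma> s) - A (of_real \<phi>)) / of_real (sqrt \<bar>s\<bar>)) \<longlongrightarrow> b * B (of_real \<phi>) 0) F"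
proof -
  have id: "((\<lambda>s. s) \<longlongrightarrow> 0) F" using F tendsto_mono tendsto_ident_at by blast
  have "\<forall>\<^sub>F s in at (0::real). s \<noteq> 0" by (simp add: eventually_at_filter)
  then have nz: "\<forall>\<^sub>F s in F. s \<noteq> 0" using F by (rule filter_leD[rotated])
  have sq: "((\<lambda>s. complex_of_real (sqrt \<bar>s\<bar>)) \<longlongrightarrow> 0) F"
    using tendsto_of_real[OF tendsto_real_sqrt[OF tendsto_rabs[OF id]]] by simp
  have ray: "(ray \<longlongrightarrow> of_real \<phi>) F"
  proof -
    have "((\<lambda>s. of_real \<phi> + (1 - \<i>) * complex_of_real s) \<longlongrightarrow> of_real \<phi> + (1 - \<i>) * of_real 0) F"
      by (intro tendsto_intros id)
    then show ?thesis by (simp add: ray_def[abs_def])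
  qed
  have "((\<lambda>s. \<sigma> s / of_real (sqrt \<bar>s\<bar>) * of_real (sqrt \<bar>s\<bar>)) \<longlongrightarrow> b * 0) F"
    by (intro tendsto_mult \<sigma> sq)
  then have "((\<lambda>s. \<sigma> s / of_real (sqrt \<bar>s\<bar>) * of_real (sqrt \<bar>s\<bar>)) \<longlongrightarrow> 0) F" by (simp only: mult_zero_right)
  then have \<sigma>0: "(\<sigma> \<longlongrightarrow> 0) F"
    by (rule Lim_transform_eventually) (rule eventually_mono[OF nz], simp)
  have "isCont (\<lambda>x. B (fst x) (snd x)) (of_real \<phi>, 0)"
    using B by (simp add: continuous_on_eq_continuous_at)
  from isCont_tendsto_compose[OF this tendsto_Pair[OF ray \<sigma>0]]
  have Bl: "((\<lambda>s. B (ray s) (\<sigma> s)) \<longlongrightarrow> B (of_real \<phi>) 0) F" by simp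
  have "((\<lambda>z. (A (of_real \<phi> + z) - A (of_real \<phi>)) / z) \<longlongrightarrow> deriv A (of_real \<phi>)) (at 0)"
    using holomorphic_derivI[OF A open_UNIV UNIV_I, of "of_real \<phi>" UNIV] by (simp add: DERIV_def)
  moreover have "filterlim (\<lambda>s. (1 - \<i>) * complex_of_real s) (at 0) F"
    unfolding filterlim_at
  proof
    show "((\<lambda>s. (1 - \<i>) * complex_of_real s) \<longlongrightarrow> 0) F"
      using tendsto_mult_left[OF tendsto_of_real[OF id], of "1 - \<i>"] by simp
    show "\<forall>\<^sub>F s in F. (1 - \<i>) * complex_of_real s \<in> UNIV \<and> (1 - \<i>) * complex_of_real s \<noteq> 0"
      using nz by (auto elim!: eventually_mono simp: complex_eq_iff)
  qed
  ultimately have "((\<lambda>s. (A (of_real \<phi> + (1 - \<i>) * complex_of_real s) - A (of_real \<phi>)) / ((1 - \<i>) * complex_of_real s)) \<longlongrightarrow> deriv A (of_real \<phi>)) F"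
    by (rule filterlim_compose)
  then have Al: "((\<lambda>s. (A (ray s) - A (of_real \<phi>)) / ((1 - \<i>) * complex_of_real s)) \<longlongrightarrow> deriv A (of_real \<phi>)) F"
    by (simp add: ray_def)
  have quot: "((\<lambda>s. (1 - \<i>) * (complex_of_real s / of_real (sqrt \<bar>s\<bar>))) \<longlongrightarrow> 0) F"
  proof (rule Lim_null_comparison)
    show "\<forall>\<^sub>F s in F. cmod ((1 - \<i>) * (complex_of_real s / of_real (sqrt \<bar>s\<bar>))) \<le> cmod (1 - \<i>) * sqrt \<bar>s\<bar>"
    proof (rule always_eventually, rule allI)
      fix s :: real
      have "\<bar>s\<bar> / sqrt \<bar>s\<bar> = sqrt \<bar>s\<bar>" by (rule real_div_sqrt) simp
      then show "cmod ((1 - \<i>) * (complex_of_real s / of_real (sqrt \<bar>s\<bar>))) \<le> cmod (1 - \<i>) * sqrt \<bar>s\<bar>"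
        unfolding norm_mult by (simp add: norm_divide)
    qed
    show "((\<lambda>s. cmod (1 - \<i>) * sqrt \<bar>s\<bar>) \<longlongrightarrow> 0) F"
      using tendsto_mult_left[OF tendsto_real_sqrt[OF tendsto_rabs[OF id]], of "cmod (1 - \<i>)"] by simp
  qed
  have "((\<lambda>s. (A (ray s) - A (of_real \<phi>)) / ((1 - \<i>) * complex_of_real s) * ((1 - \<i>) * (complex_of_real s / of_real (sqrt \<bar>s\<bar>)))
     + \<sigma> s / of_real (sqrt \<bar>s\<bar>) * B (ray s) (\<sigma> s)) \<longlongrightarrow> deriv A (of_real \<phi>) * 0 + b * B (of_real \<phi>) 0) F"
    by (intro tendsto_add tendsto_mult Al quot \<sigma> Bl)
  then have "((\<lambda>s. (A (ray s) - A (of_real \<phi>)) / ((1 - \<i>) * complex_of_real s) * ((1 - \<i>) * (complex_of_real s / of_real (sqrt \<bar>s\<bar>)))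
     + \<sigma> s / of_real (sqrt \<bar>s\<bar>) * B (ray s) (\<sigma> s)) \<longlongrightarrow> b * B (of_real \<phi>) 0) F" by simp
  then show ?thesis
  proof (rule Lim_transform_eventually)
    show "\<forall>\<^sub>F s in F. (A (ray s) - A (of_real \<phi>)) / ((1 - \<i>) * complex_of_real s) * ((1 - \<i>) * (complex_of_real s / of_real (sqrt \<bar>s\<bar>)))
     + \<sigma> s / of_real (sqrt \<bar>s\<bar>) * B (ray s) (\<sigma> s) = (H (ray s) (\<sigma> s) - A (of_real \<phi>)) / of_real (sqrt \<bar>s\<bar>)"
      using nz
    proof eventually_elim
      case (elim s)
      have c: "(1 - \<i>) * complex_of_real s \<noteq> 0" using elim by (simp add: complex_eq_iff)
      have "(A (ray s) - A (of_real \<phi>)) / ((1 - \<i>) * complex_of_real s) * ((1 - \<i>) * (complex_of_real s / of_real (sqrt \<bar>s\<bar>)))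
        = (A (ray s) - A (of_real \<phi>)) / of_real (sqrt \<bar>s\<bar>)"
        unfolding times_divide_eq_right using c by (simp add: divide_divide_eq_left)
      then show ?case by (simp add: H_split diff_divide_distrib add_divide_distrib)
    qed
  qed
qed

text \<open>
  At a critical angle one half of the diagonal lies in the strip of \<open>outer_root\<close>, the other in that
  of \<open>inner_root\<close>. On both halves the radicand of the principal root that is actually used is
  asymptotically \<open>\<bar>s\<bar> * \<bar>sin (2 * \<phi>)\<bar> * (1 - \<i>)\<close>, so the one-sided coefficients are \<open>branch_constant\<close>
  and \<open>- \<i> * branch_constant\<close>, and their sum \<open>(1 - \<i>) * branch_constant\<close> does not cancel.
\<close>

theorem branched_critical:
  assumes crit_angle: "\<phi> = crit \<or> \<phi> = pi - crit"
  shows "((\<lambda>r. exp (- \<i> * of_real (k * r)) * (of_real (r powr (3 / 4)) * (integral\<^sup>L lborel (spectral_integrand k \<phi> h r) -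
           \<i> * (1 - \<i>) * (h (k * cos \<phi>) * exp (\<i> * of_real (k * r)) * of_real (sqrt (pi / (k * r)))))))
         \<longlongrightarrow> \<i> * (1 - \<i>) * ((1 - \<i>) * branch_constant * B (of_real \<phi>) 0 * of_real (half_moment k))) at_top"
    and "branch_constant \<noteq> 0"
proof -
  obtain K where "layered_amplitude k \<phi> crit (pi - crit) K h outer_amp inner_amp outer_amp" using layered_amplitude_exists ..
  then interpret L: layered_amplitude k \<phi> crit "pi - crit" K h outer_amp inner_amp outer_amp .
  let ?\<tau> = "\<bar>sin (2 * \<phi>)\<bar>"
  have sin_sign: "\<phi> = crit \<Longrightarrow> sin (2 * \<phi>) > 0" "\<phi> = pi - crit \<Longrightarrow> sin (2 * \<phi>) < 0"
  proof -
    show "\<phi> = crit \<Longrightarrow> sin (2 * \<phi>) > 0" using crit by (intro sin_gt_zero) auto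
    have "sin (2 * (pi - crit)) = - sin (2 * crit)" by (simp add: right_diff_distrib sin_diff)
    moreover have "sin (2 * crit) > 0" using crit by (intro sin_gt_zero) auto
    ultimately show "\<phi> = pi - crit \<Longrightarrow> sin (2 * \<phi>) < 0" by simp
  qed
  then have \<tau>: "?\<tau> > 0" using crit_angle by auto
  have cut: "of_real ?\<tau> * (1 - \<i>) \<notin> \<real>\<^sub>\<le>\<^sub>0" using \<tau> by (auto simp: complex_nonpos_Reals_iff)
  then show "branch_constant \<noteq> 0" unfolding branch_constant_def using \<tau> by (auto simp: complex_eq_iff)
  have cos2: "(cos \<phi>)\<^sup>2 = \<nu>\<^sup>2" using crit_angle crit by auto
  have cc: "(cos (complex_of_real \<phi>))\<^sup>2 = of_real (\<nu>\<^sup>2)" by (simp add: cos2[symmetric] cos_of_real)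
  have slope: "((\<lambda>s. ((cos (ray s))\<^sup>2 - of_real (\<nu>\<^sup>2)) / of_real s) \<longlongrightarrow> - (of_real (sin (2 * \<phi>)) * (1 - \<i>))) F" if "F \<le> at 0" for F
    using tendsto_mono[OF that cos_squared_slope[of \<phi>]] unfolding cc ray_def .
  have slope_abs: "((\<lambda>s. ((cos (ray s))\<^sup>2 - of_real (\<nu>\<^sup>2)) / of_real s * of_real (- (?\<tau> / sin (2 * \<phi>)))) \<longlongrightarrow> of_real ?\<tau> * (1 - \<i>)) F" if "F \<le> at 0" for F
  proof -
    have e: "complex_of_real (sin (2 * \<phi>)) * of_real (?\<tau> / sin (2 * \<phi>)) = of_real ?\<tau>" using \<tau> by simp
    have "- (of_real (sin (2 * \<phi>)) * (1 - \<i>)) * of_real (- (?\<tau> / sin (2 * \<phi>))) = (complex_of_real (sin (2 * \<phi>)) * of_real (?\<tau> / sin (2 * \<phi>))) * (1 - \<i>)"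
      by (simp only: of_real_minus minus_mult_minus mult_ac)
    with tendsto_mult_right[OF slope[OF that], of "of_real (- (?\<tau> / sin (2 * \<phi>)))"] show ?thesis
      unfolding e by simp
  qed
  have h0: "h (k * cos \<phi>) = A (of_real \<phi>)"
  proof -
    have "\<bar>k * cos \<phi> / k\<bar> = \<nu>" using k \<nu> crit crit_angle by auto
    then have SSn: "SS (of_real (k * cos \<phi>)) (\<nu> * k) = of_real k * outer_root \<nu> \<phi>"
      by (intro SS_eq_root k \<nu>) (auto simp: cos_of_real)
    have "outer_root \<nu> \<phi> = 0" by (simp add: outer_root_def cc)
    then have "h (k * cos \<phi>) = H (of_real \<phi>) 0"
      by (intro h) (use SSn SS_cos[OF k, of \<phi>] \<phi> in \<open>auto simp: cos_of_real sin_of_real\<close>)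
    then show ?thesis by (simp add: H_split)
  qed
  have prof: "L.diag (\<phi> + s) = ray s" for s by (simp add: L.diag_def ray_def complex_eq_iff)
  have side: "(at_right 0 :: real filter) \<le> at 0" "(at_left 0 :: real filter) \<le> at 0" by (auto intro: at_le)
  have nz: "\<forall>\<^sub>F s in at_right (0::real). s \<noteq> 0" "\<forall>\<^sub>F s in at_left (0::real). s \<noteq> 0"
    by (auto simp: eventually_at_filter)
  show "((\<lambda>r. exp (- \<i> * of_real (k * r)) * (of_real (r powr (3 / 4)) * (integral\<^sup>L lborel (spectral_integrand k \<phi> h r) -
           \<i> * (1 - \<i>) * (h (k * cos \<phi>) * exp (\<i> * of_real (k * r)) * of_real (sqrt (pi / (k * r)))))))
         \<longlongrightarrow> \<i> * (1 - \<i>) * ((1 - \<i>) * branch_constant * B (of_real \<phi>) 0 * of_real (half_moment k))) at_top"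
  proof -
    let ?lim = "\<lambda>\<beta> F. ((\<lambda>s. (L.profile (\<phi> + s) - h (k * cos \<phi>)) / of_real (sqrt \<bar>s\<bar>)) \<longlongrightarrow> \<beta>) F"
    let ?out = "branch_constant * B (of_real \<phi>) 0" and ?inn = "- \<i> * branch_constant * B (of_real \<phi>) 0"
    have outer: "?lim ?out F" if F: "F \<le> at 0"
      and e: "\<forall>\<^sub>F s in F. s \<noteq> 0 \<and> L.profile (\<phi> + s) = outer_amp (ray s) \<and> \<bar>s\<bar> * ?\<tau> = - (s * sin (2 * \<phi>))" for F
    proof -
      have "((\<lambda>s. ((cos (ray s))\<^sup>2 - of_real (\<nu>\<^sup>2)) / of_real \<bar>s\<bar>) \<longlongrightarrow> of_real ?\<tau> * (1 - \<i>)) F"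
      proof (rule Lim_transform_eventually)
        show "((\<lambda>s. ((cos (ray s))\<^sup>2 - of_real (\<nu>\<^sup>2)) / of_real s * of_real (- (?\<tau> / sin (2 * \<phi>)))) \<longlongrightarrow> of_real ?\<tau> * (1 - \<i>)) F"
          by (rule slope_abs[OF F])
        show "\<forall>\<^sub>F s in F. ((cos (ray s))\<^sup>2 - of_real (\<nu>\<^sup>2)) / of_real s * of_real (- (?\<tau> / sin (2 * \<phi>))) = ((cos (ray s))\<^sup>2 - of_real (\<nu>\<^sup>2)) / of_real \<bar>s\<bar>"
          using e
        proof eventually_elim
          case (elim s)
          then have "- (?\<tau> / sin (2 * \<phi>)) = s / \<bar>s\<bar>" using \<tau> by (simp add: field_simps)
          then show ?case using elim by simp
        qed
      qed
      then have "((\<lambda>s. outer_root \<nu> (ray s) / of_real (sqrt \<bar>s\<bar>)) \<longlongrightarrow> branch_constant) F"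
        unfolding outer_root_def branch_constant_def
        by (rule csqrt_ratio_limit[OF _ cut]) (use e in \<open>auto elim: eventually_mono\<close>)
      from amplitude_slope[OF this F] show ?thesis
        unfolding h0 by (rule Lim_transform_eventually) (use e in \<open>auto elim: eventually_mono\<close>)
    qed
    have inner: "?lim ?inn F" if F: "F \<le> at 0"
      and e: "\<forall>\<^sub>F s in F. s \<noteq> 0 \<and> L.profile (\<phi> + s) = inner_amp (ray s) \<and> \<bar>s\<bar> * ?\<tau> = s * sin (2 * \<phi>)" for F
    proof -
      have "((\<lambda>s. (of_real (\<nu>\<^sup>2) - (cos (ray s))\<^sup>2) / of_real \<bar>s\<bar>) \<longlongrightarrow> of_real ?\<tau> * (1 - \<i>)) F"
      proof (rule Lim_transform_eventually)
        show "((\<lambda>s. ((cos (ray s))\<^sup>2 - of_real (\<nu>\<^sup>2)) / of_real s * of_real (- (?\<tau> / sin (2 * \<phi>)))) \<longlongrightarrow> of_real ?\<tau> * (1 - \<i>)) F"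
          by (rule slope_abs[OF F])
        show "\<forall>\<^sub>F s in F. ((cos (ray s))\<^sup>2 - of_real (\<nu>\<^sup>2)) / of_real s * of_real (- (?\<tau> / sin (2 * \<phi>))) = (of_real (\<nu>\<^sup>2) - (cos (ray s))\<^sup>2) / of_real \<bar>s\<bar>"
          using e
        proof eventually_elim
          case (elim s)
          then have "- (?\<tau> / sin (2 * \<phi>)) = - (s / \<bar>s\<bar>)" using \<tau> by (simp add: field_simps)
          moreover have "W / of_real s * of_real (- (s / \<bar>s\<bar>)) = - (W / of_real \<bar>s\<bar>)" for W :: complex
            using elim by simp
          ultimately show ?case by (simp only: minus_divide_left minus_diff_eq)
        qed
      qed
      then have "((\<lambda>s. csqrt (of_real (\<nu>\<^sup>2) - (cos (ray s))\<^sup>2) / of_real (sqrt \<bar>s\<bar>)) \<longlongrightarrow> branch_constant) F"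
        unfolding branch_constant_def
        by (rule csqrt_ratio_limit[OF _ cut]) (use e in \<open>auto elim: eventually_mono\<close>)
      from tendsto_mult_left[OF this, of "- \<i>"]
      have "((\<lambda>s. inner_root \<nu> (ray s) / of_real (sqrt \<bar>s\<bar>)) \<longlongrightarrow> - \<i> * branch_constant) F"
        unfolding inner_root_def by (simp only: times_divide_eq_right)
      from amplitude_slope[OF this F] show ?thesis
        unfolding h0 by (rule Lim_transform_eventually) (use e in \<open>auto elim: eventually_mono\<close>)
    qed
    have sum: "(1 - \<i>) * branch_constant * B (of_real \<phi>) 0 = ?out + ?inn"
      "(1 - \<i>) * branch_constant * B (of_real \<phi>) 0 = ?inn + ?out" by (simp_all add: algebra_simps)
    from crit_angle show ?thesis
    proof
      assume c: "\<phi> = crit"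
      have sg: "?\<tau> = sin (2 * \<phi>)" using sin_sign(1)[OF c] by simp
      have right: "?lim ?inn (at_right 0)"
      proof (rule inner[OF side(1)])
        show "\<forall>\<^sub>F s in at_right 0. s \<noteq> 0 \<and> L.profile (\<phi> + s) = inner_amp (ray s) \<and> \<bar>s\<bar> * ?\<tau> = s * sin (2 * \<phi>)"
          unfolding eventually_at_right_field sg prof L.profile_def using crit c
          by (intro exI[of _ "pi - 2 * crit"]) auto
      qed
      have left: "?lim ?out (at_left 0)"
      proof (rule outer[OF side(2)])
        show "\<forall>\<^sub>F s in at_left 0. s \<noteq> 0 \<and> L.profile (\<phi> + s) = outer_amp (ray s) \<and> \<bar>s\<bar> * ?\<tau> = - (s * sin (2 * \<phi>))"
          unfolding eventually_at_left_field sg prof L.profile_def using crit c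
          by (intro exI[of _ "- 1"]) auto
      qed
      from L.spectral_asymptotics_branch[OF right left] show ?thesis unfolding sum(2) .
    next
      assume c: "\<phi> = pi - crit"
      have sg: "?\<tau> = - sin (2 * \<phi>)" using sin_sign(2)[OF c] by simp
      have right: "?lim ?out (at_right 0)"
      proof (rule outer[OF side(1)])
        show "\<forall>\<^sub>F s in at_right 0. s \<noteq> 0 \<and> L.profile (\<phi> + s) = outer_amp (ray s) \<and> \<bar>s\<bar> * ?\<tau> = - (s * sin (2 * \<phi>))"
          unfolding eventually_at_right_field sg prof L.profile_def using crit c
          by (intro exI[of _ 1]) auto
      qed
      have left: "?lim ?inn (at_left 0)"
      proof (rule inner[OF side(2)])
        show "\<forall>\<^sub>F s in at_left 0. s \<noteq> 0 \<and> L.profile (\<phi> + s) = inner_amp (ray s) \<and> \<bar>s\<bar> * ?\<tau> = s * sin (2 * \<phi>)"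
          unfolding eventually_at_left_field sg prof L.profile_def using crit c
          by (intro exI[of _ "2 * crit - pi"]) auto
      qed
      from L.spectral_asymptotics_branch[OF right left] show ?thesis unfolding sum(1) .
    qed
  qed
qed

end

section \<open>Bessel's equation of order zero and its ascending series\<close>

text \<open>
  Neither derivative of \<open>y\<close> is controlled at the singular point \<open>0\<close>, only \<open>y\<close> itself. With \<open>q = t * y'\<close>
  the equation reads \<open>q' = - t * y\<close>, and \<open>y - q * ln\<close> has a bounded derivative. Hence
  \<open>q * ln\<close> is bounded, \<open>q\<close> tends to \<open>0\<close>, and \<open>y' = O(t)\<close>. The energy \<open>y\<^sup>2 + y'\<^sup>2\<close>
  is decreasing and tends to \<open>0\<close> at \<open>0\<close>, so it vanishes.
\<close>

lemma bessel_equation_unique: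
  fixes y y' y'' :: "real \<Rightarrow> real"
  assumes y: "\<And>t. t > 0 \<Longrightarrow> (y has_real_derivative y' t) (at t)"
    and y': "\<And>t. t > 0 \<Longrightarrow> (y' has_real_derivative y'' t) (at t)"
    and ode: "\<And>t. t > 0 \<Longrightarrow> t * y'' t + y' t + t * y t = 0"
    and lim: "(y \<longlongrightarrow> 0) (at_right 0)" and t: "t > 0"
  shows "y t = 0"
proof -
  have "\<forall>\<^sub>F s in at_right 0. \<bar>y s\<bar> < 1"
    using order_tendstoD(2)[OF tendsto_rabs[OF lim], of 1] by simp
  then obtain b where b: "b > 0" "\<And>s. 0 < s \<Longrightarrow> s < b \<Longrightarrow> \<bar>y s\<bar> < 1"
    unfolding eventually_at_right_field by auto
  define a where "a = min (b / 2) (1 / 2)"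
  have a: "0 < a" "a < 1" "\<And>s. 0 < s \<Longrightarrow> s \<le> a \<Longrightarrow> \<bar>y s\<bar> \<le> 1"
    using b by (auto simp: a_def intro: less_imp_le)
  define q where "q s = s * y' s" for s
  have q: "(q has_real_derivative - (s * y s)) (at s)" if "s > 0" for s
  proof -
    have "(q has_real_derivative y' s + s * y'' s) (at s)"
      unfolding q_def by (auto intro!: derivative_eq_intros y' that)
    moreover have "y' s + s * y'' s = - (s * y s)" using ode[OF that] by linarith
    ultimately show ?thesis by simp
  qed
  define G where "G s = y s - q s * ln s" for s
  have G: "(G has_real_derivative s * ln s * y s) (at s)" if "s > 0" for s
  proof -
    have "(G has_real_derivative y' s - (- (s * y s) * ln s + (1 / s) * q s)) (at s)"
      unfolding G_def by (intro DERIV_diff DERIV_mult y q DERIV_ln_divide that)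
    moreover have "(1 / s) * q s = y' s" using that by (simp add: q_def)
    ultimately show ?thesis by (simp add: mult_ac)
  qed
  have G_bound: "\<bar>G s\<bar> \<le> \<bar>G a\<bar> + 1" if s: "0 < s" "s \<le> a" for s
  proof -
    have der: "\<bar>u * ln u * y u\<bar> \<le> 1" if "0 < u" "u \<le> a" for u
    proof -
      have "ln (inverse u) \<le> inverse u" using ln_bound[of "inverse u"] that by simp
      then have "u * - ln u \<le> u * inverse u" using that by (intro mult_left_mono) (auto simp: ln_inverse)
      then have "\<bar>u * ln u\<bar> \<le> 1" using that a(2) ln_le_zero_iff[of u] by (simp add: abs_mult)
      then have "\<bar>u * ln u\<bar> * \<bar>y u\<bar> \<le> 1 * 1" using a(3)[OF that] by (intro mult_mono) auto
      then show ?thesis by (simp add: abs_mult)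
    qed
    have "norm (G a - G s) \<le> 1 * norm (a - s)"
      by (rule field_differentiable_bound[of "{s..a}" G "\<lambda>u. u * ln u * y u"])
         (use s der G in \<open>auto intro: has_field_derivative_at_within\<close>)
    then show ?thesis using s a by auto
  qed
  have q_log: "\<bar>q s\<bar> * \<bar>ln s\<bar> \<le> \<bar>G a\<bar> + 2" if s: "0 < s" "s \<le> a" for s
  proof -
    have "q s * ln s = y s - G s" by (simp add: G_def)
    then show ?thesis using G_bound[OF s] a(3)[OF s] unfolding abs_mult[symmetric] by linarith
  qed
  have q0: "(q \<longlongrightarrow> 0) (at_right 0)"
  proof (rule Lim_null_comparison)
    show "\<forall>\<^sub>F s in at_right 0. norm (q s) \<le> (\<bar>G a\<bar> + 2) / \<bar>ln s\<bar>"
      unfolding eventually_at_right_field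
    proof (intro exI[of _ a] conjI allI impI a)
      fix s assume s: "0 < s" "s < a"
      then have "ln s < 0" using a by simp
      then show "norm (q s) \<le> (\<bar>G a\<bar> + 2) / \<bar>ln s\<bar>" using q_log[of s] s by (subst pos_le_divide_eq) auto
    qed
    show "((\<lambda>s. (\<bar>G a\<bar> + 2) / \<bar>ln s\<bar>) \<longlongrightarrow> 0) (at_right 0)" by real_asymp
  qed
  have y'_bound: "\<bar>y' s\<bar> \<le> s" if s: "0 < s" "s \<le> a" for s
  proof -
    have "\<bar>q s - q u\<bar> \<le> s * s" if u: "0 < u" "u < s" for u
    proof -
      have "norm (q s - q u) \<le> s * norm (s - u)"
      proof (rule field_differentiable_bound[of "{u..s}" q "\<lambda>v. - (v * y v)"])
        fix v assume v: "v \<in> {u..s}"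
        then have "v * \<bar>y v\<bar> \<le> s * 1" using u s a(3)[of v] by (intro mult_mono) auto
        then show "norm (- (v * y v)) \<le> s" using v u by (simp add: abs_mult)
      qed (use u q in \<open>auto intro: has_field_derivative_at_within\<close>)
      also have "\<dots> \<le> s * s" using u by (intro mult_left_mono) auto
      finally show ?thesis by simp
    qed
    then have "\<forall>\<^sub>F u in at_right 0. \<bar>q s - q u\<bar> \<le> s * s"
      unfolding eventually_at_right_field using s by (intro exI[of _ s]) auto
    moreover have "((\<lambda>u. \<bar>q s - q u\<bar>) \<longlongrightarrow> \<bar>q s - 0\<bar>) (at_right 0)"
      by (intro tendsto_intros q0)
    ultimately have "\<bar>q s - 0\<bar> \<le> s * s"
      by (intro tendsto_upperbound[of _ _ "at_right 0"]) auto
    then show ?thesis using s by (simp add: q_def abs_mult)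
  qed
  define E where "E s = (y s)\<^sup>2 + (y' s)\<^sup>2" for s
  have E: "(E has_real_derivative - (2 * (y' s)\<^sup>2 / s)) (at s)" if "s > 0" for s
  proof -
    have "(E has_real_derivative 2 * y s * y' s + 2 * y' s * y'' s) (at s)"
      unfolding E_def using that by (auto intro!: derivative_eq_intros y y')
    moreover have "2 * y s * y' s + 2 * y' s * y'' s = - (2 * (y' s)\<^sup>2 / s)"
    proof -
      have "y'' s = - (y' s / s) - y s" using ode[OF that] that by (simp add: field_simps)
      then show ?thesis by (simp only:) (simp add: algebra_simps power2_eq_square)
    qed
    ultimately show ?thesis by simp
  qed
  have E_mono: "E t \<le> E s" if "0 < s" "s < t" for s
  proof (rule DERIV_nonpos_imp_nonincreasing[of s t E])
    fix x assume "s \<le> x"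
    then have "x > 0" using that by simp
    then show "\<exists>d. (E has_real_derivative d) (at x) \<and> d \<le> 0"
      by (intro exI[of _ "- (2 * (y' x)\<^sup>2 / x)"] conjI E) auto
  qed (use that in simp)
  have "((\<lambda>s. (y s)\<^sup>2 + s\<^sup>2) \<longlongrightarrow> 0\<^sup>2 + 0\<^sup>2) (at_right 0)"
    by (intro tendsto_intros lim)
  moreover have "\<forall>\<^sub>F s in at_right 0. E t \<le> (y s)\<^sup>2 + s\<^sup>2"
    unfolding eventually_at_right_field
  proof (intro exI[of _ "min a t"] conjI allI impI)
    fix s assume s: "0 < s" "s < min a t"
    have "(y' s)\<^sup>2 \<le> s\<^sup>2" using y'_bound[of s] s by (metis abs_le_square_iff abs_of_pos less_imp_le min_less_iff_conj)
    then show "E t \<le> (y s)\<^sup>2 + s\<^sup>2" using E_mono[of s] s by (simp add: E_def)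
  qed (use a t in auto)
  ultimately have "E t \<le> 0\<^sup>2 + 0\<^sup>2" by (intro tendsto_lowerbound[of _ _ "at_right 0"]) auto
  then show ?thesis unfolding E_def by (smt (verit) power2_eq_iff_nonneg zero_le_power2 zero_power2 power_eq_0_iff)
qed

text \<open>
  The coefficients of \<open>bessel_J0\<close> as a power series in \<open>t\<^sup>2\<close>. In this variable Bessel's equation becomes
  \<open>z * f'' + f' + f / 4 = 0\<close>.
\<close>

definition j_coeff :: "nat \<Rightarrow> real" where
  "j_coeff m = (- 1) ^ m / (fact m)\<^sup>2 / 4 ^ m"

lemma j_coeff_Suc: "(real (Suc n))\<^sup>2 * j_coeff (Suc n) = - j_coeff n / 4"
  by (simp add: j_coeff_def power2_eq_square divide_simps del: of_nat_Suc)

lemma harm_le_fact: "harm m \<le> (fact m :: real)"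
proof -
  have "harm m \<le> real m"
  proof (induction m)
    case (Suc m)
    have "inverse (real (Suc m)) \<le> 1" by (simp add: field_simps)
    with Suc show ?case by (simp add: harm_Suc)
  qed (simp add: harm_expand)
  also have "real m \<le> fact m" by (metis fact_ge_self of_nat_fact of_nat_le_iff)
  finally show ?thesis .
qed

lemma j_series_summable:
  "summable (\<lambda>n. j_coeff n * z ^ n)" "summable (\<lambda>n. (j_coeff n * harm n) * z ^ n)" for z :: real
proof -
  have le: "\<bar>j_coeff n\<bar> * harm n \<le> 1 / fact n" "\<bar>j_coeff n\<bar> \<le> 1 / fact n" for n
  proof -
    have f: "(1::real) \<le> fact n" "(1::real) \<le> 4 ^ n" by (auto simp: one_le_power)
    have "\<bar>j_coeff n\<bar> = 1 / (fact n * (fact n * 4 ^ n))" by (simp add: j_coeff_def abs_mult power2_eq_square power_abs)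
    moreover have "fact n * 1 \<le> fact n * (4::real) ^ n" using f by (intro mult_left_mono) auto
    ultimately have j: "\<bar>j_coeff n\<bar> \<le> 1 / (fact n * fact n)" using f by (auto intro!: divide_left_mono mult_left_mono)
    then have "\<bar>j_coeff n\<bar> * harm n \<le> 1 / (fact n * fact n) * fact n"
      by (intro mult_mono harm_le_fact harm_nonneg) auto
    then show "\<bar>j_coeff n\<bar> * harm n \<le> 1 / fact n" by simp
    have "1 / (fact n * fact n) \<le> 1 / (fact n :: real)" using f by (intro divide_left_mono) (auto simp: mult_le_cancel_left1)
    with j show "\<bar>j_coeff n\<bar> \<le> 1 / fact n" by linarith
  qed
  have ex: "summable (\<lambda>n. inverse (fact n) * \<bar>z\<bar> ^ n)" by (rule summable_exp)
  have "norm (j_coeff n * z ^ n) \<le> inverse (fact n) * \<bar>z\<bar> ^ n" for n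
    using mult_right_mono[OF le(2)[of n], of "\<bar>z\<bar> ^ n"] by (simp add: abs_mult power_abs inverse_eq_divide)
  then show "summable (\<lambda>n. j_coeff n * z ^ n)" by (intro summable_comparison_test'[OF ex, of 0])
  have "norm ((j_coeff n * harm n) * z ^ n) \<le> inverse (fact n) * \<bar>z\<bar> ^ n" for n
    using mult_right_mono[OF le(1)[of n], of "\<bar>z\<bar> ^ n"] harm_nonneg[of n, where 'a = real]
    by (simp add: abs_mult power_abs inverse_eq_divide)
  then show "summable (\<lambda>n. (j_coeff n * harm n) * z ^ n)" by (intro summable_comparison_test'[OF ex, of 0])
qed

definition power_series :: "(nat \<Rightarrow> real) \<Rightarrow> real \<Rightarrow> real" where
  "power_series c z = (\<Sum>n. c n * z ^ n)"

lemma power_series_derivative: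
  assumes "\<And>z. summable (\<lambda>n. c n * z ^ n)"
  shows "(power_series c has_real_derivative power_series (diffs c) z) (at z)" "\<And>z. summable (\<lambda>n. diffs c n * z ^ n)"
  unfolding power_series_def using termdiffs_strong_converges_everywhere[of c z] termdiff_converges_all[of c] assms by auto

lemma power_series_euler_sums:
  assumes "\<And>z. summable (\<lambda>n. c n * z ^ n)"
  shows "(\<lambda>n. ((real (Suc n))\<^sup>2 * c (Suc n) + c n / 4) * z ^ n) sums
    (z * power_series (diffs (diffs c)) z + power_series (diffs c) z + power_series c z / 4)"
proof -
  have s: "\<And>z. summable (\<lambda>n. diffs c n * z ^ n)" "\<And>z. summable (\<lambda>n. diffs (diffs c) n * z ^ n)"
    using power_series_derivative(2)[OF assms] power_series_derivative(2)[OF power_series_derivative(2)[OF assms]] by auto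
  have "(\<lambda>n. z * (diffs (diffs c) n * z ^ n)) sums (z * power_series (diffs (diffs c)) z)"
    unfolding power_series_def by (intro sums_mult summable_sums s)
  moreover have "z * (diffs (diffs c) n * z ^ n) = real (Suc n) * (real (Suc (Suc n)) * c (Suc (Suc n))) * z ^ Suc n" for n
    by (simp add: diffs_def)
  ultimately have "(\<lambda>n. real (Suc n) * (real (Suc (Suc n)) * c (Suc (Suc n))) * z ^ Suc n) sums (z * power_series (diffs (diffs c)) z)" by simp
  from sums_Suc[OF this] have 1: "(\<lambda>n. real n * (real (Suc n) * c (Suc n)) * z ^ n) sums (z * power_series (diffs (diffs c)) z)" by simp
  have 2: "(\<lambda>n. diffs c n * z ^ n) sums power_series (diffs c) z" "(\<lambda>n. c n * z ^ n / 4) sums (power_series c z / 4)"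
    unfolding power_series_def by (intro summable_sums s sums_divide assms)+
  have "(\<lambda>n. real n * (real (Suc n) * c (Suc n)) * z ^ n + diffs c n * z ^ n + c n * z ^ n / 4) sums
    (z * power_series (diffs (diffs c)) z + power_series (diffs c) z + power_series c z / 4)"
    by (intro sums_add 1 2)
  then show ?thesis by (rule back_subst[of "\<lambda>f. f sums _"]) (auto simp: diffs_def algebra_simps power2_eq_square)
qed

lemma j_power_series_equation: "z * power_series (diffs (diffs j_coeff)) z + power_series (diffs j_coeff) z + power_series j_coeff z / 4 = 0"
proof -
  have "(\<lambda>n. ((real (Suc n))\<^sup>2 * j_coeff (Suc n) + j_coeff n / 4) * z ^ n) = (\<lambda>n. 0)"
    unfolding j_coeff_Suc by simp
  then show ?thesis using power_series_euler_sums[OF j_series_summable(1), of z] sums_0 sums_unique2 by metis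
qed

text \<open>
  The harmonic factors produce the inhomogeneity \<open>J'\<close> that cancels the contribution of the logarithm in
  \<open>bessel_Y0\<close>.
\<close>

lemma jh_power_series_equation:
  defines "d \<equiv> \<lambda>n. j_coeff n * harm n"
  shows "z * power_series (diffs (diffs d)) z + power_series (diffs d) z + power_series d z / 4 = power_series (diffs j_coeff) z"
proof -
  have "(real (Suc n))\<^sup>2 * d (Suc n) + d n / 4 = diffs j_coeff n" for n
  proof -
    have "(real (Suc n))\<^sup>2 * d (Suc n) = ((real (Suc n))\<^sup>2 * j_coeff (Suc n)) * harm n + (real (Suc n))\<^sup>2 * j_coeff (Suc n) * inverse (real (Suc n))"
      by (simp add: d_def harm_Suc algebra_simps del: of_nat_Suc)
    also have "(real (Suc n))\<^sup>2 * j_coeff (Suc n) * inverse (real (Suc n)) = real (Suc n) * j_coeff (Suc n)"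
      by (simp add: power2_eq_square del: of_nat_Suc)
    finally show ?thesis unfolding j_coeff_Suc by (simp add: d_def diffs_def)
  qed
  then have "(\<lambda>n. diffs j_coeff n * z ^ n) sums (z * power_series (diffs (diffs d)) z + power_series (diffs d) z + power_series d z / 4)"
    using power_series_euler_sums[of d z] j_series_summable(2) by (simp add: d_def)
  moreover have "(\<lambda>n. diffs j_coeff n * z ^ n) sums power_series (diffs j_coeff) z"
    unfolding power_series_def by (intro summable_sums power_series_derivative(2) j_series_summable)
  ultimately show ?thesis by (rule sums_unique2)
qed

definition J0' :: "real \<Rightarrow> real" where "J0' t = 2 * t * power_series (diffs j_coeff) (t\<^sup>2)"
definition J0'' :: "real \<Rightarrow> real" where
  "J0'' t = 2 * power_series (diffs j_coeff) (t\<^sup>2) + 4 * t\<^sup>2 * power_series (diffs (diffs j_coeff)) (t\<^sup>2)"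

lemma bessel_J0_power_series: "bessel_J0 t = power_series j_coeff (t\<^sup>2)"
  unfolding bessel_J0_def power_series_def
  by (rule suminf_cong) (simp add: j_coeff_def power_divide power_mult)

lemma power_series_square_derivatives:
  assumes c: "\<And>z. summable (\<lambda>n. c n * z ^ n)"
  shows "((\<lambda>t. power_series c (t\<^sup>2)) has_real_derivative 2 * t * power_series (diffs c) (t\<^sup>2)) (at t)"
    and "((\<lambda>t. 2 * t * power_series (diffs c) (t\<^sup>2)) has_real_derivative
       2 * power_series (diffs c) (t\<^sup>2) + 4 * t\<^sup>2 * power_series (diffs (diffs c)) (t\<^sup>2)) (at t)"
proof -
  have sq: "((\<lambda>t. t\<^sup>2) has_real_derivative 2 * t) (at t)" for t :: real by (auto intro!: derivative_eq_intros)
  have 1: "((\<lambda>t. power_series c (t\<^sup>2)) has_real_derivative power_series (diffs c) (t\<^sup>2) * (2 * t)) (at t)" if "\<And>z. summable (\<lambda>n. c n * z ^ n)" for c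
    using DERIV_chain2[OF power_series_derivative(1)[OF that] sq] .
  show "((\<lambda>t. power_series c (t\<^sup>2)) has_real_derivative 2 * t * power_series (diffs c) (t\<^sup>2)) (at t)"
    using 1[OF c] by (simp add: mult.commute)
  show "((\<lambda>t. 2 * t * power_series (diffs c) (t\<^sup>2)) has_real_derivative
       2 * power_series (diffs c) (t\<^sup>2) + 4 * t\<^sup>2 * power_series (diffs (diffs c)) (t\<^sup>2)) (at t)"
    by (rule derivative_eq_intros refl 1[OF power_series_derivative(2)[OF c]])+ (simp add: power2_eq_square algebra_simps)
qed

lemma bessel_J0_equation:
  "(bessel_J0 has_real_derivative J0' t) (at t)" "(J0' has_real_derivative J0'' t) (at t)"
  "t * J0'' t + J0' t + t * bessel_J0 t = 0"
proof -
  show "(bessel_J0 has_real_derivative J0' t) (at t)" "(J0' has_real_derivative J0'' t) (at t)"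
    using power_series_square_derivatives[OF j_series_summable(1), of t]
    unfolding bessel_J0_power_series[abs_def] J0'_def[abs_def] J0''_def by auto
  have "t * J0'' t + J0' t + t * bessel_J0 t = 4 * t * (t\<^sup>2 * power_series (diffs (diffs j_coeff)) (t\<^sup>2) + power_series (diffs j_coeff) (t\<^sup>2) + power_series j_coeff (t\<^sup>2) / 4)"
    by (simp add: bessel_J0_power_series J0'_def J0''_def algebra_simps power2_eq_square)
  then show "t * J0'' t + J0' t + t * bessel_J0 t = 0" by (simp only: j_power_series_equation mult_zero_right)
qed

definition jh_coeff :: "nat \<Rightarrow> real" where "jh_coeff n = j_coeff n * harm n"

definition Y0' :: "real \<Rightarrow> real" where
  "Y0' t = 2 / pi * (bessel_J0 t / t + (ln (t / 2) + euler_mascheroni) * J0' t - 2 * t * power_series (diffs jh_coeff) (t\<^sup>2))"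
definition Y0'' :: "real \<Rightarrow> real" where
  "Y0'' t = 2 / pi * (- (bessel_J0 t / t\<^sup>2) + 2 * J0' t / t + (ln (t / 2) + euler_mascheroni) * J0'' t
     - (2 * power_series (diffs jh_coeff) (t\<^sup>2) + 4 * t\<^sup>2 * power_series (diffs (diffs jh_coeff)) (t\<^sup>2)))"

lemma bessel_Y0_power_series:
  "bessel_Y0 t = 2 / pi * ((ln (t / 2) + euler_mascheroni) * bessel_J0 t - power_series jh_coeff (t\<^sup>2))"
proof -
  have "(\<Sum>m. (- 1) ^ m * harm m / (fact m)\<^sup>2 * (t / 2) ^ (2 * m)) = power_series jh_coeff (t\<^sup>2)"
    unfolding power_series_def by (rule suminf_cong) (simp add: jh_coeff_def j_coeff_def power_divide power_mult)
  then show ?thesis unfolding bessel_Y0_def by (simp add: right_diff_distrib)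
qed

lemma bessel_Y0_equation:
  assumes t: "t > 0"
  shows "(bessel_Y0 has_real_derivative Y0' t) (at t)" "(Y0' has_real_derivative Y0'' t) (at t)"
  "t * Y0'' t + Y0' t + t * bessel_Y0 t = 0"
proof -
  have sum: "\<And>z. summable (\<lambda>n. jh_coeff n * z ^ n)" using j_series_summable(2) by (simp add: jh_coeff_def)
  note d = power_series_square_derivatives[OF sum, of t] bessel_J0_equation(1,2)[of t]
  have ln: "((\<lambda>t. ln (t / 2) + euler_mascheroni) has_real_derivative 1 / t) (at t)"
    using t by (auto intro!: derivative_eq_intros)
  have "((\<lambda>t. 2 / pi * ((ln (t / 2) + euler_mascheroni) * bessel_J0 t - power_series jh_coeff (t\<^sup>2))) has_real_derivative
     2 / pi * ((1 / t * bessel_J0 t + J0' t * (ln (t / 2) + euler_mascheroni)) - 2 * t * power_series (diffs jh_coeff) (t\<^sup>2))) (at t)"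
    by (intro DERIV_cmult DERIV_diff DERIV_mult ln d)
  then show "(bessel_Y0 has_real_derivative Y0' t) (at t)"
    unfolding bessel_Y0_power_series[abs_def] Y0'_def by (simp add: mult.commute)
  have "((\<lambda>t. bessel_J0 t / t) has_real_derivative (J0' t * t - bessel_J0 t * 1) / (t * t)) (at t)"
    by (intro DERIV_divide d DERIV_ident) (use t in simp)
  then have "(Y0' has_real_derivative 2 / pi * (((J0' t * t - bessel_J0 t * 1) / (t * t) + (1 / t * J0' t + J0'' t * (ln (t / 2) + euler_mascheroni)))
      - (2 * power_series (diffs jh_coeff) (t\<^sup>2) + 4 * t\<^sup>2 * power_series (diffs (diffs jh_coeff)) (t\<^sup>2)))) (at t)"
    unfolding Y0'_def[abs_def] by (intro DERIV_cmult DERIV_diff DERIV_add DERIV_mult ln d)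
  then show "(Y0' has_real_derivative Y0'' t) (at t)"
    by (rule DERIV_cong) (use t in \<open>simp add: Y0''_def field_simps power2_eq_square\<close>)
  have e1: "4 * t * (t\<^sup>2 * power_series (diffs (diffs jh_coeff)) (t\<^sup>2) + power_series (diffs jh_coeff) (t\<^sup>2) + power_series jh_coeff (t\<^sup>2) / 4) = 2 * J0' t"
    using jh_power_series_equation[of "t\<^sup>2"] by (simp add: jh_coeff_def[abs_def] J0'_def)
  let ?l = "ln (t / 2) + euler_mascheroni"
  have "t * Y0'' t + Y0' t + t * bessel_Y0 t = 2 / pi * (?l * (t * J0'' t + J0' t + t * bessel_J0 t) + 2 * J0' t
    - 4 * t * (t\<^sup>2 * power_series (diffs (diffs jh_coeff)) (t\<^sup>2) + power_series (diffs jh_coeff) (t\<^sup>2) + power_series jh_coeff (t\<^sup>2) / 4))"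
    unfolding Y0''_def Y0'_def bessel_Y0_power_series using t by (simp add: field_simps power2_eq_square)
  then show "t * Y0'' t + Y0' t + t * bessel_Y0 t = 0"
    by (simp only: e1 bessel_J0_equation(3)) simp
qed

lemma bessel_limits_at_0:
  "(bessel_J0 \<longlongrightarrow> 1) (at_right 0)"
  "((\<lambda>t. pi * bessel_Y0 t - 2 * (ln (t / 2) + euler_mascheroni)) \<longlongrightarrow> 0) (at_right 0)"
proof -
  have p0: "power_series c 0 = c 0" for c unfolding power_series_def by (rule powser_zero)
  have at0: "(f \<longlongrightarrow> f 0) (at_right 0)" if "(f has_real_derivative d) (at 0)" for f :: "real \<Rightarrow> real" and d
    using tendsto_mono[OF at_le[OF subset_UNIV] DERIV_isCont[OF that, unfolded isCont_def]] .
  have J0: "bessel_J0 0 = 1" by (simp add: bessel_J0_power_series p0 j_coeff_def)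
  show J: "(bessel_J0 \<longlongrightarrow> 1) (at_right 0)"
    using at0[OF bessel_J0_equation(1)] by (simp add: J0)
  have sum: "\<And>z. summable (\<lambda>n. jh_coeff n * z ^ n)" using j_series_summable(2) by (simp add: jh_coeff_def)
  have c: "((\<lambda>t. power_series jh_coeff (t\<^sup>2)) \<longlongrightarrow> 0) (at_right 0)"
    using at0[OF power_series_square_derivatives(1)[OF sum]] by (simp add: p0 jh_coeff_def[of 0] harm_expand)
  have "((\<lambda>t. (bessel_J0 (0 + t) - bessel_J0 0) / t) \<longlongrightarrow> J0' 0) (at_right 0)"
    using tendsto_mono[OF at_le[OF subset_UNIV] bessel_J0_equation(1)[of 0, unfolded DERIV_def]] .
  then have quot: "((\<lambda>t. (bessel_J0 t - 1) / t) \<longlongrightarrow> 0) (at_right 0)"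
    by (simp add: J0 J0'_def)
  have l: "((\<lambda>t. (ln (t / 2) + c) * t) \<longlongrightarrow> 0) (at_right 0)" for c :: real by real_asymp
  have "((\<lambda>t. 2 * (((ln (t / 2) + euler_mascheroni) * t) * ((bessel_J0 t - 1) / t) - power_series jh_coeff (t\<^sup>2))) \<longlongrightarrow> 2 * (0 * 0 - 0)) (at_right 0)"
    by (intro tendsto_intros l quot c)
  then have "((\<lambda>t. 2 * (((ln (t / 2) + euler_mascheroni) * t) * ((bessel_J0 t - 1) / t) - power_series jh_coeff (t\<^sup>2))) \<longlongrightarrow> 0) (at_right 0)" by simp
  then show "((\<lambda>t. pi * bessel_Y0 t - 2 * (ln (t / 2) + euler_mascheroni)) \<longlongrightarrow> 0) (at_right 0)"
  proof (rule Lim_transform_eventually)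
    show "\<forall>\<^sub>F t in at_right 0. 2 * (((ln (t / 2) + euler_mascheroni) * t) * ((bessel_J0 t - 1) / t) - power_series jh_coeff (t\<^sup>2)) = pi * bessel_Y0 t - 2 * (ln (t / 2) + euler_mascheroni)"
      unfolding eventually_at_right_field
    proof (intro exI[of _ 1] conjI allI impI)
      fix t :: real assume t: "0 < t"
      then have "(ln (t / 2) + euler_mascheroni) * t * ((bessel_J0 t - 1) / t) = (ln (t / 2) + euler_mascheroni) * (bessel_J0 t - 1)" by simp
      then show "2 * (((ln (t / 2) + euler_mascheroni) * t) * ((bessel_J0 t - 1) / t) - power_series jh_coeff (t\<^sup>2)) = pi * bessel_Y0 t - 2 * (ln (t / 2) + euler_mascheroni)"
        by (simp only: bessel_Y0_power_series) (simp add: algebra_simps)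
    qed simp
  qed
qed

section \<open>A spectral integral for the Hankel function\<close>

lemma dominated_convergence_within:
  fixes s :: "real \<Rightarrow> 'a \<Rightarrow> 'b::{banach, second_countable_topology}" and w :: "'a \<Rightarrow> real"
  assumes f: "f \<in> borel_measurable M" and s: "\<And>t. s t \<in> borel_measurable M" and w: "integrable M w"
    and lim: "AE x in M. ((\<lambda>t. s t x) \<longlongrightarrow> f x) (at a within S)"
    and bound: "\<forall>\<^sub>F t in at a within S. AE x in M. norm (s t x) \<le> w x"
  shows "((\<lambda>t. integral\<^sup>L M (s t)) \<longlongrightarrow> integral\<^sup>L M f) (at a within S)"
  unfolding tendsto_at_iff_sequentially comp_def
proof (intro allI impI)
  fix X :: "nat \<Rightarrow> real" assume X: "\<forall>i. X i \<in> S - {a}" "X \<longlonglongrightarrow> a"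
  have flt: "filterlim X (at a within S) sequentially"
    using X by (auto simp: filterlim_at)
  from filterlim_iff[THEN iffD1, OF flt, rule_format, OF bound]
  obtain N where w': "\<And>n. N \<le> n \<Longrightarrow> AE x in M. norm (s (X n) x) \<le> w x"
    by (auto simp: eventually_sequentially)
  show "(\<lambda>n. integral\<^sup>L M (s (X n))) \<longlonglongrightarrow> integral\<^sup>L M f"
  proof (rule LIMSEQ_offset, rule integral_dominated_convergence)
    show "AE x in M. norm (s (X (n + N)) x) \<le> w x" for n by (rule w') auto
    show "AE x in M. (\<lambda>n. s (X (n + N)) x) \<longlonglongrightarrow> f x"
      using lim
    proof eventually_elim
      fix x assume "((\<lambda>t. s t x) \<longlongrightarrow> f x) (at a within S)"
      from filterlim_compose[OF this flt] show "(\<lambda>n. s (X (n + N)) x) \<longlonglongrightarrow> f x"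
        by (rule LIMSEQ_ignore_initial_segment)
    qed
  qed (use f s w in auto)
qed

lemma derivative_under_integral:
  fixes f f' :: "real \<Rightarrow> real \<Rightarrow> real"
  assumes c: "c < t0"
    and der: "\<And>t x. c < t \<Longrightarrow> ((\<lambda>t. f t x) has_real_derivative f' t x) (at t)"
    and int: "\<And>t. c < t \<Longrightarrow> integrable lborel (f t)"
    and m: "\<And>t. f t \<in> borel_measurable borel" "f' t0 \<in> borel_measurable borel"
    and le: "\<And>t x. c < t \<Longrightarrow> \<bar>f' t x\<bar> \<le> g x" and g: "integrable lborel g"
  shows "((\<lambda>t. \<integral>x. f t x \<partial>lborel) has_real_derivative (\<integral>x. f' t0 x \<partial>lborel)) (at t0)"
  unfolding DERIV_def
proof -
  have ev: "\<forall>\<^sub>F h in at 0. c < t0 + h \<and> h \<noteq> 0"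
  proof -
    have "\<forall>\<^sub>F h in nhds 0. h \<in> {c - t0<..}" by (rule eventually_nhds_in_open) (use c in auto)
    then show ?thesis unfolding eventually_at_filter by eventually_elim auto
  qed
  have "((\<lambda>h. \<integral>x. (f (t0 + h) x - f t0 x) / h \<partial>lborel) \<longlongrightarrow> (\<integral>x. f' t0 x \<partial>lborel)) (at 0)"
  proof (rule dominated_convergence_within[where w = g])
    show "AE x in lborel. ((\<lambda>h. (f (t0 + h) x - f t0 x) / h) \<longlongrightarrow> f' t0 x) (at 0)"
      using der[OF c] by (auto simp: DERIV_def)
    show "\<forall>\<^sub>F h in at 0. AE x in lborel. norm ((f (t0 + h) x - f t0 x) / h) \<le> g x"
      using ev
    proof eventually_elim
      case (elim h)
      have "norm ((f (t0 + h) x - f t0 x) / h) \<le> g x" for x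
      proof -
        have "norm (f (t0 + h) x - f t0 x) \<le> g x * norm (t0 + h - t0)"
          by (rule field_differentiable_bound[of "{c<..}" "\<lambda>t. f t x" "\<lambda>t. f' t x"])
             (use elim c le der in \<open>auto intro: has_field_derivative_at_within\<close>)
        then show ?thesis using elim by (simp add: divide_le_eq)
      qed
      then show ?case by simp
    qed
  qed (use m g in auto)
  then show "((\<lambda>h. ((\<integral>x. f (t0 + h) x \<partial>lborel) - (\<integral>x. f t0 x \<partial>lborel)) / h) \<longlongrightarrow> (\<integral>x. f' t0 x \<partial>lborel)) (at 0)"
  proof (rule Lim_transform_eventually)
    show "\<forall>\<^sub>F h in at 0. (\<integral>x. (f (t0 + h) x - f t0 x) / h \<partial>lborel) = ((\<integral>x. f (t0 + h) x \<partial>lborel) - (\<integral>x. f t0 x \<partial>lborel)) / h"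
      using ev by eventually_elim (use int c in simp)
  qed
qed

abbreviation "unit_root \<equiv> \<lambda>\<xi>::real. SS (of_real \<xi>) 1"

definition hankel_kernel :: "real \<Rightarrow> real \<Rightarrow> complex" where
  "hankel_kernel t \<xi> = exp (- (of_real t * unit_root \<xi>)) / unit_root \<xi>"

lemma unit_root_cases:
  "\<bar>\<xi>\<bar> \<ge> 1 \<Longrightarrow> unit_root \<xi> = of_real (sqrt (\<xi>\<^sup>2 - 1))"
  "\<bar>\<xi>\<bar> < 1 \<Longrightarrow> unit_root \<xi> = - \<i> * of_real (sqrt (1 - \<xi>\<^sup>2))"
  by (simp_all add: SS_of_real)

lemma sq_cmp: "\<bar>\<xi>\<bar> \<ge> 1 \<Longrightarrow> (\<xi>::real)\<^sup>2 \<ge> 1" "\<bar>\<xi>\<bar> < 1 \<Longrightarrow> (\<xi>::real)\<^sup>2 < 1"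
  by (metis abs_le_square_iff abs_one one_power2, metis abs_one abs_square_less_1)

lemma unit_root_square: "(unit_root \<xi>)\<^sup>2 = of_real (\<xi>\<^sup>2 - 1)"
  using SS_power2[of 1 \<xi>] by simp

lemma norm_unit_root_le: "cmod (unit_root \<xi>) \<le> 1 + \<bar>\<xi>\<bar>"
proof -
  have "(cmod (unit_root \<xi>))\<^sup>2 = \<bar>\<xi>\<^sup>2 - 1\<bar>" by (simp add: unit_root_square flip: norm_power del: of_real_diff of_real_power)
  also have "\<dots> \<le> (1 + \<bar>\<xi>\<bar>)\<^sup>2" by (simp add: power2_eq_square algebra_simps abs_le_iff)
  finally show ?thesis by (rule power2_le_imp_le) simp
qed

lemma norm_exp_unit_root:
  assumes "0 \<le> c" "c \<le> t" shows "cmod (exp (- (of_real t * unit_root \<xi>))) \<le> exp c * exp (- (c * \<bar>\<xi>\<bar>))"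
proof (cases "\<bar>\<xi>\<bar> \<ge> 1")
  case True
  have "\<bar>\<xi>\<bar> - 1 \<le> sqrt (\<xi>\<^sup>2 - 1)"
    by (rule real_le_rsqrt) (use True in \<open>simp add: power2_eq_square algebra_simps flip: abs_mult\<close>)
  then have "c * (\<bar>\<xi>\<bar> - 1) \<le> t * sqrt (\<xi>\<^sup>2 - 1)" using assms True by (intro mult_mono) auto
  then have "exp (- (t * sqrt (\<xi>\<^sup>2 - 1))) \<le> exp c * exp (- (c * \<bar>\<xi>\<bar>))"
    by (simp add: algebra_simps flip: exp_add)
  then show ?thesis unfolding unit_root_cases(1)[OF True] by (simp add: norm_exp_eq_Re)
next
  case False
  then have "c * \<bar>\<xi>\<bar> \<le> c * 1" using assms by (intro mult_left_mono) auto
  then have "1 \<le> exp c * exp (- (c * \<bar>\<xi>\<bar>))" by (simp flip: exp_add)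
  moreover have "\<bar>\<xi>\<bar> < 1" using False by simp
  ultimately show ?thesis unfolding unit_root_cases(2)[OF \<open>\<bar>\<xi>\<bar> < 1\<close>] by simp
qed

lemma unit_root_measurable [measurable]: "unit_root \<in> borel_measurable borel" by simp

lemma hankel_kernel_measurable [measurable]: "hankel_kernel t \<in> borel_measurable borel"
  unfolding hankel_kernel_def by measurable

text \<open>
  Amplitude \<open>1\<close> is a branched amplitude without branching; with \<open>\<nu> = 1 / 2\<close> the saddle
  \<open>pi / 2\<close> used below is not a critical angle.
\<close>

lemma unit_amplitude: "branched_amplitude 1 \<phi> (1 / 2) 1 (\<lambda>_. 1) (\<lambda>_ _. 1) (\<lambda>_ _. 0) (\<lambda>_. 1)"
  if "0 < \<phi>" "\<phi> < pi" for \<phi>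
  by unfold_locales (use that in auto)

lemma hankel_kernel_eq: "hankel_kernel t = spectral_integrand 1 (pi / 2) (\<lambda>_. 1) t"
  by (auto simp: hankel_kernel_def spectral_integrand_def fun_eq_iff)

text \<open>
  The singularities at \<open>\<xi> = \<plusminus>1\<close> are the same for all \<open>t\<close>, so on a bounded set the kernel for \<open>t = 1\<close> serves as a
  majorant.
\<close>

lemma hankel_kernel_integrable:
  assumes t: "t > 0" shows "integrable lborel (hankel_kernel t)"
proof -
  have k1: "integrable lborel (hankel_kernel 1)"
    unfolding hankel_kernel_eq by (rule branched_amplitude.branched_integrable[OF unit_amplitude]) auto
  have "integrable lborel (\<lambda>\<xi>. exp 2 * cmod (hankel_kernel 1 \<xi>) + exp t * exp (- (t * \<bar>\<xi>\<bar>)))"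
    using k1 exp_abs_integrable[OF t] by auto
  then show ?thesis
  proof (rule Bochner_Integration.integrable_bound)
    show "AE \<xi> in lborel. norm (hankel_kernel t \<xi>) \<le> norm (exp 2 * cmod (hankel_kernel 1 \<xi>) + exp t * exp (- (t * \<bar>\<xi>\<bar>)))"
    proof (rule AE_I2)
      fix \<xi> :: real
      have "cmod (hankel_kernel t \<xi>) \<le> exp 2 * cmod (hankel_kernel 1 \<xi>) + exp t * exp (- (t * \<bar>\<xi>\<bar>))"
      proof (cases "\<bar>\<xi>\<bar> \<le> 2")
        case True
        have re: "0 \<le> Re (unit_root \<xi>)" "Re (unit_root \<xi>) \<le> 2"
        proof (atomize(full), cases "\<bar>\<xi>\<bar> \<ge> 1")
          case 1: True
          have "\<xi>\<^sup>2 \<le> 2\<^sup>2" using True by (metis abs_le_square_iff abs_numeral)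
          then have "sqrt (\<xi>\<^sup>2 - 1) \<le> 2" by (intro real_le_lsqrt) auto
          then show "0 \<le> Re (unit_root \<xi>) \<and> Re (unit_root \<xi>) \<le> 2" unfolding unit_root_cases(1)[OF 1] using sq_cmp(1)[OF 1] by simp
        next
          case False
          then show "0 \<le> Re (unit_root \<xi>) \<and> Re (unit_root \<xi>) \<le> 2" by (simp add: unit_root_cases)
        qed
        have "cmod (exp (- (of_real t * unit_root \<xi>))) \<le> 1" using re t by simp
        also have "1 \<le> exp 2 * cmod (exp (- (of_real 1 * unit_root \<xi>)))" using re by (simp flip: exp_add)
        finally have "cmod (hankel_kernel t \<xi>) \<le> exp 2 * cmod (hankel_kernel 1 \<xi>)"
          unfolding hankel_kernel_def norm_divide by (simp add: divide_right_mono)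
        then show ?thesis by (simp add: add_increasing2)
      next
        case False
        then have x: "\<bar>\<xi>\<bar> \<ge> 1" by simp
        have "2\<^sup>2 \<le> \<xi>\<^sup>2" using False by (metis abs_le_square_iff abs_numeral linear)
        then have "1 \<le> sqrt (\<xi>\<^sup>2 - 1)" by simp
        then have S1: "1 \<le> cmod (unit_root \<xi>)" unfolding unit_root_cases(1)[OF x] by simp
        have "cmod (hankel_kernel t \<xi>) \<le> cmod (exp (- (of_real t * unit_root \<xi>))) / 1"
          unfolding hankel_kernel_def norm_divide using S1 by (intro divide_left_mono) auto
        also have "\<dots> \<le> exp t * exp (- (t * \<bar>\<xi>\<bar>))" using norm_exp_unit_root[of t t] t by simp
        finally show ?thesis by (simp add: add_increasing)
      qed
      also have "\<dots> \<le> norm (exp 2 * cmod (hankel_kernel 1 \<xi>) + exp t * exp (- (t * \<bar>\<xi>\<bar>)))" by simp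
      finally show "norm (hankel_kernel t \<xi>) \<le> norm (exp 2 * cmod (hankel_kernel 1 \<xi>) + exp t * exp (- (t * \<bar>\<xi>\<bar>)))" .
    qed
  qed measurable
qed

definition moment_integrand :: "nat \<Rightarrow> real \<Rightarrow> real \<Rightarrow> complex" where
  "moment_integrand j t \<xi> = (- unit_root \<xi>) ^ j * hankel_kernel t \<xi>"

lemma moment_integrand_measurable [measurable]: "moment_integrand j t \<in> borel_measurable borel"
  unfolding moment_integrand_def by measurable

lemma moment_integrand_bound:
  assumes c: "0 < c" "c \<le> t" and j: "j = 1 \<or> j = 2"
  shows "cmod (moment_integrand j t \<xi>) \<le> exp c * (2 + 2 / c) * exp (- (c / 2 * \<bar>\<xi>\<bar>))"
proof -
  let ?e = "cmod (exp (- (of_real t * unit_root \<xi>)))"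
  have "cmod (moment_integrand j t \<xi>) \<le> (1 + \<bar>\<xi>\<bar>) * ?e"
    using j
  proof
    assume "j = 1"
    then have "cmod (moment_integrand j t \<xi>) \<le> 1 * ?e" by (simp add: moment_integrand_def hankel_kernel_def norm_mult norm_divide)
    also have "\<dots> \<le> (1 + \<bar>\<xi>\<bar>) * ?e" by (intro mult_right_mono) auto
    finally show ?thesis .
  next
    assume "j = 2"
    then have "cmod (moment_integrand j t \<xi>) = cmod (unit_root \<xi>) * ?e"
      by (simp add: moment_integrand_def hankel_kernel_def norm_mult norm_divide power2_eq_square)
    also have "\<dots> \<le> (1 + \<bar>\<xi>\<bar>) * ?e" by (intro mult_right_mono norm_unit_root_le) auto
    finally show ?thesis .
  qed
  also have "\<dots> \<le> (1 + \<bar>\<xi>\<bar>) * (exp c * exp (- (c * \<bar>\<xi>\<bar>)))"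
    using c by (intro mult_left_mono norm_exp_unit_root) auto
  also have "\<dots> \<le> ((2 + 2 / c) * exp (c / 2 * \<bar>\<xi>\<bar>)) * (exp c * exp (- (c * \<bar>\<xi>\<bar>)))"
  proof (intro mult_right_mono)
    have e: "1 \<le> exp (c / 2 * \<bar>\<xi>\<bar>)" "c / 2 * \<bar>\<xi>\<bar> \<le> exp (c / 2 * \<bar>\<xi>\<bar>)"
      using c exp_ge_add_one_self[of "c / 2 * \<bar>\<xi>\<bar>"] by (simp, linarith)
    have "1 + \<bar>\<xi>\<bar> = 1 * 1 + 2 / c * (c / 2 * \<bar>\<xi>\<bar>)" using c by simp
    also have "\<dots> \<le> 2 * exp (c / 2 * \<bar>\<xi>\<bar>) + 2 / c * exp (c / 2 * \<bar>\<xi>\<bar>)"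
      using c e by (intro add_mono mult_mono mult_left_mono) auto
    finally show "1 + \<bar>\<xi>\<bar> \<le> (2 + 2 / c) * exp (c / 2 * \<bar>\<xi>\<bar>)" by (simp add: distrib_right)
  qed auto
  also have "\<dots> = exp c * (2 + 2 / c) * exp (- (c / 2 * \<bar>\<xi>\<bar>))"
    by (simp add: mult_ac flip: exp_add)
  finally show ?thesis .
qed

lemma moment_integrand_integrable:
  assumes "t > 0" "j \<le> 2" shows "integrable lborel (moment_integrand j t)"
proof (cases "j = 0")
  case True
  then show ?thesis using hankel_kernel_integrable[OF assms(1)] by (simp add: moment_integrand_def[abs_def])
next
  case False
  then have j: "j = 1 \<or> j = 2" using assms by auto
  have g: "integrable lborel (\<lambda>\<xi>::real. exp t * (2 + 2 / t) * exp (- (t / 2 * \<bar>\<xi>\<bar>)))"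
    using assms by (intro integrable_mult_right exp_abs_integrable) auto
  show ?thesis
  proof (rule Bochner_Integration.integrable_bound[OF g])
    show "AE \<xi> in lborel. norm (moment_integrand j t \<xi>) \<le> norm (exp t * (2 + 2 / t) * exp (- (t / 2 * \<bar>\<xi>\<bar>)))"
      by (rule AE_I2, rule order.trans[OF moment_integrand_bound[OF assms(1) order.refl j]])
         (simp only: real_norm_def abs_ge_self)
  qed measurable
qed

text \<open>
  \<open>hankel_moment 0\<close> is the spectral integral; the moments of order \<open>1\<close> and \<open>2\<close> are its derivatives.
\<close>

definition hankel_moment :: "nat \<Rightarrow> real \<Rightarrow> complex" where "hankel_moment j t = (\<integral>\<xi>. moment_integrand j t \<xi> \<partial>lborel)"

lemma hankel_moment_derivative:
  assumes t: "t0 > 0" and j: "j \<le> 1"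
  shows "((\<lambda>t. Re (hankel_moment j t)) has_real_derivative Re (hankel_moment (Suc j) t0)) (at t0)"
    "((\<lambda>t. Im (hankel_moment j t)) has_real_derivative Im (hankel_moment (Suc j) t0)) (at t0)"
proof -
  have der: "((\<lambda>t. moment_integrand j t \<xi>) has_vector_derivative moment_integrand (Suc j) t \<xi>) (at t)" for t \<xi>
  proof -
    have "((\<lambda>z. (- unit_root \<xi>) ^ j * (exp (- (z * unit_root \<xi>)) / unit_root \<xi>)) has_field_derivative (- unit_root \<xi>) ^ Suc j * (exp (- (z * unit_root \<xi>)) / unit_root \<xi>)) (at z)" for z
      by (auto intro!: derivative_eq_intros simp: divide_simps)
    from has_vector_derivative_real_field[OF this] show ?thesis
      by (simp add: moment_integrand_def hankel_kernel_def)
  qed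
  let ?c = "t0 / 2"
  let ?g = "\<lambda>\<xi>::real. exp ?c * (2 + 2 / ?c) * exp (- (?c / 2 * \<bar>\<xi>\<bar>))"
  have g: "integrable lborel ?g" using t by (intro integrable_mult_right exp_abs_integrable) auto
  have b: "cmod (moment_integrand (Suc j) s \<xi>) \<le> ?g \<xi>" if "?c < s" for s \<xi>
    using that t j by (intro moment_integrand_bound) auto
  have int: "integrable lborel (moment_integrand j s)" if "?c < s" for s
    using that t j by (intro moment_integrand_integrable) auto
  have c: "?c < t0" using t by simp
  have Re: "((\<lambda>t. \<integral>\<xi>. Re (moment_integrand j t \<xi>) \<partial>lborel) has_real_derivative (\<integral>\<xi>. Re (moment_integrand (Suc j) t0 \<xi>) \<partial>lborel)) (at t0)"
  proof (rule derivative_under_integral[OF c _ _ _ _ _ g])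
    show "((\<lambda>t. Re (moment_integrand j t \<xi>)) has_real_derivative Re (moment_integrand (Suc j) t \<xi>)) (at t)" for t \<xi>
      using bounded_linear.has_vector_derivative[OF bounded_linear_Re der]
      by (simp add: has_real_derivative_iff_has_vector_derivative)
    show "\<bar>Re (moment_integrand (Suc j) s \<xi>)\<bar> \<le> ?g \<xi>" if "?c < s" for s \<xi>
      using abs_Re_le_cmod b[OF that] order.trans by blast
  qed (use int in auto)
  have Im: "((\<lambda>t. \<integral>\<xi>. Im (moment_integrand j t \<xi>) \<partial>lborel) has_real_derivative (\<integral>\<xi>. Im (moment_integrand (Suc j) t0 \<xi>) \<partial>lborel)) (at t0)"
  proof (rule derivative_under_integral[OF c _ _ _ _ _ g])
    show "((\<lambda>t. Im (moment_integrand j t \<xi>)) has_real_derivative Im (moment_integrand (Suc j) t \<xi>)) (at t)" for t \<xi>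
      using bounded_linear.has_vector_derivative[OF bounded_linear_Im der]
      by (simp add: has_real_derivative_iff_has_vector_derivative)
    show "\<bar>Im (moment_integrand (Suc j) s \<xi>)\<bar> \<le> ?g \<xi>" if "?c < s" for s \<xi>
      using abs_Im_le_cmod b[OF that] order.trans by blast
  qed (use int in auto)
  have ReW: "Re (hankel_moment i s) = (\<integral>\<xi>. Re (moment_integrand i s \<xi>) \<partial>lborel)" "Im (hankel_moment i s) = (\<integral>\<xi>. Im (moment_integrand i s \<xi>) \<partial>lborel)"
    if "s > 0" "i \<le> 2" for i s
    using moment_integrand_integrable[OF that] by (simp_all add: hankel_moment_def)
  have ev: "\<forall>\<^sub>F s in nhds t0. s > 0" using t by (intro eventually_nhds_in_open[of "{0<..}", simplified]) auto
  show "((\<lambda>t. Re (hankel_moment j t)) has_real_derivative Re (hankel_moment (Suc j) t0)) (at t0)"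
    using Re ReW(1)[OF t, of "Suc j"] j
    by (subst DERIV_cong_ev[OF refl _ refl]) (use ev ReW(1)[of _ j] j in \<open>auto elim!: eventually_mono\<close>)
  show "((\<lambda>t. Im (hankel_moment j t)) has_real_derivative Im (hankel_moment (Suc j) t0)) (at t0)"
    using Im ReW(2)[OF t, of "Suc j"] j
    by (subst DERIV_cong_ev[OF refl _ refl]) (use ev ReW(2)[of _ j] j in \<open>auto elim!: eventually_mono\<close>)
qed

lemma unit_root_derivative:
  assumes "\<bar>\<xi>\<bar> \<noteq> 1"
  shows "(unit_root has_vector_derivative of_real \<xi> / unit_root \<xi>) (at \<xi>)"
proof (cases "\<bar>\<xi>\<bar> > 1")
  case True
  then have p: "\<xi>\<^sup>2 - 1 > 0" by (metis abs_one abs_le_square_iff diff_gt_0_iff_gt not_le one_power2)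
  have "((\<lambda>x. sqrt (x\<^sup>2 - 1)) has_real_derivative \<xi> / sqrt (\<xi>\<^sup>2 - 1)) (at \<xi>)"
    using p by (auto intro!: derivative_eq_intros simp: field_simps)
  from has_vector_derivative_of_real[OF this]
  have d: "((\<lambda>x. complex_of_real (sqrt (x\<^sup>2 - 1))) has_vector_derivative of_real (\<xi> / sqrt (\<xi>\<^sup>2 - 1))) (at \<xi>)" .
  have op: "open {x::real. 1 < \<bar>x\<bar>}" by (intro open_Collect_less continuous_intros)
  have "(unit_root has_vector_derivative of_real (\<xi> / sqrt (\<xi>\<^sup>2 - 1))) (at \<xi>)"
    by (rule has_vector_derivative_transform_within_open[OF d op]) (use True unit_root_cases(1) in auto)
  then show ?thesis using True by (simp add: unit_root_cases(1))
next
  case False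
  then have l: "\<bar>\<xi>\<bar> < 1" using assms by simp
  then have p: "1 - \<xi>\<^sup>2 > 0" using sq_cmp(2) by simp
  have "((\<lambda>x. sqrt (1 - x\<^sup>2)) has_real_derivative - \<xi> / sqrt (1 - \<xi>\<^sup>2)) (at \<xi>)"
    using p by (auto intro!: derivative_eq_intros simp: field_simps)
  from has_vector_derivative_mult_right[OF has_vector_derivative_of_real[OF this], of "- \<i>"]
  have d: "((\<lambda>x. - \<i> * complex_of_real (sqrt (1 - x\<^sup>2))) has_vector_derivative - \<i> * of_real (- \<xi> / sqrt (1 - \<xi>\<^sup>2))) (at \<xi>)" .
  have op: "open {x::real. \<bar>x\<bar> < 1}" by (intro open_Collect_less continuous_intros)
  have "(unit_root has_vector_derivative - \<i> * of_real (- \<xi> / sqrt (1 - \<xi>\<^sup>2))) (at \<xi>)"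
    by (rule has_vector_derivative_transform_within_open[OF d op]) (use l unit_root_cases(2) in auto)
  moreover have "- \<i> * of_real (- \<xi> / sqrt (1 - \<xi>\<^sup>2)) = of_real \<xi> / unit_root \<xi>"
    unfolding unit_root_cases(2)[OF l] using p by (simp add: field_simps)
  ultimately show ?thesis by simp
qed

lemma unit_root_continuous: "continuous_on A unit_root"
proof -
  have eq: "unit_root \<xi> = of_real (sqrt (max (\<xi>\<^sup>2 - 1) 0)) - \<i> * of_real (sqrt (max (1 - \<xi>\<^sup>2) 0))" for \<xi>
  proof -
    show "unit_root \<xi> = of_real (sqrt (max (\<xi>\<^sup>2 - 1) 0)) - \<i> * of_real (sqrt (max (1 - \<xi>\<^sup>2) 0))"
    proof (cases "\<bar>\<xi>\<bar> \<ge> 1")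
      case True
      then show ?thesis using sq_cmp(1)[OF True] by (simp add: unit_root_cases(1) max_def)
    next
      case False
      then show ?thesis using sq_cmp(2)[of \<xi>] by (simp add: unit_root_cases(2) max_def)
    qed
  qed
  have "continuous_on A (\<lambda>\<xi>. of_real (sqrt (max (\<xi>\<^sup>2 - 1) 0)) - \<i> * complex_of_real (sqrt (max (1 - \<xi>\<^sup>2) 0)))"
    by (intro continuous_intros)
  then show ?thesis by (subst continuous_on_cong[OF refl eq])
qed

text \<open>
  Inserting the moments into Bessel's equation gives an integrand that is the exact derivative of
  \<open>- \<xi> * exp (- t * unit_root \<xi>)\<close>, which vanishes at both ends of the line.
\<close>

lemma hankel_moment_equation:
  assumes t: "t > 0"
  shows "of_real t * hankel_moment 2 t + hankel_moment 1 t + of_real t * hankel_moment 0 t = 0"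
proof -
  let ?f = "\<lambda>\<xi>. of_real t * moment_integrand 2 t \<xi> + moment_integrand 1 t \<xi> + of_real t * moment_integrand 0 t \<xi>"
  define G where "G \<xi> = - (of_real \<xi> * exp (- (of_real t * unit_root \<xi>)))" for \<xi>
  have int: "integrable lborel ?f"
    by (intro Bochner_Integration.integrable_add integrable_mult_right moment_integrand_integrable t) auto
  have hankel_moment: "of_real t * hankel_moment 2 t + hankel_moment 1 t + of_real t * hankel_moment 0 t = (\<integral>\<xi>. ?f \<xi> \<partial>lborel)"
    using moment_integrand_integrable[OF t, of 2] moment_integrand_integrable[OF t, of 1] moment_integrand_integrable[OF t, of 0]
    by (simp add: hankel_moment_def)
  have f_alt: "?f \<xi> = hankel_kernel t \<xi> * (of_real t * of_real (\<xi>\<^sup>2) - unit_root \<xi>)" for \<xi>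
  proof -
    have "?f \<xi> = hankel_kernel t \<xi> * (of_real t * (unit_root \<xi>)\<^sup>2 - unit_root \<xi> + of_real t)"
      by (simp add: moment_integrand_def algebra_simps)
    then show ?thesis by (simp add: unit_root_square algebra_simps)
  qed
  have piece: "(\<integral>\<xi>. indicator {- real n..real n} \<xi> *\<^sub>R ?f \<xi> \<partial>lborel) = G n - G (- real n)" for n
  proof -
    have "(?f has_integral (G n - G (- real n))) {- real n..real n}"
    proof (rule fundamental_theorem_of_calculus_interior_strong[of "{-1, 1}"])
      show "continuous_on {- real n..real n} G"
        unfolding G_def by (intro continuous_intros unit_root_continuous)
      fix \<xi> assume "\<xi> \<in> {- real n<..<real n} - {- 1, 1}"
      then have x: "\<bar>\<xi>\<bar> \<noteq> 1" by auto
      then have "\<xi>\<^sup>2 - 1 \<noteq> 0" by (auto simp: power2_eq_1_iff)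
      then have S0: "unit_root \<xi> \<noteq> 0" using unit_root_square[of \<xi>] by (auto simp del: of_real_diff of_real_power)
      have e: "((\<lambda>z. exp (- (of_real t * z))) has_field_derivative - (of_real t) * exp (- (of_real t * z))) (at z)" for z :: complex
        by (auto intro!: derivative_eq_intros)
      have "((\<lambda>x. exp (- (of_real t * unit_root x))) has_vector_derivative of_real \<xi> / unit_root \<xi> * (- (of_real t) * exp (- (of_real t * unit_root \<xi>)))) (at \<xi>)"
        using field_vector_diff_chain_at[OF unit_root_derivative[OF x] e] by (simp add: o_def)
      from has_vector_derivative_minus[OF has_vector_derivative_mult[OF has_vector_derivative_of_real[OF DERIV_ident] this]]
      have "(G has_vector_derivative - (of_real \<xi> * (of_real \<xi> / unit_root \<xi> * (- (of_real t) * exp (- (of_real t * unit_root \<xi>)))) + of_real 1 * exp (- (of_real t * unit_root \<xi>)))) (at \<xi>)"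
        by (simp add: G_def[abs_def])
      moreover have "- (of_real \<xi> * (of_real \<xi> / unit_root \<xi> * (- (of_real t) * exp (- (of_real t * unit_root \<xi>)))) + of_real 1 * exp (- (of_real t * unit_root \<xi>))) = ?f \<xi>"
        unfolding f_alt hankel_kernel_def using S0 by (simp add: field_simps power2_eq_square)
      ultimately show "(G has_vector_derivative ?f \<xi>) (at \<xi>)" by simp
    qed auto
    moreover have "set_integrable lborel {- real n..real n} ?f"
      unfolding set_integrable_def by (intro integrable_mult_indicator int) simp
    ultimately show ?thesis
      using set_borel_integral_eq_integral(2)[of "{- real n..real n}" ?f]
      by (simp add: has_integral_iff set_lebesgue_integral_def)
  qed
  have l1: "(\<lambda>n. \<integral>\<xi>. indicator {- real n..real n} \<xi> *\<^sub>R ?f \<xi> \<partial>lborel) \<longlonglongrightarrow> (\<integral>\<xi>. ?f \<xi> \<partial>lborel)"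
  proof (rule integral_dominated_convergence[where w = "\<lambda>\<xi>. norm (?f \<xi>)"])
    show "AE \<xi> in lborel. (\<lambda>n. indicator {- real n..real n} \<xi> *\<^sub>R ?f \<xi>) \<longlonglongrightarrow> ?f \<xi>"
    proof (rule AE_I2)
      fix \<xi> :: real
      obtain N where N: "\<bar>\<xi>\<bar> \<le> real N" using real_arch_simple by blast
      have "\<forall>\<^sub>F n in sequentially. indicator {- real n..real n} \<xi> *\<^sub>R ?f \<xi> = ?f \<xi>"
        using eventually_ge_at_top[of N] by eventually_elim (use N in \<open>auto simp: indicator_def\<close>)
      then show "(\<lambda>n. indicator {- real n..real n} \<xi> *\<^sub>R ?f \<xi>) \<longlonglongrightarrow> ?f \<xi>" by (rule tendsto_eventually)
    qed
  qed (use int in \<open>auto simp: indicator_def\<close>)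
  have l2: "(\<lambda>n. G (real n) - G (- real n)) \<longlonglongrightarrow> 0"
  proof (rule Lim_null_comparison)
    have le: "cmod (G \<xi>) \<le> \<bar>\<xi>\<bar> * (exp t * exp (- (t * \<bar>\<xi>\<bar>)))" for \<xi>
      unfolding G_def norm_minus_cancel norm_mult using norm_exp_unit_root[of t t \<xi>] t by (simp add: mult_left_mono)
    have "norm (G (real n) - G (- real n)) \<le> 2 * (real n * (exp t * exp (- (t * real n))))" for n
      using norm_triangle_ineq4[of "G (real n)" "G (- real n)"] le[of "real n"] le[of "- real n"]
      unfolding abs_minus_cancel abs_of_nat by linarith
    then show "\<forall>\<^sub>F n in sequentially. norm (G (real n) - G (- real n)) \<le> 2 * (real n * (exp t * exp (- (t * real n))))"
      by (rule always_eventually[OF allI])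
    show "(\<lambda>n. 2 * (real n * (exp t * exp (- (t * real n))))) \<longlonglongrightarrow> 0" using t by real_asymp
  qed
  show ?thesis unfolding hankel_moment using LIMSEQ_unique[OF l1[unfolded piece] l2] .
qed

lemma exp_diff_le:
  fixes x y :: real assumes "0 \<le> x" "x \<le> y" shows "exp (- x) - exp (- y) \<le> y - x"
proof -
  have "exp (- x) - exp (- y) = exp (- x) * (1 - exp (- (y - x)))" by (simp add: algebra_simps flip: exp_add)
  also have "\<dots> \<le> 1 * (1 - exp (- (y - x)))" using assms by (intro mult_right_mono) auto
  also have "\<dots> \<le> y - x"
  proof -
    have "1 - exp (- d) \<le> d" for d :: real using exp_ge_add_one_self[of "- d"] by linarith
    then show ?thesis by (simp only: mult_1)
  qed
  finally show ?thesis .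
qed

lemma square_gt_one:
  fixes x :: real assumes "x > 1" shows "x\<^sup>2 - 1 > 0" "x\<^sup>2 \<noteq> 1" "\<not> x\<^sup>2 < 1"
proof -
  have g: "1 < x\<^sup>2" using assms by (intro one_less_power) auto
  show "x\<^sup>2 - 1 > 0" using g by linarith
  show "x\<^sup>2 \<noteq> 1" using g by (rule less_imp_neq[symmetric])
  show "\<not> x\<^sup>2 < 1" using g by linarith
qed

text \<open>
  The integrand of the classical representation of \<open>- euler_mascheroni\<close>: \<open>exp (- v) / v\<close> on \<open>v > 0\<close> with
  its logarithmic divergence at \<open>0\<close> removed.
\<close>

definition gamma_kernel :: "real \<Rightarrow> real" where
  "gamma_kernel v = indicator {0<..} v * ((exp (- v) - indicator {..<1} v) / v)"

lemma gamma_kernel_measurable [measurable]: "gamma_kernel \<in> borel_measurable borel"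
  unfolding gamma_kernel_def by measurable

lemma gamma_kernel_bound:
  assumes "0 \<le> c" "c \<le> 1"
  shows "\<bar>v\<bar> powr c * \<bar>gamma_kernel v\<bar> \<le> exp 1 * exp (- (1 * \<bar>v\<bar>))"
proof (cases "v > 0")
  case v: True
  show ?thesis
  proof (cases "v < 1")
    case True
    have "1 - exp (- v) \<le> v" using exp_ge_add_one_self[of "- v"] by simp
    then have "\<bar>gamma_kernel v\<bar> \<le> 1" using v True by (simp add: gamma_kernel_def abs_divide divide_le_eq)
    moreover have "\<bar>v\<bar> powr c \<le> 1" using v True assms by (simp add: powr_le1)
    ultimately have "\<bar>v\<bar> powr c * \<bar>gamma_kernel v\<bar> \<le> 1 * 1" by (intro mult_mono) auto
    also have "\<dots> \<le> exp 1 * exp (- (1 * \<bar>v\<bar>))" using v True by (simp flip: exp_add)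
    finally show ?thesis .
  next
    case False
    then have "\<bar>v\<bar> powr c \<le> v" using assms v powr_mono[of c 1 v] by simp
    then have "\<bar>v\<bar> powr c * \<bar>gamma_kernel v\<bar> \<le> v * (exp (- v) / v)"
      using v False by (intro mult_mono) (auto simp: gamma_kernel_def)
    also have "\<dots> = 1 * exp (- v)" using v by simp
    also have "\<dots> \<le> exp 1 * exp (- (1 * \<bar>v\<bar>))" using v by (intro mult_mono) auto
    finally show ?thesis .
  qed
qed (simp add: gamma_kernel_def)

lemma gamma_dominating: "integrable lborel (\<lambda>v::real. exp 1 * exp (- (1 * \<bar>v\<bar>)))"
  by (intro integrable_mult_right exp_abs_integrable) auto

text \<open>
  With the weight \<open>v powr e\<close> the two parts can be integrated separately, to
  \<open>Gamma e - 1 / e = (Gamma (1 + e) - Gamma 1) / e\<close>; as \<open>e\<close> tends to \<open>0\<close> this is the derivative of the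
  Gamma function at \<open>1\<close>.
\<close>

lemma gamma_kernel_integral: "(\<integral>v. gamma_kernel v \<partial>lborel) = - euler_mascheroni"
proof -
  let ?s = "\<lambda>e v. \<bar>v\<bar> powr e * gamma_kernel v"
  have I: "(\<integral>v. ?s e v \<partial>lborel) = (Gamma (1 + e) - Gamma 1) / e" if e: "0 < e" "e < 1" for e :: real
  proof -
    have "((\<lambda>t. t powr (e - 1) / exp t) has_integral Gamma e) {0..}" using e by (intro Gamma_integral_real)
    moreover have "((\<lambda>t. if t \<in> {0..1} then t powr (e - 1) else 0) has_integral (1 powr (e - 1 + 1) / (e - 1 + 1))) {0..}"
      by (subst has_integral_restrict) (use e has_integral_powr_from_0[of "e - 1" 1] in auto)
    ultimately have "((\<lambda>t. t powr (e - 1) / exp t - (if t \<in> {0..1} then t powr (e - 1) else 0)) has_integral (Gamma e - 1 powr (e - 1 + 1) / (e - 1 + 1))) {0..}"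
      by (rule has_integral_diff)
    then have "(?s e has_integral (Gamma e - 1 powr (e - 1 + 1) / (e - 1 + 1))) {0..}"
    proof (rule has_integral_spike_finite[of "{0, 1}", rotated 2])
      fix t assume "t \<in> {0..} - {0, 1 :: real}"
      then have t: "t > 0" "t \<noteq> 1" by auto
      have "t powr e = t powr (e - 1) * t" using t by (simp add: powr_diff)
      then show "?s e t = t powr (e - 1) / exp t - (if t \<in> {0..1} then t powr (e - 1) else 0)"
        using t by (simp add: gamma_kernel_def exp_minus field_simps indicator_def)
    qed auto
    then have "(?s e has_integral (Gamma e - 1 / e)) {0..}" by simp
    then have h: "(?s e has_integral (Gamma e - 1 / e)) UNIV"
      by (rule has_integral_on_superset) (auto simp: gamma_kernel_def)
    have "integrable lborel (?s e)"
    proof (rule Bochner_Integration.integrable_bound[OF gamma_dominating])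
      show "AE v in lborel. norm (?s e v) \<le> norm (exp 1 * exp (- (1 * \<bar>v\<bar>)))"
        using gamma_kernel_bound[of e] e by (auto simp: abs_mult)
    qed measurable
    then have "(\<integral>v. ?s e v \<partial>lborel) = Gamma e - 1 / e"
      using has_integral_integral_lborel h has_integral_unique by blast
    also have "Gamma e = Gamma (1 + e) / e"
    proof -
      have "e \<notin> \<int>\<^sub>\<le>\<^sub>0" using e by (auto elim!: nonpos_Ints_cases)
      from Gamma_plus1[OF this] show ?thesis using e by (simp add: add.commute)
    qed
    finally show ?thesis by (simp add: diff_divide_distrib Gamma_1)
  qed
  have "((\<lambda>e. (Gamma (1 + e) - Gamma 1) / e) \<longlongrightarrow> Gamma 1 * Digamma 1) (at (0::real))"
    using has_field_derivative_Gamma[of "1::real" UNIV] by (simp add: DERIV_def)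
  then have l1: "((\<lambda>e. (Gamma (1 + e) - Gamma 1) / e) \<longlongrightarrow> - euler_mascheroni) (at_right (0::real))"
    by (intro tendsto_mono[OF at_le[of "{0<..}" UNIV 0]]) auto
  have "((\<lambda>e. \<integral>v. ?s e v \<partial>lborel) \<longlongrightarrow> (\<integral>v. gamma_kernel v \<partial>lborel)) (at_right 0)"
  proof (rule dominated_convergence_within[OF _ _ gamma_dominating])
    show "AE v in lborel. ((\<lambda>e. ?s e v) \<longlongrightarrow> gamma_kernel v) (at_right 0)"
    proof (rule AE_I2)
      fix v :: real
      show "((\<lambda>e. ?s e v) \<longlongrightarrow> gamma_kernel v) (at_right 0)"
      proof (cases "v > 0")
        case True
        have "((\<lambda>e. \<bar>v\<bar> powr e * gamma_kernel v) \<longlongrightarrow> \<bar>v\<bar> powr 0 * gamma_kernel v) (at_right 0)"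
          using True by (intro tendsto_intros) auto
        then show ?thesis using True by simp
      qed (simp add: gamma_kernel_def)
    qed
    show "\<forall>\<^sub>F e in at_right 0. AE v in lborel. norm (?s e v) \<le> exp 1 * exp (- (1 * \<bar>v\<bar>))"
      unfolding eventually_at_right_field
      by (intro exI[of _ 1]) (use gamma_kernel_bound in \<open>auto simp: abs_mult\<close>)
  qed auto
  then have l2: "((\<lambda>e. (Gamma (1 + e) - Gamma 1) / e) \<longlongrightarrow> (\<integral>v. gamma_kernel v \<partial>lborel)) (at_right (0::real))"
  proof (rule Lim_transform_eventually)
    show "\<forall>\<^sub>F e in at_right 0. (\<integral>v. ?s e v \<partial>lborel) = (Gamma (1 + e) - Gamma 1) / e"
      unfolding eventually_at_right_field by (intro exI[of _ 1]) (use I in auto)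
  qed
  show ?thesis using tendsto_unique[OF _ l2 l1] by simp
qed

lemma exponential_integral_limit:
  "((\<lambda>t. (\<integral>\<xi>. indicator {1<..} \<xi> * (exp (- (t * \<xi>)) / \<xi>) \<partial>lborel) + ln t) \<longlongrightarrow> - (euler_mascheroni :: real)) (at_right 0)"
proof -
  let ?s = "\<lambda>t v. indicator {t<..} v * gamma_kernel v"
  have I: "(\<integral>v. ?s t v \<partial>lborel) = (\<integral>\<xi>. indicator {1<..} \<xi> * (exp (- (t * \<xi>)) / \<xi>) \<partial>lborel) + ln t" if t: "0 < t" "t < 1" for t
  proof -
    let ?e = "\<lambda>v::real. indicator {t<..} v * (exp (- v) / v)" and ?l = "\<lambda>v::real. indicator {t..1} v *\<^sub>R (1 / v)"
    have ei: "integrable lborel ?e"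
    proof (rule Bochner_Integration.integrable_bound)
      show "integrable lborel (\<lambda>v::real. 1 / t * exp (- (1 * \<bar>v\<bar>)))"
        by (intro integrable_mult_right exp_abs_integrable) auto
      show "AE v in lborel. norm (?e v) \<le> norm (1 / t * exp (- (1 * \<bar>v\<bar>)))"
        using t by (intro AE_I2) (auto simp: indicator_def abs_mult frac_le)
    qed measurable
    have "((\<lambda>v. 1 / v) has_integral (ln 1 - ln t)) {t..1}"
      by (rule fundamental_theorem_of_calculus)
         (use t in \<open>auto intro!: derivative_eq_intros simp flip: has_real_derivative_iff_has_vector_derivative\<close>)
    moreover have li: "set_integrable lborel {t..1} (\<lambda>v. 1 / v)"
      using t by (intro borel_integrable_atLeastAtMost' continuous_intros) auto
    ultimately have l: "(\<integral>v. ?l v \<partial>lborel) = - ln t" "integrable lborel ?l"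
      using set_borel_integral_eq_integral(2)[OF li] by (auto simp: has_integral_iff set_lebesgue_integral_def set_integrable_def)
    have "(\<integral>v. ?s t v \<partial>lborel) = (\<integral>v. ?e v - ?l v \<partial>lborel)"
    proof (rule integral_cong_AE)
      have "AE v in lborel. v \<noteq> t \<and> v \<noteq> (1::real)" using AE_lborel_singleton[of t] AE_lborel_singleton[of 1] by auto
      then show "AE v in lborel. ?s t v = ?e v - ?l v"
        by eventually_elim (use t in \<open>auto simp: gamma_kernel_def indicator_def diff_divide_distrib\<close>)
    qed auto
    also have "\<dots> = (\<integral>v. ?e v \<partial>lborel) + ln t" using ei l by simp
    also have "(\<integral>v. ?e v \<partial>lborel) = \<bar>t\<bar> *\<^sub>R (\<integral>\<xi>. ?e (0 + t * \<xi>) \<partial>lborel)"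
      by (rule lborel_integral_real_affine) (use t in auto)
    also have "\<dots> = (\<integral>\<xi>. \<bar>t\<bar> * ?e (0 + t * \<xi>) \<partial>lborel)"
      by (simp only: real_scaleR_def integral_mult_right_zero)
    also have "\<dots> = (\<integral>\<xi>. indicator {1<..} \<xi> * (exp (- (t * \<xi>)) / \<xi>) \<partial>lborel)"
      by (rule Bochner_Integration.integral_cong) (use t in \<open>auto simp: indicator_def\<close>)
    finally show ?thesis .
  qed
  have "((\<lambda>t. \<integral>v. ?s t v \<partial>lborel) \<longlongrightarrow> (\<integral>v. gamma_kernel v \<partial>lborel)) (at_right 0)"
  proof (rule dominated_convergence_within[OF _ _ gamma_dominating])
    show "AE v in lborel. ((\<lambda>t. ?s t v) \<longlongrightarrow> gamma_kernel v) (at_right 0)"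
    proof (rule AE_I2)
      fix v :: real
      have "\<forall>\<^sub>F t in at_right 0. ?s t v = gamma_kernel v"
      proof (cases "v > 0")
        case True
        then show ?thesis unfolding eventually_at_right_field by (intro exI[of _ v]) auto
      qed (simp add: gamma_kernel_def)
      then show "((\<lambda>t. ?s t v) \<longlongrightarrow> gamma_kernel v) (at_right 0)" by (rule tendsto_eventually)
    qed
    have "norm (?s t v) \<le> exp 1 * exp (- (1 * \<bar>v\<bar>))" for t v
    proof -
      have "norm (?s t v) \<le> \<bar>v\<bar> powr 0 * \<bar>gamma_kernel v\<bar>"
      proof (cases "v > 0")
        case True
        then show ?thesis by (simp add: indicator_def)
      qed (simp add: gamma_kernel_def)
      also have "\<dots> \<le> exp 1 * exp (- (1 * \<bar>v\<bar>))" by (rule gamma_kernel_bound) auto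
      finally show ?thesis .
    qed
    then show "\<forall>\<^sub>F t in at_right 0. AE v in lborel. norm (?s t v) \<le> exp 1 * exp (- (1 * \<bar>v\<bar>))" by simp
  qed auto
  then show ?thesis unfolding gamma_kernel_integral
  proof (rule Lim_transform_eventually)
    show "\<forall>\<^sub>F t in at_right 0. (\<integral>v. ?s t v \<partial>lborel) = (\<integral>\<xi>. indicator {1<..} \<xi> * (exp (- (t * \<xi>)) / \<xi>) \<partial>lborel) + ln t"
      unfolding eventually_at_right_field by (intro exI[of _ 1]) (use I in auto)
  qed
qed

lemma arctan_integrable: "set_integrable lborel {1<..} (\<lambda>\<xi>::real. 1 / (\<xi> * sqrt (\<xi>\<^sup>2 - 1)))"
proof -
  have "set_integrable lborel (einterval (ereal 1) \<infinity>) (\<lambda>\<xi>::real. 1 / (\<xi> * sqrt (\<xi>\<^sup>2 - 1)))"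
  proof (rule interval_integral_FTC_nonneg(1)[where F = "\<lambda>x. arctan (sqrt (x\<^sup>2 - 1))"])
    fix x :: real assume "ereal 1 < ereal x"
    then have x: "x > 1" by simp
    have p: "x\<^sup>2 - 1 > 0" "x\<^sup>2 \<noteq> 1" "\<not> x\<^sup>2 < 1" by (fact square_gt_one[OF x])+
    have "((\<lambda>x. arctan (sqrt (x\<^sup>2 - 1))) has_real_derivative inverse (1 + (sqrt (x\<^sup>2 - 1))\<^sup>2) * (x / sqrt (x\<^sup>2 - 1))) (at x)"
      using p by (auto intro!: derivative_eq_intros simp: field_simps)
    moreover have "inverse (1 + (sqrt (x\<^sup>2 - 1))\<^sup>2) * (x / sqrt (x\<^sup>2 - 1)) = 1 / (x * sqrt (x\<^sup>2 - 1))"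
      using p x by (simp add: power2_eq_square field_simps)
    ultimately show "((\<lambda>x. arctan (sqrt (x\<^sup>2 - 1))) has_real_derivative 1 / (x * sqrt (x\<^sup>2 - 1))) (at x)" by simp
    show "isCont (\<lambda>\<xi>. 1 / (\<xi> * sqrt (\<xi>\<^sup>2 - 1))) x" using p x by (intro continuous_intros) auto
  next
    show "(((\<lambda>x. arctan (sqrt (x\<^sup>2 - 1))) \<circ> real_of_ereal) \<longlongrightarrow> 0) (at_right (ereal 1))"
      unfolding ereal_tendsto_simps by real_asymp
    show "(((\<lambda>x. arctan (sqrt (x\<^sup>2 - 1))) \<circ> real_of_ereal) \<longlongrightarrow> pi / 2) (at_left \<infinity>)"
      unfolding ereal_tendsto_simps by real_asymp
  qed auto
  then show ?thesis by simp
qed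

text \<open>
  This \<open>ln 2\<close> is the reason why the logarithm in \<open>bessel_Y0\<close> has argument \<open>t / 2\<close> and not \<open>t\<close>.
\<close>

lemma log_integral: "set_integrable lborel {1<..} (\<lambda>\<xi>::real. 1 / sqrt (\<xi>\<^sup>2 - 1) - 1 / \<xi>)"
    "(LINT \<xi>:{1<..}|lborel. 1 / sqrt (\<xi>\<^sup>2 - 1) - 1 / \<xi>) = (ln 2 :: real)"
proof -
  let ?F = "\<lambda>x::real. ln (x + sqrt (x\<^sup>2 - 1)) - ln x" and ?f = "\<lambda>\<xi>::real. 1 / sqrt (\<xi>\<^sup>2 - 1) - 1 / \<xi>"
  have D: "(?F has_real_derivative ?f x) (at x)" "isCont ?f x" "?f x \<ge> 0" if x: "x > 1" for x
  proof -
    have p: "x\<^sup>2 - 1 > 0" "x\<^sup>2 \<noteq> 1" "\<not> x\<^sup>2 < 1" by (fact square_gt_one[OF x])+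
    have q: "x + sqrt (x\<^sup>2 - 1) > 0" using x p by (intro add_pos_pos) auto
    have "((\<lambda>x. sqrt (x\<^sup>2 - 1)) has_real_derivative x / sqrt (x\<^sup>2 - 1)) (at x)"
      using p by (auto intro!: derivative_eq_intros simp: field_simps)
    from DERIV_chain2[OF DERIV_ln_divide[OF q] DERIV_add[OF DERIV_ident this]]
    have "(?F has_real_derivative 1 / (x + sqrt (x\<^sup>2 - 1)) * (1 + x / sqrt (x\<^sup>2 - 1)) - 1 / x) (at x)"
      by (rule DERIV_diff) (use x in \<open>auto intro: DERIV_ln_divide\<close>)
    then have "(?F has_real_derivative (1 + x / sqrt (x\<^sup>2 - 1)) / (x + sqrt (x\<^sup>2 - 1)) - 1 / x) (at x)" by simp
    moreover have "(1 + x / sqrt (x\<^sup>2 - 1)) / (x + sqrt (x\<^sup>2 - 1)) = 1 / sqrt (x\<^sup>2 - 1)"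
    proof -
      have "1 + x / sqrt (x\<^sup>2 - 1) = (x + sqrt (x\<^sup>2 - 1)) / sqrt (x\<^sup>2 - 1)" using p by (simp add: add_divide_distrib)
      then show ?thesis using q by simp
    qed
    ultimately show "(?F has_real_derivative ?f x) (at x)" by simp
    show "isCont ?f x" using p x by (intro continuous_intros) auto
    have "sqrt (x\<^sup>2 - 1) \<le> x" using x by (intro real_le_lsqrt) auto
    then show "?f x \<ge> 0" using p by (simp add: frac_le)
  qed
  have l: "((?F \<circ> real_of_ereal) \<longlongrightarrow> 0) (at_right (ereal 1))" "((?F \<circ> real_of_ereal) \<longlongrightarrow> ln 2) (at_left \<infinity>)"
    unfolding ereal_tendsto_simps by real_asymp+
  note ftc = interval_integral_FTC_nonneg[of "ereal 1" \<infinity> ?F ?f, OF _ D(1) D(2) _ l]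
  show "set_integrable lborel {1<..} ?f" using ftc(1) D(3) by auto
  have "(LBINT x=ereal 1..\<infinity>. ?f x) = ln 2" using ftc(2) D(3) by auto
  then show "(LINT \<xi>:{1<..}|lborel. ?f \<xi>) = ln 2" by (simp only: interval_integral_to_infinity_eq)
qed

lemma arcsin_integral: "set_integrable lborel {-1<..<1} (\<lambda>\<xi>::real. 1 / sqrt (1 - \<xi>\<^sup>2))"
    "(LINT \<xi>:{-1<..<1}|lborel. 1 / sqrt (1 - \<xi>\<^sup>2)) = (pi :: real)"
proof -
  let ?f = "\<lambda>\<xi>::real. 1 / sqrt (1 - \<xi>\<^sup>2)"
  have D: "(arcsin has_real_derivative ?f x) (at x)" "isCont ?f x" "?f x \<ge> 0" if x: "ereal (- 1) < ereal x" "ereal x < ereal 1" for x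
  proof -
    have p: "1 - x\<^sup>2 > 0" using x sq_cmp(2)[of x] by auto
    show "(arcsin has_real_derivative ?f x) (at x)" using x DERIV_arcsin[of x] by (simp add: inverse_eq_divide)
    show "isCont ?f x" using p by (intro continuous_intros) auto
    show "?f x \<ge> 0" using p by simp
  qed
  have c: "continuous_on {- 1..1} arcsin" by (rule continuous_on_arcsin')
  have l: "((arcsin \<circ> real_of_ereal) \<longlongrightarrow> - pi / 2) (at_right (ereal (- 1)))" "((arcsin \<circ> real_of_ereal) \<longlongrightarrow> pi / 2) (at_left (ereal 1))"
    unfolding ereal_tendsto_simps
    using continuous_on_Icc_at_rightD[OF c] continuous_on_Icc_at_leftD[OF c] by auto
  note ftc = interval_integral_FTC_nonneg[of "ereal (- 1)" "ereal 1" arcsin ?f, OF _ D(1) D(2) _ l]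
  show "set_integrable lborel {-1<..<1} ?f" using ftc(1) D(3) by auto
  have "(LBINT x=ereal (- 1)..ereal 1. ?f x) = pi" using ftc(2) D(3) by auto
  then show "(LINT \<xi>:{-1<..<1}|lborel. ?f \<xi>) = pi" by (simp add: interval_integral_Ioo)
qed

lemma hankel_kernel_propagating: "\<bar>\<xi>\<bar> < 1 \<Longrightarrow> hankel_kernel t \<xi> = \<i> * exp (\<i> * of_real (t * sqrt (1 - \<xi>\<^sup>2))) * of_real (1 / sqrt (1 - \<xi>\<^sup>2))"
proof -
  assume x: "\<bar>\<xi>\<bar> < 1"
  have "z / (- \<i> * w) = \<i> * z * (1 / w)" for z w :: complex by (simp add: divide_inverse)
  moreover have "- (of_real t * (- \<i> * of_real (sqrt (1 - \<xi>\<^sup>2)))) = \<i> * complex_of_real (t * sqrt (1 - \<xi>\<^sup>2))" by simp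
  ultimately show ?thesis unfolding hankel_kernel_def unit_root_cases(2)[OF x] by (simp only: of_real_divide of_real_1)
qed

lemma hankel_kernel_evanescent: "\<xi> > 1 \<Longrightarrow> hankel_kernel t \<xi> = of_real (exp (- (t * sqrt (\<xi>\<^sup>2 - 1))) / sqrt (\<xi>\<^sup>2 - 1))"
  unfolding hankel_kernel_def by (simp add: unit_root_cases(1) exp_of_real flip: of_real_mult of_real_minus)

lemma hankel_kernel_even: "hankel_kernel t (- \<xi>) = hankel_kernel t \<xi>"
  unfolding hankel_kernel_def by (cases "\<bar>\<xi>\<bar> \<ge> 1") (simp_all add: unit_root_cases(1) unit_root_cases(2)[of \<xi>] unit_root_cases(2)[of "- \<xi>"] del: of_real_minus)

lemma hankel_moment_split:
  assumes t: "t > 0"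
  shows "hankel_moment 0 t = (\<integral>\<xi>. indicator {- 1<..<1} \<xi> *\<^sub>R hankel_kernel t \<xi> \<partial>lborel)
    + of_real (2 * (\<integral>\<xi>. indicator {1<..} \<xi> * (exp (- (t * sqrt (\<xi>\<^sup>2 - 1))) / sqrt (\<xi>\<^sup>2 - 1)) \<partial>lborel))"
    and "integrable lborel (\<lambda>\<xi>. indicator {1<..} \<xi> * (exp (- (t * sqrt (\<xi>\<^sup>2 - 1))) / sqrt (\<xi>\<^sup>2 - 1)))"
proof -
  let ?e = "\<lambda>\<xi>. indicator {1<..} \<xi> * (exp (- (t * sqrt (\<xi>\<^sup>2 - 1))) / sqrt (\<xi>\<^sup>2 - 1))"
  let ?r = "\<lambda>\<xi>. indicator {1<..} \<xi> *\<^sub>R hankel_kernel t \<xi>" and ?m = "\<lambda>\<xi>. indicator {- 1<..<1} \<xi> *\<^sub>R hankel_kernel t \<xi>"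
  have i: "integrable lborel ?r" "integrable lborel ?m"
    by (intro integrable_mult_indicator hankel_kernel_integrable t; simp)+
  have r: "?r = (\<lambda>\<xi>. of_real (?e \<xi>))" by (auto simp: fun_eq_iff indicator_def hankel_kernel_evanescent)
  show ie: "integrable lborel ?e" using i(1) unfolding r by (simp only: complex_of_real_integrable_eq)
  have "hankel_moment 0 t = (\<integral>\<xi>. ?m \<xi> + (?r \<xi> + ?r (0 + (- 1) * \<xi>)) \<partial>lborel)"
    unfolding hankel_moment_def moment_integrand_def
  proof (rule integral_cong_AE)
    have "AE \<xi> in lborel. \<xi> \<noteq> (-1::real) \<and> \<xi> \<noteq> 1" using AE_lborel_singleton[of "-1::real"] AE_lborel_singleton[of "1::real"] by auto
    then show "AE \<xi> in lborel. (- unit_root \<xi>) ^ 0 * hankel_kernel t \<xi> = ?m \<xi> + (?r \<xi> + ?r (0 + (- 1) * \<xi>))"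
      by eventually_elim (auto simp: indicator_def hankel_kernel_even)
  qed measurable
  also have "\<dots> = (\<integral>\<xi>. ?m \<xi> \<partial>lborel) + ((\<integral>\<xi>. ?r \<xi> \<partial>lborel) + (\<integral>\<xi>. ?r (0 + (- 1) * \<xi>) \<partial>lborel))"
    using i lborel_integrable_real_affine[OF i(1), of "- 1" 0]
    by (subst Bochner_Integration.integral_add, simp, simp, subst Bochner_Integration.integral_add, simp_all)
  also have "(\<integral>\<xi>. ?r (0 + (- 1) * \<xi>) \<partial>lborel) = (\<integral>\<xi>. ?r \<xi> \<partial>lborel)"
    using lborel_integral_real_affine[of "- 1" ?r 0] by simp
  also have "(\<integral>\<xi>. ?r \<xi> \<partial>lborel) = of_real (\<integral>\<xi>. ?e \<xi> \<partial>lborel)"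
    unfolding r by (rule integral_complex_of_real)
  finally show "hankel_moment 0 t = (\<integral>\<xi>. ?m \<xi> \<partial>lborel) + of_real (2 * (\<integral>\<xi>. ?e \<xi> \<partial>lborel))" by simp
qed

text \<open>
  The propagating part tends to \<open>\<i> * pi\<close>. The evanescent part, twice an integral over \<open>\<xi> > 1\<close>, diverges
  logarithmically; its divergence is that of the exponential integral of \<open>exp (- t * \<xi>) / \<xi>\<close>, and the
  difference of the two converges to \<open>ln 2\<close>.
\<close>

lemma hankel_moment_limits:
  "((\<lambda>t. Re (hankel_moment 0 t) + 2 * (ln (t / 2) + euler_mascheroni)) \<longlongrightarrow> 0) (at_right 0)"
  "((\<lambda>t. Im (hankel_moment 0 t)) \<longlongrightarrow> pi) (at_right 0)"
proof -
  let ?m = "\<lambda>t \<xi>. indicator {- 1<..<1} \<xi> *\<^sub>R hankel_kernel t \<xi>"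
  let ?e = "\<lambda>t \<xi>. indicator {1<..} \<xi> * (exp (- (t * sqrt (\<xi>\<^sup>2 - 1))) / sqrt (\<xi>\<^sup>2 - 1)) :: real"
  let ?k = "\<lambda>t \<xi>. indicator {1<..} \<xi> * (exp (- (t * \<xi>)) / \<xi>) :: real"
  have M: "((\<lambda>t. \<integral>\<xi>. ?m t \<xi> \<partial>lborel) \<longlongrightarrow> \<i> * of_real pi) (at_right 0)"
  proof -
    have "((\<lambda>t. \<integral>\<xi>. ?m t \<xi> \<partial>lborel) \<longlongrightarrow> (\<integral>\<xi>. \<i> * of_real (indicator {- 1<..<1} \<xi> *\<^sub>R (1 / sqrt (1 - \<xi>\<^sup>2))) \<partial>lborel)) (at_right 0)"
    proof (rule dominated_convergence_within)
      show "integrable lborel (\<lambda>\<xi>. indicator {- 1<..<1} \<xi> *\<^sub>R (1 / sqrt (1 - \<xi>\<^sup>2)) :: real)"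
        using arcsin_integral(1) by (simp only: set_integrable_def)
      show "AE \<xi> in lborel. ((\<lambda>t. ?m t \<xi>) \<longlongrightarrow> \<i> * of_real (indicator {- 1<..<1} \<xi> *\<^sub>R (1 / sqrt (1 - \<xi>\<^sup>2)))) (at_right 0)"
      proof (rule AE_I2)
        fix \<xi> :: real
        show "((\<lambda>t. ?m t \<xi>) \<longlongrightarrow> \<i> * of_real (indicator {- 1<..<1} \<xi> *\<^sub>R (1 / sqrt (1 - \<xi>\<^sup>2)))) (at_right 0)"
        proof (cases "\<bar>\<xi>\<bar> < 1")
          case True
          have "((\<lambda>t. \<i> * exp (\<i> * of_real (t * sqrt (1 - \<xi>\<^sup>2))) * of_real (1 / sqrt (1 - \<xi>\<^sup>2))) \<longlongrightarrow> \<i> * exp (\<i> * of_real (0 * sqrt (1 - \<xi>\<^sup>2))) * of_real (1 / sqrt (1 - \<xi>\<^sup>2))) (at_right 0)"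
            by (intro tendsto_intros)
          then show ?thesis using True by (simp add: hankel_kernel_propagating indicator_def abs_less_iff)
        qed (auto simp: indicator_def)
      qed
      have "norm (?m t \<xi>) \<le> indicator {- 1<..<1} \<xi> *\<^sub>R (1 / sqrt (1 - \<xi>\<^sup>2))" for t \<xi>
      proof (cases "\<bar>\<xi>\<bar> < 1")
        case True
        then have "sqrt (1 - \<xi>\<^sup>2) \<ge> 0" using less_imp_le[OF sq_cmp(2)[OF True]] by simp
        then show ?thesis using True unfolding hankel_kernel_propagating[OF True] by (simp add: norm_mult norm_divide norm_exp_eq_Re)
      qed (auto simp: indicator_def)
      then show "\<forall>\<^sub>F t in at_right 0. AE \<xi> in lborel. norm (?m t \<xi>) \<le> indicator {- 1<..<1} \<xi> *\<^sub>R (1 / sqrt (1 - \<xi>\<^sup>2))"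
        by simp
    qed measurable
    also have "(\<integral>\<xi>. \<i> * of_real (indicator {- 1<..<1} \<xi> *\<^sub>R (1 / sqrt (1 - \<xi>\<^sup>2))) \<partial>lborel) = \<i> * of_real pi"
      using arcsin_integral(2) unfolding set_lebesgue_integral_def
      by (simp only: integral_mult_right_zero integral_complex_of_real)
    finally show ?thesis .
  qed
  have E: "((\<lambda>t. \<integral>\<xi>. ?e t \<xi> - ?k t \<xi> \<partial>lborel) \<longlongrightarrow> ln 2) (at_right 0)"
  proof -
    have "((\<lambda>t. \<integral>\<xi>. ?e t \<xi> - ?k t \<xi> \<partial>lborel) \<longlongrightarrow> (\<integral>\<xi>. indicator {1<..} \<xi> *\<^sub>R (1 / sqrt (\<xi>\<^sup>2 - 1) - 1 / \<xi>) \<partial>lborel)) (at_right 0)"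
    proof (rule dominated_convergence_within)
      show "integrable lborel (\<lambda>\<xi>. 2 * (indicator {1<..} \<xi> *\<^sub>R (1 / (\<xi> * sqrt (\<xi>\<^sup>2 - 1)))) :: real)"
        using arctan_integrable by (intro integrable_mult_right) (simp only: set_integrable_def)
      show "AE \<xi> in lborel. ((\<lambda>t. ?e t \<xi> - ?k t \<xi>) \<longlongrightarrow> indicator {1<..} \<xi> *\<^sub>R (1 / sqrt (\<xi>\<^sup>2 - 1) - 1 / \<xi>)) (at_right 0)"
      proof (rule AE_I2)
        fix \<xi> :: real
        show "((\<lambda>t. ?e t \<xi> - ?k t \<xi>) \<longlongrightarrow> indicator {1<..} \<xi> *\<^sub>R (1 / sqrt (\<xi>\<^sup>2 - 1) - 1 / \<xi>)) (at_right 0)"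
        proof (cases "\<xi> > 1")
          case True
          then have "sqrt (\<xi>\<^sup>2 - 1) \<noteq> 0" using square_gt_one[OF True] by simp
          then have "((\<lambda>t. exp (- (t * sqrt (\<xi>\<^sup>2 - 1))) / sqrt (\<xi>\<^sup>2 - 1) - exp (- (t * \<xi>)) / \<xi>) \<longlongrightarrow> exp (- (0 * sqrt (\<xi>\<^sup>2 - 1))) / sqrt (\<xi>\<^sup>2 - 1) - exp (- (0 * \<xi>)) / \<xi>) (at_right 0)"
            using True by (intro tendsto_intros) auto
          moreover have "?e t \<xi> - ?k t \<xi> = exp (- (t * sqrt (\<xi>\<^sup>2 - 1))) / sqrt (\<xi>\<^sup>2 - 1) - exp (- (t * \<xi>)) / \<xi>" for t
            using True by (simp add: indicator_def)
          moreover have "indicator {1<..} \<xi> *\<^sub>R (1 / sqrt (\<xi>\<^sup>2 - 1) - 1 / \<xi>) = exp (- (0 * sqrt (\<xi>\<^sup>2 - 1))) / sqrt (\<xi>\<^sup>2 - 1) - exp (- (0 * \<xi>)) / \<xi>"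
            using True by (simp add: indicator_def)
          ultimately show ?thesis by (simp only:)
        qed auto
      qed
      \<comment> \<open>both the exponents and the denominators differ by \<open>\<xi> - sqrt (\<xi>\<^sup>2 - 1) \<le> 1 / \<xi>\<close>, which provides an integrable majorant\<close>
      have "norm (?e t \<xi> - ?k t \<xi>) \<le> 2 * (indicator {1<..} \<xi> *\<^sub>R (1 / (\<xi> * sqrt (\<xi>\<^sup>2 - 1))))" if t: "0 < t" "t < 1" for t \<xi>
      proof (cases "\<xi> > 1")
        case True
        define a where "a = sqrt (\<xi>\<^sup>2 - 1)"
        have a2: "a\<^sup>2 = \<xi>\<^sup>2 - 1" "a > 0" using square_gt_one[OF True] by (simp_all add: a_def)
        have ax: "a \<le> \<xi>" unfolding a_def using True by (intro real_le_lsqrt) auto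
        have "(\<xi> - a) * (\<xi> + a) = 1" using a2 by (simp add: algebra_simps power2_eq_square)
        then have d: "\<xi> - a = 1 / (\<xi> + a)" using True a2 by (simp add: field_simps)
        then have d2: "\<xi> - a \<le> 1 / \<xi>" using True a2 by (simp add: frac_le)
        have m: "exp (- (t * \<xi>)) \<le> exp (- (t * a))" using ax t by simp
        have "exp (- (t * \<xi>)) / \<xi> \<le> exp (- (t * a)) / a" using m ax a2 by (intro frac_le) auto
        then have "norm (exp (- (t * a)) / a - exp (- (t * \<xi>)) / \<xi>) = exp (- (t * a)) / a - exp (- (t * \<xi>)) / \<xi>" by simp
        also have "\<dots> = (exp (- (t * a)) - exp (- (t * \<xi>))) / a + exp (- (t * \<xi>)) * ((\<xi> - a) / (a * \<xi>))"
          using a2 True by (simp add: field_simps)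
        also have "\<dots> \<le> (1 / \<xi>) / a + 1 * ((1 / \<xi>) / (a * 1))"
        proof (intro add_mono divide_right_mono mult_mono frac_le)
          have "exp (- (t * a)) - exp (- (t * \<xi>)) \<le> t * \<xi> - t * a"
            using ax t a2 by (intro exp_diff_le) auto
          also have "\<dots> = t * (\<xi> - a)" by (simp add: algebra_simps)
          also have "\<dots> \<le> 1 * (\<xi> - a)" using t ax by (intro mult_right_mono) auto
          finally show "exp (- (t * a)) - exp (- (t * \<xi>)) \<le> 1 / \<xi>" using d2 by simp
        qed (use a2 ax d2 True t in auto)
        also have "\<dots> = 2 * (1 / (\<xi> * a))" using a2 True by (simp add: field_simps)
        finally show ?thesis using True by (simp add: a_def)
      qed auto
      then show "\<forall>\<^sub>F t in at_right 0. AE \<xi> in lborel. norm (?e t \<xi> - ?k t \<xi>) \<le> 2 * (indicator {1<..} \<xi> *\<^sub>R (1 / (\<xi> * sqrt (\<xi>\<^sup>2 - 1))))"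
        unfolding eventually_at_right_field by (intro exI[of _ 1] conjI allI impI AE_I2) auto
    qed measurable
    then show ?thesis using log_integral(2) unfolding set_lebesgue_integral_def by (simp only:)
  qed
  have e0: "integrable lborel (?k t)" if t: "t > 0" for t
  proof (rule Bochner_Integration.integrable_bound)
    show "integrable lborel (\<lambda>\<xi>::real. exp (- (t * \<bar>\<xi>\<bar>)))" by (rule exp_abs_integrable[OF t])
    show "AE \<xi> in lborel. norm (?k t \<xi>) \<le> norm (exp (- (t * \<bar>\<xi>\<bar>)))"
      by (rule AE_I2) (auto simp: indicator_def divide_le_eq_1 field_simps)
  qed measurable
  have split: "hankel_moment 0 t = (\<integral>\<xi>. ?m t \<xi> \<partial>lborel) + of_real (2 * ((\<integral>\<xi>. ?e t \<xi> - ?k t \<xi> \<partial>lborel) + (\<integral>\<xi>. ?k t \<xi> \<partial>lborel)))" if t: "t > 0" for t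
  proof -
    have "(\<integral>\<xi>. ?e t \<xi> - ?k t \<xi> \<partial>lborel) = (\<integral>\<xi>. ?e t \<xi> \<partial>lborel) - (\<integral>\<xi>. ?k t \<xi> \<partial>lborel)"
      by (rule Bochner_Integration.integral_diff[OF hankel_moment_split(2)[OF t] e0[OF t]])
    then show ?thesis unfolding hankel_moment_split(1)[OF t] by (simp only: diff_add_cancel)
  qed
  have "((\<lambda>t. Re (\<integral>\<xi>. ?m t \<xi> \<partial>lborel) + 2 * ((\<integral>\<xi>. ?e t \<xi> - ?k t \<xi> \<partial>lborel) + ((\<integral>\<xi>. ?k t \<xi> \<partial>lborel) + ln t)) - 2 * ln 2 + 2 * euler_mascheroni)
     \<longlongrightarrow> Re (\<i> * of_real pi) + 2 * (ln 2 + - euler_mascheroni) - 2 * ln 2 + 2 * euler_mascheroni) (at_right 0)"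
    by (intro tendsto_intros M E exponential_integral_limit)
  then have "((\<lambda>t. Re (\<integral>\<xi>. ?m t \<xi> \<partial>lborel) + 2 * ((\<integral>\<xi>. ?e t \<xi> - ?k t \<xi> \<partial>lborel) + ((\<integral>\<xi>. ?k t \<xi> \<partial>lborel) + ln t)) - 2 * ln 2 + 2 * euler_mascheroni)
     \<longlongrightarrow> 0) (at_right 0)" by simp
  then show "((\<lambda>t. Re (hankel_moment 0 t) + 2 * (ln (t / 2) + euler_mascheroni)) \<longlongrightarrow> 0) (at_right 0)"
  proof (rule Lim_transform_eventually)
    show "\<forall>\<^sub>F t in at_right 0. Re (\<integral>\<xi>. ?m t \<xi> \<partial>lborel) + 2 * ((\<integral>\<xi>. ?e t \<xi> - ?k t \<xi> \<partial>lborel) + ((\<integral>\<xi>. ?k t \<xi> \<partial>lborel) + ln t)) - 2 * ln 2 + 2 * euler_mascheroni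
      = Re (hankel_moment 0 t) + 2 * (ln (t / 2) + euler_mascheroni)"
      unfolding eventually_at_right_field
    proof (intro exI[of _ 1] conjI allI impI)
      fix t :: real assume "0 < t"
      then show "Re (\<integral>\<xi>. ?m t \<xi> \<partial>lborel) + 2 * ((\<integral>\<xi>. ?e t \<xi> - ?k t \<xi> \<partial>lborel) + ((\<integral>\<xi>. ?k t \<xi> \<partial>lborel) + ln t)) - 2 * ln 2 + 2 * euler_mascheroni
        = Re (hankel_moment 0 t) + 2 * (ln (t / 2) + euler_mascheroni)"
        unfolding split[OF \<open>0 < t\<close>] plus_complex.sel Re_complex_of_real by (simp add: ln_div)
    qed simp
  qed
  have "((\<lambda>t. Im (\<integral>\<xi>. ?m t \<xi> \<partial>lborel)) \<longlongrightarrow> Im (\<i> * of_real pi)) (at_right 0)" by (intro tendsto_intros M)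
  then have "((\<lambda>t. Im (\<integral>\<xi>. ?m t \<xi> \<partial>lborel)) \<longlongrightarrow> pi) (at_right 0)" by simp
  then show "((\<lambda>t. Im (hankel_moment 0 t)) \<longlongrightarrow> pi) (at_right 0)"
  proof (rule Lim_transform_eventually)
    show "\<forall>\<^sub>F t in at_right 0. Im (\<integral>\<xi>. ?m t \<xi> \<partial>lborel) = Im (hankel_moment 0 t)"
      unfolding eventually_at_right_field
    proof (intro exI[of _ 1] conjI allI impI)
      fix t :: real assume "0 < t"
      then show "Im (\<integral>\<xi>. ?m t \<xi> \<partial>lborel) = Im (hankel_moment 0 t)"
        unfolding split[OF \<open>0 < t\<close>] plus_complex.sel Im_complex_of_real by simp
    qed simp
  qed
qed

text \<open>
  Both sides solve Bessel's equation, and the real and imaginary parts of their difference tend to \<open>0\<close>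
  at \<open>0\<close>.
\<close>

theorem hankel_moment_eq_hankel1_0:
  assumes t: "t > 0" shows "hankel_moment 0 t = \<i> * of_real pi * hankel1_0 t"
proof -
  have Re: "Re (hankel_moment 0 t) + pi * bessel_Y0 t = 0"
  proof (rule bessel_equation_unique[where y = "\<lambda>t. Re (hankel_moment 0 t) + pi * bessel_Y0 t", OF _ _ _ _ t])
    show "((\<lambda>t. Re (hankel_moment 0 t) + pi * bessel_Y0 t) has_real_derivative Re (hankel_moment 1 t) + pi * Y0' t) (at t)"
      "((\<lambda>t. Re (hankel_moment 1 t) + pi * Y0' t) has_real_derivative Re (hankel_moment 2 t) + pi * Y0'' t) (at t)" if "t > 0" for t
      using that hankel_moment_derivative(1)[of t 0] hankel_moment_derivative(1)[of t 1]
      by (auto intro!: DERIV_add DERIV_cmult bessel_Y0_equation simp: numeral_2_eq_2)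
    show "t * (Re (hankel_moment 2 t) + pi * Y0'' t) + (Re (hankel_moment 1 t) + pi * Y0' t) + t * (Re (hankel_moment 0 t) + pi * bessel_Y0 t) = 0" if "t > 0" for t
    proof -
      have "t * Re (hankel_moment 2 t) + Re (hankel_moment 1 t) + t * Re (hankel_moment 0 t) = 0" using arg_cong[OF hankel_moment_equation[OF that], of Re] by simp
      moreover have "pi * (t * Y0'' t + Y0' t + t * bessel_Y0 t) = 0" using bessel_Y0_equation(3)[OF that] by simp
      ultimately show ?thesis by (simp add: algebra_simps)
    qed
    show "((\<lambda>t. Re (hankel_moment 0 t) + pi * bessel_Y0 t) \<longlongrightarrow> 0) (at_right 0)"
      using tendsto_add[OF hankel_moment_limits(1) bessel_limits_at_0(2)] by (simp add: algebra_simps)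
  qed
  have Im: "Im (hankel_moment 0 t) - pi * bessel_J0 t = 0"
  proof (rule bessel_equation_unique[where y = "\<lambda>t. Im (hankel_moment 0 t) - pi * bessel_J0 t", OF _ _ _ _ t])
    show "((\<lambda>t. Im (hankel_moment 0 t) - pi * bessel_J0 t) has_real_derivative Im (hankel_moment 1 t) - pi * J0' t) (at t)"
      "((\<lambda>t. Im (hankel_moment 1 t) - pi * J0' t) has_real_derivative Im (hankel_moment 2 t) - pi * J0'' t) (at t)" if "t > 0" for t
      using that hankel_moment_derivative(2)[of t 0] hankel_moment_derivative(2)[of t 1]
      by (auto intro!: DERIV_diff DERIV_cmult bessel_J0_equation simp: numeral_2_eq_2)
    show "t * (Im (hankel_moment 2 t) - pi * J0'' t) + (Im (hankel_moment 1 t) - pi * J0' t) + t * (Im (hankel_moment 0 t) - pi * bessel_J0 t) = 0" if "t > 0" for t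
    proof -
      have "t * Im (hankel_moment 2 t) + Im (hankel_moment 1 t) + t * Im (hankel_moment 0 t) = 0" using arg_cong[OF hankel_moment_equation[OF that], of Im] by simp
      moreover have "pi * (t * J0'' t + J0' t + t * bessel_J0 t) = 0" using bessel_J0_equation(3)[of t] by simp
      ultimately show ?thesis by (simp add: algebra_simps)
    qed
    have "((\<lambda>t. Im (hankel_moment 0 t) - pi * bessel_J0 t) \<longlongrightarrow> pi - pi * 1) (at_right 0)"
      by (intro tendsto_intros hankel_moment_limits bessel_limits_at_0)
    then show "((\<lambda>t. Im (hankel_moment 0 t) - pi * bessel_J0 t) \<longlongrightarrow> 0) (at_right 0)" by simp
  qed
  show ?thesis using Re Im by (simp add: complex_eq_iff hankel1_0_def)
qed

theorem hankel_asymptotics: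
  "(\<lambda>t. hankel1_0 t - (1 - \<i>) / of_real pi * (exp (\<i> * of_real t) * of_real (sqrt (pi / t)))) \<in> O[at_top](\<lambda>t. of_real (t powr (- 3 / 2)))"
proof -
  interpret branched_amplitude 1 "pi / 2" "1 / 2" 1 "\<lambda>_. 1" "\<lambda>_ _. 1" "\<lambda>_ _. 0" "\<lambda>_. 1"
    by (rule unit_amplitude) auto
  let ?X = "\<lambda>r. \<i> * of_real pi * hankel1_0 r - \<i> * (1 - \<i>) * (exp (\<i> * of_real r) * of_real (sqrt (pi / r)))"
  have "(\<lambda>r. integral\<^sup>L lborel (hankel_kernel r) - \<i> * (1 - \<i>) * (exp (\<i> * of_real r) * of_real (sqrt (pi / r)))) \<in> O[at_top](\<lambda>r. of_real (r powr (- 3 / 2)))"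
    using branched_regular crit by (simp add: hankel_kernel_eq)
  moreover have "\<forall>\<^sub>F r in at_top. integral\<^sup>L lborel (hankel_kernel r) - \<i> * (1 - \<i>) * (exp (\<i> * of_real r) * of_real (sqrt (pi / r))) = ?X r"
    using eventually_gt_at_top[of 0]
    by eventually_elim (use hankel_moment_eq_hankel1_0 in \<open>simp add: hankel_moment_def moment_integrand_def\<close>)
  ultimately have "?X \<in> O[at_top](\<lambda>r. of_real (r powr (- 3 / 2)))"
    by (simp only: landau_o.big.in_cong)
  from landau_o.big.cmult_in_iff[THEN iffD2, OF _ this, of "1 / (\<i> * of_real pi)"]
  have "(\<lambda>r. 1 / (\<i> * of_real pi) * ?X r) \<in> O[at_top](\<lambda>r. of_real (r powr (- 3 / 2)))" by simp
  moreover have "1 / (\<i> * of_real pi) * ?X r = hankel1_0 r - (1 - \<i>) / of_real pi * (exp (\<i> * of_real r) * of_real (sqrt (pi / r)))" for r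
  proof -
    have "1 / (\<i> * q) * (\<i> * q * x - \<i> * (1 - \<i>) * z) = x - (1 - \<i>) / q * z" if "q \<noteq> 0" for q x z :: complex
    proof -
      have "\<i> * q * x - \<i> * (1 - \<i>) * z = (\<i> * q) * (x - (1 - \<i>) / q * z)"
        using that by (simp add: right_diff_distrib)
      then show ?thesis using that by simp
    qed
    then show ?thesis by simp
  qed
  ultimately show ?thesis by (simp only:)
qed

section \<open>Passing from the spectral integral to the remainder\<close>

context branched_amplitude
begin

lemma remainder_dichotomy:
  fixes G X :: "real \<Rightarrow> complex" and c :: complex
  assumes c: "c \<noteq> 0" and X: "X \<in> O[at_top](\<lambda>r. of_real (r powr (- 3 / 2)))"
    and G: "\<forall>\<^sub>F r in at_top. G r = c * (integral\<^sup>L lborel (spectral_integrand k \<phi> h r) -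
           \<i> * (1 - \<i>) * (h (k * cos \<phi>) * exp (\<i> * of_real (k * r)) * of_real (sqrt (pi / (k * r))))) + X r"
    and nz: "B (of_real \<phi>) 0 \<noteq> 0"
  shows "\<phi> \<noteq> crit \<and> \<phi> \<noteq> pi - crit \<Longrightarrow> G \<in> O[at_top](\<lambda>r. of_real (r powr (- 3 / 2)))"
    and "\<phi> = crit \<or> \<phi> = pi - crit \<Longrightarrow> \<exists>L. ((\<lambda>r. cmod (G r) * r powr (3 / 4)) \<longlongrightarrow> L) at_top \<and> L \<noteq> 0"
    and "\<phi> = crit \<or> \<phi> = pi - crit \<Longrightarrow> G \<notin> O[at_top](\<lambda>r. of_real (r powr (- 3 / 2)))"
proof -
  let ?Y = "\<lambda>r. integral\<^sup>L lborel (spectral_integrand k \<phi> h r) -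
           \<i> * (1 - \<i>) * (h (k * cos \<phi>) * exp (\<i> * of_real (k * r)) * of_real (sqrt (pi / (k * r))))"
  show "G \<in> O[at_top](\<lambda>r. of_real (r powr (- 3 / 2)))" if reg: "\<phi> \<noteq> crit \<and> \<phi> \<noteq> pi - crit"
  proof -
    have "?Y \<in> O[at_top](\<lambda>r. of_real (r powr (- 3 / 2)))" using branched_regular reg by blast
    then have "(\<lambda>r. c * ?Y r) \<in> O[at_top](\<lambda>r. of_real (r powr (- 3 / 2)))"
      by (rule landau_o.big.cmult_in_iff[THEN iffD2, OF c])
    from sum_in_bigo(1)[OF this X] show ?thesis
      by (subst landau_o.big.in_cong[OF G])
  qed
  have lim: "\<exists>L. ((\<lambda>r. cmod (G r) * r powr (3 / 4)) \<longlongrightarrow> L) at_top \<and> L \<noteq> 0" if cr: "\<phi> = crit \<or> \<phi> = pi - crit"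
  proof -
    let ?e = "\<lambda>r. exp (- \<i> * of_real (k * r)) :: complex"
    let ?L = "\<i> * (1 - \<i>) * ((1 - \<i>) * branch_constant * B (of_real \<phi>) 0 * of_real (half_moment k))"
    have "?L \<noteq> 0" using branched_critical(2)[OF cr] nz half_moment_pos[OF k] by (simp add: complex_eq_iff[of "1 - \<i>" 0] complex_eq_iff[of 1 \<i>])
    then have L0: "cmod (c * ?L + 0) \<noteq> 0" using c by simp
    have "((\<lambda>r. cmod (?e r * (of_real (r powr (3 / 4)) * X r))) \<longlongrightarrow> 0) at_top"
      using tendsto_norm_zero[OF bigo_powr_tendsto_zero[OF X]] by (simp add: norm_mult)
    then have "((\<lambda>r. ?e r * (of_real (r powr (3 / 4)) * X r)) \<longlongrightarrow> 0) at_top"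
      by (rule tendsto_norm_zero_cancel)
    from tendsto_norm[OF tendsto_add[OF tendsto_mult_left[OF branched_critical(1)[OF cr], of c] this]]
    have "((\<lambda>r. cmod (c * (?e r * (of_real (r powr (3 / 4)) * ?Y r)) + ?e r * (of_real (r powr (3 / 4)) * X r))) \<longlongrightarrow> cmod (c * ?L + 0)) at_top" .
    then have "((\<lambda>r. cmod (G r) * r powr (3 / 4)) \<longlongrightarrow> cmod (c * ?L + 0)) at_top"
    proof (rule Lim_transform_eventually)
      show "\<forall>\<^sub>F r in at_top. cmod (c * (?e r * (of_real (r powr (3 / 4)) * ?Y r)) + ?e r * (of_real (r powr (3 / 4)) * X r)) = cmod (G r) * r powr (3 / 4)"
        using G
      proof eventually_elim
        case (elim r)
        have "c * (?e r * (of_real (r powr (3 / 4)) * ?Y r)) + ?e r * (of_real (r powr (3 / 4)) * X r) = ?e r * of_real (r powr (3 / 4)) * (c * ?Y r + X r)"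
          by (simp add: algebra_simps)
        then show ?case unfolding elim by (simp add: norm_mult mult.commute)
      qed
    qed
    with L0 show ?thesis by blast
  qed
  then show "\<phi> = crit \<or> \<phi> = pi - crit \<Longrightarrow> \<exists>L. ((\<lambda>r. cmod (G r) * r powr (3 / 4)) \<longlongrightarrow> L) at_top \<and> L \<noteq> 0" .
  show "G \<notin> O[at_top](\<lambda>r. of_real (r powr (- 3 / 2)))" if cr: "\<phi> = crit \<or> \<phi> = pi - crit"
  proof
    assume "G \<in> O[at_top](\<lambda>r. of_real (r powr (- 3 / 2)))"
    from tendsto_norm[OF bigo_powr_tendsto_zero[OF this]]
    have "((\<lambda>r. cmod (G r) * r powr (3 / 4)) \<longlongrightarrow> 0) at_top" by (simp add: norm_mult mult.commute)
    with lim[OF cr] show False using tendsto_unique[OF trivial_limit_at_top_linorder] by blast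
  qed
qed

end

lemma far_constant:
  assumes "k > 0" "r > 0"
  shows "exp (\<i> * complex_of_real (k * r)) / of_real (sqrt r) * (exp (\<i> * of_real pi / 4) / of_real (sqrt (8 * pi * k)))
    = 1 / (4 * of_real pi) * (\<i> * (1 - \<i>) * (exp (\<i> * of_real (k * r)) * of_real (sqrt (pi / (k * r)))))"
proof -
  have e: "exp (\<i> * complex_of_real pi / 4) = (1 + \<i>) / of_real (sqrt 2)"
  proof -
    have "exp (\<i> * complex_of_real pi / 4) = cis (pi / 4)" by (simp add: cis_conv_exp)
    also have "\<dots> = (1 + \<i>) / of_real (sqrt 2)"
      by (simp add: complex_eq_iff cos_45 sin_45 real_div_sqrt field_simps)
    finally show ?thesis .
  qed
  have s: "1 / (sqrt r * (sqrt 2 * sqrt (8 * pi * k))) = sqrt (pi / (k * r)) / (4 * pi)"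
  proof -
    have "sqrt 2 * sqrt (8 * pi * k) = 4 * sqrt (pi * k)"
    proof -
      have "sqrt 2 * sqrt (8 * pi * k) = sqrt (4\<^sup>2 * (pi * k))" by (simp flip: real_sqrt_mult)
      then show ?thesis by (simp add: real_sqrt_mult)
    qed
    then have "1 / (sqrt r * (sqrt 2 * sqrt (8 * pi * k))) = 1 / (sqrt r * (4 * sqrt (pi * k)))" by (simp only:)
    also have "\<dots> = 1 / (4 * (sqrt pi * sqrt k * sqrt r))" by (simp add: real_sqrt_mult mult_ac)
    also have "\<dots> = sqrt (pi / (k * r)) / (4 * pi)"
      using assms by (simp add: real_sqrt_divide real_sqrt_mult field_simps)
    finally show ?thesis .
  qed
  have "exp (\<i> * complex_of_real (k * r)) / of_real (sqrt r) * (exp (\<i> * of_real pi / 4) / of_real (sqrt (8 * pi * k)))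
    = (1 + \<i>) * exp (\<i> * complex_of_real (k * r)) * of_real (1 / (sqrt r * (sqrt 2 * sqrt (8 * pi * k))))"
    unfolding e by simp
  also have "\<dots> = 1 / (4 * of_real pi) * (\<i> * (1 - \<i>) * (exp (\<i> * of_real (k * r)) * of_real (sqrt (pi / (k * r)))))"
    unfolding s by (simp add: algebra_simps)
  finally show ?thesis .
qed

text \<open>
  The distance from \<open>y\<close> is \<open>r - direction \<theta> \<bullet> y + O(1 / r)\<close>. The first two terms give the phase of the
  plane wave, the rest changes the phase and the amplitude only to relative order \<open>1 / r\<close>.
\<close>

lemma hankel_translated:
  fixes y :: "real \<times> real"
  assumes k: "k > 0"
  shows "(\<lambda>r. \<i> / 4 * hankel1_0 (k * norm (r *\<^sub>R direction \<theta> - y)) -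
     1 / (4 * of_real pi) * (\<i> * (1 - \<i>) * (exp (- \<i> * of_real k * of_real (direction \<theta> \<bullet> y)) * exp (\<i> * of_real (k * r)) * of_real (sqrt (pi / (k * r))))))
    \<in> O[at_top](\<lambda>r. of_real (r powr (- 3 / 2)))"
proof -
  define \<rho> where "\<rho> r = norm (r *\<^sub>R direction \<theta> - y)" for r
  define b where "b = direction \<theta> \<bullet> y"
  define Y where "Y = norm y"
  have dd: "direction \<theta> \<bullet> direction \<theta> = 1" by (simp add: direction_def flip: power2_eq_square)
  then have nd: "norm (direction \<theta>) = 1" by (simp add: norm_eq_sqrt_inner)
  have b_le: "\<bar>b\<bar> \<le> Y" using Cauchy_Schwarz_ineq2[of "direction \<theta>" y] nd by (simp add: b_def Y_def)
  \<comment> \<open>the component of \<open>y\<close> along the ray and the one orthogonal to it\<close>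
  have \<rho>2: "(\<rho> r)\<^sup>2 = (r - b)\<^sup>2 + (Y\<^sup>2 - b\<^sup>2)" for r
  proof -
    have "(\<rho> r)\<^sup>2 = (r *\<^sub>R direction \<theta> - y) \<bullet> (r *\<^sub>R direction \<theta> - y)" by (simp only: \<rho>_def power2_norm_eq_inner)
    also have "\<dots> = r * r * (direction \<theta> \<bullet> direction \<theta>) - 2 * r * b + y \<bullet> y"
      by (simp add: b_def inner_diff_left inner_diff_right inner_commute del: dot_square_norm)
    also have "y \<bullet> y = Y\<^sup>2" by (simp only: Y_def power2_norm_eq_inner)
    finally show ?thesis unfolding dd by (simp add: power2_eq_square algebra_simps)
  qed
  have \<rho>r: "\<bar>\<rho> r - r\<bar> \<le> Y" if "r \<ge> 0" for r
    using norm_triangle_ineq3[of "r *\<^sub>R direction \<theta> - y" "r *\<^sub>R direction \<theta>"] nd that by (simp add: \<rho>_def Y_def)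
  have big: "\<rho> r \<ge> r / 2" "\<rho> r > 0" if "r \<ge> 2 * Y + 1" for r
    using \<rho>r[of r] that norm_ge_zero[of y] unfolding Y_def by (auto simp: abs_le_iff)
  have \<rho>_top: "filterlim \<rho> at_top at_top"
    by (rule filterlim_at_top_mono[of "\<lambda>r. r / 2"])
       (real_asymp, use big in \<open>auto intro: eventually_mono[OF eventually_ge_at_top[of "2 * Y + 1"]]\<close>)
  have k\<rho>_top: "filterlim (\<lambda>r. k * \<rho> r) at_top at_top"
    using filterlim_tendsto_pos_mult_at_top[OF tendsto_const k \<rho>_top] .
  let ?E = "\<lambda>t. hankel1_0 t - (1 - \<i>) / of_real pi * (exp (\<i> * of_real t) * of_real (sqrt (pi / t)))"
  have 1: "(\<lambda>r. ?E (k * \<rho> r)) \<in> O[at_top](\<lambda>r. of_real (r powr (- 3 / 2)))"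
  proof -
    have "(\<lambda>r. ?E (k * \<rho> r)) \<in> O[at_top](\<lambda>r. of_real ((k * \<rho> r) powr (- 3 / 2)))"
      by (rule landau_o.big.compose[OF hankel_asymptotics k\<rho>_top])
    also have "(\<lambda>r. complex_of_real ((k * \<rho> r) powr (- 3 / 2))) \<in> O[at_top](\<lambda>r. of_real (r powr (- 3 / 2)))"
    proof (rule landau_o.bigI[of "(k / 2) powr (- 3 / 2)"])
      show "\<forall>\<^sub>F r in at_top. cmod (of_real ((k * \<rho> r) powr (- 3 / 2))) \<le> (k / 2) powr (- 3 / 2) * cmod (of_real (r powr (- 3 / 2)))"
        using eventually_ge_at_top[of "2 * Y + 1"]
      proof eventually_elim
        case (elim r)
        have r: "r > 0" using elim norm_ge_zero[of y] unfolding Y_def by linarith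
        have "(k / 2) * r \<le> k * \<rho> r" using mult_left_mono[OF big(1)[OF elim], of k] k by simp
        then have "(k * \<rho> r) powr (- 3 / 2) \<le> ((k / 2) * r) powr (- 3 / 2)"
          using k r by (intro powr_mono2') auto
        also have "\<dots> = (k / 2) powr (- 3 / 2) * r powr (- 3 / 2)" by (simp only: powr_mult)
        finally show ?case unfolding norm_of_real by simp
      qed
    qed (use k in simp)
    finally show ?thesis .
  qed
  let ?D = "\<lambda>r. exp (\<i> * of_real (k * \<rho> r)) * of_real (sqrt (pi / (k * \<rho> r))) - exp (- \<i> * of_real k * of_real b) * exp (\<i> * of_real (k * r)) * of_real (sqrt (pi / (k * r))) :: complex"
  have 2: "?D \<in> O[at_top](\<lambda>r. of_real (r powr (- 3 / 2)))"
  proof (rule landau_o.bigI[of "sqrt (pi / k) * (k * (2 * Y\<^sup>2) * 2 + 2 * Y) + 1"])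
    show "\<forall>\<^sub>F r in at_top. cmod (?D r) \<le> (sqrt (pi / k) * (k * (2 * Y\<^sup>2) * 2 + 2 * Y) + 1) * cmod (of_real (r powr (- 3 / 2)))"
      using eventually_ge_at_top[of "2 * Y + 1"]
    proof eventually_elim
      case (elim r)
      have Y0: "Y \<ge> 0" by (simp add: Y_def)
      have r: "r > 0" using elim Y0 by linarith
      have \<rho>0: "\<rho> r > 0" "\<rho> r \<ge> r / 2" using big[OF elim] by auto
      have rb: "r - b \<ge> r / 2" using b_le elim by auto
      have inv: "1 / sqrt (\<rho> r) \<le> 2 / sqrt r"
      proof -
        have "sqrt (r / 4) \<le> sqrt (\<rho> r)" using \<rho>0 r by (intro real_sqrt_le_mono) auto
        then have "sqrt r / 2 \<le> sqrt (\<rho> r)" by (simp add: real_sqrt_divide)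
        then show ?thesis using r \<rho>0 by (simp add: field_simps)
      qed
      have ph: "\<bar>\<rho> r - (r - b)\<bar> \<le> 2 * Y\<^sup>2 / r"
      proof -
        have "(\<rho> r - (r - b)) * (\<rho> r + (r - b)) = Y\<^sup>2 - b\<^sup>2" using \<rho>2[of r] by (simp add: algebra_simps power2_eq_square)
        moreover have s: "\<rho> r + (r - b) \<ge> r" using \<rho>0 rb by linarith
        ultimately have "\<rho> r - (r - b) = (Y\<^sup>2 - b\<^sup>2) / (\<rho> r + (r - b))" using r by (simp add: field_simps)
        then have "\<bar>\<rho> r - (r - b)\<bar> = \<bar>Y\<^sup>2 - b\<^sup>2\<bar> / (\<rho> r + (r - b))" using s r by (simp add: abs_divide)
        also have "\<dots> \<le> (2 * Y\<^sup>2) / r"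
        proof (rule frac_le)
          have "b\<^sup>2 \<le> Y\<^sup>2" using b_le Y0 by (metis abs_le_square_iff abs_of_nonneg)
          then show "\<bar>Y\<^sup>2 - b\<^sup>2\<bar> \<le> 2 * Y\<^sup>2" using zero_le_power2[of b] zero_le_power2[of Y] by linarith
        qed (use s r in auto)
        finally show ?thesis .
      qed
      have p1: "cmod (exp (\<i> * of_real (k * \<rho> r)) - exp (\<i> * of_real (k * (r - b)))) \<le> k * (2 * Y\<^sup>2 / r)"
      proof -
        have "cmod (exp (\<i> * of_real (k * \<rho> r)) - exp (\<i> * of_real (k * (r - b)))) \<le> exp 0 * cmod (\<i> * of_real (k * \<rho> r) - \<i> * of_real (k * (r - b)))"
          by (rule exp_diff_bound) auto
        also have "\<i> * complex_of_real (k * \<rho> r) - \<i> * of_real (k * (r - b)) = \<i> * of_real (k * (\<rho> r - (r - b)))"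
          by (simp add: algebra_simps)
        finally show ?thesis using mult_left_mono[OF ph, of k] k by (simp add: norm_mult abs_mult del: of_real_mult of_real_diff)
      qed
      have p2: "\<bar>1 / sqrt (\<rho> r) - 1 / sqrt r\<bar> \<le> 2 * Y / (r * sqrt r)"
      proof -
        have "1 / sqrt (\<rho> r) - 1 / sqrt r = (r - \<rho> r) / (sqrt (\<rho> r) * sqrt r * (sqrt r + sqrt (\<rho> r)))"
        proof -
          have "(sqrt r - sqrt (\<rho> r)) * (sqrt r + sqrt (\<rho> r)) = r - \<rho> r" using r \<rho>0 by (simp add: algebra_simps)
          then have "sqrt r - sqrt (\<rho> r) = (r - \<rho> r) / (sqrt r + sqrt (\<rho> r))"
            using r \<rho>0 by (simp add: field_simps add_pos_pos less_imp_neq[symmetric])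
          moreover have "1 / sqrt (\<rho> r) - 1 / sqrt r = (sqrt r - sqrt (\<rho> r)) / (sqrt (\<rho> r) * sqrt r)"
            using r \<rho>0 by (simp add: field_simps)
          ultimately show ?thesis by (simp add: mult_ac)
        qed
        then have "\<bar>1 / sqrt (\<rho> r) - 1 / sqrt r\<bar> = \<bar>r - \<rho> r\<bar> / (sqrt r + sqrt (\<rho> r)) / sqrt r * (1 / sqrt (\<rho> r))"
          using r \<rho>0 by (simp add: abs_mult abs_divide mult_ac)
        also have "\<dots> \<le> Y / sqrt r / sqrt r * (2 / sqrt r)"
        proof (rule mult_mono[OF divide_right_mono[OF frac_le] inv])
          show "\<bar>r - \<rho> r\<bar> \<le> Y" using \<rho>r[of r] r by (simp add: abs_minus_commute)
        qed (use r \<rho>0 Y0 in auto)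
        also have "\<dots> = 2 * Y / (r * sqrt r)" using r by (simp add: mult.assoc[symmetric])
        finally show ?thesis .
      qed
      have pw: "r powr (- 3 / 2) = 1 / (r * sqrt r)"
      proof -
        have "r powr (3 / 2) = r powr (1 + 1 / 2)" by simp
        also have "\<dots> = r * sqrt r" unfolding powr_add using r by (simp add: powr_half_sqrt)
        finally show ?thesis by (simp add: powr_minus_divide)
      qed
      have sq: "sqrt (pi / (k * x)) = sqrt (pi / k) * (1 / sqrt x)" for x by (simp add: real_sqrt_divide real_sqrt_mult)
      have ee: "exp (- \<i> * of_real k * of_real b) * exp (\<i> * of_real (k * r)) = exp (\<i> * complex_of_real (k * (r - b)))"
        by (simp add: algebra_simps flip: exp_add)
      have "?D r = of_real (sqrt (pi / k)) * ((exp (\<i> * of_real (k * \<rho> r)) - exp (\<i> * of_real (k * (r - b)))) * of_real (1 / sqrt (\<rho> r))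
          + exp (\<i> * of_real (k * (r - b))) * of_real (1 / sqrt (\<rho> r) - 1 / sqrt r))"
        unfolding ee sq of_real_mult[of "sqrt (pi / k)"] of_real_diff[of "1 / sqrt (\<rho> r)"] by (simp only: algebra_simps)
      also have "cmod \<dots> \<le> sqrt (pi / k) * (k * (2 * Y\<^sup>2 / r) * (2 / sqrt r) + 1 * (2 * Y / (r * sqrt r)))"
      proof -
        have "cmod ((exp (\<i> * of_real (k * \<rho> r)) - exp (\<i> * of_real (k * (r - b)))) * of_real (1 / sqrt (\<rho> r))
          + exp (\<i> * of_real (k * (r - b))) * of_real (1 / sqrt (\<rho> r) - 1 / sqrt r)) \<le> k * (2 * Y\<^sup>2 / r) * (2 / sqrt r) + 1 * (2 * Y / (r * sqrt r))"
        proof (rule order.trans[OF norm_triangle_ineq], unfold norm_mult, intro add_mono mult_mono p1)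
          show "cmod (of_real (1 / sqrt (\<rho> r))) \<le> 2 / sqrt r" using inv \<rho>0 by (simp add: norm_divide)
          show "cmod (of_real (1 / sqrt (\<rho> r) - 1 / sqrt r)) \<le> 2 * Y / (r * sqrt r)" unfolding norm_of_real by (rule p2)
        qed (use k r in auto)
        then show ?thesis unfolding norm_mult[of "of_real (sqrt (pi / k))"] using k by (simp add: mult_left_mono)
      qed
      also have "\<dots> = (sqrt (pi / k) * (k * (2 * Y\<^sup>2) * 2 + 2 * Y)) * (1 / (r * sqrt r))"
        using r by (simp add: field_simps)
      also have "\<dots> \<le> (sqrt (pi / k) * (k * (2 * Y\<^sup>2) * 2 + 2 * Y) + 1) * (1 / (r * sqrt r))"
        using r by (intro mult_right_mono) auto
      also have "1 / (r * sqrt r) = cmod (of_real (1 / (r * sqrt r)))" unfolding norm_of_real using r by simp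
      finally show ?case unfolding pw .
    qed
  qed (use k in \<open>auto simp: Y_def intro!: add_nonneg_pos mult_nonneg_nonneg\<close>)
  have c: "\<i> / 4 \<noteq> 0" "1 / (4 * of_real pi) * (\<i> * (1 - \<i>)) \<noteq> (0::complex)" by (auto simp: complex_eq_iff)
  have "(\<lambda>r. \<i> / 4 * ?E (k * \<rho> r) + 1 / (4 * of_real pi) * (\<i> * (1 - \<i>)) * ?D r) \<in> O[at_top](\<lambda>r. of_real (r powr (- 3 / 2)))"
    by (intro sum_in_bigo(1) landau_o.big.cmult_in_iff[THEN iffD2, OF c(1)] landau_o.big.cmult_in_iff[THEN iffD2, OF c(2)] 1 2)
  moreover have "\<i> / 4 * ?E (k * \<rho> r) + 1 / (4 * of_real pi) * (\<i> * (1 - \<i>)) * ?D r =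
    \<i> / 4 * hankel1_0 (k * norm (r *\<^sub>R direction \<theta> - y)) -
     1 / (4 * of_real pi) * (\<i> * (1 - \<i>) * (exp (- \<i> * of_real k * of_real (direction \<theta> \<bullet> y)) * exp (\<i> * of_real (k * r)) * of_real (sqrt (pi / (k * r)))))" for r
    unfolding \<rho>_def b_def by (simp add: field_simps)
  ultimately show ?thesis by (simp only:)
qed

section \<open>The two-layered Green function\<close>

text \<open>
  Supplies the continuous factor \<open>B\<close> of an amplitude whose dependence on the second root is an
  exponential.
\<close>

lemma exp_divided_difference:
  fixes c :: complex
  obtains g where "continuous_on UNIV g" "g 0 = c" "\<And>z. exp (c * z) = 1 + z * g z"
proof -
  have "((\<lambda>z. exp (c * z)) has_field_derivative c) (at 0)" by (auto intro!: derivative_eq_intros)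
  then obtain g where g: "\<And>z. exp (c * z) - exp (c * 0) = g z * (z - 0)" "isCont g 0" "g 0 = c"
    by (auto simp only: CARAT_DERIV)
  have "isCont g z" for z
  proof (cases "z = 0")
    case False
    have "isCont (\<lambda>z. (exp (c * z) - 1) / z) z" using False by (intro continuous_intros)
    then have "isCont g z" if "\<forall>\<^sub>F w in nhds z. (exp (c * w) - 1) / w = g w" using isCont_cong[OF that] by blast
    moreover have "\<forall>\<^sub>F w in nhds z. (exp (c * w) - 1) / w = g w"
    proof -
      have "\<forall>\<^sub>F w in nhds z. w \<in> - {0}" using False by (intro eventually_nhds_in_open) (auto simp: open_Compl)
      then show ?thesis
      proof eventually_elim
        case (elim w)
        then show ?case using g(1)[of w] by simp
      qed
    qed
    ultimately show ?thesis by blast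
  qed (use g in simp)
  then have "continuous_on UNIV g" by (simp add: continuous_at_imp_continuous_on)
  moreover have "exp (c * z) = 1 + z * g z" for z using g(1)[of z] by (simp add: algebra_simps)
  ultimately show ?thesis using g(3) that by blast
qed

text \<open>
  The denominator of the Fresnel coefficients is rationalised: its product with the conjugate expression
  is the constant \<open>1 - \<nu>\<^sup>2\<close>, so that the coefficients are entire in the angle and the second root.
\<close>

lemma fresnel_quotient:
  fixes s u a :: complex
  assumes "s\<^sup>2 + u\<^sup>2 = a" "a \<noteq> 0"
  shows "s - \<i> * u \<noteq> 0" "1 / (s - \<i> * u) = (s + \<i> * u) / a"
proof -
  have m: "(s - \<i> * u) * (s + \<i> * u) = a" using assms(1) by (simp add: algebra_simps power2_eq_square)
  then show n: "s - \<i> * u \<noteq> 0" using assms(2) by auto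
  show "1 / (s - \<i> * u) = (s + \<i> * u) / a" using n assms(2) m by (simp add: field_simps)
qed

locale two_layers =
  fixes kp km :: real and y :: "real \<times> real"
  assumes wavenumbers: "0 < kp" "kp < km"
begin

abbreviation "Sp \<xi> \<equiv> SS (complex_of_real \<xi>) kp"
abbreviation "Sm \<xi> \<equiv> SS (complex_of_real \<xi>) km"
abbreviation "shift t \<equiv> exp (- \<i> * of_real (km * fst y) * cos t) :: complex"
definition ratio :: real where "ratio = kp / km"

definition contrast :: complex where "contrast = of_real (1 - ratio\<^sup>2)"

text \<open>
  The amplitudes of the spectral integral for a source above and below the interface: Fresnel
  coefficient, decay or phase over the height of the source, and horizontal shift.
\<close>

definition transmitted :: "real \<Rightarrow> complex" where
  "transmitted \<xi> = 2 * Sm \<xi> / (Sp \<xi> + Sm \<xi>) * exp (- Sp \<xi> * of_real (snd y)) * exp (- \<i> * of_real (\<xi> * fst y))"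

definition reflected :: "real \<Rightarrow> complex" where
  "reflected \<xi> = (Sm \<xi> - Sp \<xi>) / (Sp \<xi> + Sm \<xi>) * exp (- Sm \<xi> * of_real (- snd y)) * exp (- \<i> * of_real (\<xi> * fst y))"

lemma ratio: "0 < ratio" "ratio < 1" "ratio * km = kp" "km > 0" "contrast \<noteq> 0"
proof -
  show r: "0 < ratio" "ratio < 1" "ratio * km = kp" "km > 0" using wavenumbers by (auto simp: ratio_def)
  have "ratio\<^sup>2 < 1" using r by (simp add: abs_square_less_1)
  then show "contrast \<noteq> 0" unfolding contrast_def by (metis diff_gt_0_iff_gt less_irrefl of_real_eq_0_iff)
qed

lemma parametrised_roots:
  assumes "complex_of_real \<xi> = of_real km * cos t" "Sm \<xi> = - \<i> * of_real km * sin t" "SS (of_real \<xi>) (ratio * km) = of_real km * s"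
  shows "Sp \<xi> + Sm \<xi> = of_real km * (s - \<i> * sin t)" "s - \<i> * sin t \<noteq> 0" "1 / (s - \<i> * sin t) = (s + \<i> * sin t) / contrast"
proof -
  have p: "Sp \<xi> = of_real km * s" using assms(3) ratio by simp
  show "Sp \<xi> + Sm \<xi> = of_real km * (s - \<i> * sin t)" unfolding p assms(2) by (simp add: algebra_simps)
  have "(of_real km * s)\<^sup>2 = (of_real km * cos t)\<^sup>2 - (of_real km * of_real ratio)\<^sup>2"
    unfolding p[symmetric] assms(1)[symmetric] SS_power2[OF wavenumbers(1)] of_real_mult[symmetric] mult.commute[of km] ratio(3) by simp
  then have "(of_real km)\<^sup>2 * s\<^sup>2 = (of_real km)\<^sup>2 * ((cos t)\<^sup>2 - (of_real ratio)\<^sup>2)"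
    by (simp only: power_mult_distrib right_diff_distrib)
  then have "s\<^sup>2 = (cos t)\<^sup>2 - (of_real ratio)\<^sup>2" using ratio(4) by simp
  then have "s\<^sup>2 + (sin t)\<^sup>2 = contrast" using sin_squared_eq[of t] by (simp add: contrast_def)
  from fresnel_quotient[OF this ratio(5)] show "s - \<i> * sin t \<noteq> 0" "1 / (s - \<i> * sin t) = (s + \<i> * sin t) / contrast" .
qed

lemma large_frequency:
  assumes "\<bar>\<xi>\<bar> \<ge> km"
  shows "Sp \<xi> = of_real (sqrt (\<xi>\<^sup>2 - kp\<^sup>2))" "Sm \<xi> = of_real (sqrt (\<xi>\<^sup>2 - km\<^sup>2))"
    "0 \<le> sqrt (\<xi>\<^sup>2 - km\<^sup>2)" "sqrt (\<xi>\<^sup>2 - km\<^sup>2) < sqrt (\<xi>\<^sup>2 - kp\<^sup>2)"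
proof -
  have "km\<^sup>2 \<le> \<xi>\<^sup>2" using abs_le_square_iff[of km \<xi>] assms wavenumbers by simp
  moreover have "kp\<^sup>2 < km\<^sup>2" using wavenumbers by (intro power_strict_mono) auto
  ultimately show "0 \<le> sqrt (\<xi>\<^sup>2 - km\<^sup>2)" "sqrt (\<xi>\<^sup>2 - km\<^sup>2) < sqrt (\<xi>\<^sup>2 - kp\<^sup>2)" by auto
qed (use assms wavenumbers in \<open>auto simp: SS_of_real\<close>)

lemma transmitted_amplitude:
  assumes y: "snd y > 0" and g: "continuous_on UNIV g" "\<And>z. exp (- of_real (km * snd y) * z) = 1 + z * g z"
    and \<phi>: "0 < \<phi>" "\<phi> < pi"
  shows "branched_amplitude km \<phi> ratio 1 transmitted
    (\<lambda>t s. 2 / contrast * (- \<i> * sin t) * (s + \<i> * sin t) * exp (- of_real (km * snd y) * s) * shift t)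
    (\<lambda>t s. 2 / contrast * (- \<i> * sin t) * (exp (- of_real (km * snd y) * s) + \<i> * sin t * g s) * shift t)
    (\<lambda>t. 2 / contrast * (sin t)\<^sup>2 * shift t)"
proof
  show "continuous_on UNIV (\<lambda>x. 2 / contrast * (- \<i> * sin (fst x)) * (exp (- of_real (km * snd y) * snd x) + \<i> * sin (fst x) * g (snd x)) * shift (fst x))"
    using ratio(5) by (intro continuous_intros continuous_on_compose2[OF g(1)] complex_sin_continuous complex_cos_continuous) auto
  show "(\<lambda>t. 2 / contrast * (sin t)\<^sup>2 * shift t) holomorphic_on UNIV"
    using ratio(5) by (intro holomorphic_intros) auto
  show "(\<lambda>t. 2 / contrast * (- \<i> * sin t) * (\<sigma> t + \<i> * sin t) * exp (- of_real (km * snd y) * \<sigma> t) * shift t) holomorphic_on S"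
    if "\<sigma> holomorphic_on S" for \<sigma> S
    using that ratio(5) by (intro holomorphic_intros) auto
  show "2 / contrast * (- \<i> * sin t) * (s + \<i> * sin t) * exp (- of_real (km * snd y) * s) * shift t
    = 2 / contrast * (sin t)\<^sup>2 * shift t + s * (2 / contrast * (- \<i> * sin t) * (exp (- of_real (km * snd y) * s) + \<i> * sin t * g s) * shift t)" for t s
  proof -
    have alg: "c * (- \<i> * u) * (s + \<i> * u) * (1 + s * q) * w = c * u\<^sup>2 * w + s * (c * (- \<i> * u) * (1 + s * q + \<i> * u * q) * w)" for c u q w :: complex
      by (simp add: algebra_simps power2_eq_square)
    show ?thesis unfolding g(2) by (rule alg)
  qed
  show "transmitted \<xi> = 2 / contrast * (- \<i> * sin t) * (s + \<i> * sin t) * exp (- of_real (km * snd y) * s) * shift t"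
    if a: "complex_of_real \<xi> = of_real km * cos t" "Sm \<xi> = - \<i> * of_real km * sin t" "SS (of_real \<xi>) (ratio * km) = of_real km * s" for \<xi> t s
  proof -
    have p: "Sp \<xi> = of_real km * s" using a(3) ratio by simp
    have e: "2 * Sm \<xi> / (Sp \<xi> + Sm \<xi>) = 2 / contrast * (- \<i> * sin t) * (s + \<i> * sin t)"
    proof -
    have "2 * Sm \<xi> / (Sp \<xi> + Sm \<xi>) = 2 * (- \<i> * sin t) * (1 / (s - \<i> * sin t))"
      unfolding parametrised_roots(1)[OF a] unfolding a(2) using ratio(4) by simp
    also have "\<dots> = 2 / contrast * (- \<i> * sin t) * (s + \<i> * sin t)" unfolding parametrised_roots(3)[OF a] by simp
    finally show ?thesis .
    qed
    show ?thesis unfolding transmitted_def e unfolding p unfolding of_real_mult a(1) by (simp add: mult_ac)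
  qed
  show "cmod (transmitted \<xi>) \<le> 1" if "\<bar>\<xi>\<bar> \<ge> km" for \<xi>
  proof -
    note L = large_frequency[OF that]
    let ?p = "sqrt (\<xi>\<^sup>2 - kp\<^sup>2)" and ?m = "sqrt (\<xi>\<^sup>2 - km\<^sup>2)"
    have "cmod (transmitted \<xi>) = \<bar>2 * ?m / (?p + ?m)\<bar> * exp (- ?p * snd y)"
      unfolding transmitted_def L(1,2) norm_mult norm_exp_eq_Re by (simp add: norm_divide norm_mult abs_mult abs_divide flip: of_real_add)
    also have "\<dots> \<le> 1 * 1"
    proof (rule mult_mono)
      have "0 \<le> 2 * ?m" "2 * ?m \<le> ?p + ?m" using L(3,4) by linarith+
      then show "\<bar>2 * ?m / (?p + ?m)\<bar> \<le> 1" unfolding abs_divide by (simp only: abs_of_nonneg order.trans[of 0 "2 * ?m" "?p + ?m"]) (intro divide_le_eq_1[THEN iffD2], linarith)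
      have "?p * snd y \<ge> 0" using L(3,4) y by (intro mult_nonneg_nonneg) linarith+
      then show "exp (- ?p * snd y) \<le> 1" by simp
    qed auto
    finally show ?thesis by simp
  qed
  show "transmitted \<in> borel_measurable borel" unfolding transmitted_def using wavenumbers(1) ratio(4) by measurable
qed (use ratio \<phi> in auto)

lemma reflected_amplitude:
  assumes y: "snd y < 0" and \<phi>: "0 < \<phi>" "\<phi> < pi"
  shows "branched_amplitude km \<phi> ratio 1 reflected
    (\<lambda>t s. - (1 / contrast) * (s + \<i> * sin t)\<^sup>2 * exp (\<i> * of_real (km * - snd y) * sin t) * shift t)
    (\<lambda>t s. - (1 / contrast) * (s + 2 * \<i> * sin t) * exp (\<i> * of_real (km * - snd y) * sin t) * shift t)
    (\<lambda>t. 1 / contrast * (sin t)\<^sup>2 * exp (\<i> * of_real (km * - snd y) * sin t) * shift t)"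
proof
  show "continuous_on UNIV (\<lambda>x. - (1 / contrast) * (snd x + 2 * \<i> * sin (fst x)) * exp (\<i> * of_real (km * - snd y) * sin (fst x)) * shift (fst x))"
    using ratio(5) by (intro continuous_intros complex_sin_continuous complex_cos_continuous) auto
  show "(\<lambda>t. 1 / contrast * (sin t)\<^sup>2 * exp (\<i> * of_real (km * - snd y) * sin t) * shift t) holomorphic_on UNIV"
    using ratio(5) by (intro holomorphic_intros) auto
  show "(\<lambda>t. - (1 / contrast) * (\<sigma> t + \<i> * sin t)\<^sup>2 * exp (\<i> * of_real (km * - snd y) * sin t) * shift t) holomorphic_on S"
    if "\<sigma> holomorphic_on S" for \<sigma> S
    using that ratio(5) by (intro holomorphic_intros) auto
  show "- (1 / contrast) * (s + \<i> * sin t)\<^sup>2 * exp (\<i> * of_real (km * - snd y) * sin t) * shift t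
    = 1 / contrast * (sin t)\<^sup>2 * exp (\<i> * of_real (km * - snd y) * sin t) * shift t
      + s * (- (1 / contrast) * (s + 2 * \<i> * sin t) * exp (\<i> * of_real (km * - snd y) * sin t) * shift t)" for t s
  proof -
    have "- (1 / contrast) * (s + \<i> * sin t)\<^sup>2 = 1 / contrast * (sin t)\<^sup>2 + s * (- (1 / contrast) * (s + 2 * \<i> * sin t))"
      by (simp add: algebra_simps power2_eq_square)
    then show ?thesis by (simp only: distrib_right mult.assoc)
  qed
  show "reflected \<xi> = - (1 / contrast) * (s + \<i> * sin t)\<^sup>2 * exp (\<i> * of_real (km * - snd y) * sin t) * shift t"
    if a: "complex_of_real \<xi> = of_real km * cos t" "Sm \<xi> = - \<i> * of_real km * sin t" "SS (of_real \<xi>) (ratio * km) = of_real km * s" for \<xi> t s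
  proof -
    have p: "Sp \<xi> = of_real km * s" using a(3) ratio by simp
    have e: "(Sm \<xi> - Sp \<xi>) / (Sp \<xi> + Sm \<xi>) = - (1 / contrast) * (s + \<i> * sin t)\<^sup>2"
    proof -
    have "(Sm \<xi> - Sp \<xi>) / (Sp \<xi> + Sm \<xi>) = (of_real km * - (s + \<i> * sin t)) / (of_real km * (s - \<i> * sin t))"
      unfolding parametrised_roots(1)[OF a] unfolding a(2) p by (simp add: algebra_simps)
    also have "\<dots> = - (s + \<i> * sin t) * (1 / (s - \<i> * sin t))" using ratio(4) by simp
    also have "\<dots> = - (1 / contrast) * (s + \<i> * sin t)\<^sup>2" unfolding parametrised_roots(3)[OF a] power2_eq_square minus_mult_left[symmetric] by simp
    finally show ?thesis .
    qed
    show ?thesis unfolding reflected_def e unfolding a(2) unfolding of_real_mult a(1) by (simp add: mult_ac)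
  qed
  show "cmod (reflected \<xi>) \<le> 1" if "\<bar>\<xi>\<bar> \<ge> km" for \<xi>
  proof -
    note L = large_frequency[OF that]
    let ?p = "sqrt (\<xi>\<^sup>2 - kp\<^sup>2)" and ?m = "sqrt (\<xi>\<^sup>2 - km\<^sup>2)"
    have "cmod (reflected \<xi>) = \<bar>(?m - ?p) / (?p + ?m)\<bar> * exp (- ?m * - snd y)"
      unfolding reflected_def L(1,2) norm_mult norm_exp_eq_Re by (simp add: norm_divide norm_mult flip: of_real_add of_real_diff)
    also have "\<dots> \<le> 1 * 1"
    proof (rule mult_mono)
      show "\<bar>(?m - ?p) / (?p + ?m)\<bar> \<le> 1" using L(3,4) unfolding abs_divide by (intro divide_le_eq_1[THEN iffD2]) linarith
      have "?m * - snd y \<ge> 0" using L(3) y by (intro mult_nonneg_nonneg) auto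
      then show "exp (- ?m * - snd y) \<le> 1" by simp
    qed auto
    finally show ?thesis by simp
  qed
  show "reflected \<in> borel_measurable borel" unfolding reflected_def using wavenumbers(1) ratio(4) by measurable
qed (use ratio \<phi> in auto)

text \<open>
  The frequencies \<open>\<plusminus>km\<close> are excluded because \<open>transmitted\<close> has a factor that cancels \<open>1 / Sm\<close> only where
  \<open>Sm\<close> does not vanish.
\<close>

lemma green_upper:
  assumes "snd y > 0"
  shows "green kp km (r *\<^sub>R direction \<theta>) y = 1 / (4 * of_real pi) * integral\<^sup>L lborel (spectral_integrand km (2 * pi - \<theta>) transmitted r)"
proof -
  have "AE \<xi> in lborel. \<xi> \<notin> {km, - km}" using AE_lborel_singleton[of km] AE_lborel_singleton[of "- km"] by eventually_elim auto
  then have ae: "AE \<xi> in lborel. exp (- Sp \<xi> * complex_of_real (snd y) + Sm \<xi> * complex_of_real (r * sin \<theta>)) / (Sp \<xi> + Sm \<xi>) *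
       exp (\<i> * complex_of_real (\<xi> * (r * cos \<theta> - fst y))) = 1 / 2 * spectral_integrand km (2 * pi - \<theta>) transmitted r \<xi>"
  proof eventually_elim
    case (elim \<xi>)
    then have "\<xi>\<^sup>2 - km\<^sup>2 \<noteq> 0" by (auto simp: power2_eq_iff)
    then have m: "Sm \<xi> \<noteq> 0" using SS_power2[OF ratio(4), of \<xi>] by (metis of_real_eq_0_iff zero_power2)
    have e: "exp (- Sp \<xi> * complex_of_real (snd y) + Sm \<xi> * complex_of_real (r * sin \<theta>)) * exp (\<i> * complex_of_real (\<xi> * (r * cos \<theta> - fst y)))
      = exp (- Sp \<xi> * of_real (snd y)) * exp (- \<i> * of_real (\<xi> * fst y)) * exp (of_real r * (- Sm \<xi> * of_real (sin (2 * pi - \<theta>)) + \<i> * of_real (\<xi> * cos (2 * pi - \<theta>))))"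
      unfolding exp_add[symmetric] by (intro arg_cong[of _ _ exp]) (simp add: algebra_simps sin_diff cos_diff)
    have "exp (- Sp \<xi> * complex_of_real (snd y) + Sm \<xi> * complex_of_real (r * sin \<theta>)) / (Sp \<xi> + Sm \<xi>) *
       exp (\<i> * complex_of_real (\<xi> * (r * cos \<theta> - fst y))) = exp (- Sp \<xi> * complex_of_real (snd y) + Sm \<xi> * complex_of_real (r * sin \<theta>)) * exp (\<i> * complex_of_real (\<xi> * (r * cos \<theta> - fst y))) / (Sp \<xi> + Sm \<xi>)" by simp
    also have "\<dots> = 1 / 2 * spectral_integrand km (2 * pi - \<theta>) transmitted r \<xi>"
      unfolding e spectral_integrand_def transmitted_def using m by simp
    finally show ?case .
  qed
  then have "(LINT \<xi>|lborel. exp (- Sp \<xi> * complex_of_real (snd y) + Sm \<xi> * complex_of_real (r * sin \<theta>)) / (Sp \<xi> + Sm \<xi>) *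
       exp (\<i> * complex_of_real (\<xi> * (r * cos \<theta> - fst y)))) = (LINT \<xi>|lborel. 1 / 2 * spectral_integrand km (2 * pi - \<theta>) transmitted r \<xi>)"
    using wavenumbers(1) ratio(4) ae by (intro integral_cong_AE) (unfold spectral_integrand_def transmitted_def, measurable)
  moreover have "green kp km (r *\<^sub>R direction \<theta>) y = 1 / (2 * of_real pi) * (LINT \<xi>|lborel. exp (- Sp \<xi> * complex_of_real (snd y) + Sm \<xi> * complex_of_real (r * sin \<theta>)) / (Sp \<xi> + Sm \<xi>) *
       exp (\<i> * complex_of_real (\<xi> * (r * cos \<theta> - fst y))))"
    unfolding green_def Let_def direction_def using assms by (simp add: upper_half_plane_def)
  ultimately have "green kp km (r *\<^sub>R direction \<theta>) y = 1 / (2 * of_real pi) * (1 / 2 * integral\<^sup>L lborel (spectral_integrand km (2 * pi - \<theta>) transmitted r))"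
    by (simp only: integral_mult_right_zero)
  then show ?thesis by simp
qed

lemma green_lower:
  assumes "snd y < 0" "r > 0" "pi < \<theta>" "\<theta> < 2 * pi"
  shows "green kp km (r *\<^sub>R direction \<theta>) y = \<i> / 4 * hankel1_0 (km * norm (r *\<^sub>R direction \<theta> - y)) +
    1 / (4 * of_real pi) * integral\<^sup>L lborel (spectral_integrand km (2 * pi - \<theta>) reflected r)"
proof -
  have "r * sin \<theta> < 0" using assms sin_lt_zero[of \<theta>] by (simp add: mult_pos_neg)
  then have a: "\<bar>r * sin \<theta> + snd y\<bar> = - r * sin \<theta> - snd y" using assms(1) by simp
  have "(Sm \<xi> - Sp \<xi>) / (Sp \<xi> + Sm \<xi>) * (exp (- Sm \<xi> * complex_of_real \<bar>r * sin \<theta> + snd y\<bar>) / Sm \<xi>) * exp (\<i> * complex_of_real (\<xi> * (r * cos \<theta> - fst y)))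
     = spectral_integrand km (2 * pi - \<theta>) reflected r \<xi>" for \<xi>
  proof -
    have e: "exp (- Sm \<xi> * complex_of_real \<bar>r * sin \<theta> + snd y\<bar>) * exp (\<i> * complex_of_real (\<xi> * (r * cos \<theta> - fst y)))
      = exp (- Sm \<xi> * of_real (- snd y)) * exp (- \<i> * of_real (\<xi> * fst y)) * exp (of_real r * (- Sm \<xi> * of_real (sin (2 * pi - \<theta>)) + \<i> * of_real (\<xi> * cos (2 * pi - \<theta>))))"
      unfolding exp_add[symmetric] a by (intro arg_cong[of _ _ exp]) (simp add: algebra_simps sin_diff cos_diff)
    have "(Sm \<xi> - Sp \<xi>) / (Sp \<xi> + Sm \<xi>) * (exp (- Sm \<xi> * complex_of_real \<bar>r * sin \<theta> + snd y\<bar>) / Sm \<xi>) * exp (\<i> * complex_of_real (\<xi> * (r * cos \<theta> - fst y)))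
      = (Sm \<xi> - Sp \<xi>) / (Sp \<xi> + Sm \<xi>) / Sm \<xi> * (exp (- Sm \<xi> * complex_of_real \<bar>r * sin \<theta> + snd y\<bar>) * exp (\<i> * complex_of_real (\<xi> * (r * cos \<theta> - fst y))))" by simp
    also have "\<dots> = spectral_integrand km (2 * pi - \<theta>) reflected r \<xi>"
      unfolding e spectral_integrand_def reflected_def by simp
    finally show ?thesis .
  qed
  then show ?thesis using assms(1) by (simp add: green_def upper_half_plane_def direction_def Let_def)
qed

text \<open>
  The coefficients in the far-field pattern are those of the spectral amplitude at the saddle
  frequency \<open>km * cos \<theta>\<close>.
\<close>

lemma fresnel_coefficients:
  assumes "pi < \<theta>" "\<theta> < 2 * pi" and \<xi>: "\<xi> = km * cos (2 * pi - \<theta>)"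
  shows "Sm \<xi> = \<i> * of_real km * of_real (sin \<theta>)" "Sp \<xi> = of_real km * SS (of_real (cos \<theta>)) ratio"
    "R_tilde (refl_index kp km) \<theta> = (Sm \<xi> - Sp \<xi>) / (Sp \<xi> + Sm \<xi>)"
    "T_tilde (refl_index kp km) \<theta> = 2 * Sm \<xi> / (Sp \<xi> + Sm \<xi>)"
proof -
  have c: "cos (2 * pi - \<theta>) = cos \<theta>" "sin (2 * pi - \<theta>) = - sin \<theta>" by (simp_all add: sin_diff cos_diff)
  show m: "Sm \<xi> = \<i> * of_real km * of_real (sin \<theta>)" using SS_cos[of km "2 * pi - \<theta>"] assms ratio(4) by (simp add: c)
  have p': "SS (of_real \<xi>) (ratio * km) = of_real km * SS (of_real (cos \<theta>)) ratio"
    using SS_scale[of km ratio "cos \<theta>"] ratio wavenumbers unfolding \<xi> c by (simp add: mult.commute)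
  then show p: "Sp \<xi> = of_real km * SS (of_real (cos \<theta>)) ratio" using ratio by simp
  have d: "Sp \<xi> + Sm \<xi> = of_real km * (\<i> * of_real (sin \<theta>) + SS (of_real (cos \<theta>)) ratio)" unfolding m p by (simp add: algebra_simps)
  have n: "1 / refl_index kp km = ratio" by (simp add: refl_index_def ratio_def)
  show R: "R_tilde (refl_index kp km) \<theta> = (Sm \<xi> - Sp \<xi>) / (Sp \<xi> + Sm \<xi>)"
      proof -
    have "Sm \<xi> - Sp \<xi> = of_real km * (\<i> * of_real (sin \<theta>) - SS (of_real (cos \<theta>)) ratio)" unfolding m p by (simp add: algebra_simps)
    then show ?thesis unfolding R_tilde_def n d using ratio(4) by simp
  qed
  have "Sp \<xi> + Sm \<xi> = of_real km * (SS (of_real (cos \<theta>)) ratio - \<i> * sin (- of_real \<theta>))" "SS (of_real (cos \<theta>)) ratio - \<i> * sin (- complex_of_real \<theta>) \<noteq> 0"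
    using parametrised_roots[of \<xi> "- of_real \<theta>" "SS (of_real (cos \<theta>)) ratio"] m p' by (auto simp: \<xi> c cos_of_real sin_of_real)
  then have "Sp \<xi> + Sm \<xi> \<noteq> 0" using ratio(4) by simp
  then show "T_tilde (refl_index kp km) \<theta> = 2 * Sm \<xi> / (Sp \<xi> + Sm \<xi>)" unfolding T_tilde_def R by (simp add: field_simps)
qed

lemma remainder_upper:
  assumes y: "snd y > 0" and \<theta>: "pi < \<theta>" "\<theta> < 2 * pi" and r: "r > 0"
  shows "G_Res kp km r \<theta> y = 1 / (4 * of_real pi) * (integral\<^sup>L lborel (spectral_integrand km (2 * pi - \<theta>) transmitted r) -
    \<i> * (1 - \<i>) * (transmitted (km * cos (2 * pi - \<theta>)) * exp (\<i> * of_real (km * r)) * of_real (sqrt (pi / (km * r)))))"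
proof -
  let ?\<xi> = "km * cos (2 * pi - \<theta>)"
  note F = fresnel_coefficients[OF \<theta> refl]
  have c: "cos (2 * pi - \<theta>) = cos \<theta>" by (simp add: cos_diff)
  have n: "1 / refl_index kp km = ratio" by (simp add: refl_index_def ratio_def)
  have "exp (- \<i> * of_real km * (of_real (fst y) * of_real (cos \<theta>) - \<i> * of_real (snd y) * SS (of_real (cos \<theta>)) ratio))
     = exp (- Sp ?\<xi> * of_real (snd y)) * exp (- \<i> * of_real (?\<xi> * fst y))"
    unfolding F(2) unfolding c exp_add[symmetric] by (intro arg_cong[of _ _ exp]) (simp add: algebra_simps)
  then have "G_infty kp km \<theta> y = exp (\<i> * of_real pi / 4) / of_real (sqrt (8 * pi * km)) * transmitted ?\<xi>"
    using y unfolding G_infty_def Let_def n F(4) transmitted_def by (simp add: upper_half_plane_def)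
  then have "exp (\<i> * complex_of_real (km * r)) / complex_of_real (sqrt r) * G_infty kp km \<theta> y
     = (exp (\<i> * complex_of_real (km * r)) / complex_of_real (sqrt r) * (exp (\<i> * of_real pi / 4) / of_real (sqrt (8 * pi * km)))) * transmitted ?\<xi>"
    by (simp only: mult.assoc)
  then show ?thesis unfolding G_Res_def green_upper[OF y] far_constant[OF ratio(4) r] by (simp only: right_diff_distrib mult_ac)
qed

lemma remainder_lower:
  assumes y: "snd y < 0" and \<theta>: "pi < \<theta>" "\<theta> < 2 * pi" and r: "r > 0"
  shows "G_Res kp km r \<theta> y = 1 / (4 * of_real pi) * (integral\<^sup>L lborel (spectral_integrand km (2 * pi - \<theta>) reflected r) -
    \<i> * (1 - \<i>) * (reflected (km * cos (2 * pi - \<theta>)) * exp (\<i> * of_real (km * r)) * of_real (sqrt (pi / (km * r))))) +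
    (\<i> / 4 * hankel1_0 (km * norm (r *\<^sub>R direction \<theta> - y)) - 1 / (4 * of_real pi) * (\<i> * (1 - \<i>) *
      (exp (- \<i> * of_real km * of_real (direction \<theta> \<bullet> y)) * exp (\<i> * of_real (km * r)) * of_real (sqrt (pi / (km * r))))))"
proof -
  let ?\<xi> = "km * cos (2 * pi - \<theta>)"
  note F = fresnel_coefficients[OF \<theta> refl]
  have c: "cos (2 * pi - \<theta>) = cos \<theta>" by (simp add: cos_diff)
  have "exp (- \<i> * of_real km * of_real (direction \<theta> \<bullet> reflect y))
     = exp (- Sm ?\<xi> * of_real (- snd y)) * exp (- \<i> * of_real (?\<xi> * fst y))"
    unfolding F(1) unfolding c exp_add[symmetric] by (intro arg_cong[of _ _ exp]) (simp add: direction_def reflect_def algebra_simps)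
  then have "G_infty kp km \<theta> y = exp (\<i> * of_real pi / 4) / of_real (sqrt (8 * pi * km)) * (exp (- \<i> * of_real km * of_real (direction \<theta> \<bullet> y)) + reflected ?\<xi>)"
    using y unfolding G_infty_def Let_def F(3) reflected_def by (simp add: upper_half_plane_def)
  then have "exp (\<i> * complex_of_real (km * r)) / complex_of_real (sqrt r) * G_infty kp km \<theta> y
     = (exp (\<i> * complex_of_real (km * r)) / complex_of_real (sqrt r) * (exp (\<i> * of_real pi / 4) / of_real (sqrt (8 * pi * km)))) *
       (exp (- \<i> * of_real km * of_real (direction \<theta> \<bullet> y)) + reflected ?\<xi>)"
    by (simp only: mult.assoc)
  then have e: "exp (\<i> * complex_of_real (km * r)) / complex_of_real (sqrt r) * G_infty kp km \<theta> y
     = 1 / (4 * of_real pi) * (\<i> * (1 - \<i>) * (exp (\<i> * of_real (km * r)) * of_real (sqrt (pi / (km * r))))) *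
       (exp (- \<i> * of_real km * of_real (direction \<theta> \<bullet> y)) + reflected ?\<xi>)"
    unfolding far_constant[OF ratio(4) r] .
  have alg: "a + b * i - b * (w * (u * v)) * (e + q) = b * (i - w * (q * u * v)) + (a - b * (w * (e * u * v)))" for a b i w u v e q :: complex
    by (simp add: algebra_simps)
  show ?thesis unfolding G_Res_def green_lower[OF y r \<theta>] e by (rule alg)
qed

lemma critical_angle_ratio: "critical_angle kp km = arccos ratio"
  by (simp add: critical_angle_def refl_index_def ratio_def)

lemma far_field_dichotomy:
  assumes "y \<in> upper_half_plane \<union> lower_half_plane" and \<theta>: "pi < \<theta>" "\<theta> < 2 * pi"
  shows "\<theta> \<notin> {pi + critical_angle kp km, 2 * pi - critical_angle kp km} \<Longrightarrow> (\<lambda>r. G_Res kp km r \<theta> y) \<in> O[at_top](\<lambda>r. of_real (r powr (- 3 / 2)))" (is "PROP ?A")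
   and "\<theta> \<in> {pi + critical_angle kp km, 2 * pi - critical_angle kp km} \<Longrightarrow>
     (\<exists>L. ((\<lambda>r. cmod (G_Res kp km r \<theta> y) * r powr (3 / 4)) \<longlongrightarrow> L) at_top \<and> L \<noteq> 0) \<and>
     (\<lambda>r. G_Res kp km r \<theta> y) \<notin> O[at_top](\<lambda>r. of_real (r powr (- 3 / 2)))" (is "PROP ?B")
proof -
  let ?\<phi> = "2 * pi - \<theta>"
  have \<phi>: "0 < ?\<phi>" "?\<phi> < pi" using \<theta> by auto
  have angles: "\<theta> \<in> {pi + critical_angle kp km, 2 * pi - critical_angle kp km} \<longleftrightarrow> ?\<phi> = arccos ratio \<or> ?\<phi> = pi - arccos ratio"
    unfolding critical_angle_ratio by auto
  have s: "sin (complex_of_real ?\<phi>) \<noteq> 0" using sin_gt_zero[OF \<phi>] unfolding sin_of_real by (simp only: of_real_eq_0_iff)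
  have c: "1 / (4 * complex_of_real pi) \<noteq> 0" by simp
  have "(PROP ?A) &&& (PROP ?B)" if up: "snd y > 0"
  proof -
    obtain g :: "complex \<Rightarrow> complex" where g: "continuous_on UNIV g" "g 0 = - of_real (km * snd y)" "\<And>z. exp (- of_real (km * snd y) * z) = 1 + z * g z"
      using exp_divided_difference by blast
    interpret branched_amplitude km ?\<phi> ratio 1 transmitted
      "\<lambda>t s. 2 / contrast * (- \<i> * sin t) * (s + \<i> * sin t) * exp (- of_real (km * snd y) * s) * shift t"
      "\<lambda>t s. 2 / contrast * (- \<i> * sin t) * (exp (- of_real (km * snd y) * s) + \<i> * sin t * g s) * shift t"
      "\<lambda>t. 2 / contrast * (sin t)\<^sup>2 * shift t"
      by (rule transmitted_amplitude[OF up g(1,3) \<phi>])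
    \<comment> \<open>the second factor of \<open>B \<phi> 0\<close> has real part 1\<close>
    have "Re (1 + \<i> * sin (complex_of_real ?\<phi>) * - of_real (km * snd y)) = 1" unfolding sin_of_real by simp
    then have "1 + \<i> * sin (complex_of_real ?\<phi>) * - of_real (km * snd y) \<noteq> 0" by (metis zero_complex.simps(1) zero_neq_one)
    then have nz: "2 / contrast * (- \<i> * sin (of_real ?\<phi>)) * (exp (- of_real (km * snd y) * 0) + \<i> * sin (of_real ?\<phi>) * g 0) * shift (of_real ?\<phi>) \<noteq> 0"
      using s ratio(5) unfolding g(2) by (simp del: of_real_mult of_real_diff)
    have "\<forall>\<^sub>F r in at_top. G_Res kp km r \<theta> y = 1 / (4 * of_real pi) * (integral\<^sup>L lborel (spectral_integrand km ?\<phi> transmitted r) -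
      \<i> * (1 - \<i>) * (transmitted (km * cos ?\<phi>) * exp (\<i> * of_real (km * r)) * of_real (sqrt (pi / (km * r))))) + 0"
      using eventually_gt_at_top[of 0] by eventually_elim (simp only: remainder_upper[OF up \<theta>] add_0_right)
    from remainder_dichotomy[OF c zero_in_bigo this nz]
    show "PROP ?A" "PROP ?B" unfolding angles crit_def by blast+
  qed
  moreover have "(PROP ?A) &&& (PROP ?B)" if low: "snd y < 0"
  proof -
    interpret branched_amplitude km ?\<phi> ratio 1 reflected
      "\<lambda>t s. - (1 / contrast) * (s + \<i> * sin t)\<^sup>2 * exp (\<i> * of_real (km * - snd y) * sin t) * shift t"
      "\<lambda>t s. - (1 / contrast) * (s + 2 * \<i> * sin t) * exp (\<i> * of_real (km * - snd y) * sin t) * shift t"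
      "\<lambda>t. 1 / contrast * (sin t)\<^sup>2 * exp (\<i> * of_real (km * - snd y) * sin t) * shift t"
      by (rule reflected_amplitude[OF low \<phi>])
    have nz: "- (1 / contrast) * (0 + 2 * \<i> * sin (of_real ?\<phi>)) * exp (\<i> * of_real (km * - snd y) * sin (of_real ?\<phi>)) * shift (of_real ?\<phi>) \<noteq> 0"
      using s ratio(5) by (simp del: of_real_mult of_real_diff)
    have "\<forall>\<^sub>F r in at_top. G_Res kp km r \<theta> y = 1 / (4 * of_real pi) * (integral\<^sup>L lborel (spectral_integrand km ?\<phi> reflected r) -
      \<i> * (1 - \<i>) * (reflected (km * cos ?\<phi>) * exp (\<i> * of_real (km * r)) * of_real (sqrt (pi / (km * r))))) +
    (\<i> / 4 * hankel1_0 (km * norm (r *\<^sub>R direction \<theta> - y)) - 1 / (4 * of_real pi) * (\<i> * (1 - \<i>) *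
      (exp (- \<i> * of_real km * of_real (direction \<theta> \<bullet> y)) * exp (\<i> * of_real (km * r)) * of_real (sqrt (pi / (km * r))))))"
      using eventually_gt_at_top[of 0] by eventually_elim (rule remainder_lower[OF low \<theta>])
    from remainder_dichotomy[OF c hankel_translated[OF ratio(4)] this nz]
    show "PROP ?A" "PROP ?B" unfolding angles crit_def by blast+
  qed
  ultimately show "PROP ?A" "PROP ?B"
    using assms(1) unfolding upper_half_plane_def lower_half_plane_def by blast+
qed

end

theorem mainTheorem8:
  fixes kp km :: real and y :: "real \<times> real"
  assumes "0 < kp" and "kp < km"
    and "y \<in> upper_half_plane \<union> lower_half_plane"
  shows
    "(\<forall>\<theta> \<in> {pi <..< 2 * pi} - {pi + critical_angle kp km, 2 * pi - critical_angle kp km}.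
        (\<lambda>r. G_Res kp km r \<theta> y) \<in> O[at_top](\<lambda>r. complex_of_real (r powr (- 3 / 2)))) \<and>
     (\<forall>\<theta> \<in> {pi + critical_angle kp km, 2 * pi - critical_angle kp km}.
        \<exists>L. ((\<lambda>r. cmod (G_Res kp km r \<theta> y) * r powr (3 / 4)) \<longlongrightarrow> L) at_top \<and> L \<noteq> 0) \<and>
     (\<forall>\<theta> \<in> {pi + critical_angle kp km, 2 * pi - critical_angle kp km}.
        (\<lambda>r. G_Res kp km r \<theta> y) \<notin> O[at_top](\<lambda>r. complex_of_real (r powr (- 3 / 2))))"
proof -
  interpret two_layers kp km y using assms(1,2) by unfold_locales
  have "0 < critical_angle kp km" "critical_angle kp km < pi"
    unfolding critical_angle_ratio using ratio(1,2) arccos_less_arccos[of ratio 1] arccos_less_arccos[of "-1" ratio] by auto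
  then have "pi < \<theta> \<and> \<theta> < 2 * pi" if "\<theta> \<in> {pi + critical_angle kp km, 2 * pi - critical_angle kp km}" for \<theta>
    using that by auto
  then show ?thesis using far_field_dichotomy[OF assms(3)] by (metis (no_types, lifting) Diff_iff greaterThanLessThan_iff)
qed

end
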